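(* Let $q\in[0,1]$ with $q<\tfrac12$. On the event $\{\tau_{q,\varepsilon}\wedge\tau^m_{q,\varepsilon}=T\}$ the stochastic travelling wave $v$ can be decomposed into $$v(t)=\hat v(\cdot+ct+\varepsilon C_0^m(t))+\varepsilon u_0^m(t)+\varepsilon r^m(t)$$ with $$\|r^m\|_T\le \alpha(T)\,\varepsilon^{1-2q},$$ where the constant $\alpha(T)$ is independent of $m$ and $\varepsilon$. Moreover, $$\lim_{\varepsilon\to0}P[\tau_{q,\varepsilon}\wedge\tau^m_{q,\varepsilon}=T]=1 .$$
   Context: Setting. Let $T>0$, $m>0$, let $\varepsilon>0$ be a (small) noise amplitude, let $\nu,b>0$ and let $f\in C^3(\mathbb R)$ be such that: $f(0)=f(a)=f(1)=0$ for some $a\in(0,1)$; $f<0$ on $(0,a)$, $f>0$ on $(a,1)$; $f'(0)<0$, $f'(a)>0$, $f'(1)<0$; $\int_0^1 f(v)\,dv\ge0$; $f''(0)>0$, $f''(1)<0$; $\sup_{x\in\mathbb R}f'(x)<\infty$; there are finite constants $L,\eta_2,\eta_3>0$ with $|f(x_1)-f(x_2)|\le L|x_1-x_2|(1+x_1^2+x_2^2)$ for all $x_1,x_2\in\mathbb R$, and, for all $v\in[0,1]$, $u\in\mathbb R$, $|f(u+v)-f(v)-f'(v)u|\le\eta_2(1+|u|)|u|^2$, $|f'(u+v)|\le\eta_3(1+|u|^2)$, $|f'(u+v)-f'(v)|\le\eta_3(|u|+|u|^2)$. Travelling wave. Fix a monotone increasing $C^2$ function $\hat v$ and $c\in\mathbb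 R$ with $c\hat v_x=\nu\hat v_{xx}+bf(\hat v)$, $\hat v(-\infty)=0$, $\hat v(+\infty)=1$ (such a pair exists, and $c\ge0$). Put $\rho(x)=Ze^{-\frac c\nu x}$ and $\Psi=\rho\,\hat v_x$, with $Z>0$ normalised so that $\int\Psi\hat v_x\,dx=1$. Put $\rho_t(x)=\rho(x+ct)$. Spaces. For a weight $\mu$ (here $\mu=1+\rho$ or $1+\rho_t$), $L^2(\mu)$ has norm $\|u\|_\mu^2=\int u^2\mu\,dx$ and $H^1(\mu)$ has norm $\|u\|_{H^1(\mu)}^2=\|u\|_\mu^2+\|u_x\|_\mu^2$; $H^{1,*}(1+\rho)$ is the dual of $H^1(1+\rho)$ in the Gelfand triple over $L^2(1+\rho)$. $H=L^2(\mathbb R)$, $V=H^1(\mathbb R)$, with Gelfand triple $V\hookrightarrow H\hookrightarrow V^*$; $\langle\cdot,\cdot\rangle$ is the inner product of $L^2(\mathbb R)$. For $h\in C([0,T];H^1(1+\rho))$ set $\|h\|_T=\sup_{t\in[0,T]}\|h(t)\|_{H^1(1+\rho_t)}$. Noise. $W$ is a $Q$-Wiener process on $L^2(1+\rho)$ such that $\sqrt Q$ is Hilbert–Schmidt from $L^2(1+\rho)$ to $H^1(1+\rho)$. Solution. Let $\eta\in H^1(1+\rho)$. For $\varepsilon>0$, $u$ is the unique variational solution, with paths in $C([0,T];H^1(1+\rho))$, of $$du=\nu\Delta u\,dt+b\big(f(u+\hat v(\cdot+ct))-f(\hat v(\cdot+ct))\big)dt+\varepsilon\,dW,\qquad u(0)=\varepsilon\eta,$$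 in the triple $H^1(1+\rho)\hookrightarrow L^2(1+\rho)\hookrightarrow H^{1,*}(1+\rho)$, where $\langle\Delta v,w\rangle=-\int v_x\,(w(1+\rho))_x\,dx$. The stochastic travelling wave is $v(t)=u(t)+\hat v(\cdot+ct)$. First-order processes. $c_0^m$ is the unique strong solution of $dc_0^m(t)=-m\,c_0^m(t)\,dt+m\langle\Psi(\cdot+ct),dW(t)\rangle$, $c_0^m(0)=m\langle\eta,\Psi\rangle$; $C_0^m(t)=\int_0^tc_0^m(s)\,ds$. The process $u_0^m\in L^2(\Omega;C([0,T];H))\cap L^2(\Omega\times(0,T);V)$ is the unique variational solution (in the triple $V\hookrightarrow H\hookrightarrow V^*$) of $du_0^m(t)=[\mathscr L_tu_0^m(t)-c_0^m(t)\hat v_x(\cdot+ct)]\,dt+dW(t)$, $u_0^m(0)=\eta$, where $\mathscr L_tu=\nu\Delta u+bf'(\hat v(\cdot+ct))u$; one has $u_0^m\in L^2(\Omega;C([0,T];H^1(1+\rho)))$. Stopping times. $\tau_{q,\varepsilon}=\inf\{t\in[0,T]:\|u(t)\|_{H^1(1+\rho_t)}\ge\varepsilon^{1-q}\}$ and $\tau_{q,\varepsilon}^m=\inf\{t\in[0,T]:|C_0^m(t)|\ge\varepsilon^{-q}\}$, with the convention $\inf\emptyset=T$.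
   Formalization: The limit of the probabilities is asserted only for 0 < q < 1/2: for q = 0 it fails, since if the norm of η in H^1(1+ρ) is at least 1 then τ_{0,ε} = 0 for every ε and the probability is 0. *)

theory Defs
  imports "HOL-Probability.Probability"
begin

section \<open>Functions of class \<open>C\<^sup>k\<close> and weak derivatives on the real line\<close>

definition Ck :: "nat \<Rightarrow> (real \<Rightarrow> real) \<Rightarrow> bool" where
  "Ck k g \<longleftrightarrow> (\<forall>j<k. \<forall>x. (deriv ^^ j) g field_differentiable at x)
              \<and> continuous_on UNIV ((deriv ^^ k) g)"

definition test_function :: "(real \<Rightarrow> real) \<Rightarrow> bool" where
  "test_function \<phi> \<longleftrightarrow> (\<forall>k. Ck k \<phi>) \<and> (\<exists>R. \<forall>x. R < \<bar>x\<bar> \<longrightarrow> \<phi> x = 0)"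

definition locally_integrable :: "(real \<Rightarrow> real) \<Rightarrow> bool" where
  "locally_integrable u \<longleftrightarrow>
     u \<in> borel_measurable borel \<and> (\<forall>R. set_integrable lborel {-R..R} u)"

definition weak_deriv :: "(real \<Rightarrow> real) \<Rightarrow> (real \<Rightarrow> real) \<Rightarrow> bool" where
  "weak_deriv u g \<longleftrightarrow> locally_integrable u \<and> locally_integrable g \<and>
     (\<forall>\<phi>. test_function \<phi> \<longrightarrow>
        (LINT x|lborel. u x * deriv \<phi> x) = - (LINT x|lborel. g x * \<phi> x))"

text \<open>A weak derivative is unique only up to a null set; everything below depends on
  \<open>wderiv u\<close> only through Lebesgue integrals.\<close>

definition wderiv :: "(real \<Rightarrow> real) \<Rightarrow> real \<Rightarrow> real" where
  "wderiv u = (SOME g. weak_deriv u g)"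


section \<open>The weighted spaces \<open>L\<^sup>2(\<mu>)\<close> and \<open>H\<^sup>1(\<mu>)\<close>\<close>

text \<open>Elements are represented by Borel functions; two representatives of the same element
  agree almost everywhere.  The unweighted spaces are those with weight \<open>\<lambda>_. 1\<close>.\<close>

definition L2 :: "(real \<Rightarrow> real) \<Rightarrow> (real \<Rightarrow> real) set" where
  "L2 \<mu> = {u \<in> borel_measurable borel. integrable lborel (\<lambda>x. (u x)\<^sup>2 * \<mu> x)}"

definition inner_L2 :: "(real \<Rightarrow> real) \<Rightarrow> (real \<Rightarrow> real) \<Rightarrow> (real \<Rightarrow> real) \<Rightarrow> real" where
  "inner_L2 \<mu> u w = (LINT x|lborel. u x * w x * \<mu> x)"

definition norm_L2 :: "(real \<Rightarrow> real) \<Rightarrow> (real \<Rightarrow> real) \<Rightarrow> real" where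
  "norm_L2 \<mu> u = sqrt (LINT x|lborel. (u x)\<^sup>2 * \<mu> x)"

definition H1 :: "(real \<Rightarrow> real) \<Rightarrow> (real \<Rightarrow> real) set" where
  "H1 \<mu> = {u \<in> L2 \<mu>. \<exists>g \<in> L2 \<mu>. weak_deriv u g}"

definition norm_H1 :: "(real \<Rightarrow> real) \<Rightarrow> (real \<Rightarrow> real) \<Rightarrow> real" where
  "norm_H1 \<mu> u = sqrt ((norm_L2 \<mu> u)\<^sup>2 + (norm_L2 \<mu> (wderiv u))\<^sup>2)"

definition enorm_H1 :: "(real \<Rightarrow> real) \<Rightarrow> (real \<Rightarrow> real) \<Rightarrow> ennreal" where
  "enorm_H1 \<mu> u = (if u \<in> H1 \<mu> then ennreal (norm_H1 \<mu> u) else \<infinity>)"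

definition C_L2 :: "real \<Rightarrow> (real \<Rightarrow> real) \<Rightarrow> (real \<Rightarrow> real \<Rightarrow> real) \<Rightarrow> bool" where
  "C_L2 T \<mu> h \<longleftrightarrow> (\<forall>t\<in>{0..T}. h t \<in> L2 \<mu> \<and>
     ((\<lambda>s. norm_L2 \<mu> (\<lambda>x. h s x - h t x)) \<longlongrightarrow> 0) (at t within {0..T}))"

definition C_H1 :: "real \<Rightarrow> (real \<Rightarrow> real) \<Rightarrow> (real \<Rightarrow> real \<Rightarrow> real) \<Rightarrow> bool" where
  "C_H1 T \<mu> h \<longleftrightarrow> (\<forall>t\<in>{0..T}. h t \<in> H1 \<mu> \<and>
     ((\<lambda>s. norm_H1 \<mu> (\<lambda>x. h s x - h t x)) \<longlongrightarrow> 0) (at t within {0..T}))"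

text \<open>The pairing of \<open>\<Delta>u\<close> with \<open>w\<close> between \<open>H\<^sup>1(\<mu>)\<close> and its dual, when the dual is attached
  to the pivot space \<open>L\<^sup>2(\<mu>)\<close>.\<close>

definition laplace_pairing :: "(real \<Rightarrow> real) \<Rightarrow> (real \<Rightarrow> real) \<Rightarrow> (real \<Rightarrow> real) \<Rightarrow> real" where
  "laplace_pairing \<mu> u w = - (LINT x|lborel. wderiv u x * wderiv (\<lambda>y. w y * \<mu> y) x)"


section \<open>The reaction term and the travelling wave\<close>

definition bistable_reaction :: "(real \<Rightarrow> real) \<Rightarrow> bool" where
  "bistable_reaction f \<longleftrightarrow> Ck 3 f \<and>
     (\<exists>a. 0 < a \<and> a < 1 \<and> f 0 = 0 \<and> f a = 0 \<and> f 1 = 0 \<and>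
        (\<forall>x\<in>{0<..<a}. f x < 0) \<and> (\<forall>x\<in>{a<..<1}. f x > 0) \<and>
        deriv f 0 < 0 \<and> deriv f a > 0 \<and> deriv f 1 < 0) \<and>
     (LINT v:{0..1}|lborel. f v) \<ge> 0 \<and>
     deriv (deriv f) 0 > 0 \<and> deriv (deriv f) 1 < 0 \<and>
     bdd_above (range (deriv f)) \<and>
     (\<exists>L>0. \<forall>x1 x2. \<bar>f x1 - f x2\<bar> \<le> L * \<bar>x1 - x2\<bar> * (1 + x1\<^sup>2 + x2\<^sup>2)) \<and>
     (\<exists>\<eta>2>0. \<forall>v\<in>{0..1}. \<forall>u.
        \<bar>f (u + v) - f v - deriv f v * u\<bar> \<le> \<eta>2 * (1 + \<bar>u\<bar>) * \<bar>u\<bar>\<^sup>2) \<and>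
     (\<exists>\<eta>3>0. \<forall>v\<in>{0..1}. \<forall>u.
        \<bar>deriv f (u + v)\<bar> \<le> \<eta>3 * (1 + \<bar>u\<bar>\<^sup>2) \<and>
        \<bar>deriv f (u + v) - deriv f v\<bar> \<le> \<eta>3 * (\<bar>u\<bar> + \<bar>u\<bar>\<^sup>2))"

definition travelling_wave ::
    "real \<Rightarrow> real \<Rightarrow> (real \<Rightarrow> real) \<Rightarrow> real \<Rightarrow> (real \<Rightarrow> real) \<Rightarrow> bool" where
  "travelling_wave \<nu> b f c vh \<longleftrightarrow> Ck 2 vh \<and> mono vh \<and>
     (\<forall>x. c * deriv vh x = \<nu> * deriv (deriv vh) x + b * f (vh x)) \<and>
     (vh \<longlongrightarrow> 0) at_bot \<and> (vh \<longlongrightarrow> 1) at_top"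

definition rho :: "real \<Rightarrow> real \<Rightarrow> real \<Rightarrow> real \<Rightarrow> real" where
  "rho \<nu> c Z x = Z * exp (- (c / \<nu>) * x)"

definition Psi :: "real \<Rightarrow> real \<Rightarrow> real \<Rightarrow> (real \<Rightarrow> real) \<Rightarrow> real \<Rightarrow> real" where
  "Psi \<nu> c Z vh x = rho \<nu> c Z x * deriv vh x"

text \<open>The weight \<open>1 + \<rho>\<^sub>t\<close>; in particular \<open>wgt \<nu> c Z 0\<close> is \<open>1 + \<rho>\<close>.\<close>

definition wgt :: "real \<Rightarrow> real \<Rightarrow> real \<Rightarrow> real \<Rightarrow> real \<Rightarrow> real" where
  "wgt \<nu> c Z t x = 1 + rho \<nu> c Z (x + c * t)"

definition norm_sup_T ::
    "real \<Rightarrow> real \<Rightarrow> real \<Rightarrow> real \<Rightarrow> (real \<Rightarrow> real \<Rightarrow> real) \<Rightarrow> real" where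
  "norm_sup_T \<nu> c Z T h = (SUP t\<in>{0..T}. norm_H1 (wgt \<nu> c Z t) (h t))"


section \<open>Operators on \<open>L\<^sup>2(\<mu>)\<close>\<close>

definition onb :: "(real \<Rightarrow> real) \<Rightarrow> (nat \<Rightarrow> real \<Rightarrow> real) \<Rightarrow> bool" where
  "onb \<mu> e \<longleftrightarrow> (\<forall>k. e k \<in> L2 \<mu>) \<and>
     (\<forall>j k. inner_L2 \<mu> (e j) (e k) = (if j = k then 1 else 0)) \<and>
     (\<forall>h\<in>L2 \<mu>. (\<forall>k. inner_L2 \<mu> h (e k) = 0) \<longrightarrow> (AE x in lborel. h x = 0))"

text \<open>Linearity and boundedness together force an operator to map almost everywhere equal
  functions to almost everywhere equal functions.\<close>

definition linear_L2 :: "(real \<Rightarrow> real) \<Rightarrow> ((real \<Rightarrow> real) \<Rightarrow> real \<Rightarrow> real) \<Rightarrow> bool" where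
  "linear_L2 \<mu> A \<longleftrightarrow> (\<forall>g\<in>L2 \<mu>. \<forall>h\<in>L2 \<mu>. \<forall>p q.
     AE x in lborel. A (\<lambda>y. p * g y + q * h y) x = p * A g x + q * A h x)"

definition nonneg_symmetric_op ::
    "(real \<Rightarrow> real) \<Rightarrow> ((real \<Rightarrow> real) \<Rightarrow> real \<Rightarrow> real) \<Rightarrow> bool" where
  "nonneg_symmetric_op \<mu> A \<longleftrightarrow> linear_L2 \<mu> A \<and> (\<forall>h\<in>L2 \<mu>. A h \<in> L2 \<mu>) \<and>
     (\<exists>K. \<forall>h\<in>L2 \<mu>. norm_L2 \<mu> (A h) \<le> K * norm_L2 \<mu> h) \<and>
     (\<forall>g\<in>L2 \<mu>. \<forall>h\<in>L2 \<mu>. inner_L2 \<mu> (A g) h = inner_L2 \<mu> g (A h)) \<and>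
     (\<forall>h\<in>L2 \<mu>. 0 \<le> inner_L2 \<mu> (A h) h)"

text \<open>For non-negative symmetric operators the trace, and for arbitrary bounded operators the
  Hilbert--Schmidt norm, does not depend on the orthonormal basis.\<close>

definition trace_class_cov ::
    "(real \<Rightarrow> real) \<Rightarrow> ((real \<Rightarrow> real) \<Rightarrow> real \<Rightarrow> real) \<Rightarrow> bool" where
  "trace_class_cov \<mu> Q \<longleftrightarrow> nonneg_symmetric_op \<mu> Q \<and>
     (\<exists>e. onb \<mu> e \<and> summable (\<lambda>k. inner_L2 \<mu> (Q (e k)) (e k)))"

definition is_sqrt_op :: "(real \<Rightarrow> real) \<Rightarrow> ((real \<Rightarrow> real) \<Rightarrow> real \<Rightarrow> real) \<Rightarrow>
    ((real \<Rightarrow> real) \<Rightarrow> real \<Rightarrow> real) \<Rightarrow> bool" where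
  "is_sqrt_op \<mu> S Q \<longleftrightarrow> nonneg_symmetric_op \<mu> S \<and>
     (\<forall>h\<in>L2 \<mu>. AE x in lborel. S (S h) x = Q h x)"

definition hilbert_schmidt_L2_H1 ::
    "(real \<Rightarrow> real) \<Rightarrow> ((real \<Rightarrow> real) \<Rightarrow> real \<Rightarrow> real) \<Rightarrow> bool" where
  "hilbert_schmidt_L2_H1 \<mu> S \<longleftrightarrow> linear_L2 \<mu> S \<and> (\<forall>h\<in>L2 \<mu>. S h \<in> H1 \<mu>) \<and>
     (\<exists>K. \<forall>h\<in>L2 \<mu>. norm_H1 \<mu> (S h) \<le> K * norm_L2 \<mu> h) \<and>
     (\<exists>e. onb \<mu> e \<and> summable (\<lambda>k. (norm_H1 \<mu> (S (e k)))\<^sup>2))"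


section \<open>The noise\<close>

definition stochastic_basis :: "'w measure \<Rightarrow> (real \<Rightarrow> 'w measure) \<Rightarrow> bool" where
  "stochastic_basis M F \<longleftrightarrow> prob_space M \<and> filtration (space M) F \<and> (\<forall>t. subalgebra M (F t))"

text \<open>Since \<open>L\<^sup>2(\<mu>)\<close> is separable, Borel measurability of an \<open>L\<^sup>2(\<mu>)\<close>-valued map is
  measurability of all its scalar products.\<close>

definition adapted_L2 :: "(real \<Rightarrow> 'w measure) \<Rightarrow> real \<Rightarrow> (real \<Rightarrow> real) \<Rightarrow>
    (real \<Rightarrow> 'w \<Rightarrow> real \<Rightarrow> real) \<Rightarrow> bool" where
  "adapted_L2 F T \<mu> X \<longleftrightarrow> (\<forall>t\<in>{0..T}. (\<forall>\<omega>\<in>space (F t). X t \<omega> \<in> L2 \<mu>) \<and>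
     (\<forall>h\<in>L2 \<mu>. (\<lambda>\<omega>. inner_L2 \<mu> (X t \<omega>) h) \<in> borel_measurable (F t)))"

text \<open>The centred normal law with variance \<open>v\<close>, where \<open>v = 0\<close> means the point mass at 0.\<close>

definition centred_gaussian :: "'w measure \<Rightarrow> ('w \<Rightarrow> real) \<Rightarrow> real \<Rightarrow> bool" where
  "centred_gaussian M X v \<longleftrightarrow> X \<in> borel_measurable M \<and>
     (if v = 0 then AE \<omega> in M. X \<omega> = 0
      else v > 0 \<and> distributed M lborel X (normal_density 0 (sqrt v)))"

definition generated_L2 :: "'w measure \<Rightarrow> (real \<Rightarrow> real) \<Rightarrow> ('w \<Rightarrow> real \<Rightarrow> real) \<Rightarrow> 'w set set" where
  "generated_L2 M \<mu> Y = sigma_sets (space M)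
     {(\<lambda>\<omega>. inner_L2 \<mu> (Y \<omega>) h) -` B \<inter> space M | h B. h \<in> L2 \<mu> \<and> B \<in> sets borel}"

definition Q_wiener_process :: "'w measure \<Rightarrow> (real \<Rightarrow> 'w measure) \<Rightarrow> real \<Rightarrow> (real \<Rightarrow> real) \<Rightarrow>
    ((real \<Rightarrow> real) \<Rightarrow> real \<Rightarrow> real) \<Rightarrow> (real \<Rightarrow> 'w \<Rightarrow> real \<Rightarrow> real) \<Rightarrow> bool" where
  "Q_wiener_process M F T \<mu> Q W \<longleftrightarrow> trace_class_cov \<mu> Q \<and> adapted_L2 F T \<mu> W \<and>
     (AE \<omega> in M. AE x in lborel. W 0 \<omega> x = 0) \<and>
     (AE \<omega> in M. C_L2 T \<mu> (\<lambda>t. W t \<omega>)) \<and>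
     (\<forall>s t. 0 \<le> s \<and> s \<le> t \<and> t \<le> T \<longrightarrow>
        (\<forall>h\<in>L2 \<mu>. centred_gaussian M (\<lambda>\<omega>. inner_L2 \<mu> (\<lambda>x. W t \<omega> x - W s \<omega> x) h)
                     ((t - s) * inner_L2 \<mu> (Q h) h)) \<and>
        prob_space.indep_set M (sets (F s)) (generated_L2 M \<mu> (\<lambda>\<omega> x. W t \<omega> x - W s \<omega> x)))"


section \<open>Stochastic integral of a deterministic integrand\<close>

text \<open>\<open>I(t)\<close> is the integral over \<open>[0,t]\<close> of \<open>\<langle>\<Phi>(s), dW(s)\<rangle>\<close>, with the (unweighted) scalar
  product of \<open>L\<^sup>2(\<real>)\<close>: for step functions it is the obvious finite sum of increments, and in
  general \<open>\<Phi>\<close> is approximated in \<open>L\<^sup>2(0,T; L\<^sup>2(\<real>))\<close> by step functions and \<open>I(t)\<close> is the limit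
  in mean square of their integrals.\<close>

definition step_fun ::
    "nat \<Rightarrow> (nat \<Rightarrow> real) \<Rightarrow> (nat \<Rightarrow> real \<Rightarrow> real) \<Rightarrow> real \<Rightarrow> real \<Rightarrow> real" where
  "step_fun n p \<phi> s x = (\<Sum>k<n. indicat_real {p k<..p (Suc k)} s * \<phi> k x)"

definition step_integral :: "(real \<Rightarrow> 'w \<Rightarrow> real \<Rightarrow> real) \<Rightarrow>
    nat \<Rightarrow> (nat \<Rightarrow> real) \<Rightarrow> (nat \<Rightarrow> real \<Rightarrow> real) \<Rightarrow> real \<Rightarrow> 'w \<Rightarrow> real" where
  "step_integral W n p \<phi> t \<omega> = (\<Sum>k<n. inner_L2 (\<lambda>_. 1) (\<phi> k)
       (\<lambda>x. W (min t (p (Suc k))) \<omega> x - W (min t (p k)) \<omega> x))"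

definition is_stoch_integral :: "'w measure \<Rightarrow> real \<Rightarrow> (real \<Rightarrow> 'w \<Rightarrow> real \<Rightarrow> real) \<Rightarrow>
    (real \<Rightarrow> real \<Rightarrow> real) \<Rightarrow> (real \<Rightarrow> 'w \<Rightarrow> real) \<Rightarrow> bool" where
  "is_stoch_integral M T W \<Phi> I \<longleftrightarrow>
     (\<forall>t\<in>{0..T}. I t \<in> borel_measurable M) \<and>
     (AE \<omega> in M. continuous_on {0..T} (\<lambda>t. I t \<omega>)) \<and>
     (\<exists>(N :: nat \<Rightarrow> nat) (p :: nat \<Rightarrow> nat \<Rightarrow> real) (\<phi> :: nat \<Rightarrow> nat \<Rightarrow> real \<Rightarrow> real).
        (\<forall>n. \<forall>k<N n. 0 \<le> p n k \<and> p n k \<le> p n (Suc k) \<and> p n (Suc k) \<le> T \<and> \<phi> n k \<in> L2 (\<lambda>_. 1)) \<and>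
        ((\<lambda>n. \<integral>\<^sup>+s\<in>{0..T}. ennreal ((norm_L2 (\<lambda>_. 1)
             (\<lambda>x. step_fun (N n) (p n) (\<phi> n) s x - \<Phi> s x))\<^sup>2) \<partial>lborel) \<longlonglongrightarrow> 0) \<and>
        (\<forall>t\<in>{0..T}. (\<lambda>n. \<integral>\<^sup>+\<omega>. ennreal ((step_integral W (N n) (p n) (\<phi> n) t \<omega> - I t \<omega>)\<^sup>2) \<partial>M)
             \<longlonglongrightarrow> 0))"


section \<open>Solutions\<close>

text \<open>Variational solution, in the triple \<open>H\<^sup>1(\<mu>) \<hookrightarrow> L\<^sup>2(\<mu>) \<hookrightarrow> H\<^sup>1(\<mu>)\<^sup>*\<close>, of
  \<open>dX = A(t, X) dt + \<sigma> dW\<close>, \<open>X(0) = x\<^sub>0\<close>, where \<open>A t \<omega> v w\<close> is the duality pairing of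
  \<open>A(t, \<omega>, v)\<close> with \<open>w\<close>.  The identity in the dual space is tested with all \<open>w\<close> in \<open>H\<^sup>1(\<mu>)\<close>.\<close>

definition variational_solution :: "'w measure \<Rightarrow> (real \<Rightarrow> 'w measure) \<Rightarrow> real \<Rightarrow> (real \<Rightarrow> real) \<Rightarrow>
    (real \<Rightarrow> 'w \<Rightarrow> (real \<Rightarrow> real) \<Rightarrow> (real \<Rightarrow> real) \<Rightarrow> real) \<Rightarrow> real \<Rightarrow>
    (real \<Rightarrow> 'w \<Rightarrow> real \<Rightarrow> real) \<Rightarrow> (real \<Rightarrow> real) \<Rightarrow> (real \<Rightarrow> 'w \<Rightarrow> real \<Rightarrow> real) \<Rightarrow> bool" where
  "variational_solution M F T \<mu> A \<sigma> W x0 X \<longleftrightarrow>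
     adapted_L2 F T \<mu> X \<and>
     (\<forall>\<omega>\<in>space M. C_L2 T \<mu> (\<lambda>t. X t \<omega>)) \<and>
     (AE \<omega> in M. (\<integral>\<^sup>+t\<in>{0..T}. (enorm_H1 \<mu> (X t \<omega>))\<^sup>2 \<partial>lborel) < \<infinity>) \<and>
     (AE \<omega> in M. \<forall>w\<in>H1 \<mu>.
        set_integrable lborel {0..T} (\<lambda>s. A s \<omega> (X s \<omega>) w) \<and>
        (\<forall>t\<in>{0..T}. inner_L2 \<mu> (X t \<omega>) w =
           inner_L2 \<mu> x0 w + (LINT s:{0..t}|lborel. A s \<omega> (X s \<omega>) w)
           + \<sigma> * inner_L2 \<mu> (W t \<omega>) w))"

definition front_drift :: "real \<Rightarrow> real \<Rightarrow> (real \<Rightarrow> real) \<Rightarrow> real \<Rightarrow> (real \<Rightarrow> real) \<Rightarrow> real \<Rightarrow>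
    real \<Rightarrow> 'w \<Rightarrow> (real \<Rightarrow> real) \<Rightarrow> (real \<Rightarrow> real) \<Rightarrow> real" where
  "front_drift \<nu> b f c vh Z t \<omega> v w =
     \<nu> * laplace_pairing (wgt \<nu> c Z 0) v w
     + b * inner_L2 (wgt \<nu> c Z 0) (\<lambda>x. f (v x + vh (x + c * t)) - f (vh (x + c * t))) w"

definition linear_drift :: "real \<Rightarrow> real \<Rightarrow> (real \<Rightarrow> real) \<Rightarrow> real \<Rightarrow> (real \<Rightarrow> real) \<Rightarrow>
    (real \<Rightarrow> 'w \<Rightarrow> real) \<Rightarrow> real \<Rightarrow> 'w \<Rightarrow> (real \<Rightarrow> real) \<Rightarrow> (real \<Rightarrow> real) \<Rightarrow> real" where
  "linear_drift \<nu> b f c vh c0 t \<omega> v w =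
     \<nu> * laplace_pairing (\<lambda>_. 1) v w
     + b * inner_L2 (\<lambda>_. 1) (\<lambda>x. deriv f (vh (x + c * t)) * v x) w
     - c0 t \<omega> * inner_L2 (\<lambda>_. 1) (\<lambda>x. deriv vh (x + c * t)) w"

definition front_solution :: "'w measure \<Rightarrow> (real \<Rightarrow> 'w measure) \<Rightarrow> real \<Rightarrow>
    real \<Rightarrow> real \<Rightarrow> (real \<Rightarrow> real) \<Rightarrow> real \<Rightarrow> (real \<Rightarrow> real) \<Rightarrow> real \<Rightarrow>
    (real \<Rightarrow> 'w \<Rightarrow> real \<Rightarrow> real) \<Rightarrow> (real \<Rightarrow> real) \<Rightarrow> real \<Rightarrow> (real \<Rightarrow> 'w \<Rightarrow> real \<Rightarrow> real) \<Rightarrow> bool" where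
  "front_solution M F T \<nu> b f c vh Z W \<eta> \<epsilon> u \<longleftrightarrow>
     variational_solution M F T (wgt \<nu> c Z 0) (front_drift \<nu> b f c vh Z) \<epsilon> W (\<lambda>x. \<epsilon> * \<eta> x) u \<and>
     (\<forall>\<omega>\<in>space M. C_H1 T (wgt \<nu> c Z 0) (\<lambda>t. u t \<omega>))"

definition is_c0 :: "'w measure \<Rightarrow> (real \<Rightarrow> 'w measure) \<Rightarrow> real \<Rightarrow>
    real \<Rightarrow> real \<Rightarrow> (real \<Rightarrow> real) \<Rightarrow> real \<Rightarrow>
    (real \<Rightarrow> 'w \<Rightarrow> real \<Rightarrow> real) \<Rightarrow> (real \<Rightarrow> real) \<Rightarrow> real \<Rightarrow> (real \<Rightarrow> 'w \<Rightarrow> real) \<Rightarrow> bool" where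
  "is_c0 M F T \<nu> c vh Z W \<eta> m c0 \<longleftrightarrow>
     (\<forall>t\<in>{0..T}. c0 t \<in> borel_measurable (F t)) \<and>
     (\<forall>\<omega>\<in>space M. continuous_on {0..T} (\<lambda>t. c0 t \<omega>)) \<and>
     (\<exists>I. is_stoch_integral M T W (\<lambda>t x. Psi \<nu> c Z vh (x + c * t)) I \<and>
        (AE \<omega> in M. \<forall>t\<in>{0..T}. c0 t \<omega> =
           m * inner_L2 (\<lambda>_. 1) \<eta> (Psi \<nu> c Z vh)
           - m * (LINT s:{0..t}|lborel. c0 s \<omega>) + m * I t \<omega>))"

definition is_u0 :: "'w measure \<Rightarrow> (real \<Rightarrow> 'w measure) \<Rightarrow> real \<Rightarrow>
    real \<Rightarrow> real \<Rightarrow> (real \<Rightarrow> real) \<Rightarrow> real \<Rightarrow> (real \<Rightarrow> real) \<Rightarrow> real \<Rightarrow>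
    (real \<Rightarrow> 'w \<Rightarrow> real \<Rightarrow> real) \<Rightarrow> (real \<Rightarrow> real) \<Rightarrow> (real \<Rightarrow> 'w \<Rightarrow> real) \<Rightarrow>
    (real \<Rightarrow> 'w \<Rightarrow> real \<Rightarrow> real) \<Rightarrow> bool" where
  "is_u0 M F T \<nu> b f c vh Z W \<eta> c0 u0 \<longleftrightarrow>
     variational_solution M F T (\<lambda>_. 1) (linear_drift \<nu> b f c vh c0) 1 W \<eta> u0 \<and>
     (\<integral>\<^sup>+\<omega>. (SUP t\<in>{0..T}. ennreal ((norm_L2 (\<lambda>_. 1) (u0 t \<omega>))\<^sup>2)) \<partial>M) < \<infinity> \<and>
     (\<integral>\<^sup>+\<omega>. (\<integral>\<^sup>+t\<in>{0..T}. (enorm_H1 (\<lambda>_. 1) (u0 t \<omega>))\<^sup>2 \<partial>lborel) \<partial>M) < \<infinity> \<and>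
     (\<forall>\<omega>\<in>space M. C_H1 T (wgt \<nu> c Z 0) (\<lambda>t. u0 t \<omega>)) \<and>
     (\<integral>\<^sup>+\<omega>. (SUP t\<in>{0..T}. ennreal ((norm_H1 (wgt \<nu> c Z 0) (u0 t \<omega>))\<^sup>2)) \<partial>M) < \<infinity>"

definition primitive :: "(real \<Rightarrow> 'w \<Rightarrow> real) \<Rightarrow> real \<Rightarrow> 'w \<Rightarrow> real" where
  "primitive c0 t \<omega> = (LINT s:{0..t}|lborel. c0 s \<omega>)"


section \<open>Stopping times\<close>

definition first_time :: "real \<Rightarrow> (real \<Rightarrow> bool) \<Rightarrow> real" where
  "first_time T P = (if \<exists>t\<in>{0..T}. P t then Inf {t \<in> {0..T}. P t} else T)"

definition tau_u :: "real \<Rightarrow> real \<Rightarrow> real \<Rightarrow> real \<Rightarrow> real \<Rightarrow> real \<Rightarrow>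
    (real \<Rightarrow> 'w \<Rightarrow> real \<Rightarrow> real) \<Rightarrow> 'w \<Rightarrow> real" where
  "tau_u T \<nu> c Z q \<epsilon> u \<omega> = first_time T (\<lambda>t. norm_H1 (wgt \<nu> c Z t) (u t \<omega>) \<ge> \<epsilon> powr (1 - q))"

definition tau_C :: "real \<Rightarrow> real \<Rightarrow> real \<Rightarrow> (real \<Rightarrow> 'w \<Rightarrow> real) \<Rightarrow> 'w \<Rightarrow> real" where
  "tau_C T q \<epsilon> C0 \<omega> = first_time T (\<lambda>t. \<bar>C0 t \<omega>\<bar> \<ge> \<epsilon> powr (- q))"

end

theory Submission
  imports Defs
begin

text \<open>
  Put \<open>w = u - \<epsilon> u\<^sub>0 - \<epsilon> C\<^sub>0 \<phi>(\<cdot> + ct)\<close>, where \<open>\<phi> = v'\<close> is the derivative of the wave profile \<open>v\<close>.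
  Differentiating the wave equation gives \<open>c \<phi>' = \<nu> \<phi>'' + b f'(v) \<phi>\<close>, so in the equation for \<open>w\<close> not
  only the noise cancels but also \<open>c\<^sub>0\<close> (on which the stopping times give no control), and \<open>w\<close> solves
  the linear parabolic equation \<open>w\<^sub>t = \<nu> w\<^sub>x\<^sub>x + b f'(v) w + b R(u)\<close> with \<open>w(0) = 0\<close> and
  \<open>\<bar>R(u)\<bar> \<le> \<eta> (1 + \<bar>u\<bar>) u\<^sup>2\<close>.  A pathwise energy estimate bounds \<open>w\<close> in the weighted \<open>H\<^sup>1\<close> norm by a
  multiple of \<open>\<epsilon>\<^bsup>2-2q\<^esup>\<close>, and a Taylor expansion of \<open>v\<close> takes care of the rest of the remainder because
  \<open>\<bar>\<phi>'\<bar>\<close> and \<open>\<bar>\<phi>''\<bar>\<close> are bounded by a multiple of \<open>\<phi>\<close>.  The same estimate up to the first time at which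
  \<open>u\<close> reaches the level \<open>\<epsilon>\<^bsup>1-q\<^esup>\<close> shows that for almost every path this level is not reached when
  \<open>\<epsilon>\<close> is small.
\<close>

section \<open>Smooth step functions\<close>

lemma Ck_0: "Ck 0 g \<longleftrightarrow> continuous_on UNIV g"
  by (simp add: Ck_def)

lemma Ck_Suc: "Ck (Suc k) g \<longleftrightarrow> (\<forall>x. g field_differentiable at x) \<and> Ck k (deriv g)"
proof -
  have *: "(deriv ^^ Suc j) g = (deriv ^^ j) (deriv g)" for j
    by (simp add: funpow_swap1)
  have "(\<forall>j<Suc k. P j) \<longleftrightarrow> P 0 \<and> (\<forall>j<k. P (Suc j))" for P
    using less_Suc_eq_0_disj by auto
  then show ?thesis
    unfolding Ck_def * by (auto simp del: funpow.simps simp: * funpow_0)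
qed

lemma Ck_SucI:
  assumes "\<And>x. (g has_real_derivative g' x) (at x)" "Ck k g'"
  shows "Ck (Suc k) g"
proof -
  have "deriv g = g'" using assms(1) by (auto intro!: ext DERIV_imp_deriv)
  then show ?thesis
    using assms by (auto simp: Ck_Suc field_differentiable_def)
qed

lemma Ck_SucD:
  assumes "Ck (Suc k) g"
  shows "(g has_real_derivative deriv g x) (at x)" "Ck k (deriv g)"
  using assms DERIV_deriv_iff_field_differentiable by (auto simp: Ck_Suc)

lemma Ck_Suc_imp: "Ck (Suc k) g \<Longrightarrow> Ck k g"
proof (induction k arbitrary: g)
  case 0
  then have "\<And>x. isCont g x" using Ck_SucD(1) DERIV_isCont by blast
  then show ?case by (simp add: Ck_0 continuous_at_imp_continuous_on)
next
  case (Suc k)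
  then show ?case using Ck_Suc by blast
qed

lemma Ck_continuous_on: "Ck k g \<Longrightarrow> continuous_on A g"
proof (induction k)
  case 0 then show ?case using Ck_0 continuous_on_subset by blast
next
  case (Suc k) then show ?case using Ck_Suc_imp by blast
qed

lemma Ck_const: "Ck k (\<lambda>_. a)"
proof (induction k arbitrary: a)
  case (Suc k)
  show ?case by (rule Ck_SucI[of _ "\<lambda>_. 0"]) (auto intro: Suc)
qed (simp add: Ck_0)

lemma Ck_add: "Ck k f \<Longrightarrow> Ck k g \<Longrightarrow> Ck k (\<lambda>x. f x + g x)"
proof (induction k arbitrary: f g)
  case 0 then show ?case by (auto simp: Ck_0 intro: continuous_intros)
next
  case (Suc k)
  show ?case
    by (rule Ck_SucI[of _ "\<lambda>x. deriv f x + deriv g x"])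
      (use Suc Ck_SucD in \<open>auto intro!: derivative_eq_intros\<close>)
qed

lemma Ck_mult: "Ck k f \<Longrightarrow> Ck k g \<Longrightarrow> Ck k (\<lambda>x. f x * g x)"
proof (induction k arbitrary: f g)
  case 0 then show ?case by (auto simp: Ck_0 intro: continuous_intros)
next
  case (Suc k)
  have "Ck k (\<lambda>x. deriv f x * g x + deriv g x * f x)"
    by (rule Ck_add[OF Suc.IH Suc.IH];
      rule Ck_SucD(2)[OF Suc.prems(1)] Ck_SucD(2)[OF Suc.prems(2)]
        Ck_Suc_imp[OF Suc.prems(1)] Ck_Suc_imp[OF Suc.prems(2)])
  moreover have "((\<lambda>x. f x * g x) has_real_derivative deriv f x * g x + deriv g x * f x) (at x)" for x
    by (rule DERIV_mult[OF Ck_SucD(1)[OF Suc.prems(1)] Ck_SucD(1)[OF Suc.prems(2)]])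
  ultimately show ?case by (rule Ck_SucI[rotated])
qed

lemma Ck_cmult: "Ck k f \<Longrightarrow> Ck k (\<lambda>x. a * f x)"
  by (intro Ck_mult Ck_const)

lemma Ck_diff: "Ck k f \<Longrightarrow> Ck k g \<Longrightarrow> Ck k (\<lambda>x. f x - g x)"
  using Ck_add[of k f "\<lambda>x. (-1) * g x"] Ck_cmult[of k g "-1"] by simp

lemma Ck_affine: "Ck k f \<Longrightarrow> Ck k (\<lambda>x. f (a * x + d))"
proof (induction k arbitrary: f)
  case 0 then show ?case
    by (auto simp: Ck_0 intro!: continuous_intros intro: continuous_on_compose2[of UNIV f])
next
  case (Suc k)
  have "Ck k (\<lambda>x. a * deriv f (a * x + d))"
    by (rule Ck_cmult[OF Suc.IH[OF Ck_SucD(2)[OF Suc.prems]]])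
  moreover have "((\<lambda>x. f (a * x + d)) has_real_derivative a * deriv f (a * x + d)) (at x)" for x
  proof -
    have "((\<lambda>x. f (a * x + d)) has_real_derivative deriv f (a * x + d) * a) (at x)"
      by (rule DERIV_chain2[OF Ck_SucD(1)[OF Suc.prems]]) (auto intro!: derivative_eq_intros)
    then show ?thesis by (simp add: mult.commute)
  qed
  ultimately show ?case by (rule Ck_SucI[rotated])
qed

definition flat_exp :: "real poly \<Rightarrow> real \<Rightarrow> real" where
  "flat_exp p x = (if 0 < x then poly p (inverse x) * exp (- inverse x) else 0)"

lemma poly_exp_tendsto_0: "((\<lambda>y. poly p y * exp (- y)) \<longlongrightarrow> (0::real)) at_top"
proof -
  have "((\<lambda>y. \<Sum>i\<le>degree p. coeff p i * (y ^ i / exp y)) \<longlongrightarrow> (\<Sum>i\<le>degree p. coeff p i * 0)) at_top"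
    by (intro tendsto_sum tendsto_mult tendsto_const tendsto_power_div_exp_0)
  moreover have "(\<Sum>i\<le>degree p. coeff p i * (y ^ i / exp y)) = poly p y * exp (- y)" for y :: real
    by (simp add: poly_altdef sum_distrib_right exp_minus divide_inverse mult.assoc)
  ultimately show ?thesis by simp
qed

lemma flat_exp_deriv:
  "(flat_exp p has_real_derivative flat_exp ([:0, 0, 1:] * (p - pderiv p)) x) (at x)"
proof -
  consider "x > 0" | "x < 0" | "x = 0" by linarith
  then show ?thesis
  proof cases
    case 1
    have "((\<lambda>x. poly p (inverse x) * exp (- inverse x)) has_real_derivative
        flat_exp ([:0, 0, 1:] * (p - pderiv p)) x) (at x)"
      using 1 unfolding flat_exp_def
      by (auto intro!: derivative_eq_intros DERIV_chain2[OF poly_DERIV]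
          simp: power2_eq_square algebra_simps)
    moreover have "\<forall>\<^sub>F y in nhds x. flat_exp p y = poly p (inverse y) * exp (- inverse y)"
      using eventually_nhds_in_open[of "{0<..}" x] 1
      by (auto simp: flat_exp_def elim!: eventually_mono)
    ultimately show ?thesis by (subst DERIV_cong_ev[OF refl _ refl])
  next
    case 2
    have "\<forall>\<^sub>F y in nhds x. flat_exp p y = 0"
      using eventually_nhds_in_open[of "{..<0}" x] 2
      by (auto simp: flat_exp_def elim!: eventually_mono)
    then show ?thesis using 2 by (subst DERIV_cong_ev[OF refl _ refl]) (auto simp: flat_exp_def)
  next
    case 3
    have "((\<lambda>y. flat_exp p y / y) \<longlongrightarrow> 0) (at_right 0)"
    proof -
      have "((\<lambda>y. poly ([:0,1:] * p) (inverse y) * exp (- inverse y)) \<longlongrightarrow> 0) (at_right (0::real))"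
        by (rule filterlim_compose[OF poly_exp_tendsto_0 filterlim_inverse_at_top_right])
      moreover have "\<forall>\<^sub>F y in at_right 0. poly ([:0,1:] * p) (inverse y) * exp (- inverse y) = flat_exp p y / y"
        by (auto simp: flat_exp_def eventually_at_filter divide_inverse)
      ultimately show ?thesis by (rule Lim_transform_eventually)
    qed
    moreover have "((\<lambda>y. flat_exp p y / y) \<longlongrightarrow> 0) (at_left 0)"
    proof (rule tendsto_eventually)
      show "\<forall>\<^sub>F y in at_left 0. flat_exp p y / y = 0"
        by (auto simp: flat_exp_def eventually_at_filter)
    qed
    ultimately have "((\<lambda>y. flat_exp p y / y) \<longlongrightarrow> 0) (at 0)"
      by (simp add: filterlim_split_at_real)
    then show ?thesis using 3 by (simp add: has_field_derivative_iff flat_exp_def)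
  qed
qed

lemma Ck_flat_exp: "Ck k (flat_exp p)"
proof (induction k arbitrary: p)
  case 0
  have "\<And>x. isCont (flat_exp p) x" using flat_exp_deriv DERIV_isCont by blast
  then show ?case by (simp add: Ck_0 continuous_at_imp_continuous_on)
next
  case (Suc k)
  show ?case by (rule Ck_SucI[OF flat_exp_deriv Suc])
qed

lemma Ck_antiderivative:
  assumes "\<And>k. Ck k g" and "\<And>x. x \<le> 0 \<Longrightarrow> g x = 0"
  obtains G where "\<And>x. (G has_real_derivative g x) (at x)" "\<And>k. Ck k G" "\<And>x. x \<le> 0 \<Longrightarrow> G x = 0"
proof -
  have "isCont g x" for x
    using assms(1)[of 0] by (simp add: Ck_0 continuous_on_eq_continuous_at)
  then obtain F where F: "\<And>x. (F has_real_derivative g x) (at x)"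
    using einterval_antiderivative[of "-\<infinity>" "\<infinity>" g] by (auto simp: has_real_derivative_iff_has_vector_derivative)
  define G where "G x = F x - F 0" for x
  have d: "(G has_real_derivative g x) (at x)" for x
    unfolding G_def using DERIV_diff[OF F DERIV_const] by simp
  have z: "G x = 0" if "x \<le> 0" for x
  proof (cases "x = 0")
    case False
    then have "x < 0" using that by simp
    have "G 0 = G x"
    proof (rule DERIV_isconst_end[OF \<open>x < 0\<close>])
      show "continuous_on {x..0} G" using d DERIV_isCont continuous_at_imp_continuous_on by blast
      show "\<And>y. x < y \<Longrightarrow> y < 0 \<Longrightarrow> DERIV G y :> 0" using d assms(2) by (metis less_imp_le)
    qed
    then show ?thesis by (simp add: G_def)
  qed (simp add: G_def)
  have "Ck k G" for k
    using Ck_SucI[OF d assms(1)] Ck_Suc_imp by blast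
  then show ?thesis using that d z by blast
qed

lemma smooth_step_exists:
  obtains S S1 :: "real \<Rightarrow> real" and \<kappa> where
    "\<And>k. Ck k S" "\<And>k. Ck k S1" "\<And>x. (S1 has_real_derivative S x) (at x)"
    "\<And>x. x \<le> 0 \<Longrightarrow> S x = 0" "\<And>x. 1 \<le> x \<Longrightarrow> S x = 1" "\<And>x. 0 \<le> S x" "\<And>x. S x \<le> 1"
    "\<And>x. x \<le> 0 \<Longrightarrow> S1 x = 0" "\<And>x. 1 \<le> x \<Longrightarrow> S1 x = x - \<kappa>"
proof -
  define \<theta> where "\<theta> x = flat_exp [:1:] x * flat_exp [:1:] (1 - x)" for x :: real
  have k: "Ck k \<theta>" for k
  proof -
    have "Ck k (\<lambda>x. flat_exp [:1:] ((-1) * x + 1))" by (intro Ck_affine Ck_flat_exp)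
    then show ?thesis unfolding \<theta>_def by (intro Ck_mult Ck_flat_exp) simp
  qed
  have n: "0 \<le> \<theta> x" and z: "x \<le> 0 \<Longrightarrow> \<theta> x = 0" and z1: "1 \<le> x \<Longrightarrow> \<theta> x = 0"
    and p: "0 < x \<Longrightarrow> x < 1 \<Longrightarrow> 0 < \<theta> x" for x
    by (auto simp: \<theta>_def flat_exp_def)
  obtain G where G: "\<And>x. (G has_real_derivative \<theta> x) (at x)" "\<And>k. Ck k G" "\<And>x. x \<le> 0 \<Longrightarrow> G x = 0"
    using Ck_antiderivative[OF k z] by metis
  have mono: "G x \<le> G y" if "x \<le> y" for x y
    using DERIV_nonneg_imp_nondecreasing[OF that] G(1) n by blast
  have const: "G x = G 1" if "1 \<le> x" for x
  proof (cases "x = 1")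
    case False
    then have "1 < x" using that by simp
    show ?thesis
    proof (rule DERIV_isconst_end[OF \<open>1 < x\<close>])
      show "continuous_on {1..x} G" using G(1) DERIV_isCont continuous_at_imp_continuous_on by blast
      show "\<And>y. 1 < y \<Longrightarrow> y < x \<Longrightarrow> DERIV G y :> 0" using G(1) z1 by (metis less_imp_le)
    qed
  qed simp
  have pos: "0 < G 1"
  proof -
    have "G 0 < G 1"
    proof (rule DERIV_pos_imp_increasing_open[of 0 1 G])
      show "\<exists>y. DERIV G x :> y \<and> y > 0" if "0 < x" "x < 1" for x using G(1) p that by blast
      show "continuous_on {0..1} G" using G(1) DERIV_isCont continuous_at_imp_continuous_on by blast
    qed simp
    then show ?thesis using G(3) by simp
  qed
  define S where "S x = inverse (G 1) * G x" for x
  have S: "\<And>k. Ck k S" "\<And>x. x \<le> 0 \<Longrightarrow> S x = 0" "\<And>x. 1 \<le> x \<Longrightarrow> S x = 1"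
  proof -
    show "Ck k S" for k unfolding S_def[abs_def] by (rule Ck_cmult[OF G(2)])
    show "S x = 0" if "x \<le> 0" for x using G(3)[OF that] by (simp add: S_def)
    show "S x = 1" if "1 \<le> x" for x unfolding S_def const[OF that] using pos by simp
  qed
  have S01: "0 \<le> S x" "S x \<le> 1" for x
  proof -
    have "G (min x 0) \<le> G x" "G x \<le> G (max x 1)" by (rule mono, simp)+
    moreover have "G (min x 0) = 0" "G (max x 1) = G 1" by (rule G(3), simp) (rule const, simp)
    ultimately have "0 \<le> G x" "G x \<le> G 1" by simp_all
    then show "0 \<le> S x" "S x \<le> 1" using pos by (auto simp: S_def field_simps)
  qed
  obtain S1 where S1: "\<And>x. (S1 has_real_derivative S x) (at x)" "\<And>k. Ck k S1" "\<And>x. x \<le> 0 \<Longrightarrow> S1 x = 0"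
    using Ck_antiderivative[OF S(1,2)] by metis
  have "S1 x = x - (1 - S1 1)" if "1 \<le> x" for x
  proof (cases "x = 1")
    case False
    then have "1 < x" using that by simp
    have "S1 x - x = S1 1 - 1"
    proof (rule DERIV_isconst_end[OF \<open>1 < x\<close>, of "\<lambda>x. S1 x - x"])
      have d: "((\<lambda>x. S1 x - x) has_real_derivative S y - 1) (at y)" for y
        by (intro derivative_intros S1(1))
      then show "continuous_on {1..x} (\<lambda>x. S1 x - x)"
        using DERIV_isCont continuous_at_imp_continuous_on by blast
      show "DERIV (\<lambda>x. S1 x - x) y :> 0" if "1 < y" "y < x" for y
        using d[of y] unfolding S(3)[OF less_imp_le[OF that(1)]] by simp
    qed
    then show ?thesis by simp
  qed simp
  from that[OF S(1) S1(2) S1(1) S(2) S(3) S01 S1(3) this] show ?thesis .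
qed

section \<open>Weak derivatives and indefinite integrals\<close>

lemma locally_integrable_Icc:
  assumes "locally_integrable g"
  shows "set_integrable lborel {a..b} g"
proof -
  have "set_integrable lborel {- max \<bar>a\<bar> \<bar>b\<bar>..max \<bar>a\<bar> \<bar>b\<bar>} g"
    using assms by (simp add: locally_integrable_def)
  then show ?thesis by (rule set_integrable_subset) auto
qed

lemma locally_integrable_continuous:
  assumes "continuous_on UNIV g"
  shows "locally_integrable g"
  unfolding locally_integrable_def
proof (intro conjI allI)
  show "g \<in> borel_measurable borel" using assms by (rule borel_measurable_continuous_onI)
  show "set_integrable lborel {-R..R} g" for R
    by (rule borel_integrable_atLeastAtMost'[OF continuous_on_subset[OF assms]]) simp
qed

lemma locally_integrable_lincomb:
  assumes "locally_integrable f" "locally_integrable g"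
  shows "locally_integrable (\<lambda>x. p * f x + q * g x)"
  using assms unfolding locally_integrable_def
  by (auto intro!: set_integral_add(1) set_integrable_mult_right)

lemma locally_integrable_mult_continuous:
  assumes "locally_integrable u" "continuous_on UNIV m"
  shows "locally_integrable (\<lambda>x. u x * m x)"
  unfolding locally_integrable_def
proof (intro conjI allI)
  have [measurable]: "u \<in> borel_measurable borel" "m \<in> borel_measurable borel"
    using assms borel_measurable_continuous_onI by (auto simp: locally_integrable_def)
  show "(\<lambda>x. u x * m x) \<in> borel_measurable borel" by measurable
  fix R :: real
  have "bounded (m ` {-R..R})"
    by (intro compact_imp_bounded compact_continuous_image continuous_on_subset[OF assms(2)]) auto
  then obtain B where B: "\<And>x. x \<in> {-R..R} \<Longrightarrow> \<bar>m x\<bar> \<le> B"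
    by (force simp: bounded_iff)
  have i: "integrable lborel (\<lambda>x. B * (indicator {-R..R} x * u x))"
    using assms(1) by (auto simp: locally_integrable_def set_integrable_def)
  show "set_integrable lborel {-R..R} (\<lambda>x. u x * m x)"
    unfolding set_integrable_def
  proof (rule Bochner_Integration.integrable_bound[OF i])
    have "\<bar>u x\<bar> * \<bar>m x\<bar> \<le> \<bar>u x\<bar> * \<bar>B\<bar>" if "x \<in> {-R..R}" for x
      using B[OF that] by (intro mult_left_mono) auto
    then show "AE x in lborel. norm (indicat_real {- R..R} x *\<^sub>R (u x * m x)) \<le> norm (B * (indicat_real {- R..R} x * u x))"
      by (intro AE_I2) (auto simp: indicator_def abs_mult mult.commute)
  qed measurable
qed

lemma integral_eq_set_integral:
  assumes "\<And>x. x \<notin> A \<Longrightarrow> f x = 0"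
  shows "(LINT x|M. f x) = (LINT x:A|M. f x :: real)"
  unfolding set_lebesgue_integral_def
  by (rule Bochner_Integration.integral_cong) (auto simp: indicator_def assms)

lemma integrable_compact_support:
  assumes "locally_integrable u" "continuous_on UNIV m" "\<And>x. \<bar>x\<bar> > R \<Longrightarrow> m x = 0"
  shows "integrable lborel (\<lambda>x. u x * m x)"
proof -
  have "set_integrable lborel {-R..R} (\<lambda>x. u x * m x)"
    by (rule locally_integrable_Icc[OF locally_integrable_mult_continuous[OF assms(1,2)]])
  moreover have "(\<lambda>x. indicator {-R..R} x *\<^sub>R (u x * m x)) = (\<lambda>x. u x * m x)"
    using assms(3) by (force simp: indicator_def fun_eq_iff)
  ultimately show ?thesis by (simp add: set_integrable_def)
qed

lemma integrable_prod_mult: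
  fixes f g :: "real \<Rightarrow> real"
  assumes f: "integrable lborel f" and g: "integrable lborel g"
  shows "integrable (lborel \<Otimes>\<^sub>M lborel) (\<lambda>(x, y). f x * g y)"
proof (rule lborel_pair.Fubini_integrable)
  have [measurable]: "f \<in> borel_measurable borel" "g \<in> borel_measurable borel"
    using assms by auto
  show "(\<lambda>(x, y). f x * g y) \<in> borel_measurable (lborel \<Otimes>\<^sub>M lborel)" by measurable
  have "(\<lambda>x. LINT y|lborel. norm (case (x, y) of (x, y) \<Rightarrow> f x * g y)) = (\<lambda>x. \<bar>f x\<bar> * (LINT y|lborel. \<bar>g y\<bar>))"
    by (simp add: abs_mult fun_eq_iff)
  then show "integrable lborel (\<lambda>x. LINT y|lborel. norm (case (x, y) of (x, y) \<Rightarrow> f x * g y))"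
    using f by auto
  show "AE x in lborel. integrable lborel (\<lambda>y. case (x, y) of (x, y) \<Rightarrow> f x * g y)"
    using g by simp
qed

definition indef_integral :: "(real \<Rightarrow> real) \<Rightarrow> (real \<Rightarrow> real) \<Rightarrow> bool" where
  "indef_integral U g \<longleftrightarrow> locally_integrable g \<and>
     (\<forall>a b. a \<le> b \<longrightarrow> U b - U a = (LINT x:{a..b}|lborel. g x))"

lemma indef_integralD:
  assumes "indef_integral U g"
  shows "locally_integrable g" "a \<le> b \<Longrightarrow> U b - U a = (LINT x:{a..b}|lborel. g x)"
  using assms by (auto simp: indef_integral_def)

lemma indef_integral_isCont:
  assumes "indef_integral U g"
  shows "isCont U x"
proof -
  have i: "set_integrable lborel {c..d} g" for c d
    by (rule locally_integrable_Icc[OF indef_integralD(1)[OF assms]])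
  have eq: "U y = U (x - 1) + integral {x - 1..y} g" if "y \<in> {x - 1..x + 1}" for y
    using indef_integralD(2)[OF assms, of "x - 1" y] that set_borel_integral_eq_integral(2)[OF i] by simp
  have "continuous_on {x - 1..x + 1} (\<lambda>y. U (x - 1) + integral {x - 1..y} g)"
    by (intro continuous_intros indefinite_integral_continuous_1 set_borel_integral_eq_integral(1)[OF i])
  then have "continuous_on {x - 1..x + 1} U"
    by (subst continuous_on_cong[OF refl eq])
  then show ?thesis by (rule continuous_on_interior) simp
qed

lemma indef_integral_continuous_on: "indef_integral U g \<Longrightarrow> continuous_on A U"
  using indef_integral_isCont continuous_at_imp_continuous_on by blast

lemma indef_integral_C1:
  assumes d: "\<And>x. (F has_real_derivative f x) (at x)" and c: "continuous_on UNIV f"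
  shows "indef_integral F f"
  unfolding indef_integral_def
proof (intro conjI allI impI)
  show "locally_integrable f" by (rule locally_integrable_continuous[OF c])
  fix a b :: real assume "a \<le> b"
  have "(\<integral>x. f x * indicator {a..b} x \<partial>lborel) = F b - F a"
    by (rule integral_FTC_Icc_real[OF \<open>a \<le> b\<close> d]) (use c in \<open>simp add: continuous_on_eq_continuous_at\<close>)
  then show "F b - F a = (LINT x:{a..b}|lborel. f x)"
    by (simp add: set_lebesgue_integral_def mult.commute)
qed

lemma indef_integral_lincomb:
  assumes "indef_integral U g" "indef_integral V h"
  shows "indef_integral (\<lambda>x. p * U x + q * V x) (\<lambda>x. p * g x + q * h x)"
  unfolding indef_integral_def
proof (intro conjI allI impI)
  show "locally_integrable (\<lambda>x. p * g x + q * h x)"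
    using assms by (intro locally_integrable_lincomb) (auto simp: indef_integral_def)
  fix a b :: real assume ab: "a \<le> b"
  have i: "set_integrable lborel {a..b} g" "set_integrable lborel {a..b} h"
    using assms locally_integrable_Icc by (auto simp: indef_integral_def)
  have "(LINT x:{a..b}|lborel. p * g x + q * h x) = p * (LINT x:{a..b}|lborel. g x) + q * (LINT x:{a..b}|lborel. h x)"
    using i by (subst set_integral_add(2)) (auto intro: set_integrable_mult_right)
  then show "p * U b + q * V b - (p * U a + q * V a) = (LINT x:{a..b}|lborel. p * g x + q * h x)"
    unfolding indef_integralD(2)[OF assms(1) ab, symmetric] indef_integralD(2)[OF assms(2) ab, symmetric]
    by (simp add: algebra_simps)
qed

lemma indef_integral_mult_C1:
  assumes U: "indef_integral U g" and d: "\<And>x. (m has_real_derivative m' x) (at x)"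
    and c: "continuous_on UNIV m'"
  shows "indef_integral (\<lambda>x. U x * m x) (\<lambda>x. g x * m x + U x * m' x)"
  unfolding indef_integral_def
proof (intro conjI allI impI)
  have cm: "continuous_on UNIV m" using d DERIV_isCont continuous_at_imp_continuous_on by blast
  have li: "locally_integrable (\<lambda>x. g x * m x)" "locally_integrable (\<lambda>x. U x * m' x)"
    by (rule locally_integrable_mult_continuous[OF indef_integralD(1)[OF U] cm])
      (rule locally_integrable_mult_continuous[OF locally_integrable_continuous[OF indef_integral_continuous_on[OF U]] c])
  show "locally_integrable (\<lambda>x. g x * m x + U x * m' x)"
    using locally_integrable_lincomb[OF li, of 1 1] by simp
  have M: "indef_integral m m'" by (rule indef_integral_C1[OF d c])
  fix a b :: real assume ab: "a \<le> b"
  define A where "A = {a..b}"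
  have [measurable]: "A \<in> sets borel" by (simp add: A_def)
  have ig: "integrable lborel (\<lambda>x. indicator A x * g x)"
    using locally_integrable_Icc[OF indef_integralD(1)[OF U], of a b] by (simp add: set_integrable_def A_def)
  have im: "integrable lborel (\<lambda>x. indicator A x * m' x)"
    using locally_integrable_Icc[OF indef_integralD(1)[OF M], of a b] by (simp add: set_integrable_def A_def)
  have [measurable]: "g \<in> borel_measurable borel" "m' \<in> borel_measurable borel"
    using U M by (auto simp: indef_integral_def locally_integrable_def)
  define h where "h x y = indicator A x * m' x * (indicator A y * g y) * (if y \<le> x then 1 else (0::real))" for x y
  have "integrable (lborel \<Otimes>\<^sub>M lborel) (case_prod h)"
  proof (rule Bochner_Integration.integrable_bound[OF integrable_prod_mult[OF im ig]])
    show "AE x in lborel \<Otimes>\<^sub>M lborel. norm (case x of (x, y) \<Rightarrow> h x y)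
      \<le> norm (case x of (x, y) \<Rightarrow> indicat_real A x * m' x * (indicat_real A y * g y))"
      by (intro AE_I2) (auto simp: h_def)
    show "case_prod h \<in> borel_measurable (lborel \<Otimes>\<^sub>M lborel)"
      unfolding h_def by measurable
  qed
  then have fub: "(\<integral>y. (\<integral>x. h x y \<partial>lborel) \<partial>lborel) = (\<integral>x. (\<integral>y. h x y \<partial>lborel) \<partial>lborel)"
    by (rule lborel_pair.Fubini_integral)
  have in1: "(\<integral>y. h x y \<partial>lborel) = indicator A x * (m' x * (U x - U a))" for x
  proof (cases "x \<in> A")
    case True
    have "(\<integral>y. h x y \<partial>lborel) = (\<integral>y. m' x * (indicator {a..x} y *\<^sub>R g y) \<partial>lborel)"
      using True by (intro Bochner_Integration.integral_cong) (auto simp: h_def A_def indicator_def)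
    also have "\<dots> = m' x * (U x - U a)"
      using True indef_integralD(2)[OF U, of a x] by (simp add: A_def set_lebesgue_integral_def)
    finally show ?thesis using True by simp
  qed (simp add: h_def)
  have in2: "(\<integral>x. h x y \<partial>lborel) = indicator A y * (g y * (m b - m y))" for y
  proof (cases "y \<in> A")
    case True
    have "(\<integral>x. h x y \<partial>lborel) = (\<integral>x. g y * (indicator {y..b} x *\<^sub>R m' x) \<partial>lborel)"
      using True by (intro Bochner_Integration.integral_cong) (auto simp: h_def A_def indicator_def)
    also have "\<dots> = g y * (m b - m y)"
      using True indef_integralD(2)[OF M, of y b] by (simp add: A_def set_lebesgue_integral_def)
    finally show ?thesis using True by simp
  qed (simp add: h_def)
  have f2: "(LINT y:A|lborel. g y * (m b - m y)) = (LINT x:A|lborel. m' x * (U x - U a))"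
    using fub unfolding in1 in2 by (simp add: set_lebesgue_integral_def)
  have s: "set_integrable lborel A g" "set_integrable lborel A m'" "set_integrable lborel A (\<lambda>x. g x * m x)"
    "set_integrable lborel A (\<lambda>x. U x * m' x)"
    using locally_integrable_Icc li indef_integralD(1)[OF U] indef_integralD(1)[OF M] by (auto simp: A_def)
  have "(LINT y:A|lborel. g y * (m b - m y)) = (LINT y:A|lborel. m b * g y - g y * m y)"
    by (rule set_lebesgue_integral_cong) (auto simp: algebra_simps)
  also have "\<dots> = m b * (U b - U a) - (LINT y:A|lborel. g y * m y)"
    using s indef_integralD(2)[OF U ab] by (subst set_integral_diff(2)) (auto simp: A_def)
  finally have e1: "(LINT y:A|lborel. g y * (m b - m y)) = m b * (U b - U a) - (LINT y:A|lborel. g y * m y)" .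
  have "(LINT x:A|lborel. m' x * (U x - U a)) = (LINT x:A|lborel. U x * m' x - U a * m' x)"
    by (rule set_lebesgue_integral_cong) (auto simp: algebra_simps)
  also have "\<dots> = (LINT x:A|lborel. U x * m' x) - U a * (m b - m a)"
    using s indef_integralD(2)[OF M ab] by (subst set_integral_diff(2)) (auto simp: A_def)
  finally have e2: "(LINT x:A|lborel. m' x * (U x - U a)) = (LINT x:A|lborel. U x * m' x) - U a * (m b - m a)" .
  have "(LINT x:A|lborel. g x * m x + U x * m' x) = (LINT x:A|lborel. g x * m x) + (LINT x:A|lborel. U x * m' x)"
    using s by (intro set_integral_add) auto
  then show "U b * m b - U a * m a = (LINT x:{a..b}|lborel. g x * m x + U x * m' x)"
    using f2 e1 e2 by (simp add: A_def algebra_simps)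
qed

lemma test_functionD:
  assumes "test_function \<phi>"
  obtains R where "R > 0" "\<And>x. \<bar>x\<bar> > R \<Longrightarrow> \<phi> x = 0" "\<And>x. \<bar>x\<bar> > R \<Longrightarrow> deriv \<phi> x = 0"
    "\<And>x. (\<phi> has_real_derivative deriv \<phi> x) (at x)" "continuous_on UNIV \<phi>" "continuous_on UNIV (deriv \<phi>)"
proof -
  obtain R0 where R0: "\<And>x. R0 < \<bar>x\<bar> \<Longrightarrow> \<phi> x = 0" and C: "\<And>k. Ck k \<phi>"
    using assms by (auto simp: test_function_def)
  have z: "deriv \<phi> x = 0" if "\<bar>x\<bar> > max R0 1" for x
  proof -
    have "x \<in> - {-max R0 1..max R0 1}" using that by auto
    then have "\<forall>\<^sub>F y in nhds x. \<phi> y = 0"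
      using eventually_nhds_in_open[of "- {-max R0 1..max R0 1}" x] R0 
      by (force elim!: eventually_mono)
    then have "DERIV \<phi> x :> 0" by (subst DERIV_cong_ev[OF refl _ refl]) auto
    then show ?thesis by (rule DERIV_imp_deriv)
  qed
  have d: "(\<phi> has_real_derivative deriv \<phi> x) (at x)" "Ck 0 (deriv \<phi>)" for x
    using Ck_SucD[OF C[of "Suc 0"]] by auto
  show ?thesis
    by (rule that[of "max R0 1"]) (use R0 z d Ck_continuous_on[OF C[of 0]] in \<open>auto simp: Ck_0\<close>)
qed

lemma indef_integral_imp_weak_deriv:
  assumes U: "indef_integral U g"
  shows "weak_deriv U g"
  unfolding weak_deriv_def
proof (intro conjI allI impI)
  show liU: "locally_integrable U" by (rule locally_integrable_continuous[OF indef_integral_continuous_on[OF U]])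
  show lig: "locally_integrable g" by (rule indef_integralD(1)[OF U])
  fix \<phi> assume "test_function \<phi>"
  then obtain R where R: "R > 0" "\<And>x. \<bar>x\<bar> > R \<Longrightarrow> \<phi> x = 0" "\<And>x. \<bar>x\<bar> > R \<Longrightarrow> deriv \<phi> x = 0"
    "\<And>x. (\<phi> has_real_derivative deriv \<phi> x) (at x)" "continuous_on UNIV \<phi>" "continuous_on UNIV (deriv \<phi>)"
    by (rule test_functionD) blast
  let ?A = "{-(R+1)..R+1}"
  have "(LINT x:?A|lborel. g x * \<phi> x + U x * deriv \<phi> x) = U (R+1) * \<phi> (R+1) - U (-(R+1)) * \<phi> (-(R+1))"
    using indef_integralD(2)[OF indef_integral_mult_C1[OF U R(4,6)], of "-(R+1)" "R+1"] R(1) by simp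
  also have "\<dots> = 0" using R(1,2) by simp
  also have "(LINT x:?A|lborel. g x * \<phi> x + U x * deriv \<phi> x) = (LINT x|lborel. g x * \<phi> x + U x * deriv \<phi> x)"
    by (rule integral_eq_set_integral[symmetric]) (use R(1-3) in \<open>auto simp: abs_if split: if_splits\<close>)
  also have "\<dots> = (LINT x|lborel. g x * \<phi> x) + (LINT x|lborel. U x * deriv \<phi> x)"
    by (intro Bochner_Integration.integral_add integrable_compact_support[OF lig R(5,2)]
        integrable_compact_support[OF liU R(6,3)])
  finally show "(LINT x|lborel. U x * deriv \<phi> x) = - (LINT x|lborel. g x * \<phi> x)" by simp
qed

lemma AE_lebesgue_differentiation:
  assumes "locally_integrable g"
  shows "AE x in lborel. (\<lambda>n. real (Suc n) * (LINT y:{x..x + 1 / real (Suc n)}|lborel. g y)) \<longlonglongrightarrow> g x"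
proof -
  have i: "set_integrable lborel {c..d} g" for c d by (rule locally_integrable_Icc[OF assms])
  have "\<And>a b. g integrable_on cbox a b"
    using set_borel_integral_eq_integral(1)[OF i] by simp
  then obtain N where N: "negligible N" "\<And>x e. \<lbrakk>x \<notin> N; 0 < e\<rbrakk> \<Longrightarrow>
     \<exists>d>0. \<forall>h. 0 < h \<and> h < d \<longrightarrow> norm (integral (cbox x (x + h *\<^sub>R One)) g /\<^sub>R h ^ DIM(real) - g x) < e"
    using integrable_ccontinuous_explicit by blast
  have "AE x in lebesgue. x \<notin> N" using N(1) by (simp add: AE_not_in negligible_iff_null_sets)
  then have "AE x in lborel. x \<notin> N" by (simp add: AE_completion_iff)
  then show ?thesis
  proof eventually_elim
    case (elim x)
    show ?case
    proof (rule LIMSEQ_I)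
      fix e :: real assume "0 < e"
      obtain d where d: "d > 0" "\<And>h. 0 < h \<Longrightarrow> h < d \<Longrightarrow> norm (integral {x..x + h} g / h - g x) < e"
        using N(2)[OF elim \<open>0 < e\<close>] by (auto simp: divide_inverse mult.commute)
      obtain n0 where n0: "1 / real (Suc n0) < d" using d(1) nat_approx_posE by blast
      have "norm (real (Suc n) * (LINT y:{x..x + 1 / real (Suc n)}|lborel. g y) - g x) < e" if "n \<ge> n0" for n
      proof -
        have "1 / real (Suc n) \<le> 1 / real (Suc n0)" using that by (simp add: frac_le)
        then have "norm (integral {x..x + 1 / real (Suc n)} g / (1 / real (Suc n)) - g x) < e"
          using n0 by (intro d(2)) auto
        then show ?thesis
          by (simp add: set_borel_integral_eq_integral(2)[OF i] mult.commute)
      qed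
      then show "\<exists>no. \<forall>n\<ge>no. norm (real (Suc n) * (LINT y:{x..x + 1 / real (Suc n)}|lborel. g y) - g x) < e"
        by blast
    qed
  qed
qed

lemma AE_lborel_ex:
  assumes "AE x in lborel. P x"
  shows "\<exists>x::real. P x"
proof (rule ccontr)
  assume "\<nexists>x. P x"
  then have "AE x::real in lborel. False" using assms by simp
  then have "emeasure lborel (UNIV :: real set) = 0" by (subst (asm) AE_iff_null) auto
  then show False by simp
qed

lemma AE_const_if_orthogonal:
  assumes li: "locally_integrable h" and o: "\<And>\<phi>. test_function \<phi> \<Longrightarrow> (LINT x|lborel. h x * deriv \<phi> x) = 0"
  obtains c where "AE x in lborel. h x = c"
proof -
  have mh[measurable]: "h \<in> borel_measurable borel" using li by (simp add: locally_integrable_def)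
  have shift: "(LINT x:{a..a+l}|lborel. h x) = (LINT x:{b..b+l}|lborel. h x)" if l: "l > 0" for a b l :: real
  proof -
    obtain S S1 \<kappa> where S: "\<And>k. Ck k S" "\<And>k. Ck k S1" "\<And>x. (S1 has_real_derivative S x) (at x)"
      "\<And>x. x \<le> 0 \<Longrightarrow> S x = 0" "\<And>x. 1 \<le> x \<Longrightarrow> S x = 1" "\<And>x. 0 \<le> S x" "\<And>x. S x \<le> 1"
      "\<And>x. x \<le> 0 \<Longrightarrow> S1 x = 0" "\<And>x. 1 \<le> x \<Longrightarrow> S1 x = x - \<kappa>"
      by (rule smooth_step_exists) blast
    define N where "N n = real (Suc n)" for n
    have N1: "N n \<ge> 1" for n by (simp add: N_def)
    define \<psi> where "\<psi> n x = S (N n * x + (- N n * a)) - S (N n * x + (- N n * (a + l)))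
       - (S (N n * x + (- N n * b)) - S (N n * x + (- N n * (b + l))))" for n x
    define \<phi> where "\<phi> n x = inverse (N n) * (S1 (N n * x + (- N n * a)) - S1 (N n * x + (- N n * (a + l)))
       - (S1 (N n * x + (- N n * b)) - S1 (N n * x + (- N n * (b + l)))))" for n x
    define R where "R = \<bar>a\<bar> + \<bar>b\<bar> + l + 1"
    have dS: "((\<lambda>x. S1 (N n * x + d)) has_real_derivative S (N n * x + d) * N n) (at x)" for n x d
      by (rule DERIV_chain2[OF S(3)]) (auto intro!: derivative_eq_intros)
    have d\<phi>: "(\<phi> n has_real_derivative \<psi> n x) (at x)" for n x
    proof -
      have "(\<phi> n has_real_derivative inverse (N n) * (S (N n * x + (- N n * a)) * N n - S (N n * x + (- N n * (a + l))) * N n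
         - (S (N n * x + (- N n * b)) * N n - S (N n * x + (- N n * (b + l))) * N n))) (at x)"
        unfolding \<phi>_def by (intro DERIV_cmult DERIV_diff dS)
      moreover have "inverse (N n) * (S (N n * x + (- N n * a)) * N n - S (N n * x + (- N n * (a + l))) * N n
         - (S (N n * x + (- N n * b)) * N n - S (N n * x + (- N n * (b + l))) * N n)) = \<psi> n x"
        using N1[of n] unfolding \<psi>_def by (simp add: field_simps)
      ultimately show ?thesis by simp
    qed
    have ge: "N n * x + (- N n * d) \<ge> 1" if "x \<ge> d + 1" for n x d
    proof -
      have "N n * (x - d) \<ge> 1 * 1" using N1[of n] that by (intro mult_mono) auto
      then show ?thesis by (simp add: algebra_simps)
    qed
    have le: "N n * x + (- N n * d) \<le> 0" if "x \<le> d" for n x d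
      using mult_left_mono[OF that, of "N n"] N1[of n] by simp
    have z\<phi>: "\<phi> n x = 0" if "\<bar>x\<bar> > R" for n x
    proof (cases "x > 0")
      case True
      then have "x \<ge> a + 1" "x \<ge> a + l + 1" "x \<ge> b + 1" "x \<ge> b + l + 1" using that l by (auto simp: R_def)
      then have "S1 (N n * x + (- N n * a)) = N n * x + (- N n * a) - \<kappa>"
        "S1 (N n * x + (- N n * (a + l))) = N n * x + (- N n * (a + l)) - \<kappa>"
        "S1 (N n * x + (- N n * b)) = N n * x + (- N n * b) - \<kappa>"
        "S1 (N n * x + (- N n * (b + l))) = N n * x + (- N n * (b + l)) - \<kappa>"
        by (intro S(9) ge; simp)+
      then show ?thesis unfolding \<phi>_def by (simp only:) (simp add: algebra_simps)
    next
      case False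
      then have "x \<le> a" "x \<le> a + l" "x \<le> b" "x \<le> b + l" using that l by (auto simp: R_def)
      then show ?thesis unfolding \<phi>_def using le[of x _ n] by (simp add: S(8))
    qed
    have z\<psi>: "\<psi> n x = 0" if "\<bar>x\<bar> > R" for n x
    proof (cases "x > 0")
      case True
      then have "x \<ge> a + 1" "x \<ge> a + l + 1" "x \<ge> b + 1" "x \<ge> b + l + 1" using that l by (auto simp: R_def)
      then show ?thesis unfolding \<psi>_def using ge[of _ x n] by (simp add: S(5))
    next
      case False
      then have "x \<le> a" "x \<le> a + l" "x \<le> b" "x \<le> b + l" using that l by (auto simp: R_def)
      then show ?thesis unfolding \<psi>_def using le[of x _ n] by (simp add: S(4))
    qed
    have "Ck k (\<phi> n)" for k n
      unfolding \<phi>_def by (intro Ck_cmult Ck_diff Ck_affine S(2))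
    then have t: "test_function (\<phi> n)" for n using z\<phi> unfolding test_function_def by blast
    have "deriv (\<phi> n) = \<psi> n" for n using d\<phi> DERIV_imp_deriv by blast
    then have zero: "(LINT x|lborel. h x * \<psi> n x) = 0" for n using o[OF t, of n] by simp
    define J where "J d x = indicat_real {d<..d+l} x" for d x
    have lim: "(\<lambda>n. S (N n * x + (- N n * d))) \<longlonglongrightarrow> (if x > d then 1 else 0)" for x d
    proof (cases "x > d")
      case True
      obtain n0 where n0: "1 / real (Suc n0) < x - d" using True nat_approx_posE[of "x - d"] by auto
      have "S (N n * x + (- N n * d)) = 1" if "n \<ge> n0" for n
      proof (rule S(5))
        have "1 / real (Suc n) \<le> 1 / real (Suc n0)" using that by (simp add: frac_le)
        then have "1 / N n < x - d" using n0 by (simp add: N_def)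
        then show "1 \<le> N n * x + (- N n * d)" using N1[of n] by (simp add: field_simps)
      qed
      then show ?thesis using True by (auto intro!: tendsto_eventually eventually_sequentiallyI[of n0])
    next
      case False
      then show ?thesis using le[of x d] by (simp add: S(4))
    qed
    have lim\<psi>: "(\<lambda>n. \<psi> n x) \<longlonglongrightarrow> J a x - J b x" for x
    proof -
      have "(\<lambda>n. \<psi> n x) \<longlonglongrightarrow> (if x > a then 1 else 0) - (if x > a + l then 1 else 0) - ((if x > b then 1 else 0) - (if x > b + l then 1 else 0))"
        unfolding \<psi>_def by (intro tendsto_diff lim)
      moreover have "(if x > a then 1 else 0) - (if x > a + l then 1 else 0) - ((if x > b then 1 else 0) - (if x > b + l then 1 else 0)) = J a x - J b x"
        using l by (auto simp: J_def indicator_def)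
      ultimately show ?thesis by simp
    qed
    have b\<psi>: "\<bar>\<psi> n x\<bar> \<le> 2" for n x
      unfolding \<psi>_def
      using S(6,7)[of "N n * x + (- N n * a)"] S(6,7)[of "N n * x + (- N n * (a + l))"]
        S(6,7)[of "N n * x + (- N n * b)"] S(6,7)[of "N n * x + (- N n * (b + l))"] by linarith
    have m\<psi>[measurable]: "\<psi> n \<in> borel_measurable borel" for n
    proof -
      have "continuous_on UNIV (\<psi> n)"
        unfolding \<psi>_def by (intro continuous_on_diff Ck_continuous_on[of 0] Ck_affine S(1))
      then show ?thesis by (rule borel_measurable_continuous_onI)
    qed
    have [measurable]: "J d \<in> borel_measurable borel" for d unfolding J_def by measurable
    have "(\<lambda>n. LINT x|lborel. h x * \<psi> n x) \<longlonglongrightarrow> (LINT x|lborel. h x * (J a x - J b x))"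
    proof (rule integral_dominated_convergence[where w="\<lambda>x. 2 * (indicator {-R..R} x * \<bar>h x\<bar>)"])
      have "integrable lborel (\<lambda>x. indicator {-R..R} x *\<^sub>R h x)"
        using locally_integrable_Icc[OF li] by (simp add: set_integrable_def)
      then have "integrable lborel (\<lambda>x. 2 * \<bar>indicator {-R..R} x *\<^sub>R h x\<bar>)" by auto
      then show "integrable lborel (\<lambda>x. 2 * (indicator {-R..R} x * \<bar>h x\<bar>))" by (simp add: abs_mult)
      show "AE x in lborel. norm (h x * \<psi> n x) \<le> 2 * (indicat_real {- R..R} x * \<bar>h x\<bar>)" for n
      proof (intro AE_I2)
        fix x
        show "norm (h x * \<psi> n x) \<le> 2 * (indicat_real {- R..R} x * \<bar>h x\<bar>)"
        proof (cases "x \<in> {-R..R}")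
          case True
          then show ?thesis using mult_left_mono[OF b\<psi>[of n x], of "\<bar>h x\<bar>"] by (simp add: abs_mult)
        next
          case False
          then have "\<bar>x\<bar> > R" by auto
          then show ?thesis by (simp add: z\<psi>)
        qed
      qed
    qed (auto intro!: tendsto_mult tendsto_const lim\<psi>)
    then have z: "(LINT x|lborel. h x * (J a x - J b x)) = 0" unfolding zero by (simp add: LIMSEQ_const_iff)
    have J: "integrable lborel (\<lambda>x. h x * J d x)" "(LINT x|lborel. h x * J d x) = (LINT x:{d..d+l}|lborel. h x)" for d
    proof -
      have i: "set_integrable lborel {d..d+l} h" by (rule locally_integrable_Icc[OF li])
      then have "set_integrable lborel {d<..d+l} h" by (rule set_integrable_subset) auto
      then show "integrable lborel (\<lambda>x. h x * J d x)" by (simp add: set_integrable_def J_def mult.commute)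
      have "AE x in lborel. x \<noteq> d" by (rule AE_lborel_singleton)
      then have "AE x in lborel. h x * J d x = indicator {d..d+l} x *\<^sub>R h x"
        by eventually_elim (auto simp: J_def indicator_def)
      then show "(LINT x|lborel. h x * J d x) = (LINT x:{d..d+l}|lborel. h x)"
        unfolding set_lebesgue_integral_def by (intro integral_cong_AE) (auto simp: J_def)
    qed
    have "(LINT x|lborel. h x * (J a x - J b x)) = (LINT x|lborel. h x * J a x) - (LINT x|lborel. h x * J b x)"
      by (simp add: right_diff_distrib J(1))
    then show ?thesis using z J(2) by simp
  qed
  have ae: "AE x in lborel. (\<lambda>n. real (Suc n) * (LINT y:{0..0 + 1 / real (Suc n)}|lborel. h y)) \<longlonglongrightarrow> h x"
    using AE_lebesgue_differentiation[OF li]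
  proof eventually_elim
    case (elim x)
    then show ?case using shift[of "1 / real (Suc n)" x 0 for n] by simp
  qed
  then obtain x0 where "(\<lambda>n. real (Suc n) * (LINT y:{0..0 + 1 / real (Suc n)}|lborel. h y)) \<longlonglongrightarrow> h x0"
    using AE_lborel_ex[OF ae] by blast
  then have "AE x in lborel. h x = h x0"
    using ae LIMSEQ_unique by (force elim: eventually_mono)
  then show ?thesis using that by blast
qed

lemma indef_integral_exists:
  assumes "locally_integrable g"
  obtains G where "indef_integral G g"
proof -
  define G where "G x = (LBINT y=ereal 0..ereal x. g y)" for x :: real
  have i: "interval_lebesgue_integrable lborel (ereal c) (ereal d) g" for c d
  proof -
    have "set_integrable lborel (einterval (ereal c') (ereal d')) g" for c' d'
      by (rule set_integrable_subset[OF locally_integrable_Icc[OF assms, of c' d']]) auto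
    then show ?thesis by (simp add: interval_lebesgue_integrable_def)
  qed
  have "G b - G a = (LINT x:{a..b}|lborel. g x)" if "a \<le> b" for a b
  proof -
    have "(LBINT y=ereal 0..ereal a. g y) + (LBINT y=ereal a..ereal b. g y) = (LBINT y=ereal 0..ereal b. g y)"
      by (rule interval_integral_sum) (simp add: i flip: ereal_min ereal_max)
    then show ?thesis using interval_integral_Icc[OF that, of g] by (simp add: G_def)
  qed
  then have "indef_integral G g" using assms by (simp add: indef_integral_def)
  then show ?thesis using that by blast
qed

lemma weak_deriv_imp_indef_integral:
  assumes w: "weak_deriv u g"
  obtains U where "indef_integral U g" "AE x in lborel. u x = U x"
proof -
  have li: "locally_integrable u" "locally_integrable g" using w by (auto simp: weak_deriv_def)
  obtain G where G: "indef_integral G g" by (rule indef_integral_exists[OF li(2)])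
  have wG: "weak_deriv G g" by (rule indef_integral_imp_weak_deriv[OF G])
  then have liG: "locally_integrable G" by (auto simp: weak_deriv_def)
  obtain c where c: "AE x in lborel. 1 * u x + (-1) * G x = c"
  proof (rule AE_const_if_orthogonal[OF locally_integrable_lincomb[OF li(1) liG, of 1 "-1"]])
    fix \<phi> assume t: "test_function \<phi>"
    then obtain R where R: "R > 0" "\<And>x. \<bar>x\<bar> > R \<Longrightarrow> deriv \<phi> x = 0" "continuous_on UNIV (deriv \<phi>)"
      by (rule test_functionD) blast
    have "(LINT x|lborel. (1 * u x + -1 * G x) * deriv \<phi> x) = (LINT x|lborel. u x * deriv \<phi> x - G x * deriv \<phi> x)"
      by (simp add: algebra_simps)
    also have "\<dots> = (LINT x|lborel. u x * deriv \<phi> x) - (LINT x|lborel. G x * deriv \<phi> x)"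
      by (intro Bochner_Integration.integral_diff integrable_compact_support[OF li(1) R(3,2)]
        integrable_compact_support[OF liG R(3,2)])
    also have "\<dots> = 0" using w wG t by (simp add: weak_deriv_def)
    finally show "(LINT x|lborel. (1 * u x + -1 * G x) * deriv \<phi> x) = 0" .
  qed blast
  have "indef_integral (\<lambda>x. 1 * G x + 1 * c) (\<lambda>x. 1 * g x + 1 * 0)"
    by (intro indef_integral_lincomb G indef_integral_C1) auto
  then have "indef_integral (\<lambda>x. G x + c) g" by simp
  moreover have "AE x in lborel. u x = G x + c" using c by eventually_elim simp
  ultimately show ?thesis using that by blast
qed

lemma weak_deriv_cong_AE:
  assumes w: "weak_deriv u g" and u: "AE x in lborel. u x = u' x" and g: "AE x in lborel. g x = g' x"
    and [measurable]: "u' \<in> borel_measurable borel" "g' \<in> borel_measurable borel"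
  shows "weak_deriv u' g'"
proof -
  have [measurable]: "u \<in> borel_measurable borel" "g \<in> borel_measurable borel"
    using w by (auto simp: weak_deriv_def locally_integrable_def)
  have s: "set_integrable lborel A a' " if "set_integrable lborel A a" "AE x in lborel. a x = a' x"
    "a' \<in> borel_measurable borel" "a \<in> borel_measurable borel" "A \<in> sets borel" for A and a a' :: "real \<Rightarrow> real"
  proof -
    have [measurable]: "a' \<in> borel_measurable borel" "a \<in> borel_measurable borel" "A \<in> sets borel" using that by auto
    have "integrable lborel (\<lambda>x. indicator A x *\<^sub>R a x) = integrable lborel (\<lambda>x. indicator A x *\<^sub>R a' x)"
      by (intro integrable_cong_AE) (use that in \<open>auto elim: eventually_mono\<close>)
    then show ?thesis using that by (simp add: set_integrable_def)
  qed
  have "locally_integrable u'" "locally_integrable g'"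
    using w s[OF _ u] s[OF _ g] by (auto simp: weak_deriv_def locally_integrable_def)
  moreover have "(LINT x|lborel. u' x * deriv \<phi> x) = - (LINT x|lborel. g' x * \<phi> x)" if t: "test_function \<phi>" for \<phi>
  proof -
    obtain R where "continuous_on UNIV \<phi>" "continuous_on UNIV (deriv \<phi>)"
      by (rule test_functionD[OF t]) blast
    then have [measurable]: "\<phi> \<in> borel_measurable borel" "deriv \<phi> \<in> borel_measurable borel"
      by (auto intro: borel_measurable_continuous_onI)
    have "(LINT x|lborel. u' x * deriv \<phi> x) = (LINT x|lborel. u x * deriv \<phi> x)"
      by (rule integral_cong_AE) (use u in \<open>auto elim: eventually_mono\<close>)
    moreover have "(LINT x|lborel. g' x * \<phi> x) = (LINT x|lborel. g x * \<phi> x)"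
      by (rule integral_cong_AE) (use g in \<open>auto elim: eventually_mono\<close>)
    ultimately show ?thesis using w t by (simp add: weak_deriv_def)
  qed
  ultimately show ?thesis by (simp add: weak_deriv_def)
qed

lemma indef_integral_unique:
  assumes "indef_integral U g" "indef_integral U g'"
  shows "AE x in lborel. g x = g' x"
  using AE_lebesgue_differentiation[OF indef_integralD(1)[OF assms(1)]]
    AE_lebesgue_differentiation[OF indef_integralD(1)[OF assms(2)]]
proof eventually_elim
  case (elim x)
  have "(LINT y:{x..x + 1 / real (Suc n)}|lborel. g y) = (LINT y:{x..x + 1 / real (Suc n)}|lborel. g' y)" for n
    using indef_integralD(2)[OF assms(1), of x "x + 1 / real (Suc n)"]
      indef_integralD(2)[OF assms(2), of x "x + 1 / real (Suc n)"] by simp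
  then show ?case using elim LIMSEQ_unique by simp
qed

lemma AE_eq_continuous:
  fixes f g :: "real \<Rightarrow> real"
  assumes ae: "AE x in lborel. f x = g x" and f: "\<And>x. isCont f x" and g: "\<And>x. isCont g x"
  shows "f = g"
proof (rule ext, rule ccontr)
  fix x assume ne: "f x \<noteq> g x"
  have "open {x. f x \<noteq> g x}"
    by (intro open_Collect_neq) (use f g continuous_at_imp_continuous_on in blast)+
  then obtain e where e: "e > 0" "ball x e \<subseteq> {x. f x \<noteq> g x}"
    using ne openE by blast
  have "AE y in lborel. y \<notin> ball x e" using ae by eventually_elim (use e in auto)
  then have "emeasure lborel (ball x e) = 0"
    by (subst (asm) AE_iff_null_sets[symmetric]) auto
  moreover have "ball x e = {x - e<..<x + e}" by (auto simp: dist_real_def)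
  ultimately show False using e(1) by simp
qed

lemma weak_deriv_unique:
  assumes "weak_deriv u g" "weak_deriv u' g'" "AE x in lborel. u x = u' x"
  shows "AE x in lborel. g x = g' x"
proof -
  obtain U where U: "indef_integral U g" "AE x in lborel. u x = U x"
    by (rule weak_deriv_imp_indef_integral[OF assms(1)])
  obtain U' where U': "indef_integral U' g'" "AE x in lborel. u' x = U' x"
    by (rule weak_deriv_imp_indef_integral[OF assms(2)])
  have "AE x in lborel. U x = U' x" using U(2) U'(2) assms(3) by eventually_elim simp
  then have "U = U'"
    by (rule AE_eq_continuous[OF _ indef_integral_isCont[OF U(1)] indef_integral_isCont[OF U'(1)]])
  then show ?thesis using indef_integral_unique U(1) U'(1) by simp
qed

lemma weak_deriv_wderiv:
  assumes "weak_deriv u g"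
  shows "weak_deriv u (wderiv u)" "AE x in lborel. wderiv u x = g x"
proof -
  show "weak_deriv u (wderiv u)" unfolding wderiv_def by (rule someI[of "weak_deriv u", OF assms])
  then show "AE x in lborel. wderiv u x = g x" using weak_deriv_unique[OF _ assms] by simp
qed

lemma weak_deriv_lincomb:
  assumes u: "weak_deriv u g" and v: "weak_deriv v h"
  shows "weak_deriv (\<lambda>x. p * u x + q * v x) (\<lambda>x. p * g x + q * h x)"
proof -
  obtain U where U: "indef_integral U g" "AE x in lborel. u x = U x"
    by (rule weak_deriv_imp_indef_integral[OF u])
  obtain V where V: "indef_integral V h" "AE x in lborel. v x = V x"
    by (rule weak_deriv_imp_indef_integral[OF v])
  have [measurable]: "u \<in> borel_measurable borel" "v \<in> borel_measurable borel"
      "g \<in> borel_measurable borel" "h \<in> borel_measurable borel"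
    using u v by (auto simp: weak_deriv_def locally_integrable_def)
  show ?thesis
  proof (rule weak_deriv_cong_AE[OF indef_integral_imp_weak_deriv[OF indef_integral_lincomb[OF U(1) V(1), of p q]]])
    show "AE x in lborel. p * U x + q * V x = p * u x + q * v x"
      using U(2) V(2) by eventually_elim simp
  qed auto
qed

lemma weak_deriv_mult_C1:
  assumes u: "weak_deriv u g" and d: "\<And>x. (m has_real_derivative m' x) (at x)"
    and c: "continuous_on UNIV m'"
  shows "weak_deriv (\<lambda>x. u x * m x) (\<lambda>x. g x * m x + u x * m' x)"
proof -
  obtain U where U: "indef_integral U g" "AE x in lborel. u x = U x"
    by (rule weak_deriv_imp_indef_integral[OF u])
  have "continuous_on UNIV m" using d DERIV_isCont continuous_at_imp_continuous_on by blast
  then have [measurable]: "u \<in> borel_measurable borel" "g \<in> borel_measurable borel"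
      "m \<in> borel_measurable borel" "m' \<in> borel_measurable borel"
    using u c by (auto simp: weak_deriv_def locally_integrable_def intro: borel_measurable_continuous_onI)
  show ?thesis
  proof (rule weak_deriv_cong_AE[OF indef_integral_imp_weak_deriv[OF indef_integral_mult_C1[OF U(1) d c]]])
    show "AE x in lborel. U x * m x = u x * m x" using U(2) by eventually_elim simp
    show "AE x in lborel. g x * m x + U x * m' x = g x * m x + u x * m' x" using U(2) by eventually_elim simp
  qed auto
qed

lemma lborel_AE_shift:
  assumes "AE x in lborel. P x" "{x. P x} \<in> sets borel"
  shows "AE x in lborel. P (x + h :: real)"
proof -
  have "AE x in distr lborel borel ((+) h). P x" using assms(1) unfolding lborel_distr_plus .
  then have "AE x in lborel. P (h + x)" by (subst (asm) AE_distr_iff) (use assms(2) in auto)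
  then show ?thesis by (simp add: add.commute)
qed

lemma set_integral_shift:
  "(LINT x:{a..b}|lborel. g (x + h)) = (LINT x:{a + h..b + h}|lborel. (g :: real \<Rightarrow> real) x)"
proof -
  have "(LINT x|lborel. indicator {a + h..b + h} x *\<^sub>R g x) = (LINT x|lborel. indicator {a + h..b + h} (h + 1 * x) *\<^sub>R g (h + 1 * x))"
    by (subst lborel_integral_real_affine[of 1 _ h]) simp_all
  also have "\<dots> = (LINT x|lborel. indicator {a..b} x *\<^sub>R g (x + h))"
    by (rule Bochner_Integration.integral_cong) (auto simp: indicator_def add.commute)
  finally show ?thesis by (simp add: set_lebesgue_integral_def)
qed

lemma locally_integrable_shift:
  assumes "locally_integrable g"
  shows "locally_integrable (\<lambda>x. g (x + h))"
  unfolding locally_integrable_def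
proof (intro conjI allI)
  have [measurable]: "g \<in> borel_measurable borel" using assms by (simp add: locally_integrable_def)
  show "(\<lambda>x. g (x + h)) \<in> borel_measurable borel" by measurable
  fix R
  have "integrable lborel (\<lambda>x. indicator {-R+h..R+h} x *\<^sub>R g x)"
    using locally_integrable_Icc[OF assms] by (simp add: set_integrable_def)
  then have "integrable lborel (\<lambda>x. indicator {-R+h..R+h} (h + 1 * x) *\<^sub>R g (h + 1 * x))"
    by (subst lborel_integrable_real_affine_iff) simp_all
  moreover have "(\<lambda>x. indicator {-R+h..R+h} (h + 1 * x) *\<^sub>R g (h + 1 * x)) = (\<lambda>x. indicator {-R..R} x *\<^sub>R g (x + h))"
    by (auto simp: indicator_def add.commute fun_eq_iff)
  ultimately show "set_integrable lborel {-R..R} (\<lambda>x. g (x + h))" by (simp add: set_integrable_def)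
qed

lemma weak_deriv_shift:
  assumes u: "weak_deriv u g"
  shows "weak_deriv (\<lambda>x. u (x + h)) (\<lambda>x. g (x + h))"
proof -
  obtain U where U: "indef_integral U g" "AE x in lborel. u x = U x"
    by (rule weak_deriv_imp_indef_integral[OF u])
  have mU: "U \<in> borel_measurable borel"
    by (rule borel_measurable_continuous_onI[OF indef_integral_continuous_on[OF U(1)]])
  have [measurable]: "u \<in> borel_measurable borel" "g \<in> borel_measurable borel" "U \<in> borel_measurable borel"
    using u mU by (auto simp: weak_deriv_def locally_integrable_def)
  have "indef_integral (\<lambda>x. U (x + h)) (\<lambda>x. g (x + h))"
    unfolding indef_integral_def
    using locally_integrable_shift[OF indef_integralD(1)[OF U(1)]] indef_integralD(2)[OF U(1)]
    by (simp add: set_integral_shift)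
  then have w: "weak_deriv (\<lambda>x. U (x + h)) (\<lambda>x. g (x + h))" by (rule indef_integral_imp_weak_deriv)
  show ?thesis
  proof (rule weak_deriv_cong_AE[OF w])
    have "AE x in lborel. u (x + h) = U (x + h)"
      by (rule lborel_AE_shift[OF U(2)]) measurable
    then show "AE x in lborel. U (x + h) = u (x + h)" by eventually_elim simp
  qed auto
qed

section \<open>Weighted \<open>L\<^sup>2\<close> and \<open>H\<^sup>1\<close> spaces\<close>

definition weight :: "(real \<Rightarrow> real) \<Rightarrow> bool" where
  "weight \<mu> \<longleftrightarrow> \<mu> \<in> borel_measurable borel \<and> (\<forall>x. 0 < \<mu> x)"

lemma weight_one: "weight (\<lambda>_. 1)"
  by (simp add: weight_def)

lemma L2_D:
  assumes "u \<in> L2 \<mu>"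
  shows "u \<in> borel_measurable borel" "integrable lborel (\<lambda>x. (u x)\<^sup>2 * \<mu> x)"
  using assms by (auto simp: L2_def)

lemma norm_L2_nonneg [simp]: "weight \<mu> \<Longrightarrow> 0 \<le> norm_L2 \<mu> u"
  unfolding norm_L2_def weight_def by (auto intro!: integral_nonneg_AE simp: less_imp_le)

lemma norm_L2_sq: "weight \<mu> \<Longrightarrow> (norm_L2 \<mu> u)\<^sup>2 = (LINT x|lborel. (u x)\<^sup>2 * \<mu> x)"
  unfolding norm_L2_def weight_def by (subst real_sqrt_pow2) (auto intro!: integral_nonneg_AE simp: less_imp_le)

lemma norm_L2_zero [simp]: "norm_L2 \<mu> (\<lambda>_. 0) = 0"
  by (simp add: norm_L2_def)

lemma L2_mult_integrable:
  assumes \<mu>: "weight \<mu>" and u: "u \<in> L2 \<mu>" and w: "w \<in> L2 \<mu>"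
  shows "integrable lborel (\<lambda>x. u x * w x * \<mu> x)"
proof (rule Bochner_Integration.integrable_bound)
  show "integrable lborel (\<lambda>x. (u x)\<^sup>2 * \<mu> x + (w x)\<^sup>2 * \<mu> x)"
    using L2_D[OF u] L2_D[OF w] by auto
  have [measurable]: "\<mu> \<in> borel_measurable borel" "u \<in> borel_measurable borel" "w \<in> borel_measurable borel"
    using \<mu> L2_D[OF u] L2_D[OF w] by (auto simp: weight_def)
  show "(\<lambda>x. u x * w x * \<mu> x) \<in> borel_measurable lborel" by measurable
  have "\<bar>u x * w x * \<mu> x\<bar> \<le> \<bar>(u x)\<^sup>2 * \<mu> x + (w x)\<^sup>2 * \<mu> x\<bar>" for x
  proof -
    have "2 * (\<bar>u x\<bar> * \<bar>w x\<bar>) \<le> (u x)\<^sup>2 + (w x)\<^sup>2"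
      using sum_squares_bound[of "\<bar>u x\<bar>" "\<bar>w x\<bar>"] by simp
    moreover have "0 \<le> \<bar>u x\<bar> * \<bar>w x\<bar>" by simp
    ultimately have "\<bar>u x\<bar> * \<bar>w x\<bar> \<le> (u x)\<^sup>2 + (w x)\<^sup>2" by linarith
    then have "\<bar>u x\<bar> * \<bar>w x\<bar> * \<mu> x \<le> ((u x)\<^sup>2 + (w x)\<^sup>2) * \<mu> x"
      using \<mu> by (intro mult_right_mono) (auto simp: weight_def less_imp_le)
    moreover have "0 < \<mu> x" using \<mu> by (simp add: weight_def)
    ultimately show ?thesis by (simp add: abs_mult distrib_right)
  qed
  then show "AE x in lborel. norm (u x * w x * \<mu> x) \<le> norm ((u x)\<^sup>2 * \<mu> x + (w x)\<^sup>2 * \<mu> x)"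
    by (intro AE_I2) simp
qed

lemma L2_lincomb:
  assumes \<mu>: "weight \<mu>" and u: "u \<in> L2 \<mu>" and w: "w \<in> L2 \<mu>"
  shows "(\<lambda>x. p * u x + q * w x) \<in> L2 \<mu>"
proof -
  have [measurable]: "u \<in> borel_measurable borel" "w \<in> borel_measurable borel"
    using L2_D[OF u] L2_D[OF w] by auto
  have "integrable lborel (\<lambda>x. p\<^sup>2 * ((u x)\<^sup>2 * \<mu> x) + 2 * p * q * (u x * w x * \<mu> x) + q\<^sup>2 * ((w x)\<^sup>2 * \<mu> x))"
    using L2_D[OF u] L2_D[OF w] L2_mult_integrable[OF assms] by auto
  moreover have "(\<lambda>x. p\<^sup>2 * ((u x)\<^sup>2 * \<mu> x) + 2 * p * q * (u x * w x * \<mu> x) + q\<^sup>2 * ((w x)\<^sup>2 * \<mu> x))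
      = (\<lambda>x. (p * u x + q * w x)\<^sup>2 * \<mu> x)"
    by (auto simp: fun_eq_iff power2_eq_square algebra_simps)
  ultimately show ?thesis by (simp add: L2_def)
qed

lemma L2_add: "weight \<mu> \<Longrightarrow> u \<in> L2 \<mu> \<Longrightarrow> w \<in> L2 \<mu> \<Longrightarrow> (\<lambda>x. u x + w x) \<in> L2 \<mu>"
  using L2_lincomb[of \<mu> u w 1 1] by simp

lemma L2_diff: "weight \<mu> \<Longrightarrow> u \<in> L2 \<mu> \<Longrightarrow> w \<in> L2 \<mu> \<Longrightarrow> (\<lambda>x. u x - w x) \<in> L2 \<mu>"
  using L2_lincomb[of \<mu> u w 1 "-1"] by simp

lemma L2_cmult: "weight \<mu> \<Longrightarrow> u \<in> L2 \<mu> \<Longrightarrow> (\<lambda>x. p * u x) \<in> L2 \<mu>"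
  using L2_lincomb[of \<mu> u u p 0] by simp

lemma inner_L2_lincomb:
  assumes "weight \<mu>" "u \<in> L2 \<mu>" "v \<in> L2 \<mu>" "w \<in> L2 \<mu>"
  shows "inner_L2 \<mu> (\<lambda>x. p * u x + q * v x) w = p * inner_L2 \<mu> u w + q * inner_L2 \<mu> v w"
proof -
  have "inner_L2 \<mu> (\<lambda>x. p * u x + q * v x) w = (LINT x|lborel. p * (u x * w x * \<mu> x) + q * (v x * w x * \<mu> x))"
    unfolding inner_L2_def by (rule Bochner_Integration.integral_cong) (auto simp: algebra_simps)
  also have "\<dots> = p * inner_L2 \<mu> u w + q * inner_L2 \<mu> v w"
    using L2_mult_integrable[OF assms(1,2,4)] L2_mult_integrable[OF assms(1,3,4)]
    by (simp add: inner_L2_def)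
  finally show ?thesis .
qed

lemma inner_L2_commute: "inner_L2 \<mu> u w = inner_L2 \<mu> w u"
  by (simp add: inner_L2_def mult.commute)

lemma inner_L2_self: "weight \<mu> \<Longrightarrow> inner_L2 \<mu> u u = (norm_L2 \<mu> u)\<^sup>2"
  by (subst norm_L2_sq) (simp_all add: inner_L2_def power2_eq_square)

lemma norm_L2_sq_lincomb:
  assumes "weight \<mu>" "u \<in> L2 \<mu>" "w \<in> L2 \<mu>"
  shows "(norm_L2 \<mu> (\<lambda>x. p * u x + q * w x))\<^sup>2 =
    p\<^sup>2 * (norm_L2 \<mu> u)\<^sup>2 + 2 * p * q * inner_L2 \<mu> u w + q\<^sup>2 * (norm_L2 \<mu> w)\<^sup>2"
proof -
  let ?v = "\<lambda>x. p * u x + q * w x"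
  have v: "?v \<in> L2 \<mu>" by (rule L2_lincomb[OF assms])
  have a: "(norm_L2 \<mu> ?v)\<^sup>2 = p * inner_L2 \<mu> u ?v + q * inner_L2 \<mu> w ?v"
    unfolding inner_L2_self[OF assms(1), symmetric] by (rule inner_L2_lincomb[OF assms v])
  have b: "inner_L2 \<mu> u ?v = p * (norm_L2 \<mu> u)\<^sup>2 + q * inner_L2 \<mu> u w"
    unfolding inner_L2_self[OF assms(1), symmetric] inner_L2_commute[of \<mu> u ?v] inner_L2_commute[of \<mu> u w]
    by (rule inner_L2_lincomb[OF assms(1,2,3,2)])
  have c: "inner_L2 \<mu> w ?v = p * inner_L2 \<mu> u w + q * (norm_L2 \<mu> w)\<^sup>2"
    unfolding inner_L2_self[OF assms(1), symmetric] inner_L2_commute[of \<mu> w ?v]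
    by (rule inner_L2_lincomb[OF assms(1,2,3,3)])
  show ?thesis unfolding a b c by (simp add: power2_eq_square algebra_simps)
qed

lemma L2_Cauchy_Schwarz:
  assumes "weight \<mu>" "u \<in> L2 \<mu>" "w \<in> L2 \<mu>"
  shows "\<bar>inner_L2 \<mu> u w\<bar> \<le> norm_L2 \<mu> u * norm_L2 \<mu> w"
proof -
  define A B C where "A = (norm_L2 \<mu> u)\<^sup>2" and "B = inner_L2 \<mu> u w" and "C = (norm_L2 \<mu> w)\<^sup>2"
  have q: "0 \<le> p\<^sup>2 * A + 2 * p * q * B + q\<^sup>2 * C" for p q
    using norm_L2_sq_lincomb[OF assms, of p q] zero_le_power2 unfolding A_def B_def C_def by metis
  have "B\<^sup>2 \<le> A * C"
  proof (cases "C = 0")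
    case True
    have "B = 0"
    proof (rule ccontr)
      assume "B \<noteq> 0"
      then have "0 \<le> A + 2 * (- (A + 1) / (2 * B)) * B" using q[of 1 "- (A + 1) / (2 * B)"] True by simp
      moreover have "2 * (- (A + 1) / (2 * B)) * B = - (A + 1)" using \<open>B \<noteq> 0\<close> by (simp add: field_simps)
      ultimately show False by linarith
    qed
    then show ?thesis using True by simp
  next
    case False
    then have "C > 0" by (simp add: C_def)
    have "0 \<le> C\<^sup>2 * A + 2 * C * (-B) * B + (-B)\<^sup>2 * C" by (rule q)
    also have "\<dots> = C * (A * C - B\<^sup>2)" by (simp add: power2_eq_square algebra_simps)
    finally show ?thesis using \<open>C > 0\<close> by (simp add: zero_le_mult_iff)
  qed
  then have "\<bar>B\<bar>\<^sup>2 \<le> (norm_L2 \<mu> u * norm_L2 \<mu> w)\<^sup>2" by (simp add: A_def C_def power_mult_distrib)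
  then show ?thesis unfolding B_def by (rule power2_le_imp_le) (simp add: assms(1))
qed

lemma norm_L2_cmult: "weight \<mu> \<Longrightarrow> norm_L2 \<mu> (\<lambda>x. p * u x) = \<bar>p\<bar> * norm_L2 \<mu> u"
proof -
  assume "weight \<mu>"
  have "norm_L2 \<mu> (\<lambda>x. p * u x) = sqrt (p\<^sup>2 * (LINT x|lborel. (u x)\<^sup>2 * \<mu> x))"
    unfolding norm_L2_def by (simp add: power_mult_distrib mult.assoc)
  then show ?thesis by (simp add: norm_L2_def real_sqrt_mult)
qed

lemma norm_L2_add:
  assumes "weight \<mu>" "u \<in> L2 \<mu>" "w \<in> L2 \<mu>"
  shows "norm_L2 \<mu> (\<lambda>x. u x + w x) \<le> norm_L2 \<mu> u + norm_L2 \<mu> w"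
proof (rule power2_le_imp_le)
  have "(norm_L2 \<mu> (\<lambda>x. u x + w x))\<^sup>2 = (norm_L2 \<mu> u)\<^sup>2 + 2 * inner_L2 \<mu> u w + (norm_L2 \<mu> w)\<^sup>2"
    using norm_L2_sq_lincomb[OF assms, of 1 1] by simp
  also have "\<dots> \<le> (norm_L2 \<mu> u + norm_L2 \<mu> w)\<^sup>2"
    using L2_Cauchy_Schwarz[OF assms] by (simp add: power2_sum)
  finally show "(norm_L2 \<mu> (\<lambda>x. u x + w x))\<^sup>2 \<le> (norm_L2 \<mu> u + norm_L2 \<mu> w)\<^sup>2" .
qed (simp add: assms)

lemma norm_L2_uminus: "norm_L2 \<mu> (\<lambda>x. - u x) = norm_L2 \<mu> u"
  by (simp add: norm_L2_def)

lemma norm_L2_diff_commute: "norm_L2 \<mu> (\<lambda>x. u x - w x) = norm_L2 \<mu> (\<lambda>x. w x - u x)"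
  by (simp add: norm_L2_def power2_commute)

lemma norm_L2_diff:
  assumes "weight \<mu>" "u \<in> L2 \<mu>" "w \<in> L2 \<mu>"
  shows "norm_L2 \<mu> (\<lambda>x. u x - w x) \<le> norm_L2 \<mu> u + norm_L2 \<mu> w"
  using norm_L2_add[OF assms(1,2) L2_cmult[OF assms(1,3), of "-1"]] norm_L2_uminus[of \<mu> w] by simp

lemma norm_L2_triangle:
  assumes "weight \<mu>" "u \<in> L2 \<mu>" "v \<in> L2 \<mu>" "w \<in> L2 \<mu>"
  shows "norm_L2 \<mu> (\<lambda>x. u x - w x) \<le> norm_L2 \<mu> (\<lambda>x. u x - v x) + norm_L2 \<mu> (\<lambda>x. v x - w x)"
  using norm_L2_add[OF assms(1) L2_diff[OF assms(1,2,3)] L2_diff[OF assms(1,3,4)]] by simp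

lemma norm_L2_lincomb:
  assumes "weight \<mu>" "u \<in> L2 \<mu>" "w \<in> L2 \<mu>"
  shows "norm_L2 \<mu> (\<lambda>x. p * u x + q * w x) \<le> \<bar>p\<bar> * norm_L2 \<mu> u + \<bar>q\<bar> * norm_L2 \<mu> w"
  using norm_L2_add[OF assms(1) L2_cmult[OF assms(1,2)] L2_cmult[OF assms(1,3)]]
  by (simp add: norm_L2_cmult[OF assms(1)])

lemma norm_L2_reverse_triangle:
  assumes "weight \<mu>" "u \<in> L2 \<mu>" "w \<in> L2 \<mu>"
  shows "\<bar>norm_L2 \<mu> u - norm_L2 \<mu> w\<bar> \<le> norm_L2 \<mu> (\<lambda>x. u x - w x)"
  using norm_L2_add[OF assms(1) L2_diff[OF assms] assms(3)]
    norm_L2_add[OF assms(1) L2_diff[OF assms(1,3,2)] assms(2)] norm_L2_diff_commute[of \<mu> u w]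
  by simp

lemma L2_dominated:
  assumes \<mu>: "weight \<mu>" and \<mu>': "weight \<mu>'" and u: "u \<in> borel_measurable borel" and w: "w \<in> L2 \<mu>'" and K: "0 \<le> K"
    and b: "AE x in lborel. (u x)\<^sup>2 * \<mu> x \<le> K\<^sup>2 * ((w x)\<^sup>2 * \<mu>' x)"
  shows "u \<in> L2 \<mu>" "norm_L2 \<mu> u \<le> K * norm_L2 \<mu>' w"
proof -
  note [measurable] = u
  have [measurable]: "\<mu> \<in> borel_measurable borel" using \<mu> by (simp add: weight_def)
  have iw: "integrable lborel (\<lambda>x. K\<^sup>2 * ((w x)\<^sup>2 * \<mu>' x))" using L2_D[OF w] by auto
  have iu: "integrable lborel (\<lambda>x. (u x)\<^sup>2 * \<mu> x)"
  proof (rule Bochner_Integration.integrable_bound[OF iw])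
    show "AE x in lborel. norm ((u x)\<^sup>2 * \<mu> x) \<le> norm (K\<^sup>2 * ((w x)\<^sup>2 * \<mu>' x))"
      using b
    proof eventually_elim
      case (elim x)
      have "0 < \<mu> x" using \<mu> by (simp add: weight_def)
      then show ?case using elim by (simp add: abs_le_iff)
    qed
  qed measurable
  then show "u \<in> L2 \<mu>" using u by (simp add: L2_def)
  have "(norm_L2 \<mu> u)\<^sup>2 \<le> (LINT x|lborel. K\<^sup>2 * ((w x)\<^sup>2 * \<mu>' x))"
    unfolding norm_L2_sq[OF \<mu>] by (rule integral_mono_AE[OF iu iw b])
  also have "\<dots> = (K * norm_L2 \<mu>' w)\<^sup>2"
    by (simp add: norm_L2_sq[OF \<mu>'] power_mult_distrib)
  finally show "norm_L2 \<mu> u \<le> K * norm_L2 \<mu>' w"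
    by (rule power2_le_imp_le) (simp add: K \<mu>')
qed

lemma L2_dominated_same:
  assumes \<mu>: "weight \<mu>" and u: "u \<in> borel_measurable borel" and w: "w \<in> L2 \<mu>" and K: "0 \<le> K"
    and b: "AE x in lborel. \<bar>u x\<bar> \<le> K * \<bar>w x\<bar>"
  shows "u \<in> L2 \<mu>" "norm_L2 \<mu> u \<le> K * norm_L2 \<mu> w"
proof -
  have "AE x in lborel. (u x)\<^sup>2 * \<mu> x \<le> K\<^sup>2 * ((w x)\<^sup>2 * \<mu> x)"
    using b
  proof eventually_elim
    case (elim x)
    have "\<bar>u x\<bar>\<^sup>2 \<le> (K * \<bar>w x\<bar>)\<^sup>2" using elim by (intro power_mono) auto
    then have "(u x)\<^sup>2 * \<mu> x \<le> (K\<^sup>2 * (w x)\<^sup>2) * \<mu> x"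
      using \<mu> by (intro mult_right_mono) (auto simp: weight_def less_imp_le power_mult_distrib)
    then show ?case by (simp add: mult.assoc)
  qed
  from L2_dominated[OF \<mu> \<mu> u w K this] show "u \<in> L2 \<mu>" "norm_L2 \<mu> u \<le> K * norm_L2 \<mu> w" .
qed

lemma L2_weight_mono:
  assumes \<mu>: "weight \<mu>" and \<mu>': "weight \<mu>'" and le: "\<And>x. \<mu> x \<le> \<mu>' x" and w: "w \<in> L2 \<mu>'"
  shows "w \<in> L2 \<mu>" "norm_L2 \<mu> w \<le> norm_L2 \<mu>' w"
proof -
  have "AE x in lborel. (w x)\<^sup>2 * \<mu> x \<le> 1\<^sup>2 * ((w x)\<^sup>2 * \<mu>' x)"
    using le by (auto intro!: mult_left_mono)
  from L2_dominated[OF \<mu> \<mu>' L2_D(1)[OF w] w _ this] show "w \<in> L2 \<mu>" "norm_L2 \<mu> w \<le> norm_L2 \<mu>' w" by auto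
qed

lemma norm_L2_cong_AE:
  assumes "weight \<mu>" "u \<in> borel_measurable borel" "w \<in> borel_measurable borel" "AE x in lborel. u x = w x"
  shows "norm_L2 \<mu> u = norm_L2 \<mu> w"
proof -
  have [measurable]: "\<mu> \<in> borel_measurable borel" "u \<in> borel_measurable borel" "w \<in> borel_measurable borel"
    using assms by (auto simp: weight_def)
  show ?thesis unfolding norm_L2_def
    by (intro arg_cong[where f=sqrt] integral_cong_AE) (use assms(4) in \<open>auto elim: eventually_mono\<close>)
qed

lemma L2_cong_AE:
  assumes "weight \<mu>" "u \<in> borel_measurable borel" "w \<in> L2 \<mu>" "AE x in lborel. u x = w x"
  shows "u \<in> L2 \<mu>"
  by (rule L2_dominated_same(1)[OF assms(1,2,3), of 1]) (use assms(4) in \<open>auto elim: eventually_mono\<close>)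

lemma weak_deriv_measurable:
  assumes "weak_deriv u g"
  shows "u \<in> borel_measurable borel" "g \<in> borel_measurable borel"
  using assms by (auto simp: weak_deriv_def locally_integrable_def)

lemma H1_D:
  assumes \<mu>: "weight \<mu>" and u: "u \<in> H1 \<mu>"
  shows "u \<in> L2 \<mu>" "weak_deriv u (wderiv u)" "wderiv u \<in> L2 \<mu>"
proof -
  obtain g where g: "u \<in> L2 \<mu>" "g \<in> L2 \<mu>" "weak_deriv u g" using u by (auto simp: H1_def)
  show "u \<in> L2 \<mu>" by fact
  show w: "weak_deriv u (wderiv u)" by (rule weak_deriv_wderiv(1)[OF g(3)])
  show "wderiv u \<in> L2 \<mu>"
    by (rule L2_cong_AE[OF \<mu> weak_deriv_measurable(2)[OF w] g(2) weak_deriv_wderiv(2)[OF g(3)]])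
qed

lemma H1_I: "u \<in> L2 \<mu> \<Longrightarrow> g \<in> L2 \<mu> \<Longrightarrow> weak_deriv u g \<Longrightarrow> u \<in> H1 \<mu>"
  by (auto simp: H1_def)

lemma norm_L2_wderiv:
  assumes "weight \<mu>" "weak_deriv u g"
  shows "norm_L2 \<mu> (wderiv u) = norm_L2 \<mu> g"
  by (rule norm_L2_cong_AE[OF assms(1) weak_deriv_measurable(2)[OF weak_deriv_wderiv(1)[OF assms(2)]]
     weak_deriv_measurable(2)[OF assms(2)] weak_deriv_wderiv(2)[OF assms(2)]])

lemma norm_H1_eq:
  assumes "weight \<mu>" "weak_deriv u g"
  shows "norm_H1 \<mu> u = sqrt ((norm_L2 \<mu> u)\<^sup>2 + (norm_L2 \<mu> g)\<^sup>2)"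
  by (simp add: norm_H1_def norm_L2_wderiv[OF assms])

lemma norm_H1_bounds:
  assumes "weight \<mu>" "weak_deriv u g"
  shows "norm_L2 \<mu> u \<le> norm_H1 \<mu> u" "norm_L2 \<mu> g \<le> norm_H1 \<mu> u"
    "norm_H1 \<mu> u \<le> norm_L2 \<mu> u + norm_L2 \<mu> g"
proof -
  show "norm_L2 \<mu> u \<le> norm_H1 \<mu> u" "norm_L2 \<mu> g \<le> norm_H1 \<mu> u"
    unfolding norm_H1_eq[OF assms] by (auto intro!: real_le_rsqrt)
  show "norm_H1 \<mu> u \<le> norm_L2 \<mu> u + norm_L2 \<mu> g"
    unfolding norm_H1_eq[OF assms] using assms(1) by (intro real_le_lsqrt) (auto simp: power2_sum)
qed

lemma C_L2_D:
  assumes "C_L2 T \<mu> h" "t \<in> {0..T}"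
  shows "h t \<in> L2 \<mu>" "((\<lambda>s. norm_L2 \<mu> (\<lambda>x. h s x - h t x)) \<longlongrightarrow> 0) (at t within {0..T})"
  using assms by (auto simp: C_L2_def)

lemma C_H1_D:
  assumes \<mu>: "weight \<mu>" and h: "C_H1 T \<mu> h"
  shows "C_L2 T \<mu> h" "C_L2 T \<mu> (\<lambda>t. wderiv (h t))" "\<And>t. t \<in> {0..T} \<Longrightarrow> weak_deriv (h t) (wderiv (h t))"
proof -
  have H: "h t \<in> H1 \<mu>" "((\<lambda>s. norm_H1 \<mu> (\<lambda>x. h s x - h t x)) \<longlongrightarrow> 0) (at t within {0..T})" if "t \<in> {0..T}" for t
    using h that by (auto simp: C_H1_def)
  show w: "weak_deriv (h t) (wderiv (h t))" if "t \<in> {0..T}" for t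
    by (rule H1_D(2)[OF \<mu> H(1)[OF that]])
  have wd: "weak_deriv (\<lambda>x. h s x - h t x) (\<lambda>x. wderiv (h s) x - wderiv (h t) x)"
    if "s \<in> {0..T}" "t \<in> {0..T}" for s t
    using weak_deriv_lincomb[OF w[OF that(1)] w[OF that(2)], of 1 "-1"] by simp
  show "C_L2 T \<mu> h" unfolding C_L2_def
  proof (intro ballI conjI)
    fix t assume t: "t \<in> {0..T}"
    show "h t \<in> L2 \<mu>" by (rule H1_D(1)[OF \<mu> H(1)[OF t]])
    show "((\<lambda>s. norm_L2 \<mu> (\<lambda>x. h s x - h t x)) \<longlongrightarrow> 0) (at t within {0..T})"
      by (rule tendsto_sandwich[OF _ _ tendsto_const H(2)[OF t]])
       (use norm_H1_bounds(1)[OF \<mu> wd[OF _ t]] \<mu> in \<open>auto simp: eventually_at_filter\<close>)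
  qed
  show "C_L2 T \<mu> (\<lambda>t. wderiv (h t))" unfolding C_L2_def
  proof (intro ballI conjI)
    fix t assume t: "t \<in> {0..T}"
    show "wderiv (h t) \<in> L2 \<mu>" by (rule H1_D(3)[OF \<mu> H(1)[OF t]])
    show "((\<lambda>s. norm_L2 \<mu> (\<lambda>x. wderiv (h s) x - wderiv (h t) x)) \<longlongrightarrow> 0) (at t within {0..T})"
      by (rule tendsto_sandwich[OF _ _ tendsto_const H(2)[OF t]])
       (use norm_H1_bounds(2)[OF \<mu> wd[OF _ t]] \<mu> in \<open>auto simp: eventually_at_filter\<close>)
  qed
qed

lemma C_H1_I:
  assumes \<mu>: "weight \<mu>" and h: "C_L2 T \<mu> h" "C_L2 T \<mu> h'" and w: "\<And>t. t \<in> {0..T} \<Longrightarrow> weak_deriv (h t) (h' t)"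
  shows "C_H1 T \<mu> h"
  unfolding C_H1_def
proof (intro ballI conjI)
  fix t assume t: "t \<in> {0..T}"
  show "h t \<in> H1 \<mu>" by (rule H1_I[OF C_L2_D(1)[OF h(1) t] C_L2_D(1)[OF h(2) t] w[OF t]])
  have wd: "weak_deriv (\<lambda>x. h s x - h t x) (\<lambda>x. h' s x - h' t x)" if "s \<in> {0..T}" for s
    using weak_deriv_lincomb[OF w[OF that] w[OF t], of 1 "-1"] by simp
  have l: "((\<lambda>s. norm_L2 \<mu> (\<lambda>x. h s x - h t x) + norm_L2 \<mu> (\<lambda>x. h' s x - h' t x)) \<longlongrightarrow> 0) (at t within {0..T})"
    using tendsto_add[OF C_L2_D(2)[OF h(1) t] C_L2_D(2)[OF h(2) t]] by simp
  show "((\<lambda>s. norm_H1 \<mu> (\<lambda>x. h s x - h t x)) \<longlongrightarrow> 0) (at t within {0..T})"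
    by (rule tendsto_sandwich[OF _ _ tendsto_const l])
      (use norm_H1_bounds[OF \<mu> wd] \<mu> in \<open>auto simp: eventually_at_filter norm_H1_def\<close>)
qed

lemma C_L2_lincomb:
  assumes \<mu>: "weight \<mu>" and h: "C_L2 T \<mu> h" and k: "C_L2 T \<mu> k"
    and a: "continuous_on {0..T} a"
  shows "C_L2 T \<mu> (\<lambda>t x. p * h t x + a t * k t x)"
  unfolding C_L2_def
proof (intro ballI conjI)
  fix t assume t: "t \<in> {0..T}"
  note ht = C_L2_D[OF h t] note kt = C_L2_D[OF k t]
  show "(\<lambda>x. p * h t x + a t * k t x) \<in> L2 \<mu>" by (rule L2_lincomb[OF \<mu> ht(1) kt(1)])
  have at: "(a \<longlongrightarrow> a t) (at t within {0..T})" using a t by (simp add: continuous_on_def)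
  have "((\<lambda>s. \<bar>p\<bar> * norm_L2 \<mu> (\<lambda>x. h s x - h t x) + (\<bar>a s\<bar> * norm_L2 \<mu> (\<lambda>x. k s x - k t x) + \<bar>a s - a t\<bar> * norm_L2 \<mu> (k t)))
     \<longlongrightarrow> \<bar>p\<bar> * 0 + (\<bar>a t\<bar> * 0 + \<bar>a t - a t\<bar> * norm_L2 \<mu> (k t))) (at t within {0..T})"
    by (intro tendsto_intros at ht(2) kt(2))
  then have l: "((\<lambda>s. \<bar>p\<bar> * norm_L2 \<mu> (\<lambda>x. h s x - h t x) + (\<bar>a s\<bar> * norm_L2 \<mu> (\<lambda>x. k s x - k t x) + \<bar>a s - a t\<bar> * norm_L2 \<mu> (k t)))
     \<longlongrightarrow> 0) (at t within {0..T})" by simp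
  have "norm_L2 \<mu> (\<lambda>x. p * h s x + a s * k s x - (p * h t x + a t * k t x))
     \<le> \<bar>p\<bar> * norm_L2 \<mu> (\<lambda>x. h s x - h t x) + (\<bar>a s\<bar> * norm_L2 \<mu> (\<lambda>x. k s x - k t x) + \<bar>a s - a t\<bar> * norm_L2 \<mu> (k t))"
    if s: "s \<in> {0..T}" for s
  proof -
    note hs = C_L2_D(1)[OF h s] note ks = C_L2_D(1)[OF k s]
    have d: "(\<lambda>x. h s x - h t x) \<in> L2 \<mu>" "(\<lambda>x. k s x - k t x) \<in> L2 \<mu>"
      by (auto intro!: L2_diff \<mu> hs ks ht(1) kt(1))
    have e: "(\<lambda>x. a s * (k s x - k t x) + (a s - a t) * k t x) \<in> L2 \<mu>"
      by (intro L2_lincomb \<mu> d kt(1))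
    have "(\<lambda>x. p * h s x + a s * k s x - (p * h t x + a t * k t x)) =
       (\<lambda>x. p * (h s x - h t x) + 1 * (a s * (k s x - k t x) + (a s - a t) * k t x))"
      by (auto simp: algebra_simps)
    then have "norm_L2 \<mu> (\<lambda>x. p * h s x + a s * k s x - (p * h t x + a t * k t x))
      \<le> \<bar>p\<bar> * norm_L2 \<mu> (\<lambda>x. h s x - h t x) + norm_L2 \<mu> (\<lambda>x. a s * (k s x - k t x) + (a s - a t) * k t x)"
      using norm_L2_lincomb[OF \<mu> d(1) e, of p 1] by simp
    then show ?thesis using norm_L2_lincomb[OF \<mu> d(2) kt(1), of "a s" "a s - a t"] by simp
  qed
  then show "((\<lambda>s. norm_L2 \<mu> (\<lambda>x. p * h s x + a s * k s x - (p * h t x + a t * k t x))) \<longlongrightarrow> 0) (at t within {0..T})"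
    by (intro tendsto_sandwich[OF _ _ tendsto_const l]) (use \<mu> in \<open>auto simp: eventually_at_filter\<close>)
qed

lemma C_L2_dominated:
  assumes \<mu>: "weight \<mu>" and h: "\<And>t. t \<in> {0..T} \<Longrightarrow> h t \<in> L2 \<mu>" and w: "w \<in> L2 \<mu>"
    and b: "\<And>s t x. s \<in> {0..T} \<Longrightarrow> t \<in> {0..T} \<Longrightarrow> \<bar>h s x - h t x\<bar> \<le> K * \<bar>a s - a t\<bar> * \<bar>w x\<bar>"
    and K: "0 \<le> K" and a: "continuous_on {0..T} a"
  shows "C_L2 T \<mu> h"
  unfolding C_L2_def
proof (intro ballI conjI)
  fix t assume t: "t \<in> {0..T}"
  show "h t \<in> L2 \<mu>" by (rule h[OF t])
  have at: "(a \<longlongrightarrow> a t) (at t within {0..T})" using a t by (simp add: continuous_on_def)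
  have "((\<lambda>s. K * \<bar>a s - a t\<bar> * norm_L2 \<mu> w) \<longlongrightarrow> K * \<bar>a t - a t\<bar> * norm_L2 \<mu> w) (at t within {0..T})"
    by (intro tendsto_intros at)
  then have l: "((\<lambda>s. K * \<bar>a s - a t\<bar> * norm_L2 \<mu> w) \<longlongrightarrow> 0) (at t within {0..T})" by simp
  have "norm_L2 \<mu> (\<lambda>x. h s x - h t x) \<le> K * \<bar>a s - a t\<bar> * norm_L2 \<mu> w" if s: "s \<in> {0..T}" for s
    by (rule L2_dominated_same(2)[OF \<mu> L2_D(1)[OF L2_diff[OF \<mu> h[OF s] h[OF t]]] w]) (use b s t K in auto)
  then show "((\<lambda>s. norm_L2 \<mu> (\<lambda>x. h s x - h t x)) \<longlongrightarrow> 0) (at t within {0..T})"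
    by (intro tendsto_sandwich[OF _ _ tendsto_const l]) (use \<mu> in \<open>auto simp: eventually_at_filter\<close>)
qed

lemma C_L2_weight_mono:
  assumes "weight \<mu>" "weight \<mu>'" "\<And>x. \<mu> x \<le> \<mu>' x" "C_L2 T \<mu>' h"
  shows "C_L2 T \<mu> h"
  unfolding C_L2_def
proof (intro ballI conjI)
  fix t assume t: "t \<in> {0..T}"
  show "h t \<in> L2 \<mu>" by (rule L2_weight_mono(1)[OF assms(1,2,3) C_L2_D(1)[OF assms(4) t]])
  have "norm_L2 \<mu> (\<lambda>x. h s x - h t x) \<le> norm_L2 \<mu>' (\<lambda>x. h s x - h t x)" if "s \<in> {0..T}" for s
    by (rule L2_weight_mono(2)[OF assms(1,2,3) L2_diff[OF assms(2) C_L2_D(1)[OF assms(4) that] C_L2_D(1)[OF assms(4) t]]])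
  then show "((\<lambda>s. norm_L2 \<mu> (\<lambda>x. h s x - h t x)) \<longlongrightarrow> 0) (at t within {0..T})"
    by (intro tendsto_sandwich[OF _ _ tendsto_const C_L2_D(2)[OF assms(4) t]])
      (use assms(1) in \<open>auto simp: eventually_at_filter\<close>)
qed

lemma C_L2_subinterval: "C_L2 T \<mu> h \<Longrightarrow> T' \<le> T \<Longrightarrow> C_L2 T' \<mu> h"
  unfolding C_L2_def
  by (intro ballI conjI; (rule tendsto_within_subset[of _ _ _ "{0..T}"])?) auto

lemma C_L2_uniform:
  assumes \<mu>: "weight \<mu>" and h: "C_L2 T \<mu> h" and \<delta>: "\<delta> > 0"
  obtains d where "d > 0" "\<And>s t. s \<in> {0..T} \<Longrightarrow> t \<in> {0..T} \<Longrightarrow> \<bar>s - t\<bar> < d \<Longrightarrow>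
    norm_L2 \<mu> (\<lambda>x. h s x - h t x) < \<delta>"
proof (rule ccontr)
  assume "\<not> thesis"
  then have "\<exists>s t. s \<in> {0..T} \<and> t \<in> {0..T} \<and> \<bar>s - t\<bar> < 1 / real (Suc n) \<and> \<not> norm_L2 \<mu> (\<lambda>x. h s x - h t x) < \<delta>" for n
    using that[of "1 / real (Suc n)"] by auto
  then obtain S R where SR: "\<And>n. S n \<in> {0..T}" "\<And>n. R n \<in> {0..T}" "\<And>n. \<bar>S n - R n\<bar> < 1 / real (Suc n)"
    "\<And>n. \<not> norm_L2 \<mu> (\<lambda>x. h (S n) x - h (R n) x) < \<delta>" by metis
  obtain l r where l: "l \<in> {0..T}" "strict_mono r" "(S \<circ> r) \<longlonglongrightarrow> l"
    using compact_imp_seq_compact[OF compact_Icc, of 0 T] SR(1) unfolding seq_compact_def by metis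
  have "(\<lambda>n. S (r n) - R (r n)) \<longlonglongrightarrow> 0"
  proof (rule Lim_null_comparison)
    have "(\<lambda>n. 1 / real (Suc n)) \<longlonglongrightarrow> 0" by (rule LIMSEQ_Suc[OF lim_inverse_n'])
    then show "((\<lambda>n. 1 / real (Suc n)) \<circ> r) \<longlonglongrightarrow> 0" using LIMSEQ_subseq_LIMSEQ[OF _ l(2)] by blast
    show "\<forall>\<^sub>F n in sequentially. norm (S (r n) - R (r n)) \<le> ((\<lambda>n. 1 / real (Suc n)) \<circ> r) n"
      using SR(3) by (auto simp: less_imp_le)
  qed
  then have Rl: "(R \<circ> r) \<longlonglongrightarrow> l" using tendsto_diff[OF l(3)] by (force simp: o_def)
  define N where "N s = norm_L2 \<mu> (\<lambda>x. h s x - h l x)" for s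
  have N: "continuous (at l within {0..T}) N"
    using C_L2_D(2)[OF h l(1)] unfolding N_def[abs_def] by (simp add: continuous_within)
  have c: "(\<lambda>n. N (X n)) \<longlonglongrightarrow> 0" if "\<And>n. X n \<in> {0..T}" "X \<longlonglongrightarrow> l" for X
    using continuous_within_tendsto_compose'[OF N, of X sequentially] that by (simp add: N_def)
  have "(\<lambda>n. N ((S \<circ> r) n) + N ((R \<circ> r) n)) \<longlonglongrightarrow> 0 + 0"
    by (intro tendsto_add c l(3) Rl) (auto simp: SR(1,2) simp del: atLeastAtMost_iff)
  then have "\<forall>\<^sub>F n in sequentially. N ((S \<circ> r) n) + N ((R \<circ> r) n) < \<delta>"
    using \<delta> by (intro order_tendstoD) auto
  then obtain n where n: "N ((S \<circ> r) n) + N ((R \<circ> r) n) < \<delta>" by (auto simp: eventually_sequentially)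
  have "norm_L2 \<mu> (\<lambda>x. h (S (r n)) x - h (R (r n)) x) \<le> N (S (r n)) + N (R (r n))"
    unfolding N_def using norm_L2_triangle[OF \<mu> C_L2_D(1)[OF h SR(1)] C_L2_D(1)[OF h l(1)] C_L2_D(1)[OF h SR(2)]]
    by (simp add: norm_L2_diff_commute[of \<mu> "h (R (r n))"])
  then show False using n SR(4)[of "r n"] by simp
qed

lemma C_L2_norm_continuous:
  assumes \<mu>: "weight \<mu>" and h: "C_L2 T \<mu> h"
  shows "continuous_on {0..T} (\<lambda>t. norm_L2 \<mu> (h t))"
  unfolding continuous_on_def
proof
  fix t assume t: "t \<in> {0..T}"
  have "\<bar>norm_L2 \<mu> (h s) - norm_L2 \<mu> (h t)\<bar> \<le> norm_L2 \<mu> (\<lambda>x. h s x - h t x)" if "s \<in> {0..T}" for s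
    by (rule norm_L2_reverse_triangle[OF \<mu> C_L2_D(1)[OF h that] C_L2_D(1)[OF h t]])
  then have "((\<lambda>s. norm_L2 \<mu> (h s) - norm_L2 \<mu> (h t)) \<longlongrightarrow> 0) (at t within {0..T})"
    by (intro Lim_null_comparison[OF _ C_L2_D(2)[OF h t]]) (auto simp: eventually_at_filter)
  then show "((\<lambda>t. norm_L2 \<mu> (h t)) \<longlongrightarrow> norm_L2 \<mu> (h t)) (at t within {0..T})"
    by (rule LIM_zero_cancel)
qed

lemma C_L2_bounded:
  assumes \<mu>: "weight \<mu>" and h: "C_L2 T \<mu> h"
  obtains B where "0 \<le> B" "\<And>t. t \<in> {0..T} \<Longrightarrow> norm_L2 \<mu> (h t) \<le> B"
proof -
  have "bounded ((\<lambda>t. norm_L2 \<mu> (h t)) ` {0..T})"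
    by (intro compact_imp_bounded compact_continuous_image C_L2_norm_continuous[OF assms] compact_Icc)
  then obtain B where "\<And>t. t \<in> {0..T} \<Longrightarrow> \<bar>norm_L2 \<mu> (h t)\<bar> \<le> B" by (force simp: bounded_iff)
  then show ?thesis using that[of "\<bar>B\<bar>"] by force
qed

lemma set_integral_Cauchy_Schwarz:
  assumes f: "f \<in> L2 (\<lambda>_. 1)" and ab: "a \<le> b"
  shows "(LINT x:{a..b}|lborel. f x)\<^sup>2 \<le> (b - a) * (LINT x:{a..b}|lborel. (f x)\<^sup>2)"
proof -
  have [measurable]: "f \<in> borel_measurable borel" using L2_D[OF f] by simp
  define F where "F x = indicator {a..b} x * f x" for x
  have F: "F \<in> L2 (\<lambda>_. 1)"
    by (rule L2_dominated_same(1)[OF weight_one _ f, of _ 1]) (auto simp: F_def[abs_def] indicator_def)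
  have I: "indicat_real {a..b} \<in> L2 (\<lambda>_. 1)"
  proof -
    have "(\<lambda>x. (indicat_real {a..b} x)\<^sup>2 * 1) = indicat_real {a..b}" by (auto simp: indicator_def)
    moreover have "integrable lborel (indicat_real {a..b})" by (rule integrable_real_indicator) (use ab in auto)
    ultimately show ?thesis by (simp add: L2_def)
  qed
  have "(inner_L2 (\<lambda>_. 1) F (indicat_real {a..b}))\<^sup>2 \<le> (norm_L2 (\<lambda>_. 1) F * norm_L2 (\<lambda>_. 1) (indicat_real {a..b}))\<^sup>2"
    using L2_Cauchy_Schwarz[OF weight_one F I] by (metis abs_ge_zero power2_abs power_mono)
  moreover have "inner_L2 (\<lambda>_. 1) F (indicat_real {a..b}) = (LINT x:{a..b}|lborel. f x)"
    unfolding inner_L2_def set_lebesgue_integral_def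
    by (rule Bochner_Integration.integral_cong) (auto simp: F_def indicator_def)
  moreover have "(norm_L2 (\<lambda>_. 1) F)\<^sup>2 = (LINT x:{a..b}|lborel. (f x)\<^sup>2)"
    unfolding norm_L2_sq[OF weight_one] set_lebesgue_integral_def
    by (rule Bochner_Integration.integral_cong) (auto simp: F_def indicator_def)
  moreover have "(norm_L2 (\<lambda>_. 1) (indicat_real {a..b}))\<^sup>2 = b - a"
  proof -
    have "(LINT x|lborel. (indicat_real {a..b} x)\<^sup>2 * 1) = (LINT x|lborel. indicat_real {a..b} x)"
      by (rule Bochner_Integration.integral_cong) (auto simp: indicator_def)
    then show ?thesis unfolding norm_L2_sq[OF weight_one] using ab by simp
  qed
  ultimately show ?thesis by (simp add: power_mult_distrib mult.commute)
qed

lemma set_integral_le_integral: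
  assumes "integrable lborel f" "\<And>x. 0 \<le> f x"
  shows "(LINT x:{a..b::real}|lborel. f x) \<le> (LINT x|lborel. (f x :: real))"
proof -
  have "set_integrable lborel {a..b} f"
    using assms(1) integrable_mult_indicator[of "{a..b}" lborel f] by (simp add: set_integrable_def)
  then show ?thesis unfolding set_lebesgue_integral_def set_integrable_def
    by (intro integral_mono assms(1)) (auto simp: indicator_def assms(2))
qed

lemma indef_integral_sup_bound:
  assumes U: "indef_integral U g" and L: "U \<in> L2 (\<lambda>_. 1)" "g \<in> L2 (\<lambda>_. 1)"
  shows "(U x)\<^sup>2 \<le> 2 * ((norm_L2 (\<lambda>_. 1) U)\<^sup>2 + (norm_L2 (\<lambda>_. 1) g)\<^sup>2)"
proof -
  define A where "A = 2 * (norm_L2 (\<lambda>_. 1) g)\<^sup>2"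
  have Ui: "integrable lborel (\<lambda>x. (U x)\<^sup>2)" and gi: "integrable lborel (\<lambda>x. (g x)\<^sup>2)" using L by (auto simp: L2_def)
  have "(U x)\<^sup>2 \<le> 2 * (U y)\<^sup>2 + A" if y: "y \<in> {x..x+1}" for y
  proof -
    have "(U y - U x)\<^sup>2 \<le> (y - x) * (LINT z:{x..y}|lborel. (g z)\<^sup>2)"
      using set_integral_Cauchy_Schwarz[OF L(2), of x y] indef_integralD(2)[OF U, of x y] y by simp
    also have "\<dots> \<le> 1 * (norm_L2 (\<lambda>_. 1) g)\<^sup>2"
      using y set_integral_le_integral[OF gi, of x y]
      by (intro mult_mono) (auto simp: norm_L2_sq[OF weight_one] set_lebesgue_integral_def intro!: integral_nonneg_AE)
    finally have "(U y - U x)\<^sup>2 \<le> (norm_L2 (\<lambda>_. 1) g)\<^sup>2" by simp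
    moreover have "(U x)\<^sup>2 \<le> 2 * (U y)\<^sup>2 + 2 * (U y - U x)\<^sup>2"
      using zero_le_power2[of "2 * U y - U x"] by (simp add: power2_eq_square algebra_simps)
    ultimately show ?thesis by (simp add: A_def)
  qed
  then have p: "indicator {x..x+1} y * (U x)\<^sup>2 \<le> indicator {x..x+1} y * (2 * (U y)\<^sup>2 + A)" for y
    by (auto simp: indicator_def)
  have cont: "continuous_on S (\<lambda>y. 2 * (U y)\<^sup>2 + A)" for S
    by (intro continuous_intros indef_integral_continuous_on[OF U])
  have "(U x)\<^sup>2 = (LINT y|lborel. indicator {x..x+1} y * (U x)\<^sup>2)" by simp
  also have "\<dots> \<le> (LINT y|lborel. indicator {x..x+1} y * (2 * (U y)\<^sup>2 + A))"
  proof (rule integral_mono[OF _ _ p])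
    show "integrable lborel (\<lambda>y. indicat_real {x..x + 1} y * (U x)\<^sup>2)" by simp
    show "integrable lborel (\<lambda>y. indicat_real {x..x + 1} y * (2 * (U y)\<^sup>2 + A))"
      using borel_integrable_atLeastAtMost'[OF cont] by (simp add: set_integrable_def)
  qed
  also have "\<dots> = 2 * (LINT y:{x..x+1}|lborel. (U y)\<^sup>2) + A"
  proof -
    have "set_integrable lborel {x..x+1} (\<lambda>y. 2 * (U y)\<^sup>2)" "set_integrable lborel {x..x+1} (\<lambda>y. A)"
      by (auto intro!: borel_integrable_atLeastAtMost' continuous_intros indef_integral_continuous_on[OF U])
    from set_integral_add(2)[OF this] show ?thesis
      by (simp add: set_lebesgue_integral_def mult.left_commute)
  qed
  also have "\<dots> \<le> 2 * (norm_L2 (\<lambda>_. 1) U)\<^sup>2 + A"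
    using set_integral_le_integral[OF Ui, of x "x+1"] by (simp add: norm_L2_sq[OF weight_one])
  finally show ?thesis by (simp add: A_def)
qed

lemma H1_sup_bound:
  assumes w: "weak_deriv u g" and L: "u \<in> L2 (\<lambda>_. 1)" "g \<in> L2 (\<lambda>_. 1)"
  shows "AE x in lborel. \<bar>u x\<bar> \<le> 2 * norm_H1 (\<lambda>_. 1) u"
proof -
  obtain U where U: "indef_integral U g" "AE x in lborel. u x = U x"
    by (rule weak_deriv_imp_indef_integral[OF w])
  have mU: "U \<in> borel_measurable borel"
    by (rule borel_measurable_continuous_onI[OF indef_integral_continuous_on[OF U(1)]])
  have UL: "U \<in> L2 (\<lambda>_. 1)"
    by (rule L2_cong_AE[OF weight_one mU L(1)]) (use U(2) in \<open>auto elim: eventually_mono\<close>)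
  have n: "norm_L2 (\<lambda>_. 1) U = norm_L2 (\<lambda>_. 1) u"
    by (rule norm_L2_cong_AE[OF weight_one mU L2_D(1)[OF L(1)]]) (use U(2) in \<open>auto elim: eventually_mono\<close>)
  have "\<bar>U x\<bar> \<le> 2 * norm_H1 (\<lambda>_. 1) u" for x
  proof (rule power2_le_imp_le)
    have "\<bar>U x\<bar>\<^sup>2 \<le> 2 * (norm_H1 (\<lambda>_. 1) u)\<^sup>2"
      using indef_integral_sup_bound[OF U(1) UL L(2), of x] n by (simp add: norm_H1_eq[OF weight_one w])
    also have "\<dots> \<le> (2 * norm_H1 (\<lambda>_. 1) u)\<^sup>2" by (simp add: power_mult_distrib)
    finally show "\<bar>U x\<bar>\<^sup>2 \<le> (2 * norm_H1 (\<lambda>_. 1) u)\<^sup>2" .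
  qed (simp add: norm_H1_def)
  then show ?thesis using U(2) by (auto elim: eventually_mono)
qed

lemma L2_translation_estimate:
  assumes w: "weak_deriv \<psi> \<psi>'" and L: "\<psi> \<in> L2 (\<lambda>_. 1)" "\<psi>' \<in> L2 (\<lambda>_. 1)" and K: "\<psi>' \<in> L2 \<kappa>"
    and \<kappa>: "weight \<kappa>" and h: "0 < h"
    and c: "\<And>x y. \<bar>x - y\<bar> \<le> h \<Longrightarrow> \<kappa> x \<le> C\<^sup>2 * \<kappa> y" "0 \<le> C"
  shows "(\<lambda>x. \<psi> (x - h) - \<psi> x) \<in> L2 \<kappa>"
    "norm_L2 \<kappa> (\<lambda>x. \<psi> (x - h) - \<psi> x) \<le> h * C * norm_L2 \<kappa> \<psi>'"
proof -
  obtain U where U: "indef_integral U \<psi>'" "AE x in lborel. \<psi> x = U x"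
    by (rule weak_deriv_imp_indef_integral[OF w])
  have mU: "U \<in> borel_measurable borel"
    by (rule borel_measurable_continuous_onI[OF indef_integral_continuous_on[OF U(1)]])
  have [measurable]: "\<psi> \<in> borel_measurable borel" "\<psi>' \<in> borel_measurable borel" "U \<in> borel_measurable borel"
    "\<kappa> \<in> borel_measurable borel"
    using weak_deriv_measurable[OF w] mU \<kappa> by (auto simp: weight_def)
  have "AE x in lborel. \<psi> (x + (- h)) = U (x + (-h))" by (rule lborel_AE_shift[OF U(2)]) measurable
  then have ae: "AE x in lborel. (\<psi> (x - h) - \<psi> x)\<^sup>2 * \<kappa> x = (U (x - h) - U x)\<^sup>2 * \<kappa> x"
    using U(2) by eventually_elim simp
  have pos: "0 < \<kappa> x" for x using \<kappa> by (simp add: weight_def)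
  have g2: "integrable lborel (\<lambda>x. (\<psi>' x)\<^sup>2)" using L(2) by (auto simp: L2_def)
  have step: "ennreal ((U (x - h) - U x)\<^sup>2 * \<kappa> x) \<le> (\<integral>\<^sup>+y. ennreal (h * C\<^sup>2 * ((\<psi>' y)\<^sup>2 * \<kappa> y)) * indicator {y..y + h} x \<partial>lborel)" for x
  proof -
    have s: "set_integrable lborel {x - h..x} (\<lambda>y. (\<psi>' y)\<^sup>2)"
      using integrable_mult_indicator[OF _ g2, of "{x - h..x}"] by (simp add: set_integrable_def)
    have "(U x - U (x - h))\<^sup>2 \<le> h * (LINT y:{x - h..x}|lborel. (\<psi>' y)\<^sup>2)"
      using set_integral_Cauchy_Schwarz[OF L(2), of "x - h" x] indef_integralD(2)[OF U(1), of "x - h" x] h by simp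
    then have "(U (x - h) - U x)\<^sup>2 * \<kappa> x \<le> h * (LINT y:{x - h..x}|lborel. (\<psi>' y)\<^sup>2) * \<kappa> x"
      using pos[of x] by (simp add: power2_commute)
    also have "\<dots> = (LINT y|lborel. h * \<kappa> x * (indicator {x - h..x} y * (\<psi>' y)\<^sup>2))"
      by (simp add: set_lebesgue_integral_def)
    finally have "ennreal ((U (x - h) - U x)\<^sup>2 * \<kappa> x) \<le> ennreal (LINT y|lborel. h * \<kappa> x * (indicator {x - h..x} y * (\<psi>' y)\<^sup>2))"
      by (rule ennreal_leI)
    also have "\<dots> = (\<integral>\<^sup>+y. ennreal (h * \<kappa> x * (indicator {x - h..x} y * (\<psi>' y)\<^sup>2)) \<partial>lborel)"
      using s h pos[of x] by (intro nn_integral_eq_integral[symmetric]) (auto simp: set_integrable_def)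
    also have "\<dots> \<le> (\<integral>\<^sup>+y. ennreal (h * C\<^sup>2 * ((\<psi>' y)\<^sup>2 * \<kappa> y)) * indicator {y..y + h} x \<partial>lborel)"
    proof (rule nn_integral_mono)
      fix y :: real
      show "ennreal (h * \<kappa> x * (indicator {x - h..x} y * (\<psi>' y)\<^sup>2)) \<le> ennreal (h * C\<^sup>2 * ((\<psi>' y)\<^sup>2 * \<kappa> y)) * indicator {y..y + h} x"
      proof (cases "y \<in> {x - h..x}")
        case True
        then have "\<kappa> x \<le> C\<^sup>2 * \<kappa> y" by (intro c) auto
        then have "\<kappa> x * (h * (\<psi>' y)\<^sup>2) \<le> C\<^sup>2 * \<kappa> y * (h * (\<psi>' y)\<^sup>2)" using h by (intro mult_right_mono) auto
        then show ?thesis using True by (auto simp: indicator_def intro!: ennreal_leI) (simp add: mult_ac)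
      qed auto
    qed
    finally show ?thesis .
  qed
  have "(\<integral>\<^sup>+x. ennreal ((\<psi> (x - h) - \<psi> x)\<^sup>2 * \<kappa> x) \<partial>lborel) = (\<integral>\<^sup>+x. ennreal ((U (x - h) - U x)\<^sup>2 * \<kappa> x) \<partial>lborel)"
    by (rule nn_integral_cong_AE) (use ae in \<open>auto elim: eventually_mono\<close>)
  also have "\<dots> \<le> (\<integral>\<^sup>+x. (\<integral>\<^sup>+y. ennreal (h * C\<^sup>2 * ((\<psi>' y)\<^sup>2 * \<kappa> y)) * indicator {y..y + h} x \<partial>lborel) \<partial>lborel)"
    by (rule nn_integral_mono[OF step])
  also have "\<dots> = (\<integral>\<^sup>+y. (\<integral>\<^sup>+x. ennreal (h * C\<^sup>2 * ((\<psi>' y)\<^sup>2 * \<kappa> y)) * indicator {y..y + h} x \<partial>lborel) \<partial>lborel)"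
  proof (rule lborel_pair.Fubini')
    have eq: "(\<lambda>(y, x). ennreal (h * C\<^sup>2 * ((\<psi>' y)\<^sup>2 * \<kappa> y)) * indicator {y..y + h} x) =
      (\<lambda>(y, x::real). ennreal (h * C\<^sup>2 * ((\<psi>' y)\<^sup>2 * \<kappa> y)) * (if y \<le> x \<and> x \<le> y + h then 1 else 0))"
      by (auto simp: indicator_def fun_eq_iff)
    show "(\<lambda>(y, x). ennreal (h * C\<^sup>2 * ((\<psi>' y)\<^sup>2 * \<kappa> y)) * indicator {y..y + h} x) \<in> borel_measurable (lborel \<Otimes>\<^sub>M lborel)"
      unfolding eq by measurable
  qed
  also have "\<dots> = (\<integral>\<^sup>+y. ennreal (h\<^sup>2 * C\<^sup>2 * ((\<psi>' y)\<^sup>2 * \<kappa> y)) \<partial>lborel)"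
  proof (rule nn_integral_cong)
    fix y :: real
    have "(\<integral>\<^sup>+x. ennreal (h * C\<^sup>2 * ((\<psi>' y)\<^sup>2 * \<kappa> y)) * indicator {y..y + h} x \<partial>lborel) = ennreal (h * C\<^sup>2 * ((\<psi>' y)\<^sup>2 * \<kappa> y)) * ennreal h"
      using h by (subst nn_integral_cmult_indicator) auto
    also have "\<dots> = ennreal (h\<^sup>2 * C\<^sup>2 * ((\<psi>' y)\<^sup>2 * \<kappa> y))"
      using h pos[of y] by (subst ennreal_mult''[symmetric]) (auto simp: power2_eq_square mult_ac)
    finally show "(\<integral>\<^sup>+x. ennreal (h * C\<^sup>2 * ((\<psi>' y)\<^sup>2 * \<kappa> y)) * indicator {y..y + h} x \<partial>lborel) = ennreal (h\<^sup>2 * C\<^sup>2 * ((\<psi>' y)\<^sup>2 * \<kappa> y))" .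
  qed
  also have "\<dots> = ennreal (LINT y|lborel. h\<^sup>2 * C\<^sup>2 * ((\<psi>' y)\<^sup>2 * \<kappa> y))"
    using K pos by (intro nn_integral_eq_integral) (auto simp: L2_def less_imp_le)
  also have "\<dots> = ennreal ((h * C * norm_L2 \<kappa> \<psi>')\<^sup>2)"
    by (simp add: norm_L2_sq[OF \<kappa>] power_mult_distrib)
  finally have fin: "(\<integral>\<^sup>+x. ennreal ((\<psi> (x - h) - \<psi> x)\<^sup>2 * \<kappa> x) \<partial>lborel) \<le> ennreal ((h * C * norm_L2 \<kappa> \<psi>')\<^sup>2)" .
  have nn: "AE x in lborel. 0 \<le> (\<psi> (x - h) - \<psi> x)\<^sup>2 * \<kappa> x" using pos by (simp add: less_imp_le)
  have int: "integrable lborel (\<lambda>x. (\<psi> (x - h) - \<psi> x)\<^sup>2 * \<kappa> x)"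
    by (rule integrableI_nonneg[OF _ nn]) (use fin in \<open>auto simp: le_less_trans\<close>)
  then show "(\<lambda>x. \<psi> (x - h) - \<psi> x) \<in> L2 \<kappa>" by (simp add: L2_def)
  have "ennreal (LINT x|lborel. (\<psi> (x - h) - \<psi> x)\<^sup>2 * \<kappa> x) \<le> ennreal ((h * C * norm_L2 \<kappa> \<psi>')\<^sup>2)"
    using fin by (simp add: nn_integral_eq_integral[OF int nn])
  then have "(norm_L2 \<kappa> (\<lambda>x. \<psi> (x - h) - \<psi> x))\<^sup>2 \<le> (h * C * norm_L2 \<kappa> \<psi>')\<^sup>2"
    by (simp add: norm_L2_sq[OF \<kappa>])
  then show "norm_L2 \<kappa> (\<lambda>x. \<psi> (x - h) - \<psi> x) \<le> h * C * norm_L2 \<kappa> \<psi>'"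
    by (rule power2_le_imp_le) (use h c(2) \<kappa> in simp)
qed

lemma norm_L2_difference_quotient_limit:
  assumes w: "weak_deriv u g" and m: "weight m" and g: "g \<in> L2 m" and K: "0 \<le> K"
    and d: "\<And>h. 0 < h \<Longrightarrow> h \<le> 1 \<Longrightarrow> (\<lambda>x. u (x + h) - u x) \<in> L2 m"
      "\<And>h. 0 < h \<Longrightarrow> h \<le> 1 \<Longrightarrow> norm_L2 m (\<lambda>x. u (x + h) - u x) \<le> h * K"
  shows "norm_L2 m g \<le> K"
proof -
  obtain U where U: "indef_integral U g" "AE x in lborel. u x = U x"
    by (rule weak_deriv_imp_indef_integral[OF w])
  have mU: "U \<in> borel_measurable borel"
    by (rule borel_measurable_continuous_onI[OF indef_integral_continuous_on[OF U(1)]])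
  have [measurable]: "u \<in> borel_measurable borel" "g \<in> borel_measurable borel" "U \<in> borel_measurable borel"
    "m \<in> borel_measurable borel"
    using weak_deriv_measurable[OF w] mU m by (auto simp: weight_def)
  have pos: "0 < m x" for x using m by (simp add: weight_def)
  define H where "H n = 1 / real (Suc n)" for n
  have H: "0 < H n" "H n \<le> 1" for n by (auto simp: H_def)
  define D where "D n x = (u (x + H n) - u x) / H n" for n x
  have [measurable]: "D n \<in> borel_measurable borel" for n unfolding D_def by measurable
  have "AE x in lborel. \<forall>n. u (x + H n) = U (x + H n)"
    by (subst AE_all_countable, intro allI lborel_AE_shift[OF U(2)]) measurable
  then have lim: "AE x in lborel. (\<lambda>n. D n x) \<longlonglongrightarrow> g x"
    using U(2) AE_lebesgue_differentiation[OF indef_integralD(1)[OF U(1)]]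
  proof eventually_elim
    case (elim x)
    have "(LINT y:{x..x + 1 / real (Suc n)}|lborel. g y) = U (x + H n) - U x" for n
      using indef_integralD(2)[OF U(1), of x "x + H n"] H(1)[of n] by (simp add: H_def)
    then have "real (Suc n) * (LINT y:{x..x + 1 / real (Suc n)}|lborel. g y) = D n x" for n
      using elim(1,2) by (simp add: D_def H_def)
    then show ?case using elim(3) by simp
  qed
  have DK: "(\<integral>\<^sup>+x. ennreal ((D n x)\<^sup>2 * m x) \<partial>lborel) \<le> ennreal (K\<^sup>2)" for n
  proof -
    have e: "(\<lambda>x. (D n x)\<^sup>2 * m x) = (\<lambda>x. inverse ((H n)\<^sup>2) * ((u (x + H n) - u x)\<^sup>2 * m x))"
      by (auto simp: D_def power_mult_distrib power_inverse divide_inverse)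
    have i: "integrable lborel (\<lambda>x. (D n x)\<^sup>2 * m x)"
      unfolding e using d(1)[OF H, of n] by (auto simp: L2_def)
    have "(LINT x|lborel. (D n x)\<^sup>2 * m x) = inverse ((H n)\<^sup>2) * (norm_L2 m (\<lambda>x. u (x + H n) - u x))\<^sup>2"
      unfolding e norm_L2_sq[OF m] by simp
    also have "\<dots> \<le> inverse ((H n)\<^sup>2) * (H n * K)\<^sup>2"
      using d(2)[OF H, of n] m by (intro mult_left_mono power_mono) auto
    also have "\<dots> = K\<^sup>2" using H(1)[of n] by (simp add: power_mult_distrib)
    finally show ?thesis using pos
      by (subst nn_integral_eq_integral[OF i]) (auto simp: less_imp_le intro!: ennreal_leI)
  qed
  have "(\<integral>\<^sup>+x. ennreal ((g x)\<^sup>2 * m x) \<partial>lborel) = (\<integral>\<^sup>+x. liminf (\<lambda>n. ennreal ((D n x)\<^sup>2 * m x)) \<partial>lborel)"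
  proof (rule nn_integral_cong_AE)
    show "AE x in lborel. ennreal ((g x)\<^sup>2 * m x) = liminf (\<lambda>n. ennreal ((D n x)\<^sup>2 * m x))"
      using lim
    proof eventually_elim
      case (elim x)
      have "(\<lambda>n. ennreal ((D n x)\<^sup>2 * m x)) \<longlonglongrightarrow> ennreal ((g x)\<^sup>2 * m x)"
        by (intro tendsto_ennrealI tendsto_intros elim)
      then show ?case by (simp add: lim_imp_Liminf)
    qed
  qed
  also have "\<dots> \<le> liminf (\<lambda>n. \<integral>\<^sup>+x. ennreal ((D n x)\<^sup>2 * m x) \<partial>lborel)"
    by (rule nn_integral_liminf) measurable
  also have "\<dots> \<le> liminf (\<lambda>n. ennreal (K\<^sup>2))" by (rule Liminf_mono) (simp add: DK)
  also have "\<dots> = ennreal (K\<^sup>2)" by (simp add: Liminf_const)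
  finally have "(\<integral>\<^sup>+x. ennreal ((g x)\<^sup>2 * m x) \<partial>lborel) \<le> ennreal (K\<^sup>2)" .
  then have "(norm_L2 m g)\<^sup>2 \<le> K\<^sup>2"
    using pos by (subst (asm) nn_integral_eq_integral[OF L2_D(2)[OF g]])
      (auto simp: less_imp_le norm_L2_sq[OF m])
  then show ?thesis using K by (rule power2_le_imp_le)
qed

section \<open>Travelling waves\<close>

lemma harnack:
  fixes g g' :: "real \<Rightarrow> real"
  assumes d: "\<And>x. (g has_real_derivative g' x) (at x)" and b: "\<And>x. \<bar>g' x\<bar> \<le> K * g x"
  shows "g (x + h) \<le> exp (K * \<bar>h\<bar>) * g x"
proof (cases "h \<ge> 0")
  case True
  have "g (x + h) * exp (- K * (x + h)) \<le> g x * exp (- K * x)"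
  proof (rule DERIV_nonpos_imp_nonincreasing[of x "x + h" "\<lambda>y. g y * exp (- K * y)"])
    fix y
    have "((\<lambda>y. g y * exp (- K * y)) has_real_derivative (g' y - K * g y) * exp (- K * y)) (at y)"
      by (auto intro!: derivative_eq_intros d simp: algebra_simps)
    moreover have "(g' y - K * g y) * exp (- K * y) \<le> 0"
      using b[of y] by (intro mult_nonpos_nonneg) auto
    ultimately show "\<exists>z. ((\<lambda>y. g y * exp (- K * y)) has_real_derivative z) (at y) \<and> z \<le> 0" by blast
  qed (use True in simp)
  then have "g (x + h) * exp (- K * (x + h)) * exp (K * (x + h)) \<le> g x * exp (- K * x) * exp (K * (x + h))"
    by (rule mult_right_mono) simp
  then show ?thesis using True by (simp add: mult.assoc flip: exp_add) (simp add: algebra_simps)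
next
  case False
  have "g (x + h) * exp (K * (x + h)) \<le> g x * exp (K * x)"
  proof (rule DERIV_nonneg_imp_nondecreasing[of "x + h" x "\<lambda>y. g y * exp (K * y)"])
    fix y
    have "((\<lambda>y. g y * exp (K * y)) has_real_derivative (g' y + K * g y) * exp (K * y)) (at y)"
      by (auto intro!: derivative_eq_intros d simp: algebra_simps)
    moreover have "(g' y + K * g y) * exp (K * y) \<ge> 0"
      using b[of y] by (intro mult_nonneg_nonneg) auto
    ultimately show "\<exists>z. ((\<lambda>y. g y * exp (K * y)) has_real_derivative z) (at y) \<and> z \<ge> 0" by blast
  qed (use False in simp)
  then have "g (x + h) * exp (K * (x + h)) * exp (- (K * (x + h))) \<le> g x * exp (K * x) * exp (- (K * (x + h)))"
    by (rule mult_right_mono) simp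
  then show ?thesis using False by (simp add: mult.assoc flip: exp_add) (simp add: algebra_simps)
qed

lemma nonneg_gradient_lower_bound:
  fixes p p1 p2 :: "real \<Rightarrow> real"
  assumes nn: "\<And>x. 0 \<le> p x" and d: "\<And>x. (p has_real_derivative p1 x) (at x)"
    and d1: "\<And>x. (p1 has_real_derivative p2 x) (at x)"
    and le: "\<And>x. p2 x \<le> \<kappa> * p1 x + B * p x" and B: "0 \<le> B"
  shows "- (\<bar>\<kappa>\<bar> + B + 1) * p x0 \<le> p1 x0"
proof (rule ccontr)
  assume neg: "\<not> ?thesis"
  define K where "K = \<bar>\<kappa>\<bar> + B + 1"
  define a where "a = \<kappa> + K"
  have a1: "a \<ge> 1" using B by (simp add: a_def K_def)
  have K1: "K \<ge> 1" using B by (simp add: K_def)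
  define q where "q x = p1 x + K * p x" for x
  have q0: "q x0 < 0" using neg by (simp add: q_def K_def algebra_simps)
  have q': "p2 x + K * p1 x \<le> a * q x" for x
  proof -
    have "K * (\<kappa> + K) \<ge> 1 * (B + 1)" using B K1 by (intro mult_mono) (auto simp: K_def)
    then have "B * p x \<le> K * (\<kappa> + K) * p x" using nn[of x] by (intro mult_right_mono) auto
    then show ?thesis using le[of x] by (simp add: q_def a_def algebra_simps)
  qed
  have qle: "q x \<le> q x0" if x: "x \<ge> x0" for x
  proof -
    have "q x * exp (- a * x) \<le> q x0 * exp (- a * x0)"
    proof (rule DERIV_nonpos_imp_nonincreasing[OF x, of "\<lambda>y. q y * exp (- a * y)"])
      fix y
      have "((\<lambda>y. q y * exp (- a * y)) has_real_derivative (p2 y + K * p1 y - a * q y) * exp (- a * y)) (at y)"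
        unfolding q_def by (auto intro!: derivative_eq_intros d d1 simp: algebra_simps)
      moreover have "(p2 y + K * p1 y - a * q y) * exp (- a * y) \<le> 0"
        using q'[of y] by (intro mult_nonpos_nonneg) auto
      ultimately show "\<exists>z. ((\<lambda>y. q y * exp (- a * y)) has_real_derivative z) (at y) \<and> z \<le> 0" by blast
    qed
    then have "q x * exp (- a * x) * exp (a * x) \<le> q x0 * exp (- a * x0) * exp (a * x)"
      by (rule mult_right_mono) simp
    then have "q x \<le> q x0 * exp (a * (x - x0))"
      by (simp add: mult.assoc flip: exp_add) (simp add: algebra_simps)
    also have "\<dots> \<le> q x0 * 1" using q0 a1 x by (intro mult_left_mono_neg) auto
    finally show ?thesis by simp
  qed
  define x where "x = x0 + (p x0 + 1) / (- q x0)"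
  have xx: "x0 < x" using q0 nn[of x0] by (simp add: x_def add_nonneg_pos divide_pos_neg zero_less_divide_iff)
  obtain z where z: "z > x0" "z < x" "p x - p x0 = (x - x0) * p1 z"
    using MVT2[OF xx d] by auto
  have "p1 z \<le> q x0" using qle[of z] z(1) nn[of z] K1 unfolding q_def[of z]
    by (smt (verit) mult_nonneg_nonneg)
  then have "p x - p x0 \<le> (x - x0) * q x0" unfolding z(3) using xx by (intro mult_left_mono) auto
  also have "\<dots> = - (p x0 + 1)" using q0 by (simp add: x_def field_simps)
  finally show False using nn[of x] by simp
qed

lemma nonneg_gradient_bound:
  fixes p p1 p2 :: "real \<Rightarrow> real"
  assumes nn: "\<And>x. 0 \<le> p x" and d: "\<And>x. (p has_real_derivative p1 x) (at x)"
    and d1: "\<And>x. (p1 has_real_derivative p2 x) (at x)"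
    and le: "\<And>x. p2 x \<le> \<kappa> * p1 x + B * p x" and B: "0 \<le> B"
  shows "\<bar>p1 x\<bar> \<le> (\<bar>\<kappa>\<bar> + B + 1) * p x"
proof -
  have "- (\<bar>- \<kappa>\<bar> + B + 1) * p (- (- x)) \<le> - p1 (- (- x))"
  proof (rule nonneg_gradient_lower_bound[where p="\<lambda>x. p (- x)" and ?p2.0="\<lambda>x. p2 (- x)" and ?p1.0="\<lambda>x. - p1 (- x)"])
    show "((\<lambda>x. p (- x)) has_real_derivative - p1 (- x)) (at x)" for x
    proof -
      have "((\<lambda>x. p (- x)) has_real_derivative p1 (- x) * (- 1)) (at x)"
        by (rule DERIV_chain2[OF d]) (auto intro!: derivative_eq_intros)
      then show ?thesis by simp
    qed
    show "((\<lambda>x. - p1 (- x)) has_real_derivative p2 (- x)) (at x)" for x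
    proof -
      have "((\<lambda>x. p1 (- x)) has_real_derivative p2 (- x) * (- 1)) (at x)"
        by (rule DERIV_chain2[OF d1]) (auto intro!: derivative_eq_intros)
      from DERIV_minus[OF this] show ?thesis by simp
    qed
  qed (use nn le B in auto)
  then show ?thesis using nonneg_gradient_lower_bound[OF assms, of x] by (auto simp: abs_le_iff algebra_simps)
qed

lemma MVT_shift:
  fixes g g' :: "real \<Rightarrow> real"
  assumes d: "\<And>x. (g has_real_derivative g' x) (at x)"
  shows "\<exists>\<theta>. \<bar>\<theta>\<bar> \<le> \<bar>h\<bar> \<and> g (x + h) - g x = h * g' (x + \<theta>)"
proof -
  consider "h > 0" | "h < 0" | "h = 0" by linarith
  then show ?thesis
  proof cases
    case 1
    then obtain z where "z > x" "z < x + h" "g (x + h) - g x = (x + h - x) * g' z"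
      using MVT2[of x "x + h" g g'] d by auto
    then show ?thesis by (intro exI[of _ "z - x"]) auto
  next
    case 2
    then obtain z where "z > x + h" "z < x" "g x - g (x + h) = (x - (x + h)) * g' z"
      using MVT2[of "x + h" x g g'] d by auto
    then show ?thesis by (intro exI[of _ "z - x"]) (auto simp: algebra_simps)
  next
    case 3
    then show ?thesis by (intro exI[of _ 0]) simp
  qed
qed

lemma shift_bound:
  fixes g g' \<phi> :: "real \<Rightarrow> real"
  assumes d: "\<And>x. (g has_real_derivative g' x) (at x)" and b: "\<And>x. \<bar>g' x\<bar> \<le> L * \<phi> x"
    and H: "\<And>x h. \<phi> (x + h) \<le> exp (K * \<bar>h\<bar>) * \<phi> x" and L: "0 \<le> L" and K: "0 \<le> K" and p: "\<And>x. 0 \<le> \<phi> x"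
  shows "\<bar>g (x + h) - g x\<bar> \<le> L * \<bar>h\<bar> * exp (K * \<bar>h\<bar>) * \<phi> x"
proof -
  obtain \<theta> where \<theta>: "\<bar>\<theta>\<bar> \<le> \<bar>h\<bar>" "g (x + h) - g x = h * g' (x + \<theta>)"
    using MVT_shift[OF d] by blast
  have "\<bar>g' (x + \<theta>)\<bar> \<le> L * (exp (K * \<bar>\<theta>\<bar>) * \<phi> x)"
    using b[of "x + \<theta>"] H[of x \<theta>] L by (meson mult_left_mono order_trans)
  also have "\<dots> \<le> L * (exp (K * \<bar>h\<bar>) * \<phi> x)"
    using mult_left_mono[OF \<theta>(1) K] L p by (intro mult_left_mono mult_right_mono) auto
  finally have "\<bar>h\<bar> * \<bar>g' (x + \<theta>)\<bar> \<le> \<bar>h\<bar> * (L * (exp (K * \<bar>h\<bar>) * \<phi> x))"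
    by (rule mult_left_mono) simp
  then show ?thesis unfolding \<theta>(2) by (simp add: abs_mult mult_ac)
qed

lemma taylor_shift_bound:
  fixes g g' g'' \<phi> :: "real \<Rightarrow> real"
  assumes d: "\<And>x. (g has_real_derivative g' x) (at x)" and d': "\<And>x. (g' has_real_derivative g'' x) (at x)"
    and b: "\<And>x. \<bar>g'' x\<bar> \<le> L * \<phi> x"
    and H: "\<And>x h. \<phi> (x + h) \<le> exp (K * \<bar>h\<bar>) * \<phi> x" and L: "0 \<le> L" and K: "0 \<le> K" and p: "\<And>x. 0 \<le> \<phi> x"
  shows "\<bar>g (x + h) - g x - h * g' x\<bar> \<le> L * h\<^sup>2 * exp (K * \<bar>h\<bar>) * \<phi> x"
proof -
  obtain \<theta> where \<theta>: "\<bar>\<theta>\<bar> \<le> \<bar>h\<bar>" "g (x + h) - g x = h * g' (x + \<theta>)"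
    using MVT_shift[OF d] by blast
  have "\<bar>g' (x + \<theta>) - g' x\<bar> \<le> L * \<bar>\<theta>\<bar> * exp (K * \<bar>\<theta>\<bar>) * \<phi> x"
    by (rule shift_bound[OF d' b H L K p])
  also have "\<dots> \<le> L * \<bar>h\<bar> * exp (K * \<bar>h\<bar>) * \<phi> x"
    using \<theta>(1) mult_left_mono[OF \<theta>(1) K] L p by (intro mult_right_mono mult_mono mult_left_mono) auto
  finally have "\<bar>h\<bar> * \<bar>g' (x + \<theta>) - g' x\<bar> \<le> \<bar>h\<bar> * (L * \<bar>h\<bar> * exp (K * \<bar>h\<bar>) * \<phi> x)"
    by (rule mult_left_mono) simp
  moreover have "g (x + h) - g x - h * g' x = h * (g' (x + \<theta>) - g' x)"
    by (simp only: right_diff_distrib \<theta>(2)[symmetric])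
  moreover have "\<bar>h\<bar> * (L * \<bar>h\<bar> * exp (K * \<bar>h\<bar>) * \<phi> x) = L * (\<bar>h\<bar> * \<bar>h\<bar>) * exp (K * \<bar>h\<bar>) * \<phi> x"
    by (simp only: mult_ac)
  moreover have "\<bar>h\<bar> * \<bar>h\<bar> = h\<^sup>2" by (simp add: power2_eq_square)
  ultimately show ?thesis by (simp add: abs_mult)
qed

lemma bistable_reaction_deriv:
  assumes "bistable_reaction f"
  shows "(f has_real_derivative deriv f x) (at x)" "continuous_on UNIV (deriv f)"
proof -
  have "Ck 3 f" using assms by (simp add: bistable_reaction_def)
  then have C: "Ck (Suc (Suc (Suc 0))) f" by (simp add: numeral_3_eq_3)
  show "(f has_real_derivative deriv f x) (at x)" by (rule Ck_SucD(1)[OF C])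
  show "continuous_on UNIV (deriv f)" by (rule Ck_continuous_on[OF Ck_SucD(2)[OF C]])
qed

lemma bistable_reaction_bounds:
  assumes "bistable_reaction f"
  shows "\<exists>\<eta>>0. (\<forall>u v. 0 \<le> v \<longrightarrow> v \<le> 1 \<longrightarrow> \<bar>f (u + v) - f v - deriv f v * u\<bar> \<le> \<eta> * (1 + \<bar>u\<bar>) * \<bar>u\<bar>\<^sup>2) \<and>
    (\<forall>v. 0 \<le> v \<longrightarrow> v \<le> 1 \<longrightarrow> \<bar>deriv f v\<bar> \<le> \<eta>)"
proof -
  obtain \<eta>2 where e2: "0 < \<eta>2" "\<And>v u. v \<in> {0..1} \<Longrightarrow> \<bar>f (u + v) - f v - deriv f v * u\<bar> \<le> \<eta>2 * (1 + \<bar>u\<bar>) * \<bar>u\<bar>\<^sup>2"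
    using assms unfolding bistable_reaction_def by metis
  obtain \<eta>3 where e3: "0 < \<eta>3" "\<And>v u. v \<in> {0..1} \<Longrightarrow> \<bar>deriv f (u + v)\<bar> \<le> \<eta>3 * (1 + \<bar>u\<bar>\<^sup>2)"
    using assms unfolding bistable_reaction_def by metis
  have "\<bar>f (u + v) - f v - deriv f v * u\<bar> \<le> max \<eta>2 \<eta>3 * (1 + \<bar>u\<bar>) * \<bar>u\<bar>\<^sup>2" if "0 \<le> v" "v \<le> 1" for u v
  proof -
    have "\<eta>2 * (1 + \<bar>u\<bar>) * \<bar>u\<bar>\<^sup>2 \<le> max \<eta>2 \<eta>3 * (1 + \<bar>u\<bar>) * \<bar>u\<bar>\<^sup>2" by (intro mult_right_mono) auto
    then show ?thesis using e2(2)[of v u] that by simp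
  qed
  moreover have "\<bar>deriv f v\<bar> \<le> max \<eta>2 \<eta>3" if "0 \<le> v" "v \<le> 1" for v
    using e3(2)[of v 0] that by simp
  moreover have "0 < max \<eta>2 \<eta>3" using e2(1) by simp
  ultimately show ?thesis by blast
qed

lemma weight_wgt: "Z > 0 \<Longrightarrow> weight (wgt \<nu> c Z t)"
  unfolding weight_def
proof (intro conjI allI)
  assume "Z > 0"
  have "continuous_on UNIV (wgt \<nu> c Z t)"
    unfolding wgt_def[abs_def] rho_def[abs_def] by (intro continuous_intros)
  then show "wgt \<nu> c Z t \<in> borel_measurable borel" by (rule borel_measurable_continuous_onI)
  show "0 < wgt \<nu> c Z t x" for x using \<open>Z > 0\<close> by (simp add: wgt_def rho_def add_pos_pos)
qed

lemma wave_properties: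
  assumes \<nu>: "\<nu> > 0" and b: "b > 0" and f: "bistable_reaction f" and tw: "travelling_wave \<nu> b f c vh"
    and Z: "Z > 0" and norm: "(LINT x|lborel. Psi \<nu> c Z vh x * deriv vh x) = 1"
  obtains \<phi>1 \<phi>2 K where
    "\<And>x. (vh has_real_derivative deriv vh x) (at x)" "\<And>x. (deriv vh has_real_derivative \<phi>1 x) (at x)"
    "\<And>x. (\<phi>1 has_real_derivative \<phi>2 x) (at x)" "continuous_on UNIV \<phi>2"
    "\<And>x. 0 \<le> vh x" "\<And>x. vh x \<le> 1" "\<And>x. 0 \<le> deriv vh x" "1 \<le> K"
    "\<And>x. \<bar>\<phi>1 x\<bar> \<le> K * deriv vh x" "\<And>x. \<bar>\<phi>2 x\<bar> \<le> K * deriv vh x"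
    "\<And>x h. deriv vh (x + h) \<le> exp (K * \<bar>h\<bar>) * deriv vh x" "deriv vh \<in> L2 (wgt \<nu> c Z 0)"
    "\<And>x. c * \<phi>1 x = \<nu> * \<phi>2 x + b * (deriv f (vh x) * deriv vh x)"
proof -
  obtain \<eta>3 where e3: "0 < \<eta>3" "\<And>v. 0 \<le> v \<Longrightarrow> v \<le> 1 \<Longrightarrow> \<bar>deriv f v\<bar> \<le> \<eta>3"
    using bistable_reaction_bounds[OF f] by blast
  note e = e3 bistable_reaction_deriv[OF f]
  have C2: "Ck (Suc (Suc 0)) vh" using tw by (simp add: travelling_wave_def numeral_2_eq_2)
  have mono: "mono vh" and ode: "\<And>x. c * deriv vh x = \<nu> * deriv (deriv vh) x + b * f (vh x)"
    and lim: "(vh \<longlongrightarrow> 0) at_bot" "(vh \<longlongrightarrow> 1) at_top" using tw by (auto simp: travelling_wave_def)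
  define p p1 where "p = deriv vh" and "p1 = deriv p"
  have d: "(vh has_real_derivative p x) (at x)" for x unfolding p_def by (rule Ck_SucD(1)[OF C2])
  have dp: "(p has_real_derivative p1 x) (at x)" for x
    unfolding p1_def p_def by (rule Ck_SucD(1)[OF Ck_SucD(2)[OF C2]])
  have p1: "p1 x = (c * p x - b * f (vh x)) / \<nu>" for x
    using ode[of x] \<nu> by (simp add: p1_def p_def field_simps)
  define p2 where "p2 x = (c * p1 x - b * (deriv f (vh x) * p x)) / \<nu>" for x
  have dp1: "(p1 has_real_derivative p2 x) (at x)" for x
  proof -
    have "((\<lambda>x. inverse \<nu> * (c * p x - b * f (vh x))) has_real_derivative
        inverse \<nu> * (c * p1 x - b * (deriv f (vh x) * p x))) (at x)"
      by (intro DERIV_cmult DERIV_diff dp DERIV_chain2[OF e(3) d])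
    moreover have "(\<lambda>x. inverse \<nu> * (c * p x - b * f (vh x))) = p1"
      by (simp add: p1 fun_eq_iff divide_inverse)
    ultimately show ?thesis by (simp add: p2_def divide_inverse mult.commute)
  qed
  have cvh: "continuous_on UNIV vh" "continuous_on UNIV p" "continuous_on UNIV p1"
    using d dp dp1 by (auto intro: DERIV_continuous_on has_field_derivative_at_within)
  have "continuous_on UNIV (\<lambda>x. deriv f (vh x))"
    by (rule continuous_on_compose2[OF e(4) cvh(1)]) simp
  then have c2: "continuous_on UNIV p2"
    unfolding p2_def[abs_def] by (intro continuous_intros cvh) (use \<nu> in auto)
  have v0: "0 \<le> vh x" for x
  proof (rule tendsto_upperbound[OF lim(1)])
    show "\<forall>\<^sub>F y in at_bot. vh y \<le> vh x"
      using eventually_le_at_bot[of x] by eventually_elim (use mono in \<open>auto simp: mono_def\<close>)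
  qed simp
  have v1: "vh x \<le> 1" for x
  proof (rule tendsto_lowerbound[OF lim(2)])
    show "\<forall>\<^sub>F y in at_top. vh x \<le> vh y"
      using eventually_ge_at_top[of x] by eventually_elim (use mono in \<open>auto simp: mono_def\<close>)
  qed simp
  have p0: "0 \<le> p x" for x
    by (rule mono_on_imp_deriv_nonneg[OF mono d[of x]]) simp
  define B where "B = b * \<eta>3 / \<nu>"
  have B: "0 \<le> B" using b e(1) \<nu> by (simp add: B_def)
  have fb: "\<bar>b * (deriv f (vh x) * p x) / \<nu>\<bar> \<le> B * p x" for x
  proof -
    have "\<bar>deriv f (vh x)\<bar> * p x \<le> \<eta>3 * p x" by (rule mult_right_mono[OF e(2)[OF v0 v1] p0])
    then have "b * (\<bar>deriv f (vh x)\<bar> * p x) / \<nu> \<le> b * (\<eta>3 * p x) / \<nu>"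
      using b \<nu> by (intro divide_right_mono mult_left_mono) auto
    then show ?thesis using b \<nu> p0[of x] by (simp add: abs_mult B_def)
  qed
  define K0 where "K0 = \<bar>c / \<nu>\<bar> + B + 1"
  have K0: "K0 \<ge> 1" using B by (simp add: K0_def)
  have b1: "\<bar>p1 x\<bar> \<le> K0 * p x" for x
    unfolding K0_def
  proof (rule nonneg_gradient_bound[OF p0 dp dp1 _ B])
    show "p2 x \<le> c / \<nu> * p1 x + B * p x" for x
      using fb[of x] unfolding p2_def diff_divide_distrib abs_le_iff by simp
  qed
  define K where "K = K0 * K0 + K0"
  have "\<bar>c / \<nu>\<bar> \<le> K0" "B \<le> K0" unfolding K0_def using B abs_ge_zero[of "c / \<nu>"] by linarith+
  then have KK: "K0 \<le> K" "\<bar>c / \<nu>\<bar> * K0 + B \<le> K"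
    using K0 mult_right_mono[of "\<bar>c / \<nu>\<bar>" K0 K0] unfolding K_def by auto
  have b1': "\<bar>p1 x\<bar> \<le> K * p x" for x
    using b1[of x] mult_right_mono[OF KK(1) p0[of x]] by simp
  have b2: "\<bar>p2 x\<bar> \<le> K * p x" for x
  proof -
    have "\<bar>p2 x\<bar> \<le> \<bar>c / \<nu> * p1 x\<bar> + \<bar>b * (deriv f (vh x) * p x) / \<nu>\<bar>"
      using abs_triangle_ineq4[of "c / \<nu> * p1 x" "b * (deriv f (vh x) * p x) / \<nu>"]
      unfolding p2_def diff_divide_distrib times_divide_eq_left .
    also have "\<dots> \<le> \<bar>c / \<nu>\<bar> * (K0 * p x) + B * p x"
      unfolding abs_mult[of "c / \<nu>"] by (intro add_mono mult_left_mono b1 fb) simp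
    also have "\<dots> = (\<bar>c / \<nu>\<bar> * K0 + B) * p x" by (simp add: algebra_simps)
    also have "\<dots> \<le> K * p x" by (rule mult_right_mono[OF KK(2) p0])
    finally show ?thesis .
  qed
  have H: "p (x + h) \<le> exp (K * \<bar>h\<bar>) * p x" for x h by (rule harnack[OF dp b1'])
  have pb: "p x \<le> exp K" for x
  proof -
    obtain z where z: "z > x" "z < x + 1" "vh (x + 1) - vh x = (x + 1 - x) * p z"
      using MVT2[of x "x + 1" vh p] d by auto
    have "p z \<le> 1" using z(3) v0[of x] v1[of "x + 1"] by simp
    have "p x \<le> exp (K * \<bar>x - z\<bar>) * p z" using H[of z "x - z"] by simp
    also have "\<dots> \<le> exp K * 1"
      using z K0 KK(1) \<open>p z \<le> 1\<close> p0[of z] mult_left_mono[of "\<bar>x - z\<bar>" 1 K] by (intro mult_mono) auto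
    finally show ?thesis by simp
  qed
  have "set_integrable lborel (einterval (-\<infinity>) \<infinity>) p"
  proof (rule interval_integral_FTC_nonneg(1)[where F=vh and A=0 and B=1])
    show "((vh \<circ> real_of_ereal) \<longlongrightarrow> 0) (at_right (- \<infinity>))" "((vh \<circ> real_of_ereal) \<longlongrightarrow> 1) (at_left \<infinity>)"
      using lim by (simp_all add: ereal_tendsto_simps)
  qed (use d p0 cvh(2) in \<open>auto simp: continuous_on_eq_continuous_at\<close>)
  then have pi: "integrable lborel p" by (simp add: set_integrable_def)
  have pm[measurable]: "p \<in> borel_measurable borel" by (rule borel_measurable_continuous_onI[OF cvh(2)])
  have i1: "integrable lborel (\<lambda>x. (p x)\<^sup>2)"
  proof (rule Bochner_Integration.integrable_bound)
    show "integrable lborel (\<lambda>x. exp K * p x)" using pi by simp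
    show "AE x in lborel. norm ((p x)\<^sup>2) \<le> norm (exp K * p x)"
      using pb p0 by (auto simp: power2_eq_square intro!: mult_right_mono)
  qed measurable
  have i2: "integrable lborel (\<lambda>x. (p x)\<^sup>2 * rho \<nu> c Z x)"
  proof -
    have "integrable lborel (\<lambda>x. Psi \<nu> c Z vh x * deriv vh x)"
      by (rule ccontr) (use norm in \<open>simp add: not_integrable_integral_eq\<close>)
    moreover have "(\<lambda>x. Psi \<nu> c Z vh x * deriv vh x) = (\<lambda>x. (p x)\<^sup>2 * rho \<nu> c Z x)"
      by (auto simp: Psi_def p_def power2_eq_square mult_ac)
    ultimately show ?thesis by simp
  qed
  have "p \<in> L2 (wgt \<nu> c Z 0)"
    using Bochner_Integration.integrable_add[OF i1 i2] by (simp add: L2_def wgt_def algebra_simps)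
  moreover have "1 \<le> K" using K0 KK(1) by simp
  moreover have "c * p1 x = \<nu> * p2 x + b * (deriv f (vh x) * p x)" for x
    using \<nu> by (simp add: p2_def)
  ultimately show ?thesis
    using that[of p1 p2 K, folded p_def] d dp dp1 c2 v0 v1 p0 b1' b2 H by presburger
qed

section \<open>A weighted parabolic energy estimate\<close>

lemma discrete_gronwall:
  fixes E :: "real \<Rightarrow> real"
  assumes K: "0 \<le> K" and F: "0 \<le> F" and E0: "E 0 \<le> 0"
    and step: "\<And>\<delta>. \<delta> > 0 \<Longrightarrow> \<exists>d>0. \<forall>s t. 0 \<le> s \<longrightarrow> s \<le> t \<longrightarrow> t \<le> T \<longrightarrow> t - s < d \<longrightarrow>
      E t \<le> E s + (t - s) * (K * E s + F + \<delta>)"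
    and t: "0 \<le> t" "t \<le> T"
  shows "E t \<le> exp (K * t) * t * F"
proof -
  have *: "E t \<le> exp (K * t) * t * (F + \<delta>)" if \<delta>: "\<delta> > 0" for \<delta>
  proof -
    obtain d where d: "d > 0" "\<And>s t. 0 \<le> s \<Longrightarrow> s \<le> t \<Longrightarrow> t \<le> T \<Longrightarrow> t - s < d \<Longrightarrow>
      E t \<le> E s + (t - s) * (K * E s + F + \<delta>)" using step[OF \<delta>] by blast
    obtain n where n: "t / d < real n" using reals_Archimedean2 by blast
    then have n0: "n > 0" using t(1) d(1) by (cases n) (auto simp: divide_less_0_iff)
    define \<Delta> where "\<Delta> = t / real n"
    have \<Delta>: "0 \<le> \<Delta>" "\<Delta> < d" "real n * \<Delta> = t"
      using t(1) d(1) n n0 by (auto simp: \<Delta>_def field_simps)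
    have "j \<le> n \<Longrightarrow> E (real j * \<Delta>) \<le> exp (K * (real j * \<Delta>)) * (real j * \<Delta>) * (F + \<delta>)" for j
    proof (induction j)
      case 0
      then show ?case using E0 by simp
    next
      case (Suc j)
      define s where "s = real j * \<Delta>"
      have s1: "real (Suc j) * \<Delta> = s + \<Delta>" by (simp add: s_def algebra_simps)
      have s0: "0 \<le> s" using \<Delta>(1) by (simp add: s_def)
      have "s + \<Delta> \<le> real n * \<Delta>" unfolding s1[symmetric] using Suc.prems \<Delta>(1) by (intro mult_right_mono) auto
      then have sT: "s + \<Delta> \<le> T" using \<Delta>(3) t(2) by simp
      have "E (s + \<Delta>) \<le> E s + (s + \<Delta> - s) * (K * E s + F + \<delta>)"
        by (rule d(2)) (use s0 \<Delta> sT in auto)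
      also have "\<dots> = (1 + K * \<Delta>) * E s + \<Delta> * (F + \<delta>)" by (simp add: algebra_simps)
      also have "\<dots> \<le> (1 + K * \<Delta>) * (exp (K * s) * s * (F + \<delta>)) + \<Delta> * (F + \<delta>)"
        using Suc \<Delta>(1) K by (intro add_mono mult_left_mono) (auto simp: s_def)
      also have "\<dots> \<le> exp (K * \<Delta>) * (exp (K * s) * s * (F + \<delta>)) + exp (K * (s + \<Delta>)) * (\<Delta> * (F + \<delta>))"
      proof (rule add_mono)
        show "(1 + K * \<Delta>) * (exp (K * s) * s * (F + \<delta>)) \<le> exp (K * \<Delta>) * (exp (K * s) * s * (F + \<delta>))"
          using s0 F \<delta> by (intro mult_right_mono exp_ge_add_one_self) auto
        have "1 * (\<Delta> * (F + \<delta>)) \<le> exp (K * (s + \<Delta>)) * (\<Delta> * (F + \<delta>))"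
          using s0 F \<delta> \<Delta>(1) K by (intro mult_right_mono) auto
        then show "\<Delta> * (F + \<delta>) \<le> exp (K * (s + \<Delta>)) * (\<Delta> * (F + \<delta>))" by simp
      qed
      also have "\<dots> = exp (K * (s + \<Delta>)) * (s + \<Delta>) * (F + \<delta>)"
        by (simp add: exp_add algebra_simps)
      finally show ?case unfolding s1 .
    qed
    from this[of n] show ?thesis unfolding \<Delta>(3) by simp
  qed
  show ?thesis
  proof (cases "t = 0")
    case True
    then show ?thesis using E0 by simp
  next
    case False
    then have c: "0 < exp (K * t) * t" using t(1) by simp
    show ?thesis
    proof (rule field_le_epsilon)
      fix e :: real assume "0 < e"
      then have "E t \<le> exp (K * t) * t * (F + e / (exp (K * t) * t))" using c by (intro *) (rule divide_pos_pos)
      also have "\<dots> = exp (K * t) * t * F + e" using False by (simp add: distrib_left)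
      finally show "E t \<le> exp (K * t) * t * F + e" .
    qed
  qed
qed

locale regular_weight =
  fixes m m' :: "real \<Rightarrow> real" and k B :: real
  assumes m_deriv: "\<And>x. (m has_real_derivative m' x) (at x)" and m'_cont: "continuous_on UNIV m'"
    and m_ge1: "\<And>x. 1 \<le> m x" and m_le: "\<And>x. m x \<le> B" and k_nonneg: "0 \<le> k"
    and m'_le: "\<And>x. \<bar>m' x\<bar> \<le> k * m x"
begin

lemma m_pos: "0 < m x" using m_ge1[of x] by linarith

lemma B_ge1: "1 \<le> B" using m_ge1[of 0] m_le[of 0] by linarith

lemma m_cont: "continuous_on UNIV m"
  using m_deriv DERIV_isCont continuous_at_imp_continuous_on by blast

lemma m_meas [measurable]: "m \<in> borel_measurable borel" "m' \<in> borel_measurable borel"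
  using m_cont m'_cont by (auto intro: borel_measurable_continuous_onI)

lemma weight_m: "weight m" by (simp add: weight_def m_pos)

lemma weight_inv: "weight (\<lambda>x. 1 / m x)" by (simp add: weight_def m_pos)

lemma L2_m_imp_L2: "u \<in> L2 m \<Longrightarrow> u \<in> L2 (\<lambda>_. 1)"
  using L2_weight_mono(1)[OF weight_one weight_m] m_ge1 by blast

lemma m_shift: "m (x + h) \<le> exp (k * \<bar>h\<bar>) * m x"
  by (rule harnack[OF m_deriv m'_le])

lemma L2_mult_m:
  assumes "Y \<in> L2 m"
  shows "(\<lambda>x. Y x * m x) \<in> L2 (\<lambda>_. 1)" "(\<lambda>x. Y x * m' x) \<in> L2 (\<lambda>_. 1)"
    "(\<lambda>x. Y x * m x) \<in> L2 (\<lambda>x. 1 / m x)" "norm_L2 (\<lambda>x. 1 / m x) (\<lambda>x. Y x * m x) \<le> norm_L2 m Y"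
    "(\<lambda>x. Y x * m' x) \<in> L2 (\<lambda>x. 1 / m x)" "norm_L2 (\<lambda>x. 1 / m x) (\<lambda>x. Y x * m' x) \<le> k * norm_L2 m Y"
    "(\<lambda>x. Y x * m' x / m x) \<in> L2 m" "norm_L2 m (\<lambda>x. Y x * m' x / m x) \<le> k * norm_L2 m Y"
proof -
  have [measurable]: "Y \<in> borel_measurable borel" using assms by (auto simp: L2_def)
  have mB: "(m x)\<^sup>2 \<le> B\<^sup>2 * m x" for x
  proof -
    have "m x * m x \<le> B * m x" using m_le[of x] m_pos[of x] by simp
    also have "\<dots> \<le> (B * B) * m x" using B_ge1 m_pos[of x] mult_right_mono[of 1 B B] by simp
    finally show ?thesis by (simp add: power2_eq_square)
  qed
  have m'2: "(m' x)\<^sup>2 \<le> k\<^sup>2 * (m x)\<^sup>2" for x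
    using power_mono[OF m'_le[of x], of 2] by (simp add: power_mult_distrib)
  have m'm: "(m' x)\<^sup>2 * (1 / m x) \<le> k\<^sup>2 * m x" for x
    using m'2[of x] m_pos[of x] by (simp add: field_simps power2_eq_square)
  have a1: "AE x in lborel. (Y x * m x)\<^sup>2 * 1 \<le> B\<^sup>2 * ((Y x)\<^sup>2 * m x)"
    using mult_left_mono[OF mB, of "(Y x)\<^sup>2" for x] by (auto simp: power_mult_distrib mult_ac)
  show "(\<lambda>x. Y x * m x) \<in> L2 (\<lambda>_. 1)"
    by (rule L2_dominated(1)[OF weight_one weight_m _ assms _ a1]) (use B_ge1 in auto)
  have m'B: "(m' x)\<^sup>2 \<le> (k * B)\<^sup>2 * m x" for x
    using m'2[of x] mult_left_mono[OF mB[of x], of "k\<^sup>2"] by (simp add: power_mult_distrib)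
  have a2: "AE x in lborel. (Y x * m' x)\<^sup>2 * 1 \<le> (k * B)\<^sup>2 * ((Y x)\<^sup>2 * m x)"
    using mult_left_mono[OF m'B, of "(Y x)\<^sup>2" for x] by (auto simp: power_mult_distrib mult_ac)
  show "(\<lambda>x. Y x * m' x) \<in> L2 (\<lambda>_. 1)"
    by (rule L2_dominated(1)[OF weight_one weight_m _ assms _ a2]) (use B_ge1 k_nonneg in auto)
  have a3: "AE x in lborel. (Y x * m x)\<^sup>2 * (1 / m x) \<le> 1\<^sup>2 * ((Y x)\<^sup>2 * m x)"
    using m_pos by (auto simp: power_mult_distrib power2_eq_square less_imp_neq[symmetric])
  show "(\<lambda>x. Y x * m x) \<in> L2 (\<lambda>x. 1 / m x)" "norm_L2 (\<lambda>x. 1 / m x) (\<lambda>x. Y x * m x) \<le> norm_L2 m Y"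
    using L2_dominated[OF weight_inv weight_m _ assms _ a3] by auto
  have a4: "AE x in lborel. (Y x * m' x)\<^sup>2 * (1 / m x) \<le> k\<^sup>2 * ((Y x)\<^sup>2 * m x)"
    using mult_left_mono[OF m'm, of "(Y x)\<^sup>2" for x] by (auto simp: power_mult_distrib mult_ac)
  show "(\<lambda>x. Y x * m' x) \<in> L2 (\<lambda>x. 1 / m x)" "norm_L2 (\<lambda>x. 1 / m x) (\<lambda>x. Y x * m' x) \<le> k * norm_L2 m Y"
    using L2_dominated[OF weight_inv weight_m _ assms k_nonneg a4] by auto
  have "\<bar>Y x * m' x / m x\<bar> \<le> k * \<bar>Y x\<bar>" for x
  proof -
    have "\<bar>Y x\<bar> * \<bar>m' x\<bar> \<le> \<bar>Y x\<bar> * (k * m x)" by (rule mult_left_mono[OF m'_le]) simp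
    then show ?thesis using m_pos[of x] by (simp add: abs_mult pos_divide_le_eq mult_ac)
  qed
  then have a5: "AE x in lborel. \<bar>Y x * m' x / m x\<bar> \<le> k * \<bar>Y x\<bar>" by simp
  show "(\<lambda>x. Y x * m' x / m x) \<in> L2 m" "norm_L2 m (\<lambda>x. Y x * m' x / m x) \<le> k * norm_L2 m Y"
    using L2_dominated_same[OF weight_m _ assms k_nonneg a5] by auto
qed

lemma inner_one_mult_m: "inner_L2 (\<lambda>_. 1) g (\<lambda>x. Y x * m x) = inner_L2 m g Y"
  unfolding inner_L2_def by (rule Bochner_Integration.integral_cong) auto

end

definition energy_const1 :: "real \<Rightarrow> real \<Rightarrow> real \<Rightarrow> real" where
  "energy_const1 \<nu> k a = (\<nu> * k + a)\<^sup>2 / \<nu> + 2 * a + 1"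

definition energy_const2 :: "real \<Rightarrow> real" where
  "energy_const2 \<nu> = 1 / \<nu> + 1"

lemma energy_quadratic_bound:
  fixes \<nu> k a G p e :: real
  assumes "\<nu> > 0"
  shows "- (2 * \<nu> * p\<^sup>2) + 2 * \<nu> * k * p * e + 2 * (a * e + G) * (e + p)
    \<le> energy_const1 \<nu> k a * e\<^sup>2 + energy_const2 \<nu> * G\<^sup>2"
proof -
  define X where "X = (\<nu> * k + a) * e"
  have "(X + G)\<^sup>2 \<le> 2 * X\<^sup>2 + 2 * G\<^sup>2"
    using zero_le_power2[of "X - G"] by (simp add: power2_eq_square algebra_simps)
  then have "(X + G)\<^sup>2 / (2 * \<nu>) \<le> (2 * X\<^sup>2 + 2 * G\<^sup>2) / (2 * \<nu>)"
    using assms by (intro divide_right_mono) auto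
  also have "\<dots> = (\<nu> * k + a)\<^sup>2 / \<nu> * e\<^sup>2 + 1 / \<nu> * G\<^sup>2"
    using assms by (simp add: X_def power_mult_distrib add_divide_distrib)
  finally have 1: "(X + G)\<^sup>2 / (2 * \<nu>) \<le> (\<nu> * k + a)\<^sup>2 / \<nu> * e\<^sup>2 + 1 / \<nu> * G\<^sup>2" .
  have "0 \<le> (2 * \<nu> * p - (X + G))\<^sup>2 / (2 * \<nu>)" using assms by simp
  also have "\<dots> = 2 * \<nu> * p\<^sup>2 - 2 * p * (X + G) + (X + G)\<^sup>2 / (2 * \<nu>)"
    using assms by (simp add: power2_eq_square field_simps)
  finally have 2: "- (2 * \<nu> * p\<^sup>2) + 2 * p * (X + G) \<le> (X + G)\<^sup>2 / (2 * \<nu>)" by simp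
  have 3: "2 * G * e \<le> G\<^sup>2 + e\<^sup>2" by (rule sum_squares_bound)
  have "- (2 * \<nu> * p\<^sup>2) + 2 * \<nu> * k * p * e + 2 * (a * e + G) * (e + p)
    = (- (2 * \<nu> * p\<^sup>2) + 2 * p * (X + G)) + 2 * a * e\<^sup>2 + 2 * G * e"
    by (simp add: X_def power2_eq_square algebra_simps)
  also have "\<dots> \<le> ((\<nu> * k + a)\<^sup>2 / \<nu> * e\<^sup>2 + 1 / \<nu> * G\<^sup>2) + 2 * a * e\<^sup>2 + (G\<^sup>2 + e\<^sup>2)"
    using 1 2 3 by linarith
  finally show ?thesis by (simp add: energy_const1_def energy_const2_def algebra_simps)
qed

lemma (in regular_weight) energy_estimate:
  fixes y y' :: "real \<Rightarrow> real \<Rightarrow> real" and l :: "real \<Rightarrow> (real \<Rightarrow> real) \<Rightarrow> real"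
  assumes \<nu>: "\<nu> > 0" and a: "0 \<le> a" and G: "0 \<le> G"
    and y: "C_L2 T m y" and y': "C_L2 T m y'"
    and w: "\<And>t. t \<in> {0..T} \<Longrightarrow> weak_deriv (y t) (y' t)"
    and y0: "norm_L2 m (y 0) = 0"
    and l: "\<And>r Y Y'. r \<in> {0..T} \<Longrightarrow> weak_deriv Y Y' \<Longrightarrow> Y \<in> L2 m \<Longrightarrow> Y' \<in> L2 m \<Longrightarrow>
      l r (\<lambda>x. Y x * m x) \<le> (a * norm_L2 m (y r) + G) * (norm_L2 m Y + norm_L2 m Y')"
    and eq: "\<And>s t \<psi> \<psi>'. 0 \<le> s \<Longrightarrow> s \<le> t \<Longrightarrow> t \<le> T \<Longrightarrow> weak_deriv \<psi> \<psi>' \<Longrightarrow>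
      \<psi> \<in> L2 (\<lambda>_. 1) \<Longrightarrow> \<psi>' \<in> L2 (\<lambda>_. 1) \<Longrightarrow>
      set_integrable lborel {s..t} (\<lambda>r. - \<nu> * inner_L2 (\<lambda>_. 1) (y' r) \<psi>' + l r \<psi>) \<and>
      inner_L2 (\<lambda>_. 1) (\<lambda>x. y t x - y s x) \<psi> =
        (LINT r:{s..t}|lborel. - \<nu> * inner_L2 (\<lambda>_. 1) (y' r) \<psi>' + l r \<psi>)"
    and t: "t \<in> {0..T}"
  shows "(norm_L2 m (y t))\<^sup>2 \<le> exp (energy_const1 \<nu> k a * t) * t * (energy_const2 \<nu> * G\<^sup>2)"
proof (rule discrete_gronwall[where T=T and E="\<lambda>t. (norm_L2 m (y t))\<^sup>2"])
  show "0 \<le> energy_const1 \<nu> k a" "0 \<le> energy_const2 \<nu> * G\<^sup>2"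
    using \<nu> a by (auto simp: energy_const1_def energy_const2_def)
  show "(norm_L2 m (y 0))\<^sup>2 \<le> 0" by (simp add: y0)
  show "0 \<le> t" "t \<le> T" using t by auto
  obtain P1 where P1: "0 \<le> P1" "\<And>t. t \<in> {0..T} \<Longrightarrow> norm_L2 m (y t) \<le> P1"
    by (rule C_L2_bounded[OF weight_m y]) blast
  obtain P2 where P2: "0 \<le> P2" "\<And>t. t \<in> {0..T} \<Longrightarrow> norm_L2 m (y' t) \<le> P2"
    by (rule C_L2_bounded[OF weight_m y']) blast
  define P where "P = P1 + P2"
  have P: "0 \<le> P" "\<And>t. t \<in> {0..T} \<Longrightarrow> norm_L2 m (y t) \<le> P" "\<And>t. t \<in> {0..T} \<Longrightarrow> norm_L2 m (y' t) \<le> P"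
    using P1 P2 by (force simp: P_def)+
  define C where "C = \<nu> * (3 * P + 1) + \<nu> * k * (3 * P + 1) + (2 * a * P + 2 * G + a * (4 * P + 2)) + 1"
  have C: "C > 0" using \<nu> k_nonneg P(1) a G by (auto simp: C_def intro!: add_nonneg_pos add_nonneg_nonneg mult_nonneg_nonneg)
  fix \<delta>0 :: real assume \<delta>0: "\<delta>0 > 0"
  define \<delta> where "\<delta> = min 1 (\<delta>0 / C)"
  have \<delta>: "0 < \<delta>" "\<delta> \<le> 1" "\<delta> * C \<le> \<delta>0"
    using \<delta>0 C by (auto simp: \<delta>_def min_def field_simps)
  obtain d1 where d1: "d1 > 0" "\<And>s t. s \<in> {0..T} \<Longrightarrow> t \<in> {0..T} \<Longrightarrow> \<bar>s - t\<bar> < d1 \<Longrightarrow> norm_L2 m (\<lambda>x. y s x - y t x) < \<delta>"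
    by (rule C_L2_uniform[OF weight_m y \<delta>(1)]) blast
  obtain d2 where d2: "d2 > 0" "\<And>s t. s \<in> {0..T} \<Longrightarrow> t \<in> {0..T} \<Longrightarrow> \<bar>s - t\<bar> < d2 \<Longrightarrow> norm_L2 m (\<lambda>x. y' s x - y' t x) < \<delta>"
    by (rule C_L2_uniform[OF weight_m y' \<delta>(1)]) blast
  show "\<exists>d>0. \<forall>s t. 0 \<le> s \<longrightarrow> s \<le> t \<longrightarrow> t \<le> T \<longrightarrow> t - s < d \<longrightarrow> (norm_L2 m (y t))\<^sup>2 \<le>
     (norm_L2 m (y s))\<^sup>2 + (t - s) * (energy_const1 \<nu> k a * (norm_L2 m (y s))\<^sup>2 + energy_const2 \<nu> * G\<^sup>2 + \<delta>0)"
  proof (intro exI[of _ "min d1 d2"] conjI allI impI)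
    show "0 < min d1 d2" using d1 d2 by simp
    fix s t assume st: "0 \<le> s" "s \<le> t" "t \<le> T" "t - s < min d1 d2"
    have sT: "s \<in> {0..T}" and tT: "t \<in> {0..T}" using st by auto
    note ys = C_L2_D(1)[OF y sT] C_L2_D(1)[OF y' sT] note yt = C_L2_D(1)[OF y tT] C_L2_D(1)[OF y' tT]
    define e p where "e = norm_L2 m (y s)" and "p = norm_L2 m (y' s)"
    have ep: "0 \<le> e" "e \<le> P" "0 \<le> p" "p \<le> P" using P(2,3)[OF sT] weight_m by (auto simp: e_def p_def)
    define Y Y' where "Y x = y t x + y s x" and "Y' x = y' t x + y' s x" for x
    have YL: "Y \<in> L2 m" "Y' \<in> L2 m"
      unfolding Y_def[abs_def] Y'_def[abs_def] by (intro L2_add weight_m ys yt)+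
    have wY: "weak_deriv Y Y'"
      using weak_deriv_lincomb[OF w[OF tT] w[OF sT], of 1 1] by (simp add: Y_def[abs_def] Y'_def[abs_def])
    define \<psi> \<psi>' where "\<psi> x = Y x * m x" and "\<psi>' x = Y' x * m x + Y x * m' x" for x
    have w\<psi>: "weak_deriv \<psi> \<psi>'"
      unfolding \<psi>_def[abs_def] \<psi>'_def[abs_def] by (rule weak_deriv_mult_C1[OF wY m_deriv m'_cont])
    have \<psi>L: "\<psi> \<in> L2 (\<lambda>_. 1)" "\<psi>' \<in> L2 (\<lambda>_. 1)"
      unfolding \<psi>_def[abs_def] \<psi>'_def[abs_def] by (intro L2_add L2_mult_m weight_one YL)+
    have dt: "norm_L2 m (\<lambda>x. y r x - y s x) \<le> \<delta>" "norm_L2 m (\<lambda>x. y' r x - y' s x) \<le> \<delta>" if "r \<in> {s..t}" for r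
      using d1(2)[of r s] d2(2)[of r s] that st by auto
    have nY: "norm_L2 m Y \<le> 2 * e + \<delta>" "norm_L2 m Y' \<le> 2 * p + \<delta>"
    proof -
      have "Y = (\<lambda>x. (y t x - y s x) + 2 * y s x)" "Y' = (\<lambda>x. (y' t x - y' s x) + 2 * y' s x)"
        by (auto simp: Y_def Y'_def)
      then show "norm_L2 m Y \<le> 2 * e + \<delta>" "norm_L2 m Y' \<le> 2 * p + \<delta>"
        using norm_L2_add[OF weight_m L2_diff[OF weight_m yt(1) ys(1)] L2_cmult[OF weight_m ys(1), of 2]]
          norm_L2_add[OF weight_m L2_diff[OF weight_m yt(2) ys(2)] L2_cmult[OF weight_m ys(2), of 2]]
          dt[of t] st by (auto simp: norm_L2_cmult[OF weight_m] e_def p_def)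
    qed
    have bound: "- \<nu> * inner_L2 (\<lambda>_. 1) (y' r) \<psi>' + l r \<psi> \<le> energy_const1 \<nu> k a * e\<^sup>2 + energy_const2 \<nu> * G\<^sup>2 + \<delta>0"
      if r: "r \<in> {s..t}" for r
    proof -
      have rT: "r \<in> {0..T}" using r st by auto
      note yr = C_L2_D(1)[OF y rT] C_L2_D(1)[OF y' rT]
      define V where "V x = Y x * m' x / m x" for x
      have V: "V \<in> L2 m" "norm_L2 m V \<le> k * norm_L2 m Y"
        unfolding V_def[abs_def] using L2_mult_m(7,8)[OF YL(1)] by auto
      have "norm_L2 m (y' r) \<le> norm_L2 m (\<lambda>x. y' r x - y' s x) + norm_L2 m (y' s)"
        "norm_L2 m (y r) \<le> norm_L2 m (\<lambda>x. y r x - y s x) + norm_L2 m (y s)"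
        using norm_L2_add[OF weight_m L2_diff[OF weight_m yr(2) ys(2)] ys(2)]
          norm_L2_add[OF weight_m L2_diff[OF weight_m yr(1) ys(1)] ys(1)] by auto
      then have nr: "norm_L2 m (y' r) \<le> p + \<delta>" "norm_L2 m (y r) \<le> e + \<delta>"
        using dt[OF r] by (auto simp: e_def p_def)
      have i1: "inner_L2 (\<lambda>_. 1) (y' r) \<psi>' = inner_L2 m (y' r) Y' + inner_L2 m (y' r) V"
      proof -
        have "inner_L2 (\<lambda>_. 1) (y' r) \<psi>' = inner_L2 m (y' r) (\<lambda>x. 1 * Y' x + 1 * V x)"
          unfolding inner_L2_def
          by (rule Bochner_Integration.integral_cong)
            (auto simp: \<psi>'_def V_def field_simps m_pos less_imp_neq[OF m_pos, symmetric])
        also have "\<dots> = 1 * inner_L2 m (y' r) Y' + 1 * inner_L2 m (y' r) V"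
          unfolding inner_L2_commute[of m "y' r"]
          by (rule inner_L2_lincomb[OF weight_m YL(2) V(1) yr(2)])
        finally show ?thesis by simp
      qed
      have "\<bar>inner_L2 m (y' r) V\<bar> \<le> norm_L2 m (y' r) * norm_L2 m V"
        by (rule L2_Cauchy_Schwarz[OF weight_m yr(2) V(1)])
      also have "\<dots> \<le> (p + \<delta>) * (k * (2 * e + \<delta>))"
      proof (rule mult_mono[OF nr(1)])
        show "norm_L2 m V \<le> k * (2 * e + \<delta>)"
          using V(2) mult_left_mono[OF nY(1) k_nonneg] by linarith
      qed (use ep \<delta> weight_m in auto)
      finally have i2: "\<bar>inner_L2 m (y' r) V\<bar> \<le> (p + \<delta>) * (k * (2 * e + \<delta>))" .
      define D where "D x = y' r x - y' s x" for x
      define D' where "D' x = y' t x - y' s x" for x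
      have DL: "D \<in> L2 m" "D' \<in> L2 m" unfolding D_def[abs_def] D'_def[abs_def] by (intro L2_diff weight_m yr ys yt)+
      have nD: "norm_L2 m D \<le> \<delta>" "norm_L2 m D' \<le> \<delta>"
        unfolding D_def[abs_def] D'_def[abs_def] using dt(2)[OF r] dt(2)[of t] st by auto
      have "inner_L2 m (y' r) Y' = inner_L2 m (\<lambda>x. 1 * D x + 1 * y' s x) Y'" by (simp add: D_def)
      also have "\<dots> = inner_L2 m D Y' + inner_L2 m (y' s) Y'"
        using inner_L2_lincomb[OF weight_m DL(1) ys(2) YL(2), of 1 1] by simp
      also have "inner_L2 m (y' s) Y' = inner_L2 m (\<lambda>x. 2 * y' s x + 1 * D' x) (y' s)"
        unfolding inner_L2_commute[of m "y' s"] by (simp add: D'_def Y'_def[abs_def] add.commute)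
      also have "\<dots> = 2 * p\<^sup>2 + inner_L2 m D' (y' s)"
        using inner_L2_lincomb[OF weight_m ys(2) DL(2) ys(2), of 2 1] inner_L2_self[OF weight_m, of "y' s"]
        by (simp add: p_def)
      finally have i3: "inner_L2 m (y' r) Y' = inner_L2 m D Y' + (2 * p\<^sup>2 + inner_L2 m D' (y' s))" .
      have "\<bar>inner_L2 m D Y'\<bar> \<le> norm_L2 m D * norm_L2 m Y'" by (rule L2_Cauchy_Schwarz[OF weight_m DL(1) YL(2)])
      also have "\<dots> \<le> \<delta> * (2 * p + \<delta>)" by (rule mult_mono[OF nD(1) nY(2)]) (use \<delta> weight_m in auto)
      finally have i4: "\<bar>inner_L2 m D Y'\<bar> \<le> \<delta> * (2 * p + \<delta>)" .
      have "\<bar>inner_L2 m D' (y' s)\<bar> \<le> norm_L2 m D' * p" unfolding p_def by (rule L2_Cauchy_Schwarz[OF weight_m DL(2) ys(2)])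
      also have "\<dots> \<le> \<delta> * p" by (rule mult_right_mono[OF nD(2) ep(3)])
      finally have i5: "\<bar>inner_L2 m D' (y' s)\<bar> \<le> \<delta> * p" .
      have "2 * p\<^sup>2 - (3 * \<delta> * p + \<delta> * \<delta>) - (p + \<delta>) * (k * (2 * e + \<delta>)) \<le> inner_L2 (\<lambda>_. 1) (y' r) \<psi>'"
        using i2 i4 i5 unfolding i1 i3 abs_le_iff by (simp add: algebra_simps)
      then have j1: "- \<nu> * inner_L2 (\<lambda>_. 1) (y' r) \<psi>' \<le> - \<nu> * (2 * p\<^sup>2 - (3 * \<delta> * p + \<delta> * \<delta>) - (p + \<delta>) * (k * (2 * e + \<delta>)))"
        using \<nu> by simp
      have "l r \<psi> \<le> (a * norm_L2 m (y r) + G) * (norm_L2 m Y + norm_L2 m Y')"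
        unfolding \<psi>_def[abs_def] by (rule l[OF rT wY YL])
      also have "\<dots> \<le> (a * (e + \<delta>) + G) * ((2 * e + \<delta>) + (2 * p + \<delta>))"
        by (intro mult_mono add_mono nY mult_left_mono nr order_refl) (use a G ep \<delta> weight_m in auto)
      finally have j2: "l r \<psi> \<le> (a * (e + \<delta>) + G) * ((2 * e + \<delta>) + (2 * p + \<delta>))" .
      have q1: "\<nu> * (3 * \<delta> * p + \<delta> * \<delta>) \<le> \<delta> * (\<nu> * (3 * P + 1))"
      proof -
        have "3 * p + \<delta> \<le> 3 * P + 1" using ep \<delta> by simp
        then have "(\<nu> * \<delta>) * (3 * p + \<delta>) \<le> (\<nu> * \<delta>) * (3 * P + 1)" using \<nu> \<delta> by (intro mult_left_mono) auto
        then show ?thesis by (simp add: algebra_simps)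
      qed
      have q2: "\<nu> * ((p + \<delta>) * (k * (2 * e + \<delta>))) \<le> 2 * \<nu> * k * p * e + \<delta> * (\<nu> * k * (3 * P + 1))"
      proof -
        have "p + 2 * e + \<delta> \<le> 3 * P + 1" using ep \<delta> by simp
        then have "(\<nu> * k * \<delta>) * (p + 2 * e + \<delta>) \<le> (\<nu> * k * \<delta>) * (3 * P + 1)" using \<nu> \<delta> k_nonneg by (intro mult_left_mono) auto
        then show ?thesis by (simp add: algebra_simps)
      qed
      have q3: "(a * (e + \<delta>) + G) * ((2 * e + \<delta>) + (2 * p + \<delta>)) \<le> 2 * (a * e + G) * (e + p) + \<delta> * (2 * a * P + 2 * G + a * (4 * P + 2))"
      proof -
        have "2 * (a * e + G) + a * (2 * e + 2 * p + 2 * \<delta>) \<le> 2 * (a * P + G) + a * (4 * P + 2)"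
          using ep \<delta> a by (intro add_mono mult_left_mono) auto
        then have "\<delta> * (2 * (a * e + G) + a * (2 * e + 2 * p + 2 * \<delta>)) \<le> \<delta> * (2 * (a * P + G) + a * (4 * P + 2))"
          using \<delta> by (intro mult_left_mono) auto
        then show ?thesis by (simp add: algebra_simps)
      qed
      have "- \<nu> * (2 * p\<^sup>2 - (3 * \<delta> * p + \<delta> * \<delta>) - (p + \<delta>) * (k * (2 * e + \<delta>)))
        = - (2 * \<nu> * p\<^sup>2) + \<nu> * (3 * \<delta> * p + \<delta> * \<delta>) + \<nu> * ((p + \<delta>) * (k * (2 * e + \<delta>)))"
        by (simp only: right_diff_distrib)
      then have "- \<nu> * inner_L2 (\<lambda>_. 1) (y' r) \<psi>' + l r \<psi>
        \<le> - (2 * \<nu> * p\<^sup>2) + 2 * \<nu> * k * p * e + 2 * (a * e + G) * (e + p) + (\<delta> * (\<nu> * (3 * P + 1)) + \<delta> * (\<nu> * k * (3 * P + 1))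
          + \<delta> * (2 * a * P + 2 * G + a * (4 * P + 2)))"
        using j1 j2 q1 q2 q3 by linarith
      also have "\<delta> * (\<nu> * (3 * P + 1)) + \<delta> * (\<nu> * k * (3 * P + 1)) + \<delta> * (2 * a * P + 2 * G + a * (4 * P + 2)) = \<delta> * C - \<delta>"
        by (simp add: C_def algebra_simps)
      finally show ?thesis using energy_quadratic_bound[OF \<nu>, of p k e a G] \<delta> by linarith
    qed
    have i: "inner_L2 (\<lambda>_. 1) (\<lambda>x. y t x - y s x) \<psi> = (norm_L2 m (y t))\<^sup>2 - e\<^sup>2"
    proof -
      have "inner_L2 (\<lambda>_. 1) (\<lambda>x. y t x - y s x) \<psi> = (LINT x|lborel. (y t x)\<^sup>2 * m x - (y s x)\<^sup>2 * m x)"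
        unfolding inner_L2_def
        by (rule Bochner_Integration.integral_cong) (auto simp: \<psi>_def Y_def power2_eq_square algebra_simps)
      also have "\<dots> = (norm_L2 m (y t))\<^sup>2 - e\<^sup>2"
        unfolding e_def norm_L2_sq[OF weight_m]
        by (rule Bochner_Integration.integral_diff[OF L2_D(2)[OF yt(1)] L2_D(2)[OF ys(1)]])
      finally show ?thesis .
    qed
    define M where "M = energy_const1 \<nu> k a * e\<^sup>2 + energy_const2 \<nu> * G\<^sup>2 + \<delta>0"
    have "(LINT r:{s..t}|lborel. - \<nu> * inner_L2 (\<lambda>_. 1) (y' r) \<psi>' + l r \<psi>) \<le> (LINT r:{s..t}|lborel. M)"
      by (rule set_integral_mono) (use eq[OF st(1-3) w\<psi> \<psi>L] bound in \<open>auto simp: M_def intro: borel_integrable_atLeastAtMost'\<close>)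
    also have "\<dots> = (t - s) * M" using st by (simp add: set_lebesgue_integral_def)
    finally show "(norm_L2 m (y t))\<^sup>2 \<le> (norm_L2 m (y s))\<^sup>2 +
       (t - s) * (energy_const1 \<nu> k a * (norm_L2 m (y s))\<^sup>2 + energy_const2 \<nu> * G\<^sup>2 + \<delta>0)"
      using eq[OF st(1-3) w\<psi> \<psi>L] i by (simp add: M_def e_def)
  qed
qed

lemma L2_shift:
  assumes m: "weight m" and c: "\<And>x. m x \<le> C\<^sup>2 * m (x + h)" and C: "0 \<le> C" and u: "u \<in> L2 m"
  shows "(\<lambda>x. u (x + h)) \<in> L2 m" "norm_L2 m (\<lambda>x. u (x + h)) \<le> C * norm_L2 m u"
proof -
  have [measurable]: "u \<in> borel_measurable borel" "m \<in> borel_measurable borel" using u m by (auto simp: L2_def weight_def)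
  have "integrable lborel (\<lambda>x. (u (h + 1 * x))\<^sup>2 * m (h + 1 * x))"
    using L2_D(2)[OF u] by (subst lborel_integrable_real_affine_iff) simp_all
  then have i: "(\<lambda>x. u (x + h)) \<in> L2 (\<lambda>x. m (x + h))" by (simp add: L2_def add.commute)
  have w: "weight (\<lambda>x. m (x + h))" using m by (simp add: weight_def)
  have "(LINT x|lborel. (u (x + h))\<^sup>2 * m (x + h)) = (LINT x|lborel. (u x)\<^sup>2 * m x)"
    by (subst (2) lborel_integral_real_affine[of 1 _ h]) (simp_all add: add.commute)
  then have n: "norm_L2 (\<lambda>x. m (x + h)) (\<lambda>x. u (x + h)) = norm_L2 m u" by (simp add: norm_L2_def)
  have a: "AE x in lborel. (u (x + h))\<^sup>2 * m x \<le> C\<^sup>2 * ((u (x + h))\<^sup>2 * m (x + h))"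
    using mult_left_mono[OF c, of "(u (x + h))\<^sup>2" for x] by (simp add: mult_ac)
  show "(\<lambda>x. u (x + h)) \<in> L2 m" "norm_L2 m (\<lambda>x. u (x + h)) \<le> C * norm_L2 m u"
    using L2_dominated[OF m w _ i C a] n by auto
qed

lemma L2_one_shift:
  assumes "u \<in> L2 (\<lambda>_. 1)"
  shows "(\<lambda>x. u (x + h)) \<in> L2 (\<lambda>_. 1)"
  by (rule L2_shift(1)[OF weight_one _ _ assms, of 1]) auto

lemma inner_L2_one_shift:
  "inner_L2 (\<lambda>_. 1) u (\<lambda>x. w (x + - h)) = inner_L2 (\<lambda>_. 1) (\<lambda>x. u (x + h)) w"
  unfolding inner_L2_def
  by (subst lborel_integral_real_affine[of 1 _ h]) (simp_all add: add.commute)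

lemma inner_L2_one_translation_difference:
  assumes "u \<in> L2 (\<lambda>_. 1)" "w \<in> L2 (\<lambda>_. 1)"
  shows "inner_L2 (\<lambda>_. 1) u (\<lambda>x. w (x - h) - w x) = inner_L2 (\<lambda>_. 1) (\<lambda>x. u (x + h) - u x) w"
proof -
  have ws: "(\<lambda>x. w (x + - h)) \<in> L2 (\<lambda>_. 1)" by (rule L2_one_shift[OF assms(2)])
  have us: "(\<lambda>x. u (x + h)) \<in> L2 (\<lambda>_. 1)" by (rule L2_one_shift[OF assms(1)])
  have "inner_L2 (\<lambda>_. 1) u (\<lambda>x. w (x - h) - w x) = inner_L2 (\<lambda>_. 1) u (\<lambda>x. w (x + - h)) - inner_L2 (\<lambda>_. 1) u w"
    unfolding inner_L2_commute[of _ u]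
    using inner_L2_lincomb[OF weight_one ws assms(2,1), of 1 "-1"] by simp
  also have "\<dots> = inner_L2 (\<lambda>_. 1) (\<lambda>x. u (x + h) - u x) w"
    unfolding inner_L2_one_shift
    using inner_L2_lincomb[OF weight_one us assms(1,2), of 1 "-1"] by simp
  finally show ?thesis .
qed

definition parabolic_const0 :: "real \<Rightarrow> real \<Rightarrow> real \<Rightarrow> real \<Rightarrow> real" where
  "parabolic_const0 \<nu> k a T = sqrt (exp (energy_const1 \<nu> k a * T) * T * energy_const2 \<nu>)"

definition parabolic_const :: "real \<Rightarrow> real \<Rightarrow> real \<Rightarrow> real \<Rightarrow> real" where
  "parabolic_const \<nu> k a T = parabolic_const0 \<nu> k a T +
     parabolic_const0 \<nu> k 0 T * (exp k * (1 + k) * (a * parabolic_const0 \<nu> k a T + 1))"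

lemma parabolic_const0_nonneg: "\<nu> > 0 \<Longrightarrow> 0 \<le> T \<Longrightarrow> 0 \<le> parabolic_const0 \<nu> k a T"
  by (simp add: parabolic_const0_def energy_const2_def)

lemma parabolic_const0_bound:
  assumes \<nu>: "\<nu> > 0" and a: "0 \<le> a" and t: "t \<in> {0..T}" and G: "0 \<le> G" and n: "0 \<le> n"
    and le: "n\<^sup>2 \<le> exp (energy_const1 \<nu> k a * t) * t * (energy_const2 \<nu> * G\<^sup>2)"
  shows "n \<le> parabolic_const0 \<nu> k a T * G"
proof (rule power2_le_imp_le)
  have c: "0 \<le> energy_const1 \<nu> k a" "0 \<le> energy_const2 \<nu>" using \<nu> a by (auto simp: energy_const1_def energy_const2_def)
  have "n\<^sup>2 \<le> exp (energy_const1 \<nu> k a * T) * T * (energy_const2 \<nu> * G\<^sup>2)"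
    by (rule order_trans[OF le], intro mult_right_mono mult_mono) (use t c mult_left_mono[of t T] in auto)
  also have "\<dots> = (parabolic_const0 \<nu> k a T * G)\<^sup>2"
    using t c by (simp add: parabolic_const0_def power_mult_distrib)
  finally show "n\<^sup>2 \<le> (parabolic_const0 \<nu> k a T * G)\<^sup>2" .
qed (use parabolic_const0_nonneg[OF \<nu>] t G in auto)

text \<open>The bound on the derivative is the energy estimate for the translation differences
  \<open>w(t, x + h) - w(t, x)\<close>, whose source term can be integrated by parts discretely.\<close>

lemma (in regular_weight) parabolic_estimate:
  fixes w w' g :: "real \<Rightarrow> real \<Rightarrow> real"
  assumes \<nu>: "\<nu> > 0" and a: "0 \<le> a" and G: "0 \<le> G"
    and w: "C_L2 T m w" and w': "C_L2 T m w'"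
    and wd: "\<And>t. t \<in> {0..T} \<Longrightarrow> weak_deriv (w t) (w' t)"
    and g: "\<And>r. r \<in> {0..T} \<Longrightarrow> g r \<in> L2 m"
      "\<And>r. r \<in> {0..T} \<Longrightarrow> norm_L2 m (g r) \<le> a * norm_L2 m (w r) + G"
    and int: "\<And>\<psi> \<psi>'. weak_deriv \<psi> \<psi>' \<Longrightarrow> \<psi> \<in> L2 (\<lambda>_. 1) \<Longrightarrow> \<psi>' \<in> L2 (\<lambda>_. 1) \<Longrightarrow>
      set_integrable lborel {0..T} (\<lambda>r. - \<nu> * inner_L2 (\<lambda>_. 1) (w' r) \<psi>' + inner_L2 (\<lambda>_. 1) (g r) \<psi>)"
    and eq: "\<And>t \<psi> \<psi>'. t \<in> {0..T} \<Longrightarrow> weak_deriv \<psi> \<psi>' \<Longrightarrow> \<psi> \<in> L2 (\<lambda>_. 1) \<Longrightarrow> \<psi>' \<in> L2 (\<lambda>_. 1) \<Longrightarrow>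
      inner_L2 (\<lambda>_. 1) (w t) \<psi> =
        (LINT r:{0..t}|lborel. - \<nu> * inner_L2 (\<lambda>_. 1) (w' r) \<psi>' + inner_L2 (\<lambda>_. 1) (g r) \<psi>)"
    and t: "t \<in> {0..T}"
  shows "norm_L2 m (w t) \<le> parabolic_const \<nu> k a T * G" "norm_L2 m (w' t) \<le> parabolic_const \<nu> k a T * G"
proof -
  have T: "0 \<le> T" using t by simp
  note wL = C_L2_D(1)[OF w] C_L2_D(1)[OF w']
  note w1 = wL[THEN L2_m_imp_L2]
  have g1: "g r \<in> L2 (\<lambda>_. 1)" if "r \<in> {0..T}" for r by (rule L2_m_imp_L2[OF g(1)[OF that]])
  have eq2: "set_integrable lborel {s..t} (\<lambda>r. - \<nu> * inner_L2 (\<lambda>_. 1) (w' r) \<psi>' + inner_L2 (\<lambda>_. 1) (g r) \<psi>) \<and>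
      inner_L2 (\<lambda>_. 1) (\<lambda>x. w t x - w s x) \<psi> =
        (LINT r:{s..t}|lborel. - \<nu> * inner_L2 (\<lambda>_. 1) (w' r) \<psi>' + inner_L2 (\<lambda>_. 1) (g r) \<psi>)"
    if st: "0 \<le> s" "s \<le> t" "t \<le> T" and \<psi>: "weak_deriv \<psi> \<psi>'" "\<psi> \<in> L2 (\<lambda>_. 1)" "\<psi>' \<in> L2 (\<lambda>_. 1)"
    for s t \<psi> \<psi>'
  proof -
    let ?F = "\<lambda>r. - \<nu> * inner_L2 (\<lambda>_. 1) (w' r) \<psi>' + inner_L2 (\<lambda>_. 1) (g r) \<psi>"
    have sub: "set_integrable lborel {c..d} ?F" if "0 \<le> c" "d \<le> T" for c d
      by (rule set_integrable_subset[OF int[OF \<psi>]]) (use that in auto)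
    have I: "(LINT r:{c..d}|lborel. ?F r) = integral {c..d} ?F" "?F integrable_on {c..d}" if "0 \<le> c" "d \<le> T" for c d
      using set_borel_integral_eq_integral[OF sub[OF that]] by auto
    have sT: "s \<in> {0..T}" and tT: "t \<in> {0..T}" using st by auto
    have "inner_L2 (\<lambda>_. 1) (\<lambda>x. w t x - w s x) \<psi> = inner_L2 (\<lambda>_. 1) (w t) \<psi> - inner_L2 (\<lambda>_. 1) (w s) \<psi>"
      using inner_L2_lincomb[OF weight_one w1(1)[OF tT] w1(1)[OF sT] \<psi>(2), of 1 "-1"] by simp
    also have "\<dots> = integral {0..t} ?F - integral {0..s} ?F"
      unfolding eq[OF tT \<psi>] eq[OF sT \<psi>] using st I(1)[of 0 t] I(1)[of 0 s] by simp
    also have "\<dots> = integral {s..t} ?F"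
      using Henstock_Kurzweil_Integration.integral_combine[OF st(1,2) I(2)[of 0 t]] st by simp
    finally show ?thesis using sub[of s t] I(1)[of s t] st by simp
  qed
  have w0: "norm_L2 m (w 0) = 0"
  proof -
    have T0: "0 \<in> {0..T}" using T by simp
    define \<psi> \<psi>' where "\<psi> x = w 0 x * m x" and "\<psi>' x = w' 0 x * m x + w 0 x * m' x" for x
    have p: "weak_deriv \<psi> \<psi>'" "\<psi> \<in> L2 (\<lambda>_. 1)" "\<psi>' \<in> L2 (\<lambda>_. 1)"
      unfolding \<psi>_def[abs_def] \<psi>'_def[abs_def]
      by (intro weak_deriv_mult_C1[OF wd[OF T0] m_deriv m'_cont] L2_add weight_one L2_mult_m wL T0)+
    have "set_integrable lborel {0..0} (\<lambda>r. - \<nu> * inner_L2 (\<lambda>_. 1) (w' r) \<psi>' + inner_L2 (\<lambda>_. 1) (g r) \<psi>)"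
      by (rule set_integrable_subset[OF int[OF p]]) (use T in auto)
    then have "inner_L2 (\<lambda>_. 1) (w 0) \<psi> = 0"
      unfolding eq[OF T0 p] by (subst set_borel_integral_eq_integral(2)) simp_all
    then have "(norm_L2 m (w 0))\<^sup>2 = 0"
      unfolding \<psi>_def[abs_def] inner_one_mult_m by (simp add: inner_L2_self[OF weight_m])
    then show ?thesis by simp
  qed
  have est0: "norm_L2 m (w t) \<le> parabolic_const0 \<nu> k a T * G" if t: "t \<in> {0..T}" for t
  proof (rule parabolic_const0_bound[OF \<nu> a t G])
    show "0 \<le> norm_L2 m (w t)" by (simp add: weight_m)
    show "(norm_L2 m (w t))\<^sup>2 \<le> exp (energy_const1 \<nu> k a * t) * t * (energy_const2 \<nu> * G\<^sup>2)"
    proof (rule energy_estimate[OF \<nu> a G w w' wd w0 _ _ t, where l="\<lambda>r \<psi>. inner_L2 (\<lambda>_. 1) (g r) \<psi>"])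
      fix r Y Y' assume r: "r \<in> {0..T}" and Y: "weak_deriv Y Y'" "Y \<in> L2 m" "Y' \<in> L2 m"
      have "inner_L2 (\<lambda>_. 1) (g r) (\<lambda>x. Y x * m x) \<le> norm_L2 m (g r) * norm_L2 m Y"
        unfolding inner_one_mult_m using L2_Cauchy_Schwarz[OF weight_m g(1)[OF r] Y(2)] by simp
      also have "\<dots> \<le> (a * norm_L2 m (w r) + G) * (norm_L2 m Y + norm_L2 m Y')"
        using g(2)[OF r] a G by (intro mult_mono) (auto simp: weight_m)
      finally show "inner_L2 (\<lambda>_. 1) (g r) (\<lambda>x. Y x * m x) \<le> (a * norm_L2 m (w r) + G) * (norm_L2 m Y + norm_L2 m Y')" .
    qed (use eq2 in auto)
  qed
  define A0 where "A0 = parabolic_const0 \<nu> k a T"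
  have A0: "0 \<le> A0" using parabolic_const0_nonneg[OF \<nu> T] by (simp add: A0_def)
  define GG where "GG = exp k * (1 + k) * ((a * A0 + 1) * G)"
  have GG: "0 \<le> GG" using k_nonneg a A0 G by (simp add: GG_def)
  have gG: "norm_L2 m (g r) \<le> (a * A0 + 1) * G" if "r \<in> {0..T}" for r
    using g(2)[OF that] mult_left_mono[OF est0[OF that] a] by (simp add: A0_def algebra_simps)
  have shift: "m x \<le> (exp k)\<^sup>2 * m (x + h)" if "\<bar>h\<bar> \<le> 1" for x h
  proof -
    have "m x \<le> exp (k * \<bar>h\<bar>) * m (x + h)" using m_shift[of "x + h" "- h"] by simp
    also have "\<dots> \<le> exp (2 * k) * m (x + h)"
    proof (rule mult_right_mono)
      have "k * \<bar>h\<bar> \<le> k * 1" using that k_nonneg by (intro mult_left_mono) auto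
      then show "exp (k * \<bar>h\<bar>) \<le> exp (2 * k)" using k_nonneg by simp
    qed (simp add: m_pos less_imp_le)
    finally show ?thesis by (simp add: power2_eq_square flip: exp_add)
  qed
  have diff: "(\<lambda>x. w t (x + h) - w t x) \<in> L2 m \<and>
      norm_L2 m (\<lambda>x. w t (x + h) - w t x) \<le> h * (parabolic_const0 \<nu> k 0 T * GG)" if h: "0 < h" "h \<le> 1" for h
  proof -
    define z z' where "z t x = w t (x + h) - w t x" and "z' t x = w' t (x + h) - w' t x" for t x
    have sC: "C_L2 T m (\<lambda>t x. v t (x + h))" if v: "C_L2 T m v" for v
      unfolding C_L2_def
    proof (intro ballI conjI)
      fix t assume t: "t \<in> {0..T}"
      show "(\<lambda>x. v t (x + h)) \<in> L2 m"
        by (rule L2_shift(1)[OF weight_m shift _ C_L2_D(1)[OF v t]]) (use h in auto)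
      have "((\<lambda>s. exp k * norm_L2 m (\<lambda>x. v s x - v t x)) \<longlongrightarrow> exp k * 0) (at t within {0..T})"
        by (intro tendsto_intros C_L2_D(2)[OF v t])
      then have l: "((\<lambda>s. exp k * norm_L2 m (\<lambda>x. v s x - v t x)) \<longlongrightarrow> 0) (at t within {0..T})" by simp
      have "norm_L2 m (\<lambda>x. v s (x + h) - v t (x + h)) \<le> exp k * norm_L2 m (\<lambda>x. v s x - v t x)" if "s \<in> {0..T}" for s
        by (rule L2_shift(2)[OF weight_m shift _ L2_diff[OF weight_m C_L2_D(1)[OF v that] C_L2_D(1)[OF v t]]]) (use h in auto)
      then show "((\<lambda>s. norm_L2 m (\<lambda>x. v s (x + h) - v t (x + h))) \<longlongrightarrow> 0) (at t within {0..T})"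
        by (intro tendsto_sandwich[OF _ _ tendsto_const l]) (use weight_m in \<open>auto simp: eventually_at_filter\<close>)
    qed
    have z: "C_L2 T m z" "C_L2 T m z'"
      using C_L2_lincomb[OF weight_m sC[OF w] w continuous_on_const, of 1 "-1"]
        C_L2_lincomb[OF weight_m sC[OF w'] w' continuous_on_const, of 1 "-1"]
      by (simp_all add: z_def[abs_def] z'_def[abs_def])
    have zd: "weak_deriv (z t) (z' t)" if "t \<in> {0..T}" for t
      using weak_deriv_lincomb[OF weak_deriv_shift[OF wd[OF that], of h] wd[OF that], of 1 "-1"]
      by (simp add: z_def[abs_def] z'_def[abs_def])
    have z0: "norm_L2 m (z 0) = 0"
    proof -
      have T0: "0 \<in> {0..T}" using T by simp
      have "norm_L2 m (\<lambda>x. w 0 (x + h)) \<le> exp k * norm_L2 m (w 0)"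
        by (rule L2_shift(2)[OF weight_m shift _ wL(1)[OF T0]]) (use h in auto)
      moreover have "(\<lambda>x. w 0 (x + h)) \<in> L2 m"
        by (rule L2_shift(1)[OF weight_m shift _ wL(1)[OF T0]]) (use h in auto)
      ultimately have "norm_L2 m (z 0) \<le> 0"
        using norm_L2_diff[OF weight_m _ wL(1)[OF T0], of "\<lambda>x. w 0 (x + h)"] w0 by (simp add: z_def[abs_def])
      then show ?thesis using norm_L2_nonneg[OF weight_m, of "z 0"] by simp
    qed
    define l where "l r \<psi> = inner_L2 (\<lambda>_. 1) (g r) (\<lambda>x. \<psi> (x - h) - \<psi> x)" for r \<psi>
    have "norm_L2 m (z t) \<le> parabolic_const0 \<nu> k 0 T * (h * GG)"
    proof (rule parabolic_const0_bound[OF \<nu> order_refl t])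
      show "0 \<le> h * GG" using h GG by simp
      show "0 \<le> norm_L2 m (z t)" by (simp add: weight_m)
      show "(norm_L2 m (z t))\<^sup>2 \<le> exp (energy_const1 \<nu> k 0 * t) * t * (energy_const2 \<nu> * (h * GG)\<^sup>2)"
      proof (rule energy_estimate[OF \<nu> order_refl _ z zd z0 _ _ t, where l=l])
        show "0 \<le> h * GG" using h GG by simp
        fix r Y Y' assume r: "r \<in> {0..T}" and Y: "weak_deriv Y Y'" "Y \<in> L2 m" "Y' \<in> L2 m"
        define \<psi> \<psi>' where "\<psi> x = Y x * m x" and "\<psi>' x = Y' x * m x + Y x * m' x" for x
        have p: "weak_deriv \<psi> \<psi>'" "\<psi> \<in> L2 (\<lambda>_. 1)" "\<psi>' \<in> L2 (\<lambda>_. 1)" "\<psi>' \<in> L2 (\<lambda>x. 1 / m x)"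
          unfolding \<psi>_def[abs_def] \<psi>'_def[abs_def]
          by (intro weak_deriv_mult_C1[OF Y(1) m_deriv m'_cont] L2_add weight_one weight_inv L2_mult_m Y)+
        have "norm_L2 (\<lambda>x. 1 / m x) \<psi>' \<le> norm_L2 (\<lambda>x. 1 / m x) (\<lambda>x. Y' x * m x) + norm_L2 (\<lambda>x. 1 / m x) (\<lambda>x. Y x * m' x)"
          unfolding \<psi>'_def[abs_def] by (rule norm_L2_add[OF weight_inv L2_mult_m(3)[OF Y(3)] L2_mult_m(5)[OF Y(2)]])
        also have "\<dots> \<le> norm_L2 m Y' + k * norm_L2 m Y"
          using L2_mult_m(4)[OF Y(3)] L2_mult_m(6)[OF Y(2)] by simp
        also have "\<dots> \<le> (1 + k) * (norm_L2 m Y + norm_L2 m Y')"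
          using k_nonneg norm_L2_nonneg[OF weight_m, of Y] norm_L2_nonneg[OF weight_m, of Y']
          by (simp add: algebra_simps)
        finally have n: "norm_L2 (\<lambda>x. 1 / m x) \<psi>' \<le> (1 + k) * (norm_L2 m Y + norm_L2 m Y')" .
        define D where "D x = \<psi> (x - h) - \<psi> x" for x
        have inv: "1 / m x \<le> (exp k)\<^sup>2 * (1 / m y)" if "\<bar>x - y\<bar> \<le> h" for x y
          using shift[of "x - y" y] that h m_pos[of x] m_pos[of y] by (simp add: field_simps)
        have D: "D \<in> L2 (\<lambda>x. 1 / m x)" "norm_L2 (\<lambda>x. 1 / m x) D \<le> h * exp k * norm_L2 (\<lambda>x. 1 / m x) \<psi>'"
          unfolding D_def[abs_def] by (rule L2_translation_estimate[OF p weight_inv h(1) inv]; simp)+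
        have "inner_L2 (\<lambda>_. 1) (g r) D = inner_L2 m (g r) (\<lambda>x. D x / m x)"
          unfolding inner_L2_def by (rule Bochner_Integration.integral_cong) (auto simp: less_imp_neq[OF m_pos, symmetric])
        have mD: "(\<lambda>x. D x / m x) \<in> L2 m" "norm_L2 m (\<lambda>x. D x / m x) \<le> 1 * norm_L2 (\<lambda>x. 1 / m x) D"
        proof -
          have [measurable]: "D \<in> borel_measurable borel" using D(1) by (simp add: L2_def)
          have a: "AE x in lborel. (D x / m x)\<^sup>2 * m x \<le> 1\<^sup>2 * ((D x)\<^sup>2 * (1 / m x))"
            using m_pos by (auto simp: power2_eq_square less_imp_neq[OF m_pos, symmetric])
          show "(\<lambda>x. D x / m x) \<in> L2 m" "norm_L2 m (\<lambda>x. D x / m x) \<le> 1 * norm_L2 (\<lambda>x. 1 / m x) D"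
            using L2_dominated[OF weight_m weight_inv _ D(1) _ a] by auto
        qed
        have "l r \<psi> = inner_L2 m (g r) (\<lambda>x. D x / m x)" unfolding l_def D_def[symmetric] by fact
        also have "\<dots> \<le> norm_L2 m (g r) * norm_L2 m (\<lambda>x. D x / m x)"
          using L2_Cauchy_Schwarz[OF weight_m g(1)[OF r] mD(1)] by simp
        also have "\<dots> \<le> ((a * A0 + 1) * G) * (h * exp k * ((1 + k) * (norm_L2 m Y + norm_L2 m Y')))"
        proof (rule mult_mono[OF gG[OF r]])
          have "h * exp k * norm_L2 (\<lambda>x. 1 / m x) \<psi>' \<le> h * exp k * ((1 + k) * (norm_L2 m Y + norm_L2 m Y'))"
            using h by (intro mult_left_mono n) auto
          then show "norm_L2 m (\<lambda>x. D x / m x) \<le> h * exp k * ((1 + k) * (norm_L2 m Y + norm_L2 m Y'))"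
            using mD(2) D(2) by linarith
        qed (use a A0 G weight_m in auto)
        also have "\<dots> = (0 * norm_L2 m (z r) + h * GG) * (norm_L2 m Y + norm_L2 m Y')"
          by (simp add: GG_def mult_ac)
        finally show "l r (\<lambda>x. Y x * m x) \<le> (0 * norm_L2 m (z r) + h * GG) * (norm_L2 m Y + norm_L2 m Y')"
          unfolding \<psi>_def[abs_def] .
      next
        fix s t \<psi> \<psi>' assume st: "0 \<le> s" "s \<le> t" "t \<le> T" and p: "weak_deriv \<psi> \<psi>'" "\<psi> \<in> L2 (\<lambda>_. 1)" "\<psi>' \<in> L2 (\<lambda>_. 1)"
        define \<xi> \<xi>' where "\<xi> x = \<psi> (x - h) - \<psi> x" and "\<xi>' x = \<psi>' (x - h) - \<psi>' x" for x
        have c: "weak_deriv \<xi> \<xi>'" "\<xi> \<in> L2 (\<lambda>_. 1)" "\<xi>' \<in> L2 (\<lambda>_. 1)"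
          using weak_deriv_lincomb[OF weak_deriv_shift[OF p(1), of "- h"] p(1), of 1 "-1"]
            L2_diff[OF weight_one L2_one_shift[OF p(2), of "- h"] p(2)]
            L2_diff[OF weight_one L2_one_shift[OF p(3), of "- h"] p(3)]
          by (simp_all add: \<xi>_def[abs_def] \<xi>'_def[abs_def])
        have F: "- \<nu> * inner_L2 (\<lambda>_. 1) (w' r) \<xi>' + inner_L2 (\<lambda>_. 1) (g r) \<xi> = - \<nu> * inner_L2 (\<lambda>_. 1) (z' r) \<psi>' + l r \<psi>"
          if "r \<in> {s..t}" for r
        proof -
          have rT: "r \<in> {0..T}" using that st by auto
          show ?thesis unfolding \<xi>'_def[abs_def] \<xi>_def[abs_def] l_def z'_def[abs_def]
            by (simp add: inner_L2_one_translation_difference[OF w1(2)[OF rT] p(3)])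
        qed
        have tT: "t \<in> {0..T}" "s \<in> {0..T}" using st by auto
        have "inner_L2 (\<lambda>_. 1) (\<lambda>x. w t x - w s x) \<xi> = inner_L2 (\<lambda>_. 1) (\<lambda>x. z t x - z s x) \<psi>"
          unfolding \<xi>_def[abs_def] inner_L2_one_translation_difference[OF L2_diff[OF weight_one w1(1)[OF tT(1)] w1(1)[OF tT(2)]] p(2)]
          by (simp add: z_def algebra_simps)
        moreover have "set_integrable lborel {s..t} (\<lambda>r. - \<nu> * inner_L2 (\<lambda>_. 1) (w' r) \<xi>' + inner_L2 (\<lambda>_. 1) (g r) \<xi>) =
          set_integrable lborel {s..t} (\<lambda>r. - \<nu> * inner_L2 (\<lambda>_. 1) (z' r) \<psi>' + l r \<psi>)"
          by (rule set_integrable_cong) (use F in auto)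
        moreover have "(LINT r:{s..t}|lborel. - \<nu> * inner_L2 (\<lambda>_. 1) (w' r) \<xi>' + inner_L2 (\<lambda>_. 1) (g r) \<xi>) =
          (LINT r:{s..t}|lborel. - \<nu> * inner_L2 (\<lambda>_. 1) (z' r) \<psi>' + l r \<psi>)"
          by (rule set_lebesgue_integral_cong) (use F in auto)
        ultimately show "set_integrable lborel {s..t} (\<lambda>r. - \<nu> * inner_L2 (\<lambda>_. 1) (z' r) \<psi>' + l r \<psi>) \<and>
          inner_L2 (\<lambda>_. 1) (\<lambda>x. z t x - z s x) \<psi> = (LINT r:{s..t}|lborel. - \<nu> * inner_L2 (\<lambda>_. 1) (z' r) \<psi>' + l r \<psi>)"
          using eq2[OF st c] by simp
      qed
    qed
    then show ?thesis using C_L2_D(1)[OF z(1) t] by (simp add: z_def[abs_def] mult_ac)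
  qed
  have "norm_L2 m (w' t) \<le> parabolic_const0 \<nu> k 0 T * GG"
    by (rule norm_L2_difference_quotient_limit[OF wd[OF t] weight_m wL(2)[OF t]])
      (use diff GG parabolic_const0_nonneg[OF \<nu> T] in auto)
  moreover have "0 \<le> parabolic_const0 \<nu> k 0 T * GG" using GG parabolic_const0_nonneg[OF \<nu> T] by simp
  moreover have "parabolic_const \<nu> k a T * G = A0 * G + parabolic_const0 \<nu> k 0 T * GG"
    by (simp add: parabolic_const_def A0_def GG_def algebra_simps)
  moreover have "0 \<le> A0 * G" using A0 G by simp
  ultimately show "norm_L2 m (w t) \<le> parabolic_const \<nu> k a T * G" "norm_L2 m (w' t) \<le> parabolic_const \<nu> k a T * G"
    using est0[OF t] by (simp_all add: A0_def)
qed

section \<open>Weights and wave profiles\<close>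

lemma C_L2_const: "u \<in> L2 \<mu> \<Longrightarrow> C_L2 T \<mu> (\<lambda>_. u)"
  by (simp add: C_L2_def)

lemma C_L2_inner_continuous:
  assumes \<mu>: "weight \<mu>" and h: "C_L2 T \<mu> h" and \<psi>: "\<psi> \<in> L2 \<mu>"
  shows "continuous_on {0..T} (\<lambda>t. inner_L2 \<mu> (h t) \<psi>)"
  unfolding continuous_on_def
proof
  fix t assume t: "t \<in> {0..T}"
  have b: "\<bar>inner_L2 \<mu> (h s) \<psi> - inner_L2 \<mu> (h t) \<psi>\<bar> \<le> norm_L2 \<mu> (\<lambda>x. h s x - h t x) * norm_L2 \<mu> \<psi>" if s: "s \<in> {0..T}" for s
  proof -
    note hs = C_L2_D(1)[OF h s] C_L2_D(1)[OF h t]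
    have "inner_L2 \<mu> (h s) \<psi> - inner_L2 \<mu> (h t) \<psi> = inner_L2 \<mu> (\<lambda>x. h s x - h t x) \<psi>"
      using inner_L2_lincomb[OF \<mu> hs \<psi>, of 1 "-1"] by simp
    then show ?thesis using L2_Cauchy_Schwarz[OF \<mu> L2_diff[OF \<mu> hs] \<psi>] by simp
  qed
  have l: "((\<lambda>s. norm_L2 \<mu> (\<lambda>x. h s x - h t x) * norm_L2 \<mu> \<psi>) \<longlongrightarrow> 0) (at t within {0..T})"
    by (rule tendsto_mult_left_zero[OF C_L2_D(2)[OF h t]])
  have "((\<lambda>s. inner_L2 \<mu> (h s) \<psi> - inner_L2 \<mu> (h t) \<psi>) \<longlongrightarrow> 0) (at t within {0..T})"
  proof (rule Lim_null_comparison[OF _ l])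
    show "\<forall>\<^sub>F s in at t within {0..T}. norm (inner_L2 \<mu> (h s) \<psi> - inner_L2 \<mu> (h t) \<psi>)
        \<le> norm_L2 \<mu> (\<lambda>x. h s x - h t x) * norm_L2 \<mu> \<psi>"
      unfolding eventually_at_filter real_norm_def by (rule always_eventually) (intro allI impI b)
  qed
  then show "((\<lambda>t. inner_L2 \<mu> (h t) \<psi>) \<longlongrightarrow> inner_L2 \<mu> (h t) \<psi>) (at t within {0..T})" by (rule LIM_zero_cancel)
qed

lemma integral_weak_deriv_eq_0:
  assumes w: "weak_deriv G g" and G: "integrable lborel G" and g: "integrable lborel g"
  shows "(LINT x|lborel. g x) = 0"
proof -
  obtain S S1 :: "real \<Rightarrow> real" and \<kappa> where S:
    "\<And>k. Ck k S" "\<And>k. Ck k S1" "\<And>x. (S1 has_real_derivative S x) (at x)"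
    "\<And>x. x \<le> 0 \<Longrightarrow> S x = 0" "\<And>x. 1 \<le> x \<Longrightarrow> S x = 1" "\<And>x. 0 \<le> S x" "\<And>x. S x \<le> 1"
    "\<And>x. x \<le> 0 \<Longrightarrow> S1 x = 0" "\<And>x. 1 \<le> x \<Longrightarrow> S1 x = x - \<kappa>"
    by (rule smooth_step_exists) blast
  have dS: "(S has_real_derivative deriv S x) (at x)" "Ck 0 (deriv S)" for x
    using Ck_SucD[OF S(1)[of "Suc 0"]] by auto
  have z: "deriv S x = 0" if "x < 0 \<or> 1 < x" for x
  proof -
    have "\<exists>A v. open A \<and> x \<in> A \<and> (\<forall>y\<in>A. S y = v)"
    proof (cases "x < 0")
      case True then show ?thesis by (intro exI[of _ "{..<0}"] exI[of _ 0]) (auto simp: S(4))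
    next
      case False then show ?thesis using that by (intro exI[of _ "{1<..}"] exI[of _ 1]) (auto simp: S(5))
    qed
    then obtain A v where A: "open A" "x \<in> A" "\<And>y. y \<in> A \<Longrightarrow> S y = v" by blast
    have "\<forall>\<^sub>F y in nhds x. S y = v"
      using eventually_nhds_in_open[OF A(1,2)] by eventually_elim (rule A(3))
    then have "DERIV S x :> 0" by (subst DERIV_cong_ev[OF refl _ refl]) auto
    then show ?thesis by (rule DERIV_imp_deriv)
  qed
  have cS': "continuous_on A (deriv S)" for A using dS(2) by (rule Ck_continuous_on)
  have "bounded (deriv S ` {0..1})" by (intro compact_imp_bounded compact_continuous_image cS' compact_Icc)
  then obtain B where B: "\<And>x. x \<in> {0..1} \<Longrightarrow> \<bar>deriv S x\<bar> \<le> B" by (force simp: bounded_iff)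
  have B': "\<bar>deriv S x\<bar> \<le> \<bar>B\<bar>" for x
    using B[of x] z[of x] by (cases "x \<in> {0..1}") auto
  define \<phi> where "\<phi> n x = S (1 * x + (real n + 1)) - S (1 * x + (- real n))" for n x
  have ck: "Ck k (\<phi> n)" for k n unfolding \<phi>_def[abs_def] by (intro Ck_diff Ck_affine S(1))
  have sup: "\<phi> n x = 0" if "\<bar>x\<bar> > real n + 1" for n x
    using that S(4,5) by (cases "x > 0") (auto simp: \<phi>_def)
  have t: "test_function (\<phi> n)" for n unfolding test_function_def using ck sup by blast
  have d\<phi>: "deriv (\<phi> n) x = deriv S (x + (real n + 1)) - deriv S (x + (- real n))" for n x
  proof (rule DERIV_imp_deriv)
    have 1: "((\<lambda>x. S (1 * x + d)) has_real_derivative deriv S (1 * x + d) * 1) (at x)" for d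
      by (rule DERIV_chain2[OF dS(1)]) (auto intro!: derivative_eq_intros)
    from DERIV_diff[OF 1 1, of "real n + 1" "- real n"]
    show "(\<phi> n has_real_derivative deriv S (x + (real n + 1)) - deriv S (x + (- real n))) (at x)"
      unfolding \<phi>_def[abs_def] by simp
  qed
  have [measurable]: "\<phi> n \<in> borel_measurable borel" "deriv (\<phi> n) \<in> borel_measurable borel" for n
    by (auto intro!: borel_measurable_continuous_onI Ck_continuous_on[of 0] ck Ck_SucD(2)[of 0])
  have [measurable]: "G \<in> borel_measurable borel" "g \<in> borel_measurable borel"
    using weak_deriv_measurable[OF w] by auto
  have l1: "(\<lambda>n. LINT x|lborel. g x * \<phi> n x) \<longlonglongrightarrow> (LINT x|lborel. g x)"
  proof (rule integral_dominated_convergence[where w="\<lambda>x. \<bar>g x\<bar>"])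
    have "\<bar>\<phi> n x\<bar> \<le> 1" for n x
      using S(6,7)[of "x + (real n + 1)"] S(6,7)[of "x + (- real n)"] by (simp add: \<phi>_def abs_le_iff) 
    then show "AE x in lborel. norm (g x * \<phi> n x) \<le> \<bar>g x\<bar>" for n
      by (auto simp: abs_mult mult_left_le)
    have "(\<lambda>n. g x * \<phi> n x) \<longlonglongrightarrow> g x" for x
    proof (rule tendsto_eventually)
      obtain N where "\<bar>x\<bar> < real N" using reals_Archimedean2 by blast
      then have "g x * \<phi> n x = g x" if "n \<ge> N" for n
        using that S(4)[of "x - real n"] S(5)[of "x + (real n + 1)"] by (simp add: \<phi>_def abs_less_iff)
      then show "\<forall>\<^sub>F n in sequentially. g x * \<phi> n x = g x" by (rule eventually_sequentiallyI)
    qed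
    then show "AE x in lborel. (\<lambda>n. g x * \<phi> n x) \<longlonglongrightarrow> g x" by simp
  qed (use g in auto)
  have l2: "(\<lambda>n. LINT x|lborel. G x * deriv (\<phi> n) x) \<longlonglongrightarrow> (LINT x::real|lborel. 0::real)"
  proof (rule integral_dominated_convergence[where w="\<lambda>x. \<bar>G x\<bar> * (2 * \<bar>B\<bar>)"])
    have b: "\<bar>deriv (\<phi> n) x\<bar> \<le> 2 * \<bar>B\<bar>" for n x
      using B'[of "x + (real n + 1)"] B'[of "x + (- real n)"] unfolding d\<phi> by linarith
    show "AE x in lborel. norm (G x * deriv (\<phi> n) x) \<le> \<bar>G x\<bar> * (2 * \<bar>B\<bar>)" for n
      using b by (intro AE_I2) (simp add: abs_mult mult_left_mono)
    have "(\<lambda>n. G x * deriv (\<phi> n) x) \<longlonglongrightarrow> 0" for x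
    proof (rule tendsto_eventually)
      obtain N where "\<bar>x\<bar> < real N" using reals_Archimedean2 by blast
      then have "G x * deriv (\<phi> n) x = 0" if "n \<ge> N" for n
        using that z[of "x - real n"] z[of "x + (real n + 1)"] by (simp add: d\<phi> abs_less_iff)
      then show "\<forall>\<^sub>F n in sequentially. G x * deriv (\<phi> n) x = 0" by (rule eventually_sequentiallyI)
    qed
    then show "AE x in lborel. (\<lambda>n. G x * deriv (\<phi> n) x) \<longlonglongrightarrow> 0" by simp
  qed (use G in auto)
  have "(LINT x|lborel. G x * deriv (\<phi> n) x) = - (LINT x|lborel. g x * \<phi> n x)" for n
    using w t by (simp add: weak_deriv_def)
  then have "(\<lambda>n. - (LINT x|lborel. g x * \<phi> n x)) \<longlonglongrightarrow> 0" using l2 by simp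
  then show ?thesis using LIMSEQ_unique[OF tendsto_minus[OF l1]] by force
qed

lemma inner_L2_one_by_parts:
  assumes w: "weak_deriv \<psi> \<psi>'" and L: "\<psi> \<in> L2 (\<lambda>_. 1)" "\<psi>' \<in> L2 (\<lambda>_. 1)"
    and d: "\<And>x. (p has_real_derivative p' x) (at x)" and c: "continuous_on UNIV p'"
    and P: "p \<in> L2 (\<lambda>_. 1)" "p' \<in> L2 (\<lambda>_. 1)"
  shows "inner_L2 (\<lambda>_. 1) p' \<psi> = - inner_L2 (\<lambda>_. 1) p \<psi>'"
proof -
  have i: "integrable lborel (\<lambda>x. \<psi> x * p x)" "integrable lborel (\<lambda>x. \<psi>' x * p x)" "integrable lborel (\<lambda>x. \<psi> x * p' x)"
    using L2_mult_integrable[OF weight_one] L P by force+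
  have "(LINT x|lborel. \<psi>' x * p x + \<psi> x * p' x) = 0"
    by (rule integral_weak_deriv_eq_0[OF weak_deriv_mult_C1[OF w d c]]) (use i in auto)
  then show ?thesis using i by (simp add: inner_L2_def mult.commute)
qed

locale travelling_front =
  fixes T \<nu> b c Z :: real and f vh \<phi>1 \<phi>2 :: "real \<Rightarrow> real" and K \<eta> :: real
  assumes T_pos: "0 < T" and nu_pos: "0 < \<nu>" and b_pos: "0 < b" and Z_pos: "0 < Z"
    and f_deriv: "\<And>x. (f has_real_derivative deriv f x) (at x)" and f'_cont: "continuous_on UNIV (deriv f)"
    and eta_pos: "0 < \<eta>"
    and f_taylor: "\<And>u v. 0 \<le> v \<Longrightarrow> v \<le> 1 \<Longrightarrow> \<bar>f (u + v) - f v - deriv f v * u\<bar> \<le> \<eta> * (1 + \<bar>u\<bar>) * \<bar>u\<bar>\<^sup>2"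
    and f'_le: "\<And>v. 0 \<le> v \<Longrightarrow> v \<le> 1 \<Longrightarrow> \<bar>deriv f v\<bar> \<le> \<eta>"
    and vh_deriv: "\<And>x. (vh has_real_derivative deriv vh x) (at x)"
    and \<phi>_deriv: "\<And>x. (deriv vh has_real_derivative \<phi>1 x) (at x)"
    and \<phi>1_deriv: "\<And>x. (\<phi>1 has_real_derivative \<phi>2 x) (at x)" and \<phi>2_cont: "continuous_on UNIV \<phi>2"
    and vh_ge0: "\<And>x. 0 \<le> vh x" and vh_le1: "\<And>x. vh x \<le> 1" and \<phi>_nonneg: "\<And>x. 0 \<le> deriv vh x"
    and K_ge1: "1 \<le> K"
    and \<phi>1_le: "\<And>x. \<bar>\<phi>1 x\<bar> \<le> K * deriv vh x" and \<phi>2_le: "\<And>x. \<bar>\<phi>2 x\<bar> \<le> K * deriv vh x"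
    and \<phi>_harnack: "\<And>x h. deriv vh (x + h) \<le> exp (K * \<bar>h\<bar>) * deriv vh x"
    and \<phi>_L2: "deriv vh \<in> L2 (wgt \<nu> c Z 0)"
    and wave_eq: "\<And>x. c * \<phi>1 x = \<nu> * \<phi>2 x + b * (deriv f (vh x) * deriv vh x)"
begin

abbreviation "\<mu> \<equiv> wgt \<nu> c Z 0"
abbreviation "\<phi> \<equiv> deriv vh"

definition "\<kappa> = c / \<nu>"
definition "decay t = exp (- (c\<^sup>2 * t / \<nu>))"

lemma weight_\<mu>: "weight \<mu>" and weight_wgt_t: "weight (wgt \<nu> c Z t)"
  using weight_wgt Z_pos by auto

lemma mu_eq: "\<mu> x = 1 + Z * exp (- (\<kappa> * x))"
  by (simp add: wgt_def rho_def \<kappa>_def)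

lemma wgt_eq: "wgt \<nu> c Z t x = (1 - decay t) * 1 + decay t * \<mu> x"
proof -
  have "c / \<nu> * (x + c * t) = \<kappa> * x + c\<^sup>2 * t / \<nu>" by (simp add: \<kappa>_def algebra_simps power2_eq_square)
  then have "exp (- (c / \<nu>) * (x + c * t)) = exp (- (\<kappa> * x)) * decay t"
    by (simp add: decay_def flip: exp_add)
  then show ?thesis by (simp add: wgt_def rho_def mu_eq \<kappa>_def algebra_simps)
qed

lemma mu_ge1: "1 \<le> \<mu> x" using Z_pos by (simp add: mu_eq)

lemma decay: "0 < decay t" "0 \<le> t \<Longrightarrow> decay t \<le> 1"
  using nu_pos by (auto simp: decay_def)

lemma wgt_le_mu: "0 \<le> t \<Longrightarrow> wgt \<nu> c Z t x \<le> \<mu> x"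
proof -
  assume "0 \<le> t"
  then have "(1 - decay t) * 1 \<le> (1 - decay t) * \<mu> x" using decay mu_ge1 by (intro mult_left_mono) auto
  then show ?thesis unfolding wgt_eq[of t] by (simp add: algebra_simps)
qed

lemma wgt_ge1: "0 \<le> t \<Longrightarrow> 1 \<le> wgt \<nu> c Z t x"
  using Z_pos by (simp add: wgt_def rho_def)

definition "D = exp (c\<^sup>2 * T / \<nu>)"

lemma D_ge1: "1 \<le> D" using nu_pos T_pos by (simp add: D_def)

lemma mu_le_wgt:
  assumes "t \<in> {0..T}"
  shows "\<mu> x \<le> D\<^sup>2 * wgt \<nu> c Z t x"
proof -
  have "decay T \<le> decay t" using assms nu_pos by (simp add: decay_def divide_right_mono mult_left_mono)
  moreover have "D * decay T = 1" by (simp add: D_def decay_def flip: exp_add)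
  ultimately have "1 \<le> D * decay t" using D_ge1 mult_left_mono[of "decay T" "decay t" D] by simp
  then have 1: "\<mu> x \<le> (D * decay t) * \<mu> x" using mu_ge1[of x] by simp
  have "decay t * \<mu> x \<le> wgt \<nu> c Z t x" unfolding wgt_eq[of t] using decay[of t] assms by simp
  then have "D * (decay t * \<mu> x) \<le> D * wgt \<nu> c Z t x" using D_ge1 by (intro mult_left_mono) auto
  also have "\<dots> \<le> D\<^sup>2 * wgt \<nu> c Z t x"
    using D_ge1 wgt_ge1[of t x] assms by (intro mult_right_mono) (auto simp: power2_eq_square)
  finally show ?thesis using 1 by (simp add: mult.assoc)
qed

lemma L2_mu_imp_L2: "u \<in> L2 \<mu> \<Longrightarrow> u \<in> L2 (\<lambda>_. 1)"
  using L2_weight_mono(1)[OF weight_one weight_\<mu>] mu_ge1 by blast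

lemma mu_deriv: "(\<mu> has_real_derivative - \<kappa> * (Z * exp (- (\<kappa> * x)))) (at x)"
  unfolding mu_eq[abs_def] by (auto intro!: derivative_eq_intros)

text \<open>Bounded weights increasing to \<open>1 + \<rho>\<close> as \<open>j\<close> decreases to \<open>0\<close>.  Multiplying an element of
  \<open>H\<^sup>1(1 + \<rho>)\<close> by such a weight gives an element of the unweighted \<open>H\<^sup>1\<close>, which is a test function for
  the equations of both \<open>u\<close> and \<open>u\<^sub>0\<close>.\<close>

definition "wj j x = 1 + Z / (exp (\<kappa> * x) + j * Z)"
definition "wj' j x = - Z * (\<kappa> * exp (\<kappa> * x)) / (exp (\<kappa> * x) + j * Z)\<^sup>2"

lemma wj_regular:
  assumes j: "j > 0"
  shows "regular_weight (wj j) (wj' j) \<bar>\<kappa>\<bar> (1 + 1 / j)"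
proof
  have p: "exp (\<kappa> * x) + j * Z > 0" for x using j Z_pos by (simp add: add_pos_pos)
  show "(wj j has_real_derivative wj' j x) (at x)" for x
    unfolding wj_def[abs_def] wj'_def using p[of x]
    by (auto intro!: derivative_eq_intros simp: power2_eq_square)
  show "continuous_on UNIV (wj' j)"
    unfolding wj'_def[abs_def] using p by (intro continuous_intros) (auto simp: less_imp_neq[symmetric])
  show "1 \<le> wj j x" for x using p[of x] Z_pos by (simp add: wj_def)
  have "Z / (exp (\<kappa> * x) + j * Z) \<le> Z / (j * Z)" for x
    using j Z_pos by (intro divide_left_mono mult_pos_pos p) auto
  then show "wj j x \<le> 1 + 1 / j" for x using Z_pos by (simp add: wj_def)
  show "0 \<le> \<bar>\<kappa>\<bar>" by simp
  show "\<bar>wj' j x\<bar> \<le> \<bar>\<kappa>\<bar> * wj j x" for x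
  proof -
    have "exp (\<kappa> * x) / (exp (\<kappa> * x) + j * Z) \<le> 1" using p[of x] j Z_pos by simp
    then have "\<bar>\<kappa>\<bar> * (Z / (exp (\<kappa> * x) + j * Z)) * (exp (\<kappa> * x) / (exp (\<kappa> * x) + j * Z)) \<le> \<bar>\<kappa>\<bar> * (Z / (exp (\<kappa> * x) + j * Z)) * 1"
      using p[of x] Z_pos by (intro mult_left_mono) auto
    moreover have "\<bar>wj' j x\<bar> = \<bar>\<kappa>\<bar> * (Z / (exp (\<kappa> * x) + j * Z)) * (exp (\<kappa> * x) / (exp (\<kappa> * x) + j * Z))"
      using p[of x] Z_pos by (simp add: wj'_def abs_mult power2_eq_square)
    ultimately show ?thesis by (simp add: wj_def distrib_left)
  qed
qed

lemma wj_le_mu: "j > 0 \<Longrightarrow> wj j x \<le> \<mu> x"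
proof -
  assume "j > 0"
  then have "Z / (exp (\<kappa> * x) + j * Z) \<le> Z / exp (\<kappa> * x)"
    using Z_pos by (intro divide_left_mono mult_pos_pos add_pos_pos) auto
  then show ?thesis by (simp add: wj_def mu_eq exp_minus divide_inverse)
qed

lemma norm_mu_le_if_wj:
  assumes u: "u \<in> L2 \<mu>" and b: "\<And>j. j > 0 \<Longrightarrow> norm_L2 (wj j) u \<le> A" and A: "0 \<le> A"
  shows "norm_L2 \<mu> u \<le> A"
proof (rule power2_le_imp_le[OF _ A])
  define J where "J n = 1 / real (Suc n)" for n
  have J: "J n > 0" for n by (simp add: J_def)
  have w: "weight (wj (J n))" for n using regular_weight.weight_m[OF wj_regular[OF J]] .
  have [measurable]: "u \<in> borel_measurable borel" "\<mu> \<in> borel_measurable borel" "wj (J n) \<in> borel_measurable borel" for n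
    using u w weight_\<mu> by (auto simp: L2_def weight_def)
  have Jl: "J \<longlonglongrightarrow> 0" unfolding J_def[abs_def] by (rule LIMSEQ_Suc[OF lim_inverse_n'])
  have "(\<lambda>n. LINT x|lborel. (u x)\<^sup>2 * wj (J n) x) \<longlonglongrightarrow> (LINT x|lborel. (u x)\<^sup>2 * \<mu> x)"
  proof (rule integral_dominated_convergence[where w="\<lambda>x. (u x)\<^sup>2 * \<mu> x"])
    show "integrable lborel (\<lambda>x. (u x)\<^sup>2 * \<mu> x)" by (rule L2_D(2)[OF u])
    have "0 < wj (J n) x" for n x using w by (simp add: weight_def)
    then show "AE x in lborel. norm ((u x)\<^sup>2 * wj (J n) x) \<le> (u x)\<^sup>2 * \<mu> x" for n
      using wj_le_mu[OF J] by (auto intro!: mult_left_mono simp: abs_mult abs_of_pos)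
    have "(\<lambda>n. (u x)\<^sup>2 * wj (J n) x) \<longlonglongrightarrow> (u x)\<^sup>2 * (1 + Z / (exp (\<kappa> * x) + 0 * Z))" for x
      unfolding wj_def by (intro tendsto_intros Jl) simp
    then show "AE x in lborel. (\<lambda>n. (u x)\<^sup>2 * wj (J n) x) \<longlonglongrightarrow> (u x)\<^sup>2 * \<mu> x"
      by (simp add: mu_eq exp_minus divide_inverse)
  qed measurable
  then show "(norm_L2 \<mu> u)\<^sup>2 \<le> A\<^sup>2"
    unfolding norm_L2_sq[OF weight_\<mu>]
  proof (rule tendsto_upperbound)
    show "\<forall>\<^sub>F n in sequentially. (LINT x|lborel. (u x)\<^sup>2 * wj (J n) x) \<le> A\<^sup>2"
      unfolding norm_L2_sq[OF w, symmetric] using b[OF J] norm_L2_nonneg[OF w]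
      by (auto intro!: always_eventually power_mono)
  qed simp
qed

lemma H1_one_imp_H1_mu:
  assumes w: "weak_deriv \<psi> \<psi>'" and L: "\<psi> \<in> L2 (\<lambda>_. 1)" "\<psi>' \<in> L2 (\<lambda>_. 1)"
  shows "(\<lambda>x. \<psi> x * (1 / \<mu> x)) \<in> H1 \<mu>"
proof -
  define E where "E x = Z * exp (- (\<kappa> * x))" for x
  define i' where "i' x = \<kappa> * E x / (\<mu> x)\<^sup>2" for x
  have p: "0 < \<mu> x" for x using mu_ge1[of x] by linarith
  have E: "0 < E x" "E x \<le> \<mu> x" for x using Z_pos by (auto simp: E_def mu_eq)
  have d: "((\<lambda>x. 1 / \<mu> x) has_real_derivative i' x) (at x)" for x
    using DERIV_divide[OF DERIV_const[of 1] mu_deriv[of x]] p[of x]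
    by (simp add: i'_def E_def power2_eq_square less_imp_neq[symmetric])
  have cm: "continuous_on UNIV \<mu>" using mu_deriv DERIV_isCont continuous_at_imp_continuous_on by blast
  have ci: "continuous_on UNIV i'"
    unfolding i'_def[abs_def] E_def using p by (intro continuous_intros cm) (auto simp: less_imp_neq[symmetric])
  have [measurable]: "\<psi> \<in> borel_measurable borel" "\<psi>' \<in> borel_measurable borel" "i' \<in> borel_measurable borel"
     "\<mu> \<in> borel_measurable borel"
    using weak_deriv_measurable[OF w] ci weight_\<mu> by (auto intro: borel_measurable_continuous_onI simp: weight_def)
  have q: "(v x * (1 / \<mu> x))\<^sup>2 * \<mu> x \<le> 1\<^sup>2 * ((v x)\<^sup>2 * 1)" for v :: "real \<Rightarrow> real" and x
  proof -
    have "(v x * (1 / \<mu> x))\<^sup>2 * \<mu> x = (v x)\<^sup>2 * (1 / \<mu> x)"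
      using p[of x] by (simp add: power2_eq_square power_mult_distrib field_simps)
    also have "\<dots> \<le> (v x)\<^sup>2 * 1" using mu_ge1[of x] by (intro mult_left_mono) auto
    finally show ?thesis by simp
  qed
  have q2: "(\<psi> x * i' x)\<^sup>2 * \<mu> x \<le> \<bar>\<kappa>\<bar>\<^sup>2 * ((\<psi> x)\<^sup>2 * 1)" for x
  proof -
    have "\<bar>i' x\<bar> \<le> \<bar>\<kappa>\<bar> * (1 / \<mu> x)"
    proof -
      have "\<bar>\<kappa>\<bar> * E x \<le> \<bar>\<kappa>\<bar> * \<mu> x" using E by (intro mult_left_mono) auto
      then show ?thesis using p[of x] E(1)[of x]
        by (simp add: i'_def abs_mult power2_eq_square field_simps)
    qed
    then have "(i' x)\<^sup>2 \<le> (\<bar>\<kappa>\<bar> * (1 / \<mu> x))\<^sup>2" using power_mono[of "\<bar>i' x\<bar>" _ 2] by simp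
    then have "(\<psi> x * i' x)\<^sup>2 * \<mu> x \<le> ((\<psi> x)\<^sup>2 * (\<bar>\<kappa>\<bar> * (1 / \<mu> x))\<^sup>2) * \<mu> x"
      using p[of x] by (intro mult_right_mono) (auto simp: power_mult_distrib mult_left_mono)
    also have "\<dots> = \<bar>\<kappa>\<bar>\<^sup>2 * ((\<psi> x * (1 / \<mu> x))\<^sup>2 * \<mu> x)" by (simp add: power_mult_distrib power_divide mult_ac)
    also have "\<dots> \<le> \<bar>\<kappa>\<bar>\<^sup>2 * (1\<^sup>2 * ((\<psi> x)\<^sup>2 * 1))" by (rule mult_left_mono[OF q]) simp
    finally show ?thesis by simp
  qed
  have "(\<lambda>x. \<psi> x * (1 / \<mu> x)) \<in> L2 \<mu>"
    by (rule L2_dominated(1)[OF weight_\<mu> weight_one _ L(1), of _ 1]) (use q in auto)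
  moreover have "(\<lambda>x. \<psi>' x * (1 / \<mu> x)) \<in> L2 \<mu>"
    by (rule L2_dominated(1)[OF weight_\<mu> weight_one _ L(2), of _ 1]) (use q in auto)
  moreover have "(\<lambda>x. \<psi> x * i' x) \<in> L2 \<mu>"
    by (rule L2_dominated(1)[OF weight_\<mu> weight_one _ L(1), of _ "\<bar>\<kappa>\<bar>"]) (use q2 in auto)
  ultimately show ?thesis
    using H1_I[OF _ L2_add[OF weight_\<mu>] weak_deriv_mult_C1[OF w d ci]] by blast
qed

lemma continuous_wave: "continuous_on A vh" "continuous_on A \<phi>" "continuous_on A \<phi>1" "continuous_on A \<phi>2"
  by (rule DERIV_continuous_on[OF has_field_derivative_at_within], rule vh_deriv \<phi>_deriv \<phi>1_deriv)+
    (rule continuous_on_subset[OF \<phi>2_cont], simp)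

lemma wave_measurable [measurable]: "vh \<in> borel_measurable borel" "\<phi> \<in> borel_measurable borel"
   "\<phi>1 \<in> borel_measurable borel" "\<phi>2 \<in> borel_measurable borel"
  using continuous_wave by (auto intro: borel_measurable_continuous_onI)

lemma f_measurable [measurable]: "f \<in> borel_measurable borel" "deriv f \<in> borel_measurable borel"
proof -
  have "continuous_on UNIV f" using f_deriv by (auto intro: DERIV_continuous_on has_field_derivative_at_within)
  then show "f \<in> borel_measurable borel" "deriv f \<in> borel_measurable borel"
    using f'_cont by (auto intro: borel_measurable_continuous_onI)
qed

lemma L2_le_phi:
  assumes "g \<in> borel_measurable borel" "\<And>x. \<bar>g x\<bar> \<le> A * \<phi> x" "0 \<le> A"
  shows "g \<in> L2 \<mu>" "norm_L2 \<mu> g \<le> A * norm_L2 \<mu> \<phi>"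
  using L2_dominated_same[OF weight_\<mu> assms(1) \<phi>_L2 assms(3)] assms(2) \<phi>_nonneg by auto

lemma shift_le_phi:
  assumes "\<And>x. \<bar>g x\<bar> \<le> A * \<phi> x" "0 \<le> A" "\<bar>y\<bar> \<le> Y"
  shows "\<bar>g (x + y)\<bar> \<le> A * exp (K * Y) * \<phi> x"
proof -
  have "\<phi> (x + y) \<le> exp (K * \<bar>y\<bar>) * \<phi> x" by (rule \<phi>_harnack)
  also have "\<dots> \<le> exp (K * Y) * \<phi> x"
    using assms(3) K_ge1 \<phi>_nonneg by (intro mult_right_mono) auto
  finally have "A * \<phi> (x + y) \<le> A * (exp (K * Y) * \<phi> x)" using assms(2) by (rule mult_left_mono)
  then show ?thesis using assms(1)[of "x + y"] by simp
qed

lemma C_L2_wave_shift: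
  assumes d: "\<And>x. (g has_real_derivative g' x) (at x)" and b: "\<And>x. \<bar>g' x\<bar> \<le> K * \<phi> x"
    and y: "continuous_on {0..T} y"
  shows "C_L2 T \<mu> (\<lambda>t x. g (x + y t) - g x)"
proof -
  have cg: "continuous_on UNIV g" using d by (auto intro: DERIV_continuous_on has_field_derivative_at_within)
  have [measurable]: "g \<in> borel_measurable borel" by (rule borel_measurable_continuous_onI[OF cg])
  have "bounded (y ` {0..T})" by (intro compact_imp_bounded compact_continuous_image y compact_Icc)
  then obtain Y0 where Y0: "\<And>t. t \<in> {0..T} \<Longrightarrow> \<bar>y t\<bar> \<le> Y0" by (force simp: bounded_iff)
  define Y where "Y = \<bar>Y0\<bar>"
  have Y: "\<bar>y t\<bar> \<le> Y" if "t \<in> {0..T}" for t using Y0[OF that] by (simp add: Y_def)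
  have K0: "0 \<le> K" using K_ge1 by simp
  have B: "\<bar>g (x + y s) - g (x + y t)\<bar> \<le> (K * exp (K * (2 * Y)) * exp (K * Y)) * \<bar>y s - y t\<bar> * \<phi> x"
    if st: "s \<in> {0..T}" "t \<in> {0..T}" for s t x
  proof -
    have "\<bar>g ((x + y t) + (y s - y t)) - g (x + y t)\<bar> \<le> K * \<bar>y s - y t\<bar> * exp (K * \<bar>y s - y t\<bar>) * \<phi> (x + y t)"
      by (rule shift_bound[OF d b \<phi>_harnack K0 K0 \<phi>_nonneg])
    also have "\<dots> \<le> K * \<bar>y s - y t\<bar> * exp (K * (2 * Y)) * (1 * exp (K * Y) * \<phi> x)"
    proof (rule mult_mono)
      have "\<bar>y s - y t\<bar> \<le> 2 * Y" using Y[OF st(1)] Y[OF st(2)] by linarith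
      then show "K * \<bar>y s - y t\<bar> * exp (K * \<bar>y s - y t\<bar>) \<le> K * \<bar>y s - y t\<bar> * exp (K * (2 * Y))"
        using K0 by (intro mult_left_mono) (auto simp: mult_left_mono)
      show "\<phi> (x + y t) \<le> 1 * exp (K * Y) * \<phi> x"
        using shift_le_phi[of \<phi> 1 "y t" Y x] Y[OF st(2)] \<phi>_nonneg by simp
    qed (use K0 \<phi>_nonneg in auto)
    finally show ?thesis by (simp add: mult_ac)
  qed
  show ?thesis
  proof (rule C_L2_dominated[OF weight_\<mu> _ \<phi>_L2 _ _ y])
    show "0 \<le> K * exp (K * (2 * Y)) * exp (K * Y)" using K0 by simp
    show "\<bar>g (x + y s) - g x - (g (x + y t) - g x)\<bar> \<le> (K * exp (K * (2 * Y)) * exp (K * Y)) * \<bar>y s - y t\<bar> * \<bar>\<phi> x\<bar>"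
      if "s \<in> {0..T}" "t \<in> {0..T}" for s t x
      using B[OF that] \<phi>_nonneg by simp
    show "(\<lambda>x. g (x + y t) - g x) \<in> L2 \<mu>" if t: "t \<in> {0..T}" for t
    proof (rule L2_le_phi(1))
      show "\<bar>g (x + y t) - g x\<bar> \<le> (K * \<bar>y t\<bar> * exp (K * \<bar>y t\<bar>)) * \<phi> x" for x
        by (rule shift_bound[OF d b \<phi>_harnack K0 K0 \<phi>_nonneg])
    qed (use K0 in auto)
  qed
qed

lemma \<phi>1_L2: "\<phi>1 \<in> L2 \<mu>" and \<phi>2_L2: "\<phi>2 \<in> L2 \<mu>"
  using L2_le_phi(1)[OF _ \<phi>1_le] L2_le_phi(1)[OF _ \<phi>2_le] K_ge1 by auto

lemma C_L2_\<phi>: "C_L2 T \<mu> (\<lambda>t x. \<phi> (x + c * t))" and C_L2_\<phi>1: "C_L2 T \<mu> (\<lambda>t x. \<phi>1 (x + c * t))"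
proof -
  have y: "continuous_on {0..T} (\<lambda>t. c * t)" by (intro continuous_intros)
  show "C_L2 T \<mu> (\<lambda>t x. \<phi> (x + c * t))"
    using C_L2_lincomb[OF weight_\<mu> C_L2_wave_shift[OF \<phi>_deriv \<phi>1_le y] C_L2_const[OF \<phi>_L2] continuous_on_const, of 1 1] by simp
  show "C_L2 T \<mu> (\<lambda>t x. \<phi>1 (x + c * t))"
    using C_L2_lincomb[OF weight_\<mu> C_L2_wave_shift[OF \<phi>1_deriv \<phi>2_le y] C_L2_const[OF \<phi>1_L2] continuous_on_const, of 1 1] by simp
qed

lemma C_L2_mu_imp_one: "C_L2 T \<mu> h \<Longrightarrow> C_L2 T (\<lambda>_. 1) h"
  using C_L2_weight_mono[OF weight_one weight_\<mu>] mu_ge1 by blast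

lemma norm_wgt_sq:
  assumes "u \<in> L2 \<mu>"
  shows "(norm_L2 (wgt \<nu> c Z t) u)\<^sup>2 = (1 - decay t) * (norm_L2 (\<lambda>_. 1) u)\<^sup>2 + decay t * (norm_L2 \<mu> u)\<^sup>2"
proof -
  have "(LINT x|lborel. (u x)\<^sup>2 * wgt \<nu> c Z t x) = (LINT x|lborel. (1 - decay t) * ((u x)\<^sup>2 * 1) + decay t * ((u x)\<^sup>2 * \<mu> x))"
    by (rule Bochner_Integration.integral_cong) (auto simp: wgt_eq[of t] algebra_simps)
  also have "\<dots> = (1 - decay t) * (LINT x|lborel. (u x)\<^sup>2 * 1) + decay t * (LINT x|lborel. (u x)\<^sup>2 * \<mu> x)"
    using L2_D(2)[OF assms] L2_D(2)[OF L2_mu_imp_L2[OF assms]] by simp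
  finally show ?thesis using norm_L2_sq[OF weight_wgt_t] norm_L2_sq[OF weight_one] norm_L2_sq[OF weight_\<mu>] by simp
qed

lemma continuous_norm_H1_wgt:
  assumes U: "C_H1 T \<mu> U"
  shows "continuous_on {0..T} (\<lambda>t. norm_H1 (wgt \<nu> c Z t) (U t))"
proof -
  note d = C_H1_D[OF weight_\<mu> U]
  have cd: "continuous_on {0..T} decay" unfolding decay_def[abs_def] using nu_pos by (intro continuous_intros) auto
  have c: "continuous_on {0..T} (\<lambda>t. (norm_L2 (wgt \<nu> c Z t) (h t))\<^sup>2)" if h: "C_L2 T \<mu> h" for h
  proof -
    have "continuous_on {0..T} (\<lambda>t. (1 - decay t) * (norm_L2 (\<lambda>_. 1) (h t))\<^sup>2 + decay t * (norm_L2 \<mu> (h t))\<^sup>2)"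
      by (intro continuous_intros cd C_L2_norm_continuous[OF weight_\<mu> h] C_L2_norm_continuous[OF weight_one C_L2_mu_imp_one[OF h]])
    then show ?thesis by (rule continuous_on_eq) (rule norm_wgt_sq[symmetric, OF C_L2_D(1)[OF h]])
  qed
  show ?thesis unfolding norm_H1_def
    by (intro continuous_on_real_sqrt continuous_on_add c d)
qed

end

section \<open>Cancellation of the noise\<close>

lemma has_real_derivative_quadratic:
  fixes P :: "real \<Rightarrow> real"
  assumes "\<And>s. s \<in> S \<Longrightarrow> \<bar>P s - P t - (s - t) * q\<bar> \<le> M * (s - t)\<^sup>2"
  shows "(P has_real_derivative q) (at t within S)"
  unfolding has_field_derivative_iff
proof (rule LIM_zero_cancel, rule Lim_null_comparison)
  have "((\<lambda>s. M * \<bar>s - t\<bar>) \<longlongrightarrow> M * \<bar>t - t\<bar>) (at t within S)" by (intro tendsto_intros)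
  then show "((\<lambda>s. M * \<bar>s - t\<bar>) \<longlongrightarrow> 0) (at t within S)" by simp
  have "\<bar>(P s - P t) / (s - t) - q\<bar> \<le> M * \<bar>s - t\<bar>" if "s \<in> S" "s \<noteq> t" for s
  proof -
    have "(P s - P t) / (s - t) - q = (P s - P t - (s - t) * q) / (s - t)"
      using that by (simp add: field_simps)
    then have "\<bar>(P s - P t) / (s - t) - q\<bar> = \<bar>P s - P t - (s - t) * q\<bar> / \<bar>s - t\<bar>" by simp
    also have "\<dots> \<le> M * (s - t)\<^sup>2 / \<bar>s - t\<bar>" using assms[OF that(1)] by (intro divide_right_mono) auto
    also have "\<dots> = M * \<bar>s - t\<bar>"
    proof -
      define d where "d = \<bar>s - t\<bar>"
      have "d > 0" "(s - t)\<^sup>2 = d\<^sup>2" using that by (auto simp: d_def)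
      then show ?thesis unfolding d_def[symmetric] by (simp add: power2_eq_square)
    qed
    finally show ?thesis .
  qed
  then show "\<forall>\<^sub>F s in at t within S. norm ((P s - P t) / (s - t) - q) \<le> M * \<bar>s - t\<bar>"
    by (auto simp: eventually_at_filter)
qed

lemma parabolic_const0_mono:
  assumes "\<nu> > 0" "0 \<le> a" "0 \<le> s" "s \<le> t"
  shows "parabolic_const0 \<nu> k a s \<le> parabolic_const0 \<nu> k a t"
proof -
  have c: "0 \<le> energy_const1 \<nu> k a" "0 \<le> energy_const2 \<nu>"
    using assms by (auto simp: energy_const1_def energy_const2_def)
  show ?thesis unfolding parabolic_const0_def
    by (intro real_sqrt_le_mono mult_right_mono mult_mono) (use assms c mult_left_mono[of s t] in auto)
qed

lemma parabolic_const_mono: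
  assumes "\<nu> > 0" "0 \<le> a" "0 \<le> s" "s \<le> t" "0 \<le> k"
  shows "parabolic_const \<nu> k a s \<le> parabolic_const \<nu> k a t"
  unfolding parabolic_const_def
  by (intro add_mono mult_mono mult_left_mono parabolic_const0_mono)
    (use assms parabolic_const0_nonneg in \<open>auto intro!: mult_nonneg_nonneg add_nonneg_nonneg\<close>)

lemma parabolic_const_nonneg:
  "\<nu> > 0 \<Longrightarrow> 0 \<le> a \<Longrightarrow> 0 \<le> t \<Longrightarrow> 0 \<le> k \<Longrightarrow> 0 \<le> parabolic_const \<nu> k a t"
  unfolding parabolic_const_def using parabolic_const0_nonneg
  by (auto intro!: add_nonneg_nonneg mult_nonneg_nonneg)

lemma parabolic_const_0: "parabolic_const \<nu> k a 0 = 0"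
  by (simp add: parabolic_const_def parabolic_const0_def)

lemma set_integral_deriv:
  fixes c0 :: "real \<Rightarrow> real"
  assumes c0: "continuous_on {0..T} c0" and t: "t \<in> {0..T}"
  shows "((\<lambda>t. LINT s:{0..t}|lborel. c0 s) has_real_derivative c0 t) (at t within {0..T})"
proof (rule has_field_derivative_transform_within[where d=1 and f="\<lambda>t. integral {0..t} c0"])
  show "((\<lambda>t. integral {0..t} c0) has_real_derivative c0 t) (at t within {0..T})"
    by (rule integral_has_real_derivative[OF c0 t])
  show "integral {0..s} c0 = (LINT s:{0..s}|lborel. c0 s)" if "s \<in> {0..T}" for s
    by (rule set_borel_integral_eq_integral(2)[symmetric, OF borel_integrable_atLeastAtMost'[OF continuous_on_subset[OF c0]]])
      (use that in auto)
qed (use t in auto)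

lemma set_integral_continuous:
  fixes c0 :: "real \<Rightarrow> real"
  assumes "continuous_on {0..T} c0"
  shows "continuous_on {0..T} (\<lambda>t. LINT s:{0..t}|lborel. c0 s)"
  by (rule DERIV_continuous_on[OF set_integral_deriv[OF assms]])

context travelling_front
begin

definition "parabolic_K t = parabolic_const \<nu> \<bar>\<kappa>\<bar> (b * \<eta>) t"

definition "source_bound \<theta> = b * (2 * \<eta> * D * (1 + 2 * \<theta>) * \<theta>\<^sup>2)"

definition "remainder_K \<theta> = 2 * (parabolic_K T * (b * (2 * \<eta> * D * (1 + 2 * \<theta>))) +
  K * exp (K * \<theta>) * exp (K * (\<bar>c\<bar> * T)) * norm_L2 \<mu> \<phi>)"

lemma parabolic_K_nonneg: "0 \<le> t \<Longrightarrow> 0 \<le> parabolic_K t"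
  unfolding parabolic_K_def using nu_pos b_pos eta_pos by (intro parabolic_const_nonneg) auto

lemma parabolic_K_mono: "0 \<le> s \<Longrightarrow> s \<le> t \<Longrightarrow> parabolic_K s \<le> parabolic_K t"
  unfolding parabolic_K_def using nu_pos b_pos eta_pos by (intro parabolic_const_mono) auto

lemma parabolic_K_0: "parabolic_K 0 = 0"
  by (simp add: parabolic_K_def parabolic_const_0)

end

locale front_path = travelling_front +
  fixes \<epsilon> :: real and U V Wp :: "real \<Rightarrow> real \<Rightarrow> real" and c0 :: "real \<Rightarrow> real" and \<eta>0 :: "real \<Rightarrow> real"
  assumes eps_pos: "0 < \<epsilon>" and U: "C_H1 T (wgt \<nu> c Z 0) U" and V: "C_H1 T (wgt \<nu> c Z 0) V"
    and c0: "continuous_on {0..T} c0"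
    and eqU: "\<And>h. h \<in> H1 (wgt \<nu> c Z 0) \<Longrightarrow>
      set_integrable lborel {0..T} (\<lambda>s. \<nu> * laplace_pairing (wgt \<nu> c Z 0) (U s) h
        + b * inner_L2 (wgt \<nu> c Z 0) (\<lambda>x. f (U s x + vh (x + c * s)) - f (vh (x + c * s))) h) \<and>
      (\<forall>t\<in>{0..T}. inner_L2 (wgt \<nu> c Z 0) (U t) h = inner_L2 (wgt \<nu> c Z 0) (\<lambda>x. \<epsilon> * \<eta>0 x) h +
        (LINT s:{0..t}|lborel. \<nu> * laplace_pairing (wgt \<nu> c Z 0) (U s) h
          + b * inner_L2 (wgt \<nu> c Z 0) (\<lambda>x. f (U s x + vh (x + c * s)) - f (vh (x + c * s))) h)
        + \<epsilon> * inner_L2 (wgt \<nu> c Z 0) (Wp t) h)"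
    and eqV: "\<And>h. h \<in> H1 (\<lambda>_. 1) \<Longrightarrow>
      set_integrable lborel {0..T} (\<lambda>s. \<nu> * laplace_pairing (\<lambda>_. 1) (V s) h
        + b * inner_L2 (\<lambda>_. 1) (\<lambda>x. deriv f (vh (x + c * s)) * V s x) h
        - c0 s * inner_L2 (\<lambda>_. 1) (\<lambda>x. deriv vh (x + c * s)) h) \<and>
      (\<forall>t\<in>{0..T}. inner_L2 (\<lambda>_. 1) (V t) h = inner_L2 (\<lambda>_. 1) \<eta>0 h +
        (LINT s:{0..t}|lborel. \<nu> * laplace_pairing (\<lambda>_. 1) (V s) h
          + b * inner_L2 (\<lambda>_. 1) (\<lambda>x. deriv f (vh (x + c * s)) * V s x) h
          - c0 s * inner_L2 (\<lambda>_. 1) (\<lambda>x. deriv vh (x + c * s)) h)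
        + 1 * inner_L2 (\<lambda>_. 1) (Wp t) h)"
begin

definition "C t = (LINT s:{0..t}|lborel. c0 s)"
definition "w t x = 1 * (1 * U t x + (- \<epsilon>) * V t x) + (- (\<epsilon> * C t)) * \<phi> (x + c * t)"
definition "w' t x = 1 * (1 * wderiv (U t) x + (- \<epsilon>) * wderiv (V t) x) + (- (\<epsilon> * C t)) * \<phi>1 (x + c * t)"
definition "R t x = f (U t x + vh (x + c * t)) - f (vh (x + c * t)) - deriv f (vh (x + c * t)) * U t x"
definition "g t x = b * R t x + b * (deriv f (vh (x + c * t)) * w t x)"

lemma C_deriv: "t \<in> {0..T} \<Longrightarrow> (C has_real_derivative c0 t) (at t within {0..T})"
  unfolding C_def[abs_def] by (rule set_integral_deriv[OF c0])

lemma C_cont: "continuous_on {0..T} C"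
  by (rule DERIV_continuous_on[OF C_deriv])

lemma C_0: "C 0 = 0"
proof -
  have "set_integrable lborel {0..0} c0"
    by (rule borel_integrable_atLeastAtMost'[OF continuous_on_subset[OF c0]]) (use T_pos in auto)
  then show ?thesis by (simp add: C_def set_borel_integral_eq_integral(2))
qed

lemmas U_D = C_H1_D[OF weight_\<mu> U]
lemmas V_D = C_H1_D[OF weight_\<mu> V]

lemma w_C: "C_L2 T \<mu> w" "C_L2 T \<mu> w'"
  unfolding w_def[abs_def] w'_def[abs_def]
  by (intro C_L2_lincomb weight_\<mu> U_D V_D C_L2_\<phi> C_L2_\<phi>1 continuous_intros C_cont)+

lemma w_weak_deriv:
  assumes "t \<in> {0..T}"
  shows "weak_deriv (w t) (w' t)"
proof -
  have "indef_integral (\<lambda>x. \<phi> (x + c * t)) (\<lambda>x. \<phi>1 (x + c * t))"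
  proof (rule indef_integral_C1)
    have "((\<lambda>x. \<phi> (x + c * t)) has_real_derivative \<phi>1 (x + c * t) * 1) (at x)" for x
      by (rule DERIV_chain2[OF \<phi>_deriv]) (auto intro!: derivative_eq_intros)
    then show "((\<lambda>x. \<phi> (x + c * t)) has_real_derivative \<phi>1 (x + c * t)) (at x)" for x by simp
    show "continuous_on UNIV (\<lambda>x. \<phi>1 (x + c * t))"
      by (rule continuous_on_compose2[OF continuous_wave(3)[of UNIV]]) (auto intro: continuous_intros)
  qed
  then show ?thesis unfolding w_def[abs_def] w'_def[abs_def]
    by (intro weak_deriv_lincomb U_D V_D assms indef_integral_imp_weak_deriv)
qed

lemma f'_mult_L2:
  assumes "u \<in> L2 m" "weight m"
  shows "(\<lambda>x. deriv f (vh (x + y)) * u x) \<in> L2 m" "norm_L2 m (\<lambda>x. deriv f (vh (x + y)) * u x) \<le> \<eta> * norm_L2 m u"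
proof -
  have [measurable]: "u \<in> borel_measurable borel" using assms by (simp add: L2_def)
  have "\<bar>deriv f (vh (x + y)) * u x\<bar> \<le> \<eta> * \<bar>u x\<bar>" for x
    unfolding abs_mult by (intro mult_right_mono f'_le vh_ge0 vh_le1) simp
  then show "(\<lambda>x. deriv f (vh (x + y)) * u x) \<in> L2 m" "norm_L2 m (\<lambda>x. deriv f (vh (x + y)) * u x) \<le> \<eta> * norm_L2 m u"
    using L2_dominated_same[OF assms(2) _ assms(1), of "\<lambda>x. deriv f (vh (x + y)) * u x" \<eta>] eta_pos by auto
qed

lemma R_bound:
  assumes t: "t \<in> {0..T}" and \<theta>: "norm_H1 (wgt \<nu> c Z t) (U t) \<le> \<theta>"
  shows "R t \<in> L2 \<mu>" "norm_L2 \<mu> (R t) \<le> 2 * \<eta> * D * (1 + 2 * \<theta>) * \<theta>\<^sup>2"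
proof -
  note UL = C_L2_D(1)[OF U_D(1) t] C_L2_D(1)[OF U_D(2) t] U_D(3)[OF t]
  have [measurable]: "U t \<in> borel_measurable borel" using UL(1) by (simp add: L2_def)
  have t0: "0 \<le> t" using t by simp
  have le: "\<And>x. 1 \<le> wgt \<nu> c Z t x" by (rule wgt_ge1[OF t0])
  have Uw: "U t \<in> L2 (wgt \<nu> c Z t)" "wderiv (U t) \<in> L2 (wgt \<nu> c Z t)"
    using L2_weight_mono(1)[OF weight_wgt_t weight_\<mu> wgt_le_mu[OF t0]] UL by auto
  have "norm_H1 (\<lambda>_. 1) (U t) \<le> norm_H1 (wgt \<nu> c Z t) (U t)"
    unfolding norm_H1_def
    by (intro real_sqrt_le_mono add_mono power_mono L2_weight_mono(2)[OF weight_one weight_wgt_t le] Uw norm_L2_nonneg[OF weight_one])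
  then have sup: "AE x in lborel. \<bar>U t x\<bar> \<le> 2 * \<theta>"
    using H1_sup_bound[OF UL(3) UL(1,2)[THEN L2_mu_imp_L2]] \<theta> by (auto elim!: eventually_mono)
  have \<theta>0: "0 \<le> \<theta>" using \<theta> norm_H1_bounds(1)[OF weight_wgt_t UL(3)] norm_L2_nonneg[OF weight_wgt_t] by (meson order_trans)
  have Rb: "AE x in lborel. \<bar>R t x\<bar> \<le> (\<eta> * (1 + 2 * \<theta>) * (2 * \<theta>)) * \<bar>U t x\<bar>"
    using sup
  proof eventually_elim
    case (elim x)
    have "\<bar>R t x\<bar> \<le> \<eta> * (1 + \<bar>U t x\<bar>) * \<bar>U t x\<bar>\<^sup>2"
      unfolding R_def by (rule f_taylor[OF vh_ge0 vh_le1])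
    also have "\<dots> = \<eta> * (1 + \<bar>U t x\<bar>) * \<bar>U t x\<bar> * \<bar>U t x\<bar>" by (simp add: power2_eq_square)
    also have "\<dots> \<le> (\<eta> * (1 + 2 * \<theta>) * (2 * \<theta>)) * \<bar>U t x\<bar>"
      using elim eta_pos \<theta>0 by (intro mult_right_mono mult_mono mult_left_mono) auto
    finally show ?case .
  qed
  have [measurable]: "R t \<in> borel_measurable borel" unfolding R_def[abs_def] by measurable
  have c: "0 \<le> \<eta> * (1 + 2 * \<theta>) * (2 * \<theta>)" using eta_pos \<theta>0 by simp
  show "R t \<in> L2 \<mu>" by (rule L2_dominated_same(1)[OF weight_\<mu> _ UL(1) c Rb]) simp
  have "norm_L2 \<mu> (R t) \<le> (\<eta> * (1 + 2 * \<theta>) * (2 * \<theta>)) * norm_L2 \<mu> (U t)"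
    by (rule L2_dominated_same(2)[OF weight_\<mu> _ UL(1) c Rb]) simp
  also have "\<dots> \<le> (\<eta> * (1 + 2 * \<theta>) * (2 * \<theta>)) * (D * \<theta>)"
  proof (rule mult_left_mono[OF _ c])
    have "norm_L2 \<mu> (U t) \<le> D * norm_L2 (wgt \<nu> c Z t) (U t)"
      by (rule L2_dominated(2)[OF weight_\<mu> weight_wgt_t _ Uw(1)])
        (use mu_le_wgt[OF t] D_ge1 in \<open>auto simp: mult.left_commute intro!: mult_left_mono\<close>)
    also have "\<dots> \<le> D * \<theta>"
      by (rule mult_left_mono[OF order_trans[OF norm_H1_bounds(1)[OF weight_wgt_t UL(3)] \<theta>]]) (use D_ge1 in simp)
    finally show "norm_L2 \<mu> (U t) \<le> D * \<theta>" .
  qed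
  also have "\<dots> = 2 * \<eta> * D * (1 + 2 * \<theta>) * \<theta>\<^sup>2" by (simp add: power2_eq_square mult_ac)
  finally show "norm_L2 \<mu> (R t) \<le> 2 * \<eta> * D * (1 + 2 * \<theta>) * \<theta>\<^sup>2" .
qed

lemma R_L2: "t \<in> {0..T} \<Longrightarrow> R t \<in> L2 \<mu>"
  using R_bound(1) by blast

lemma g_L2: "t \<in> {0..T} \<Longrightarrow> g t \<in> L2 \<mu>"
  unfolding g_def[abs_def]
  by (intro L2_lincomb weight_\<mu> R_L2 f'_mult_L2 C_L2_D(1)[OF w_C(1)])

lemma phase_derivative:
  assumes \<psi>: "\<psi> \<in> L2 (\<lambda>_. 1)" and t: "t \<in> {0..T}"
  shows "((\<lambda>t. inner_L2 (\<lambda>_. 1) (\<lambda>x. \<phi> (x + c * t)) \<psi>) has_real_derivative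
    c * inner_L2 (\<lambda>_. 1) (\<lambda>x. \<phi>1 (x + c * t)) \<psi>) (at t within {0..T})"
proof (rule has_real_derivative_quadratic)
  fix s assume s: "s \<in> {0..T}"
  have K0: "0 \<le> K" using K_ge1 by simp
  note p = C_L2_D(1)[OF C_L2_\<phi>, THEN L2_mu_imp_L2] C_L2_D(1)[OF C_L2_\<phi>1, THEN L2_mu_imp_L2]
  define h where "h = c * (s - t)"
  define q where "q x = 1 * (1 * \<phi> (x + c * s) + (-1) * \<phi> (x + c * t)) + (- h) * \<phi>1 (x + c * t)" for x
  have d: "(\<lambda>x. 1 * \<phi> (x + c * s) + (-1) * \<phi> (x + c * t)) \<in> L2 (\<lambda>_. 1)"
    by (intro L2_lincomb weight_one p s t)
  have q1: "q \<in> L2 (\<lambda>_. 1)" unfolding q_def[abs_def] by (intro L2_lincomb weight_one p s t)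
  have "inner_L2 (\<lambda>_. 1) q \<psi> = inner_L2 (\<lambda>_. 1) (\<lambda>x. \<phi> (x + c * s)) \<psi> - inner_L2 (\<lambda>_. 1) (\<lambda>x. \<phi> (x + c * t)) \<psi>
     - (s - t) * (c * inner_L2 (\<lambda>_. 1) (\<lambda>x. \<phi>1 (x + c * t)) \<psi>)"
    unfolding q_def[abs_def] inner_L2_lincomb[OF weight_one d p(2)[OF t] \<psi>] inner_L2_lincomb[OF weight_one p(1)[OF s] p(1)[OF t] \<psi>]
    by (simp add: h_def)
  moreover have "\<bar>inner_L2 (\<lambda>_. 1) q \<psi>\<bar> \<le> norm_L2 (\<lambda>_. 1) q * norm_L2 (\<lambda>_. 1) \<psi>"
    by (rule L2_Cauchy_Schwarz[OF weight_one q1 \<psi>])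
  moreover have "norm_L2 (\<lambda>_. 1) q \<le> (K * h\<^sup>2 * exp (K * (\<bar>c\<bar> * T)) * exp (K * (\<bar>c\<bar> * T))) * norm_L2 (\<lambda>_. 1) \<phi>"
  proof (rule L2_dominated_same(2)[OF weight_one L2_D(1)[OF q1] L2_mu_imp_L2[OF \<phi>_L2]])
    have hb: "\<bar>h\<bar> \<le> \<bar>c\<bar> * T" using s t unfolding h_def abs_mult by (intro mult_left_mono) auto
    have cb: "\<bar>c * t\<bar> \<le> \<bar>c\<bar> * T" using t unfolding abs_mult by (intro mult_left_mono) auto
    have "\<bar>q x\<bar> \<le> (K * h\<^sup>2 * exp (K * (\<bar>c\<bar> * T)) * exp (K * (\<bar>c\<bar> * T))) * \<bar>\<phi> x\<bar>" for x
    proof -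
      have "\<bar>\<phi> ((x + c * t) + h) - \<phi> (x + c * t) - h * \<phi>1 (x + c * t)\<bar> \<le> K * h\<^sup>2 * exp (K * \<bar>h\<bar>) * \<phi> (x + c * t)"
        by (rule taylor_shift_bound[OF \<phi>_deriv \<phi>1_deriv \<phi>2_le \<phi>_harnack K0 K0 \<phi>_nonneg])
      also have "\<dots> \<le> K * h\<^sup>2 * exp (K * (\<bar>c\<bar> * T)) * (1 * exp (K * (\<bar>c\<bar> * T)) * \<phi> x)"
        using shift_le_phi[of \<phi> 1, OF _ _ cb, of x] \<phi>_nonneg mult_left_mono[OF hb K0] K0
        by (intro mult_mono) auto
      finally show ?thesis using \<phi>_nonneg[of x] by (simp add: q_def h_def algebra_simps)
    qed
    then show "AE x in lborel. \<bar>q x\<bar> \<le> (K * h\<^sup>2 * exp (K * (\<bar>c\<bar> * T)) * exp (K * (\<bar>c\<bar> * T))) * \<bar>\<phi> x\<bar>" by simp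
  qed (use K0 in auto)
  ultimately have "\<bar>inner_L2 (\<lambda>_. 1) (\<lambda>x. \<phi> (x + c * s)) \<psi> - inner_L2 (\<lambda>_. 1) (\<lambda>x. \<phi> (x + c * t)) \<psi>
     - (s - t) * (c * inner_L2 (\<lambda>_. 1) (\<lambda>x. \<phi>1 (x + c * t)) \<psi>)\<bar>
    \<le> (K * h\<^sup>2 * exp (K * (\<bar>c\<bar> * T)) * exp (K * (\<bar>c\<bar> * T))) * norm_L2 (\<lambda>_. 1) \<phi> * norm_L2 (\<lambda>_. 1) \<psi>"
    using mult_right_mono[OF _ norm_L2_nonneg[OF weight_one, of \<psi>]] by (metis order_trans)
  then show "\<bar>inner_L2 (\<lambda>_. 1) (\<lambda>x. \<phi> (x + c * s)) \<psi> - inner_L2 (\<lambda>_. 1) (\<lambda>x. \<phi> (x + c * t)) \<psi>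
     - (s - t) * (c * inner_L2 (\<lambda>_. 1) (\<lambda>x. \<phi>1 (x + c * t)) \<psi>)\<bar>
    \<le> (K * c\<^sup>2 * exp (K * (\<bar>c\<bar> * T)) * exp (K * (\<bar>c\<bar> * T)) * norm_L2 (\<lambda>_. 1) \<phi> * norm_L2 (\<lambda>_. 1) \<psi>) * (s - t)\<^sup>2"
    by (simp add: h_def power_mult_distrib mult_ac)
qed

text \<open>The noise and the term \<open>c0\<close> cancel: \<open>w\<close> solves a linear parabolic equation whose source is
  quadratic in \<open>U\<close>.\<close>

lemma w_equation:
  assumes \<psi>: "weak_deriv \<psi> \<psi>'" "\<psi> \<in> L2 (\<lambda>_. 1)" "\<psi>' \<in> L2 (\<lambda>_. 1)"
  shows "set_integrable lborel {0..T} (\<lambda>r. - \<nu> * inner_L2 (\<lambda>_. 1) (w' r) \<psi>' + inner_L2 (\<lambda>_. 1) (g r) \<psi>)"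
    "\<And>t. t \<in> {0..T} \<Longrightarrow> inner_L2 (\<lambda>_. 1) (w t) \<psi> =
        (LINT r:{0..t}|lborel. - \<nu> * inner_L2 (\<lambda>_. 1) (w' r) \<psi>' + inner_L2 (\<lambda>_. 1) (g r) \<psi>)"
proof -
  define I where "I u = inner_L2 (\<lambda>_. 1) u \<psi>" for u
  define I' where "I' u = inner_L2 (\<lambda>_. 1) u \<psi>'" for u
  have lin: "I (\<lambda>x. p * u x + q * v x) = p * I u + q * I v" "I' (\<lambda>x. p * u x + q * v x) = p * I' u + q * I' v"
    if "u \<in> L2 (\<lambda>_. 1)" "v \<in> L2 (\<lambda>_. 1)" for p q u v
    unfolding I_def I'_def using inner_L2_lincomb[OF weight_one that] \<psi> by auto
  define h where "h x = \<psi> x * (1 / \<mu> x)" for x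
  have h: "h \<in> H1 \<mu>" unfolding h_def[abs_def] by (rule H1_one_imp_H1_mu[OF \<psi>])
  have \<psi>H: "\<psi> \<in> H1 (\<lambda>_. 1)" by (rule H1_I[OF \<psi>(2,3,1)])
  have \<mu>0: "\<mu> x \<noteq> 0" for x using mu_ge1[of x] by linarith
  have h\<mu>: "(\<lambda>y. h y * \<mu> y) = \<psi>" using \<mu>0 by (simp add: h_def fun_eq_iff)
  have inh: "inner_L2 \<mu> u h = I u" for u
    unfolding inner_L2_def I_def using \<mu>0 by (intro Bochner_Integration.integral_cong) (auto simp: h_def)
  have m\<psi>: "\<psi>' \<in> borel_measurable borel" "wderiv \<psi> \<in> borel_measurable borel"
    using weak_deriv_measurable \<psi>(1) weak_deriv_wderiv(1)[OF \<psi>(1)] by auto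
  have lap1: "laplace_pairing (\<lambda>_. 1) u \<psi> = - I' (wderiv u)" if "wderiv u \<in> borel_measurable borel" for u
  proof -
    note [measurable] = m\<psi> that
    have "(LINT x|lborel. wderiv u x * wderiv \<psi> x) = (LINT x|lborel. wderiv u x * \<psi>' x)"
      by (rule integral_cong_AE) (use weak_deriv_wderiv(2)[OF \<psi>(1)] in \<open>auto elim: eventually_mono\<close>)
    then show ?thesis by (simp add: laplace_pairing_def I'_def inner_L2_def)
  qed
  have lap\<mu>: "laplace_pairing \<mu> u h = - I' (wderiv u)" if "wderiv u \<in> borel_measurable borel" for u
    using lap1[OF that] by (simp add: laplace_pairing_def h\<mu>)
  have mU: "wderiv (U s) \<in> borel_measurable borel" "wderiv (V s) \<in> borel_measurable borel" if "s \<in> {0..T}" for s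
    using weak_deriv_measurable(2) U_D(3)[OF that] V_D(3)[OF that] by auto
  note UL = C_L2_D(1)[OF U_D(1), THEN L2_mu_imp_L2] C_L2_D(1)[OF U_D(2), THEN L2_mu_imp_L2]
  note VL = C_L2_D(1)[OF V_D(1), THEN L2_mu_imp_L2] C_L2_D(1)[OF V_D(2), THEN L2_mu_imp_L2]
  note PL = C_L2_D(1)[OF C_L2_\<phi>, THEN L2_mu_imp_L2] C_L2_D(1)[OF C_L2_\<phi>1, THEN L2_mu_imp_L2]
  define F where "F s u x = deriv f (vh (x + c * s)) * u x" for s and u :: "real \<Rightarrow> real" and x
  have FL: "F s u \<in> L2 (\<lambda>_. 1)" if "u \<in> L2 (\<lambda>_. 1)" for s u
    unfolding F_def[abs_def] by (rule f'_mult_L2(1)[OF that weight_one])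
  define p p1 where "p s x = \<phi> (x + c * s)" and "p1 s x = \<phi>1 (x + c * s)" for s x
  have pL: "p s \<in> L2 (\<lambda>_. 1)" "p1 s \<in> L2 (\<lambda>_. 1)" if "s \<in> {0..T}" for s
    unfolding p_def[abs_def] p1_def[abs_def] using PL that by auto
  define AU where "AU s = - \<nu> * I' (wderiv (U s)) + b * (I (R s) + I (F s (U s)))" for s
  define AV where "AV s = - \<nu> * I' (wderiv (V s)) + b * I (F s (V s)) - c0 s * I (p s)" for s
  define AC where "AC s = c0 s * I (p s) + C s * (c * I (p1 s))" for s
  have X: "I (\<lambda>x. f (U s x + vh (x + c * s)) - f (vh (x + c * s))) = I (R s) + I (F s (U s))" if s: "s \<in> {0..T}" for s
  proof -
    have "(\<lambda>x. f (U s x + vh (x + c * s)) - f (vh (x + c * s))) = (\<lambda>x. 1 * R s x + 1 * F s (U s) x)"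
      by (auto simp: R_def F_def)
    then show ?thesis using lin(1)[OF L2_mu_imp_L2[OF R_L2[OF s]] FL[OF UL(1)[OF s]], of 1 1 s] by simp
  qed
  have AU: "\<nu> * laplace_pairing \<mu> (U s) h + b * inner_L2 \<mu> (\<lambda>x. f (U s x + vh (x + c * s)) - f (vh (x + c * s))) h = AU s"
    if s: "s \<in> {0..T}" for s
    unfolding inh X[OF s] lap\<mu>[OF mU(1)[OF s]] AU_def by simp
  have AV: "\<nu> * laplace_pairing (\<lambda>_. 1) (V s) \<psi> + b * inner_L2 (\<lambda>_. 1) (\<lambda>x. deriv f (vh (x + c * s)) * V s x) \<psi>
      - c0 s * inner_L2 (\<lambda>_. 1) (\<lambda>x. \<phi> (x + c * s)) \<psi> = AV s" if s: "s \<in> {0..T}" for s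
    unfolding lap1[OF mU(2)[OF s]] AV_def F_def[abs_def] p_def[abs_def] I_def by simp
  have sub: "{0..t} \<subseteq> {0..T}" if "t \<in> {0..T}" for t using that by auto
  have iU: "set_integrable lborel {0..T} AU"
    by (rule iffD1[OF set_integrable_cong[OF refl refl AU] conjunct1[OF eqU[OF h]]])
  have iV: "set_integrable lborel {0..T} AV"
    by (rule iffD1[OF set_integrable_cong[OF refl refl AV] conjunct1[OF eqV[OF \<psi>H]]])
  have contP: "continuous_on {0..T} (\<lambda>s. I (p s))" "continuous_on {0..T} (\<lambda>s. I (p1 s))"
    unfolding I_def p_def p1_def
    by (intro C_L2_inner_continuous[OF weight_one _ \<psi>(2)] C_L2_mu_imp_one C_L2_\<phi> C_L2_\<phi>1)+
  have cAC: "continuous_on {0..T} AC"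
    unfolding AC_def[abs_def] by (intro continuous_intros c0 C_cont contP)
  then have iC: "set_integrable lborel {0..T} AC" by (rule borel_integrable_atLeastAtMost')
  have sI: "set_integrable lborel {0..t} A" if "set_integrable lborel {0..T} A" "t \<in> {0..T}" for A :: "real \<Rightarrow> real" and t
    by (rule set_integrable_subset[OF that(1)]) (use that in auto)
  have LU: "I (U t) = \<epsilon> * I \<eta>0 + (LINT s:{0..t}|lborel. AU s) + \<epsilon> * I (Wp t)" if t: "t \<in> {0..T}" for t
  proof -
    have "(LINT s:{0..t}|lborel. \<nu> * laplace_pairing \<mu> (U s) h
          + b * inner_L2 \<mu> (\<lambda>x. f (U s x + vh (x + c * s)) - f (vh (x + c * s))) h) = (LINT s:{0..t}|lborel. AU s)"
      by (rule set_lebesgue_integral_cong) (use AU t in auto)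
    moreover have "I (\<lambda>x. \<epsilon> * \<eta>0 x) = \<epsilon> * I \<eta>0" by (simp add: I_def inner_L2_def mult.assoc)
    ultimately show ?thesis using bspec[OF conjunct2[OF eqU[OF h]] t] unfolding inh by simp
  qed
  have LV: "I (V t) = I \<eta>0 + (LINT s:{0..t}|lborel. AV s) + I (Wp t)" if t: "t \<in> {0..T}" for t
  proof -
    have "(LINT s:{0..t}|lborel. \<nu> * laplace_pairing (\<lambda>_. 1) (V s) \<psi>
          + b * inner_L2 (\<lambda>_. 1) (\<lambda>x. deriv f (vh (x + c * s)) * V s x) \<psi>
          - c0 s * inner_L2 (\<lambda>_. 1) (\<lambda>x. \<phi> (x + c * s)) \<psi>) = (LINT s:{0..t}|lborel. AV s)"
      by (rule set_lebesgue_integral_cong) (use AV t in auto)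
    then show ?thesis using bspec[OF conjunct2[OF eqV[OF \<psi>H]] t] unfolding I_def by simp
  qed
  have LC: "C t * I (p t) = (LINT s:{0..t}|lborel. AC s)" if t: "t \<in> {0..T}" for t
  proof -
    have "(AC has_integral C t * I (p t) - C 0 * I (p 0)) {0..t}"
    proof (rule fundamental_theorem_of_calculus)
      fix s assume "s \<in> {0..t}"
      then have s: "s \<in> {0..T}" using t by auto
      have "((\<lambda>s. C s * I (p s)) has_real_derivative c0 s * I (p s) + (c * I (p1 s)) * C s) (at s within {0..T})"
        using DERIV_mult[OF C_deriv[OF s] phase_derivative[OF \<psi>(2) s]]
        by (simp add: I_def p_def[abs_def] p1_def[abs_def])
      then have "((\<lambda>s. C s * I (p s)) has_real_derivative AC s) (at s within {0..T})"
        by (simp add: AC_def mult.commute)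
      then show "((\<lambda>s. C s * I (p s)) has_vector_derivative AC s) (at s within {0..t})"
        unfolding has_real_derivative_iff_has_vector_derivative
        by (rule has_vector_derivative_within_subset) (use t in auto)
    qed (use t in auto)
    then show ?thesis
      using set_borel_integral_eq_integral(2)[OF sI[OF iC t]] by (simp add: C_0 integral_unique)
  qed
  have integrand: "- \<nu> * I' (w' s) + I (g s) = AU s - \<epsilon> * AV s - \<epsilon> * AC s" if s: "s \<in> {0..T}" for s
  proof -
    have L1: "(\<lambda>x. 1 * wderiv (U s) x + (- \<epsilon>) * wderiv (V s) x) \<in> L2 (\<lambda>_. 1)"
      by (intro L2_lincomb weight_one UL VL s)
    have 1: "I' (w' s) = I' (wderiv (U s)) - \<epsilon> * I' (wderiv (V s)) - \<epsilon> * C s * I' (p1 s)"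
    proof -
      have "w' s = (\<lambda>x. 1 * (1 * wderiv (U s) x + (- \<epsilon>) * wderiv (V s) x) + (- (\<epsilon> * C s)) * p1 s x)"
        by (auto simp: w'_def p1_def)
      then show ?thesis
        using lin(2)[OF L1 pL(2)[OF s], of 1 "- (\<epsilon> * C s)"] lin(2)[OF UL(2)[OF s] VL(2)[OF s], of 1 "- \<epsilon>"] by simp
    qed
    have L2: "(\<lambda>x. 1 * F s (U s) x + (- \<epsilon>) * F s (V s) x) \<in> L2 (\<lambda>_. 1)"
      by (intro L2_lincomb weight_one FL UL VL s)
    have L3: "(\<lambda>x. 1 * (1 * F s (U s) x + (- \<epsilon>) * F s (V s) x) + (- (\<epsilon> * C s)) * F s (p s) x) \<in> L2 (\<lambda>_. 1)"
      by (intro L2_lincomb weight_one L2 FL pL s)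
    have 2: "I (g s) = b * I (R s) + b * (I (F s (U s)) - \<epsilon> * I (F s (V s)) - \<epsilon> * C s * I (F s (p s)))"
    proof -
      have "g s = (\<lambda>x. b * R s x + b * (1 * (1 * F s (U s) x + (- \<epsilon>) * F s (V s) x) + (- (\<epsilon> * C s)) * F s (p s) x))"
        by (auto simp: g_def w_def F_def p_def algebra_simps)
      then show ?thesis
        using lin(1)[OF L2_mu_imp_L2[OF R_L2[OF s]] L3, of b b] lin(1)[OF L2 FL[OF pL(1)[OF s], of s], of 1 "- (\<epsilon> * C s)"]
          lin(1)[OF FL[OF UL(1)[OF s], of s] FL[OF VL(1)[OF s], of s], of 1 "- \<epsilon>"] by simp
    qed
    have 3: "c * I (p1 s) = - \<nu> * I' (p1 s) + b * I (F s (p s))"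
    proof -
      define p2 where "p2 x = \<phi>2 (x + c * s)" for x
      have "\<bar>c * s\<bar> \<le> \<bar>c\<bar> * T" using s unfolding abs_mult by (intro mult_left_mono) auto
      then have "\<bar>p2 x\<bar> \<le> (K * exp (K * (\<bar>c\<bar> * T))) * \<phi> x" for x
        unfolding p2_def using shift_le_phi[OF \<phi>2_le] K_ge1 by simp
      then have p2L: "p2 \<in> L2 (\<lambda>_. 1)"
        using L2_le_phi(1)[of p2 "K * exp (K * (\<bar>c\<bar> * T))"] K_ge1 L2_mu_imp_L2 by (simp add: p2_def[abs_def])
      have dp1: "(p1 s has_real_derivative p2 x) (at x)" for x
      proof -
        have "((\<lambda>x. \<phi>1 (x + c * s)) has_real_derivative \<phi>2 (x + c * s) * 1) (at x)"
          by (rule DERIV_chain2[OF \<phi>1_deriv]) (auto intro!: derivative_eq_intros)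
        then show ?thesis by (simp add: p1_def[abs_def] p2_def)
      qed
      have cp2: "continuous_on UNIV p2"
        unfolding p2_def[abs_def] by (rule continuous_on_compose2[OF \<phi>2_cont]) (auto intro: continuous_intros)
      have "I p2 = - I' (p1 s)"
        unfolding I_def I'_def by (rule inner_L2_one_by_parts[OF \<psi> dp1 cp2 pL(2)[OF s] p2L])
      moreover have "I (\<lambda>x. \<nu> * p2 x + b * F s (p s) x) = \<nu> * I p2 + b * I (F s (p s))"
        by (rule lin(1)[OF p2L FL[OF pL(1)[OF s]]])
      moreover have "(\<lambda>x. \<nu> * p2 x + b * F s (p s) x) = (\<lambda>x. c * p1 s x)"
        by (auto simp: p2_def F_def p_def p1_def wave_eq)
      moreover have "I (\<lambda>x. c * p1 s x) = c * I (p1 s)" by (simp add: I_def inner_L2_def mult.assoc)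
      ultimately show ?thesis by simp
    qed
    have 4: "C s * (c * I (p1 s)) = C s * (- \<nu> * I' (p1 s) + b * I (F s (p s)))" by (simp only: 3)
    show ?thesis unfolding 1 2 AU_def AV_def AC_def 4 by (simp add: algebra_simps)
  qed
  have iS: "set_integrable lborel {0..T} (\<lambda>s. AU s - \<epsilon> * AV s - \<epsilon> * AC s)"
    using iU iV iC by (intro set_integral_diff(1) set_integrable_mult_right) auto
  show "set_integrable lborel {0..T} (\<lambda>r. - \<nu> * inner_L2 (\<lambda>_. 1) (w' r) \<psi>' + inner_L2 (\<lambda>_. 1) (g r) \<psi>)"
    using iffD2[OF set_integrable_cong[OF refl refl integrand] iS] unfolding I_def I'_def .
  show "inner_L2 (\<lambda>_. 1) (w t) \<psi> =
        (LINT r:{0..t}|lborel. - \<nu> * inner_L2 (\<lambda>_. 1) (w' r) \<psi>' + inner_L2 (\<lambda>_. 1) (g r) \<psi>)" if t: "t \<in> {0..T}" for t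
  proof -
    have L1: "(\<lambda>x. 1 * U t x + (- \<epsilon>) * V t x) \<in> L2 (\<lambda>_. 1)" by (intro L2_lincomb weight_one UL VL t)
    have "w t = (\<lambda>x. 1 * (1 * U t x + (- \<epsilon>) * V t x) + (- (\<epsilon> * C t)) * p t x)"
      by (auto simp: w_def p_def)
    then have "I (w t) = I (U t) - \<epsilon> * I (V t) - \<epsilon> * (C t * I (p t))"
      using lin(1)[OF L1 pL(1)[OF t], of 1 "- (\<epsilon> * C t)"] lin(1)[OF UL(1)[OF t] VL(1)[OF t], of 1 "- \<epsilon>"] by simp
    also have "\<dots> = (LINT s:{0..t}|lborel. AU s) - \<epsilon> * (LINT s:{0..t}|lborel. AV s) - \<epsilon> * (LINT s:{0..t}|lborel. AC s)"
      unfolding LU[OF t] LV[OF t] LC[OF t] by (simp add: algebra_simps)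
    also have "\<dots> = (LINT s:{0..t}|lborel. AU s - \<epsilon> * AV s - \<epsilon> * AC s)"
      using sI[OF iU t] sI[OF iV t] sI[OF iC t]
      by (simp add: set_integral_diff(2) set_integral_diff(1) set_integrable_mult_right)
    also have "\<dots> = (LINT r:{0..t}|lborel. - \<nu> * I' (w' r) + I (g r))"
      by (rule set_lebesgue_integral_cong) (use integrand t in auto)
    finally show ?thesis by (simp add: I_def I'_def)
  qed
qed

lemma remainder_bound:
  assumes t0: "t0 \<in> {0..T}" and \<theta>: "0 \<le> \<theta>" "\<And>r. r \<in> {0..t0} \<Longrightarrow> norm_H1 (wgt \<nu> c Z r) (U r) \<le> \<theta>"
    and t: "t \<in> {0..t0}"
  shows "norm_L2 \<mu> (w t) \<le> parabolic_K t0 * source_bound \<theta>"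
    "norm_L2 \<mu> (w' t) \<le> parabolic_K t0 * source_bound \<theta>"
proof -
  have sub: "r \<in> {0..T}" if "r \<in> {0..t0}" for r using that t0 by auto
  have S0: "0 \<le> source_bound \<theta>" using \<theta> b_pos eta_pos D_ge1 by (simp add: source_bound_def)
  have a0: "0 \<le> b * \<eta>" using b_pos eta_pos by simp
  have A0: "0 \<le> parabolic_K t0 * source_bound \<theta>"
    unfolding parabolic_K_def by (intro mult_nonneg_nonneg parabolic_const_nonneg S0 nu_pos a0) (use t0 in auto)
  have "norm_L2 (wj j) (w t) \<le> parabolic_K t0 * source_bound \<theta> \<and> norm_L2 (wj j) (w' t) \<le> parabolic_K t0 * source_bound \<theta>"
    if j: "j > 0" for j
  proof -
    interpret rw: regular_weight "wj j" "wj' j" "\<bar>\<kappa>\<bar>" "1 + 1 / j" by (rule wj_regular[OF j])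
    note mono = L2_weight_mono[OF rw.weight_m weight_\<mu> wj_le_mu[OF j]]
    have C: "C_L2 t0 (wj j) w" "C_L2 t0 (wj j) w'"
      using C_L2_subinterval[OF C_L2_weight_mono[OF rw.weight_m weight_\<mu> wj_le_mu[OF j]]] w_C t0 by auto
    have gb: "norm_L2 (wj j) (g r) \<le> (b * \<eta>) * norm_L2 (wj j) (w r) + source_bound \<theta>" if r: "r \<in> {0..t0}" for r
    proof -
      have wL: "w r \<in> L2 (wj j)" by (rule C_L2_D(1)[OF C(1) r])
      have RL: "R r \<in> L2 (wj j)" by (rule mono(1)[OF R_L2[OF sub[OF r]]])
      have "norm_L2 (wj j) (g r) \<le> \<bar>b\<bar> * norm_L2 (wj j) (R r) + \<bar>b\<bar> * norm_L2 (wj j) (\<lambda>x. deriv f (vh (x + c * r)) * w r x)"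
        unfolding g_def[abs_def] by (rule norm_L2_lincomb[OF rw.weight_m RL f'_mult_L2(1)[OF wL rw.weight_m]])
      also have "\<dots> \<le> b * (2 * \<eta> * D * (1 + 2 * \<theta>) * \<theta>\<^sup>2) + b * (\<eta> * norm_L2 (wj j) (w r))"
        using b_pos f'_mult_L2(2)[OF wL rw.weight_m, of "c * r"] order_trans[OF mono(2)[OF R_L2[OF sub[OF r]]] R_bound(2)[OF sub[OF r] \<theta>(2)[OF r]]]
        by (intro add_mono mult_mono) (auto simp: rw.weight_m)
      finally show ?thesis by (simp add: source_bound_def)
    qed
    have I: "set_integrable lborel {0..t0} (\<lambda>r. - \<nu> * inner_L2 (\<lambda>_. 1) (w' r) \<psi>' + inner_L2 (\<lambda>_. 1) (g r) \<psi>)"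
      if "weak_deriv \<psi> \<psi>'" "\<psi> \<in> L2 (\<lambda>_. 1)" "\<psi>' \<in> L2 (\<lambda>_. 1)" for \<psi> \<psi>'
      by (rule set_integrable_subset[OF w_equation(1)[OF that]]) (use t0 in auto)
    show ?thesis unfolding parabolic_K_def
      using rw.parabolic_estimate[OF nu_pos a0 S0 C w_weak_deriv[OF sub] mono(1)[OF g_L2[OF sub]] gb I w_equation(2)[OF _ _ _ sub] t]
      by blast
  qed
  then show "norm_L2 \<mu> (w t) \<le> parabolic_K t0 * source_bound \<theta>"
    "norm_L2 \<mu> (w' t) \<le> parabolic_K t0 * source_bound \<theta>"
    using norm_mu_le_if_wj[OF C_L2_D(1)[OF w_C(1) sub[OF t]] _ A0] norm_mu_le_if_wj[OF C_L2_D(1)[OF w_C(2) sub[OF t]] _ A0] by auto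
qed

end

section \<open>The remainder\<close>

context travelling_front
begin

lemma front_profile_bounded:
  assumes V: "C_H1 T \<mu> V" and a: "continuous_on {0..T} a"
  shows "\<exists>A. \<forall>t\<in>{0..T}.
    norm_L2 \<mu> (\<lambda>x. V t x + a t * \<phi> (x + c * t)) + norm_L2 \<mu> (\<lambda>x. wderiv (V t) x + a t * \<phi>1 (x + c * t)) \<le> A"
proof -
  note d = C_H1_D[OF weight_\<mu> V]
  have C: "C_L2 T \<mu> (\<lambda>t x. V t x + a t * \<phi> (x + c * t))" "C_L2 T \<mu> (\<lambda>t x. wderiv (V t) x + a t * \<phi>1 (x + c * t))"
    using C_L2_lincomb[OF weight_\<mu> d(1) C_L2_\<phi> a, of 1] C_L2_lincomb[OF weight_\<mu> d(2) C_L2_\<phi>1 a, of 1] by simp_all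
  obtain A1 where A1: "0 \<le> A1" "\<And>t. t \<in> {0..T} \<Longrightarrow> norm_L2 \<mu> (\<lambda>x. V t x + a t * \<phi> (x + c * t)) \<le> A1"
    by (rule C_L2_bounded[OF weight_\<mu> C(1)]) blast
  obtain A2 where A2: "0 \<le> A2" "\<And>t. t \<in> {0..T} \<Longrightarrow> norm_L2 \<mu> (\<lambda>x. wderiv (V t) x + a t * \<phi>1 (x + c * t)) \<le> A2"
    by (rule C_L2_bounded[OF weight_\<mu> C(2)]) blast
  show ?thesis
    by (rule exI[of _ "A1 + A2"]) (use A1(2) A2(2) in \<open>auto intro!: add_mono\<close>)
qed

end

context front_path
begin

definition "r t x = (U t x + vh (x + c * t) - vh (x + c * t + \<epsilon> * C t)) / \<epsilon> - V t x"

definition "q t x = (1 * (vh (x + (c * t + \<epsilon> * C t)) - vh x) + (- 1) * (vh (x + c * t) - vh x)) + (- (\<epsilon> * C t)) * \<phi> (x + c * t)"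

definition "q' t x = (1 * (\<phi> (x + (c * t + \<epsilon> * C t)) - \<phi> x) + (- 1) * (\<phi> (x + c * t) - \<phi> x)) + (- (\<epsilon> * C t)) * \<phi>1 (x + c * t)"

lemma \<phi>_le: "\<bar>\<phi> x\<bar> \<le> K * \<phi> x"
  using mult_right_mono[OF K_ge1 \<phi>_nonneg[of x]] \<phi>_nonneg[of x] by simp

lemma q_C: "C_L2 T \<mu> q" "C_L2 T \<mu> q'"
proof -
  have y: "continuous_on {0..T} (\<lambda>t. c * t + \<epsilon> * C t)" "continuous_on {0..T} (\<lambda>t. c * t)"
    by (intro continuous_intros C_cont)+
  have e: "continuous_on {0..T} (\<lambda>t. - (\<epsilon> * C t))" by (intro continuous_intros C_cont)
  show "C_L2 T \<mu> q"
    using C_L2_lincomb[OF weight_\<mu> C_L2_lincomb[OF weight_\<mu> C_L2_wave_shift[OF vh_deriv \<phi>_le y(1)]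
        C_L2_wave_shift[OF vh_deriv \<phi>_le y(2)] continuous_on_const, of 1 "-1"] C_L2_\<phi> e, of 1]
    by (simp add: q_def[abs_def])
  show "C_L2 T \<mu> q'"
    using C_L2_lincomb[OF weight_\<mu> C_L2_lincomb[OF weight_\<mu> C_L2_wave_shift[OF \<phi>_deriv \<phi>1_le y(1)]
        C_L2_wave_shift[OF \<phi>_deriv \<phi>1_le y(2)] continuous_on_const, of 1 "-1"] C_L2_\<phi>1 e, of 1]
    by (simp add: q'_def[abs_def])
qed

lemma q_weak_deriv: "weak_deriv (q t) (q' t)"
proof (rule indef_integral_imp_weak_deriv, rule indef_integral_C1)
  have s: "((\<lambda>x. g (x + d)) has_real_derivative g' (x + d)) (at x)"
    if "\<And>x. (g has_real_derivative g' x) (at x)" for g g' :: "real \<Rightarrow> real" and d x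
  proof -
    have "((\<lambda>x. g (x + d)) has_real_derivative g' (x + d) * 1) (at x)"
      by (rule DERIV_chain2[OF that]) (auto intro!: derivative_eq_intros)
    then show ?thesis by simp
  qed
  show "(q t has_real_derivative q' t x) (at x)" for x
    unfolding q_def[abs_def] q'_def
    by (intro DERIV_add DERIV_cmult DERIV_diff s vh_deriv \<phi>_deriv)
  have sc: "continuous_on UNIV (\<lambda>x. g (x + d))" if "continuous_on UNIV g" for g :: "real \<Rightarrow> real" and d
    by (rule continuous_on_compose2[OF that]) (auto intro: continuous_intros)
  show "continuous_on UNIV (q' t)"
    unfolding q'_def[abs_def] by (intro continuous_intros sc continuous_wave)
qed

lemma q_norm:
  assumes t: "t \<in> {0..T}" and \<theta>: "\<bar>\<epsilon> * C t\<bar> \<le> \<theta>" "\<theta> \<le> \<theta>0"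
  shows "norm_L2 \<mu> (q t) \<le> K * exp (K * \<theta>0) * exp (K * (\<bar>c\<bar> * T)) * norm_L2 \<mu> \<phi> * \<theta>\<^sup>2"
    "norm_L2 \<mu> (q' t) \<le> K * exp (K * \<theta>0) * exp (K * (\<bar>c\<bar> * T)) * norm_L2 \<mu> \<phi> * \<theta>\<^sup>2"
proof -
  define h where "h = \<epsilon> * C t"
  have K0: "0 \<le> K" using K_ge1 by simp
  have cb: "\<bar>c * t\<bar> \<le> \<bar>c\<bar> * T" using t unfolding abs_mult by (intro mult_left_mono) auto
  have h\<theta>: "\<bar>h\<bar> \<le> \<theta>" "h\<^sup>2 \<le> \<theta>\<^sup>2" "\<bar>h\<bar> \<le> \<theta>0" using \<theta> power_mono[of "\<bar>h\<bar>" \<theta> 2] by (auto simp: h_def)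
  have b: "norm_L2 \<mu> v \<le> K * exp (K * \<theta>0) * exp (K * (\<bar>c\<bar> * T)) * norm_L2 \<mu> \<phi> * \<theta>\<^sup>2"
    if v: "v \<in> L2 \<mu>" and vb: "\<And>x. \<bar>v x\<bar> \<le> K * h\<^sup>2 * exp (K * \<bar>h\<bar>) * \<phi> (x + c * t)" for v
  proof -
    have "\<bar>v x\<bar> \<le> (K * \<theta>\<^sup>2 * exp (K * \<theta>0) * exp (K * (\<bar>c\<bar> * T))) * \<phi> x" for x
    proof -
      have "\<bar>v x\<bar> \<le> K * h\<^sup>2 * exp (K * \<bar>h\<bar>) * \<phi> (x + c * t)" by (rule vb)
      also have "\<dots> \<le> K * \<theta>\<^sup>2 * exp (K * \<theta>0) * (1 * exp (K * (\<bar>c\<bar> * T)) * \<phi> x)"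
        using shift_le_phi[of \<phi> 1, OF _ _ cb, of x] \<phi>_nonneg mult_left_mono[OF h\<theta>(3) K0] K0 h\<theta>(2)
        by (intro mult_mono) auto
      finally show ?thesis by (simp add: mult_ac)
    qed
    from L2_le_phi(2)[OF L2_D(1)[OF v] this] show ?thesis using K0 by (simp add: mult_ac)
  qed
  show "norm_L2 \<mu> (q t) \<le> K * exp (K * \<theta>0) * exp (K * (\<bar>c\<bar> * T)) * norm_L2 \<mu> \<phi> * \<theta>\<^sup>2"
  proof (rule b[OF C_L2_D(1)[OF q_C(1) t]])
    fix x
    have "\<bar>vh ((x + c * t) + h) - vh (x + c * t) - h * \<phi> (x + c * t)\<bar> \<le> K * h\<^sup>2 * exp (K * \<bar>h\<bar>) * \<phi> (x + c * t)"
      by (rule taylor_shift_bound[OF vh_deriv \<phi>_deriv \<phi>1_le \<phi>_harnack K0 K0 \<phi>_nonneg])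
    then show "\<bar>q t x\<bar> \<le> K * h\<^sup>2 * exp (K * \<bar>h\<bar>) * \<phi> (x + c * t)"
      by (simp add: q_def h_def add.assoc)
  qed
  show "norm_L2 \<mu> (q' t) \<le> K * exp (K * \<theta>0) * exp (K * (\<bar>c\<bar> * T)) * norm_L2 \<mu> \<phi> * \<theta>\<^sup>2"
  proof (rule b[OF C_L2_D(1)[OF q_C(2) t]])
    fix x
    have "\<bar>\<phi> ((x + c * t) + h) - \<phi> (x + c * t) - h * \<phi>1 (x + c * t)\<bar> \<le> K * h\<^sup>2 * exp (K * \<bar>h\<bar>) * \<phi> (x + c * t)"
      by (rule taylor_shift_bound[OF \<phi>_deriv \<phi>1_deriv \<phi>2_le \<phi>_harnack K0 K0 \<phi>_nonneg])
    then show "\<bar>q' t x\<bar> \<le> K * h\<^sup>2 * exp (K * \<bar>h\<bar>) * \<phi> (x + c * t)"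
      by (simp add: q'_def h_def add.assoc)
  qed
qed

lemma r_eq: "r = (\<lambda>t x. (1 / \<epsilon>) * w t x + (- (1 / \<epsilon>)) * q t x)"
  using eps_pos by (auto simp: r_def w_def q_def fun_eq_iff field_simps)

lemma norm_H1_wgt_le:
  assumes t: "t \<in> {0..T}" and v: "weak_deriv v v'" "v \<in> L2 \<mu>" "v' \<in> L2 \<mu>"
  shows "norm_H1 (wgt \<nu> c Z t) v \<le> norm_L2 \<mu> v + norm_L2 \<mu> v'"
proof -
  have t0: "0 \<le> t" using t by simp
  have "norm_H1 (wgt \<nu> c Z t) v \<le> norm_L2 (wgt \<nu> c Z t) v + norm_L2 (wgt \<nu> c Z t) v'"
    by (rule norm_H1_bounds(3)[OF weight_wgt_t v(1)])
  also have "\<dots> \<le> norm_L2 \<mu> v + norm_L2 \<mu> v'"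
    by (intro add_mono L2_weight_mono(2)[OF weight_wgt_t weight_\<mu> wgt_le_mu[OF t0]] v)
  finally show ?thesis .
qed

lemma remainder_decomposition:
  assumes \<theta>: "0 \<le> \<theta>" "\<theta> \<le> \<theta>0" and N: "\<And>t. t \<in> {0..T} \<Longrightarrow> norm_H1 (wgt \<nu> c Z t) (U t) \<le> \<theta>"
    and c\<theta>: "\<And>t. t \<in> {0..T} \<Longrightarrow> \<bar>\<epsilon> * C t\<bar> \<le> \<theta>"
  shows "C_H1 T \<mu> r" "norm_sup_T \<nu> c Z T r \<le> remainder_K \<theta>0 * (\<theta>\<^sup>2 / \<epsilon>)"
proof -
  define r' where "r' t x = (1 / \<epsilon>) * w' t x + (- (1 / \<epsilon>)) * q' t x" for t x
  have rd: "weak_deriv (r t) (r' t)" if "t \<in> {0..T}" for t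
    unfolding r_eq r'_def[abs_def] by (rule weak_deriv_lincomb[OF w_weak_deriv[OF that] q_weak_deriv])
  have rC: "C_L2 T \<mu> r" "C_L2 T \<mu> r'"
    unfolding r_eq r'_def[abs_def] by (intro C_L2_lincomb weight_\<mu> w_C q_C continuous_on_const)+
  show "C_H1 T \<mu> r" by (rule C_H1_I[OF weight_\<mu> rC rd])
  define A where "A = parabolic_K T * (b * (2 * \<eta> * D * (1 + 2 * \<theta>0)))"
  define B where "B = K * exp (K * \<theta>0) * exp (K * (\<bar>c\<bar> * T)) * norm_L2 \<mu> \<phi>"
  have TT: "T \<in> {0..T}" using T_pos by simp
  have "source_bound \<theta> \<le> b * (2 * \<eta> * D * (1 + 2 * \<theta>0) * \<theta>\<^sup>2)"
    unfolding source_bound_def using b_pos eta_pos D_ge1 \<theta> by (intro mult_left_mono mult_right_mono) auto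
  then have S: "parabolic_K T * source_bound \<theta> \<le> A * \<theta>\<^sup>2"
    using mult_left_mono[OF _ parabolic_K_nonneg[of T]] T_pos by (force simp: A_def mult_ac)
  have "norm_H1 (wgt \<nu> c Z t) (r t) \<le> 2 * (A + B) * (\<theta>\<^sup>2 / \<epsilon>)" if t: "t \<in> {0..T}" for t
  proof -
    note L = C_L2_D(1)[OF w_C(1) t] C_L2_D(1)[OF w_C(2) t] C_L2_D(1)[OF q_C(1) t] C_L2_D(1)[OF q_C(2) t]
    have wb: "norm_L2 \<mu> (w t) \<le> A * \<theta>\<^sup>2" "norm_L2 \<mu> (w' t) \<le> A * \<theta>\<^sup>2"
      using order_trans[OF remainder_bound(1)[OF TT \<theta>(1) N t] S] order_trans[OF remainder_bound(2)[OF TT \<theta>(1) N t] S] by auto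
    have qb: "norm_L2 \<mu> (q t) \<le> B * \<theta>\<^sup>2" "norm_L2 \<mu> (q' t) \<le> B * \<theta>\<^sup>2"
      using q_norm[OF t c\<theta>[OF t] \<theta>(2)] by (auto simp: B_def)
    have e: "0 \<le> 1 / \<epsilon>" using eps_pos by simp
    have "norm_L2 \<mu> (r t) \<le> \<bar>1 / \<epsilon>\<bar> * norm_L2 \<mu> (w t) + \<bar>- (1 / \<epsilon>)\<bar> * norm_L2 \<mu> (q t)"
      unfolding r_eq by (rule norm_L2_lincomb[OF weight_\<mu> L(1,3)])
    also have "\<dots> \<le> 1 / \<epsilon> * (A * \<theta>\<^sup>2) + 1 / \<epsilon> * (B * \<theta>\<^sup>2)"
      unfolding abs_minus_cancel abs_of_nonneg[OF e] by (intro add_mono mult_left_mono wb qb e)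
    finally have r1: "norm_L2 \<mu> (r t) \<le> 1 / \<epsilon> * (A * \<theta>\<^sup>2) + 1 / \<epsilon> * (B * \<theta>\<^sup>2)" .
    have "norm_L2 \<mu> (r' t) \<le> \<bar>1 / \<epsilon>\<bar> * norm_L2 \<mu> (w' t) + \<bar>- (1 / \<epsilon>)\<bar> * norm_L2 \<mu> (q' t)"
      unfolding r'_def[abs_def] by (rule norm_L2_lincomb[OF weight_\<mu> L(2,4)])
    also have "\<dots> \<le> 1 / \<epsilon> * (A * \<theta>\<^sup>2) + 1 / \<epsilon> * (B * \<theta>\<^sup>2)"
      unfolding abs_minus_cancel abs_of_nonneg[OF e] by (intro add_mono mult_left_mono wb qb e)
    finally have r2: "norm_L2 \<mu> (r' t) \<le> 1 / \<epsilon> * (A * \<theta>\<^sup>2) + 1 / \<epsilon> * (B * \<theta>\<^sup>2)" .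
    have "norm_H1 (wgt \<nu> c Z t) (r t) \<le> norm_L2 \<mu> (r t) + norm_L2 \<mu> (r' t)"
      by (rule norm_H1_wgt_le[OF t rd[OF t] C_L2_D(1)[OF rC(1) t] C_L2_D(1)[OF rC(2) t]])
    also have "\<dots> \<le> 2 * (1 / \<epsilon> * (A * \<theta>\<^sup>2) + 1 / \<epsilon> * (B * \<theta>\<^sup>2))" using r1 r2 by simp
    also have "\<dots> = 2 * (A + B) * (\<theta>\<^sup>2 / \<epsilon>)" by (simp add: algebra_simps add_divide_distrib)
    finally show ?thesis .
  qed
  then show "norm_sup_T \<nu> c Z T r \<le> remainder_K \<theta>0 * (\<theta>\<^sup>2 / \<epsilon>)"
    unfolding norm_sup_T_def remainder_K_def A_def[symmetric] B_def[symmetric]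
    by (intro cSUP_least) (use T_pos in auto)
qed

lemma norm_U_bound:
  assumes t: "t \<in> {0..T}" and \<theta>: "0 \<le> \<theta>" "\<And>r. r \<in> {0..t} \<Longrightarrow> norm_H1 (wgt \<nu> c Z r) (U r) \<le> \<theta>"
    and A: "norm_L2 \<mu> (\<lambda>x. V t x + C t * \<phi> (x + c * t)) + norm_L2 \<mu> (\<lambda>x. wderiv (V t) x + C t * \<phi>1 (x + c * t)) \<le> A"
  shows "norm_H1 (wgt \<nu> c Z t) (U t) \<le> \<epsilon> * A + 2 * (parabolic_K t * source_bound \<theta>)"
proof -
  have tt: "t \<in> {0..t}" using t by simp
  note L = C_L2_D(1)[OF w_C(1) t] C_L2_D(1)[OF w_C(2) t] C_L2_D(1)[OF U_D(1) t] C_L2_D(1)[OF U_D(2) t]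
    C_L2_D(1)[OF V_D(1) t] C_L2_D(1)[OF V_D(2) t] C_L2_D(1)[OF C_L2_\<phi> t] C_L2_D(1)[OF C_L2_\<phi>1 t]
  have P: "(\<lambda>x. V t x + C t * \<phi> (x + c * t)) \<in> L2 \<mu>" "(\<lambda>x. wderiv (V t) x + C t * \<phi>1 (x + c * t)) \<in> L2 \<mu>"
    using L2_lincomb[OF weight_\<mu> L(5,7), of 1 "C t"] L2_lincomb[OF weight_\<mu> L(6,8), of 1 "C t"] by simp_all
  have "U t = (\<lambda>x. 1 * w t x + \<epsilon> * (V t x + C t * \<phi> (x + c * t)))"
    by (auto simp: w_def algebra_simps)
  then have "norm_L2 \<mu> (U t) \<le> norm_L2 \<mu> (w t) + \<epsilon> * norm_L2 \<mu> (\<lambda>x. V t x + C t * \<phi> (x + c * t))"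
    using norm_L2_lincomb[OF weight_\<mu> L(1) P(1), of 1 \<epsilon>] eps_pos by simp
  moreover have "wderiv (U t) = (\<lambda>x. 1 * w' t x + \<epsilon> * (wderiv (V t) x + C t * \<phi>1 (x + c * t)))"
    by (auto simp: w'_def algebra_simps)
  then have "norm_L2 \<mu> (wderiv (U t)) \<le> norm_L2 \<mu> (w' t) + \<epsilon> * norm_L2 \<mu> (\<lambda>x. wderiv (V t) x + C t * \<phi>1 (x + c * t))"
    using norm_L2_lincomb[OF weight_\<mu> L(2) P(2), of 1 \<epsilon>] eps_pos by simp
  moreover have "norm_H1 (wgt \<nu> c Z t) (U t) \<le> norm_L2 \<mu> (U t) + norm_L2 \<mu> (wderiv (U t))"
    by (rule norm_H1_wgt_le[OF t U_D(3)[OF t] L(3,4)])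
  moreover have "norm_L2 \<mu> (w t) \<le> parabolic_K t * source_bound \<theta>" "norm_L2 \<mu> (w' t) \<le> parabolic_K t * source_bound \<theta>"
    using remainder_bound[OF t \<theta> tt] by auto
  moreover have "\<epsilon> * norm_L2 \<mu> (\<lambda>x. V t x + C t * \<phi> (x + c * t)) + \<epsilon> * norm_L2 \<mu> (\<lambda>x. wderiv (V t) x + C t * \<phi>1 (x + c * t)) \<le> \<epsilon> * A"
    using mult_left_mono[OF A, of \<epsilon>] eps_pos by (simp add: distrib_left)
  ultimately show ?thesis by linarith
qed

text \<open>Before the first time at which the norm of \<open>U\<close> reaches \<open>\<theta>\<close> the source is of order
  \<open>\<theta>\<^sup>2\<close>, so the bound for \<open>U\<close> improves and the level \<open>\<theta>\<close> is never reached.\<close>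

lemma norm_U_below:
  assumes \<theta>: "0 < \<theta>"
    and A: "\<And>t. t \<in> {0..T} \<Longrightarrow> norm_L2 \<mu> (\<lambda>x. V t x + C t * \<phi> (x + c * t)) +
      norm_L2 \<mu> (\<lambda>x. wderiv (V t) x + C t * \<phi>1 (x + c * t)) \<le> A"
    and small: "\<epsilon> * A + 2 * (parabolic_K T * source_bound \<theta>) < \<theta>"
    and t: "t \<in> {0..T}"
  shows "norm_H1 (wgt \<nu> c Z t) (U t) < \<theta>"
proof (rule ccontr)
  assume not: "\<not> ?thesis"
  define N where "N t = norm_H1 (wgt \<nu> c Z t) (U t)" for t
  have cN: "continuous_on {0..T} N" unfolding N_def[abs_def] by (rule continuous_norm_H1_wgt[OF U])
  have N0: "0 \<le> N t" for t by (simp add: N_def norm_H1_def)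
  define S where "S = {t \<in> {0..T}. \<theta> \<le> N t}"
  have "closed S" unfolding S_def by (intro continuous_on_closed_Collect_le continuous_on_const cN closed_atLeastAtMost)
  moreover have "t \<in> S" using not t by (simp add: S_def N_def)
  moreover have bd: "bdd_below S" by (rule bdd_belowI[of _ 0]) (auto simp: S_def)
  ultimately have "Inf S \<in> S" by (intro closed_contains_Inf) auto
  then obtain \<sigma> where \<sigma>: "\<sigma> \<in> {0..T}" "\<theta> \<le> N \<sigma>" "\<And>t. t \<in> {0..T} \<Longrightarrow> t < \<sigma> \<Longrightarrow> N t < \<theta>"
    using cInf_lower[OF _ bd] by (force simp: S_def not_le[symmetric])
  have A0: "0 \<le> source_bound \<theta>" using \<theta> b_pos eta_pos D_ge1 by (simp add: source_bound_def)
  have e: "\<epsilon> * A < \<theta>"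
    using small A0 parabolic_K_nonneg[of T] T_pos mult_nonneg_nonneg[of "parabolic_K T" "source_bound \<theta>"] by linarith
  show False
  proof (cases "\<sigma> = 0")
    case True
    have "N \<sigma> \<le> \<epsilon> * A + 2 * (parabolic_K \<sigma> * source_bound (N 0))"
      unfolding N_def[of \<sigma>] by (rule norm_U_bound[OF \<sigma>(1) N0 _ A[OF \<sigma>(1)]]) (use True in \<open>auto simp: N_def\<close>)
    then show False using True e \<sigma>(2) by (simp add: parabolic_K_0)
  next
    case False
    then have pos: "0 < \<sigma>" using \<sigma>(1) by simp
    have cl: "closure {0..<\<sigma>} = {0..\<sigma>}" using pos by (rule closure_atLeastLessThan)
    have "N \<sigma> \<le> \<theta>"
    proof (rule continuous_le_on_closure[of "{0..<\<sigma>}" N])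
      show "continuous_on (closure {0..<\<sigma>}) N" unfolding cl by (rule continuous_on_subset[OF cN]) (use \<sigma>(1) in auto)
      show "\<sigma> \<in> closure {0..<\<sigma>}" unfolding cl using pos by simp
      show "\<And>x. x \<in> {0..<\<sigma>} \<Longrightarrow> N x \<le> \<theta>" using \<sigma> by (auto intro: less_imp_le)
    qed
    then have "N r \<le> \<theta>" if "r \<in> {0..\<sigma>}" for r
      using that \<sigma> by (cases "r = \<sigma>") (auto intro: less_imp_le)
    then have "N \<sigma> \<le> \<epsilon> * A + 2 * (parabolic_K \<sigma> * source_bound \<theta>)"
      unfolding N_def using \<theta> by (intro norm_U_bound[OF \<sigma>(1) _ _ A[OF \<sigma>(1)]]) auto
    also have "\<dots> \<le> \<epsilon> * A + 2 * (parabolic_K T * source_bound \<theta>)"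
      using parabolic_K_mono[of \<sigma> T] \<sigma>(1) A0 by (simp add: mult_right_mono)
    finally show False using small \<sigma>(2) by simp
  qed
qed

end

section \<open>Measurability\<close>

lemma measurable_continuous_family:
  fixes X :: "real \<Rightarrow> 'w \<Rightarrow> real"
  assumes m: "\<And>t. X t \<in> borel_measurable M" and c: "\<And>\<omega> t. \<omega> \<in> space M \<Longrightarrow> isCont (\<lambda>t. X t \<omega>) t"
  shows "(\<lambda>(\<omega>, t). X t \<omega>) \<in> borel_measurable (M \<Otimes>\<^sub>M lborel)"
proof -
  define g where "g n t = real_of_int \<lfloor>t * real (Suc n)\<rfloor> / real (Suc n)" for n t
  have gm: "(\<lambda>p. case p of (\<omega>, t) \<Rightarrow> X (g n t) \<omega>) \<in> borel_measurable (M \<Otimes>\<^sub>M lborel)" for n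
  proof -
    have "(\<lambda>p. (\<lambda>i p. X (real_of_int i / real (Suc n)) (fst p)) \<lfloor>snd p * real (Suc n)\<rfloor> p) \<in> borel_measurable (M \<Otimes>\<^sub>M lborel)"
    proof (rule measurable_compose_countable[where f="\<lambda>i p. X (real_of_int i / real (Suc n)) (fst p)" and g="\<lambda>p. \<lfloor>snd p * real (Suc n)\<rfloor>"])
      show "(\<lambda>p. X (real_of_int i / real (Suc n)) (fst p)) \<in> borel_measurable (M \<Otimes>\<^sub>M lborel)" for i
        by (rule measurable_compose[OF measurable_fst m])
      show "(\<lambda>p. \<lfloor>snd p * real (Suc n)\<rfloor>) \<in> M \<Otimes>\<^sub>M lborel \<rightarrow>\<^sub>M count_space UNIV" by measurable
    qed
    then show ?thesis by (simp add: g_def split_beta')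
  qed
  show ?thesis
  proof (rule borel_measurable_LIMSEQ_real[where u="\<lambda>n p. case p of (\<omega>, t) \<Rightarrow> X (g n t) \<omega>", OF _ gm])
    fix p :: "'w \<times> real" assume p: "p \<in> space (M \<Otimes>\<^sub>M lborel)"
    obtain \<omega> t where pt: "p = (\<omega>, t)" by (cases p)
    have \<omega>: "\<omega> \<in> space M" using p pt by (simp add: space_pair_measure)
    have "(\<lambda>n. g n t) \<longlonglongrightarrow> t"
    proof (rule LIM_zero_cancel, rule Lim_null_comparison)
      show "(\<lambda>n. 1 / real (Suc n)) \<longlonglongrightarrow> 0" by (rule LIMSEQ_Suc[OF lim_inverse_n'])
      have "\<bar>g n t - t\<bar> \<le> 1 / real (Suc n)" for n
      proof -
        have "\<bar>real_of_int \<lfloor>t * real (Suc n)\<rfloor> - t * real (Suc n)\<bar> \<le> 1" by linarith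
        then have "\<bar>real_of_int \<lfloor>t * real (Suc n)\<rfloor> - t * real (Suc n)\<bar> / real (Suc n) \<le> 1 / real (Suc n)"
          by (rule divide_right_mono) simp
        moreover have "g n t - t = (real_of_int \<lfloor>t * real (Suc n)\<rfloor> - t * real (Suc n)) / real (Suc n)"
          by (simp add: g_def diff_divide_distrib)
        ultimately show ?thesis by simp
      qed
      then show "\<forall>\<^sub>F n in sequentially. norm (g n t - t) \<le> 1 / real (Suc n)" by simp
    qed
    then have "(\<lambda>n. X (g n t) \<omega>) \<longlonglongrightarrow> X t \<omega>" by (rule isCont_tendsto_compose[OF c[OF \<omega>]])
    then show "(\<lambda>n. case p of (\<omega>, t) \<Rightarrow> X (g n t) \<omega>) \<longlonglongrightarrow> (case p of (\<omega>, t) \<Rightarrow> X t \<omega>)" by (simp add: pt)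
  qed
qed

lemma measurable_primitive:
  fixes X :: "real \<Rightarrow> 'w \<Rightarrow> real"
  assumes m: "\<And>t. t \<in> {0..T} \<Longrightarrow> X t \<in> borel_measurable M"
    and c: "\<And>\<omega>. \<omega> \<in> space M \<Longrightarrow> continuous_on {0..T} (\<lambda>t. X t \<omega>)" and t: "t \<in> {0..T}"
  shows "(\<lambda>\<omega>. LINT s:{0..t}|lborel. X s \<omega>) \<in> borel_measurable M"
proof -
  define k where "k s = max 0 (min T s)" for s
  have k: "k s \<in> {0..T}" for s using t by (auto simp: k_def)
  have ck: "continuous_on UNIV k" unfolding k_def[abs_def] by (intro continuous_intros)
  have "(\<lambda>(\<omega>, s). X (k s) \<omega>) \<in> borel_measurable (M \<Otimes>\<^sub>M lborel)"
  proof (rule measurable_continuous_family)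
    show "X (k s) \<in> borel_measurable M" for s by (rule m[OF k])
    show "isCont (\<lambda>s. X (k s) \<omega>) s" if \<omega>: "\<omega> \<in> space M" for \<omega> s
    proof -
      have "continuous_on UNIV (\<lambda>s. X (k s) \<omega>)"
        by (rule continuous_on_compose2[OF c[OF \<omega>] ck]) (use k in auto)
      then show ?thesis by (simp add: continuous_on_eq_continuous_at)
    qed
  qed
  then have [measurable]: "(\<lambda>p. X (k (snd p)) (fst p)) \<in> borel_measurable (M \<Otimes>\<^sub>M lborel)"
    by (simp add: split_beta')
  have meas: "(\<lambda>\<omega>. LINT s|lborel. indicator {0..t} s *\<^sub>R X (k s) \<omega>) \<in> borel_measurable M"
  proof (rule lborel.borel_measurable_lebesgue_integral)
    have "(\<lambda>p. indicat_real {0..t} (snd p) * X (k (snd p)) (fst p)) \<in> borel_measurable (M \<Otimes>\<^sub>M lborel)" by measurable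
    then show "(\<lambda>(\<omega>, s). indicat_real {0..t} s *\<^sub>R X (k s) \<omega>) \<in> borel_measurable (M \<Otimes>\<^sub>M lborel)"
      by (simp add: split_beta')
  qed
  have eq: "(LINT s|lborel. indicator {0..t} s *\<^sub>R X (k s) \<omega>) = (LINT s:{0..t}|lborel. X s \<omega>)" for \<omega>
    unfolding set_lebesgue_integral_def
    by (rule Bochner_Integration.integral_cong) (use t in \<open>auto simp: indicator_def k_def\<close>)
  show ?thesis using meas unfolding eq .
qed

lemma continuous_average_limit:
  fixes U :: "real \<Rightarrow> real"
  assumes c: "continuous_on UNIV U"
  shows "(\<lambda>n. real (Suc n) * (LINT y:{x..x + 1 / real (Suc n)}|lborel. U y)) \<longlonglongrightarrow> U x"
proof -
  have "\<And>y. isCont U y" using c by (simp add: continuous_on_eq_continuous_at)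
  then obtain F where F: "\<And>y. (F has_real_derivative U y) (at y)"
    using einterval_antiderivative[of "-\<infinity>" "\<infinity>" U] by (auto simp: has_real_derivative_iff_has_vector_derivative)
  have FI: "indef_integral F U" by (rule indef_integral_C1[OF F c])
  define H where "H n = 1 / real (Suc n)" for n
  have H: "H \<longlonglongrightarrow> 0" "H n > 0" for n unfolding H_def[abs_def] by (rule LIMSEQ_Suc[OF lim_inverse_n']) simp
  have "((\<lambda>h. (F (x + h) - F x) / h) \<longlongrightarrow> U x) (at 0)" using F[of x] by (simp add: DERIV_def)
  then have "(\<lambda>n. (F (x + H n) - F x) / H n) \<longlonglongrightarrow> U x"
    using H by (auto simp: tendsto_at_iff_sequentially o_def less_imp_neq[symmetric])
  moreover have "(F (x + H n) - F x) / H n = real (Suc n) * (LINT y:{x..x + 1 / real (Suc n)}|lborel. U y)" for n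
    using indef_integralD(2)[OF FI, of x "x + H n"] H(2)[of n] by (simp add: H_def)
  ultimately show ?thesis by simp
qed

lemma integral_sq_eq_enn2real:
  assumes "weight v" "f \<in> borel_measurable borel"
  shows "(norm_L2 v f)\<^sup>2 = enn2real (\<integral>\<^sup>+x. ennreal ((f x)\<^sup>2 * v x) \<partial>lborel)"
proof -
  have [measurable]: "v \<in> borel_measurable borel" "f \<in> borel_measurable borel" using assms by (auto simp: weight_def)
  have "\<And>x. 0 < v x" using assms(1) by (simp add: weight_def)
  then show ?thesis unfolding norm_L2_sq[OF assms(1)]
    by (intro integral_eq_nn_integral) (auto simp: less_imp_le)
qed

lemma measurable_norm_H1:
  fixes u :: "'w \<Rightarrow> real \<Rightarrow> real"
  assumes \<mu>: "weight \<mu>" and \<mu>1: "\<And>x. 1 \<le> \<mu> x" and v: "weight v"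
    and u: "\<And>\<omega>. \<omega> \<in> space M \<Longrightarrow> u \<omega> \<in> H1 \<mu>"
    and m: "\<And>h. h \<in> L2 \<mu> \<Longrightarrow> (\<lambda>\<omega>. inner_L2 \<mu> (u \<omega>) h) \<in> borel_measurable M"
  shows "(\<lambda>\<omega>. norm_H1 v (u \<omega>)) \<in> borel_measurable M"
proof -
  have [measurable]: "\<mu> \<in> borel_measurable borel" "v \<in> borel_measurable borel" using \<mu> v by (auto simp: weight_def)
  have v0: "0 < v x" for x using v by (simp add: weight_def)
  have \<mu>0: "\<mu> x \<noteq> 0" for x using \<mu>1[of x] by linarith
  have "\<exists>Y. indef_integral Y (wderiv (u \<omega>)) \<and> (AE x in lborel. u \<omega> x = Y x)" if "\<omega> \<in> space M" for \<omega>
    using weak_deriv_imp_indef_integral[OF H1_D(2)[OF \<mu> u[OF that]]] by metis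
  then obtain Y where Y: "\<And>\<omega>. \<omega> \<in> space M \<Longrightarrow> indef_integral (Y \<omega>) (wderiv (u \<omega>))"
    "\<And>\<omega>. \<omega> \<in> space M \<Longrightarrow> AE x in lborel. u \<omega> x = Y \<omega> x" by metis
  have mY: "Y \<omega> \<in> borel_measurable borel" if "\<omega> \<in> space M" for \<omega>
    by (rule borel_measurable_continuous_onI[OF indef_integral_continuous_on[OF Y(1)[OF that]]])
  have mu: "u \<omega> \<in> borel_measurable borel" "wderiv (u \<omega>) \<in> borel_measurable borel" if "\<omega> \<in> space M" for \<omega>
    using weak_deriv_measurable[OF H1_D(2)[OF \<mu> u[OF that]]] by auto
  have Yx: "(\<lambda>\<omega>. Y \<omega> x) \<in> borel_measurable M" for x
  proof -
    define h where "h n y = indicat_real {x..x + 1 / real (Suc n)} y / \<mu> y" for n y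
    have hm: "(\<lambda>\<omega>. real (Suc n) * inner_L2 \<mu> (u \<omega>) (h n)) \<in> borel_measurable M" for n
    proof -
      have "h n \<in> L2 \<mu>"
      proof -
        have i: "integrable lborel (indicat_real {x..x + 1 / real (Suc n)})"
          by (rule integrable_real_indicator) auto
        have "integrable lborel (\<lambda>y. (h n y)\<^sup>2 * \<mu> y)"
        proof (rule Bochner_Integration.integrable_bound[OF i])
          show "AE y in lborel. norm ((h n y)\<^sup>2 * \<mu> y) \<le> norm (indicat_real {x..x + 1 / real (Suc n)} y)"
          proof (rule AE_I2)
            fix y
            have "(1 / \<mu> y)\<^sup>2 * \<mu> y = 1 / \<mu> y" using \<mu>0[of y] by (simp add: power2_eq_square)
            also have "\<dots> \<le> 1" using \<mu>1[of y] by simp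
            finally have "(1 / \<mu> y)\<^sup>2 * \<mu> y \<le> 1" .
            moreover have "0 \<le> (1 / \<mu> y)\<^sup>2 * \<mu> y" using \<mu>1[of y] by (intro mult_nonneg_nonneg) auto
            ultimately show "norm ((h n y)\<^sup>2 * \<mu> y) \<le> norm (indicat_real {x..x + 1 / real (Suc n)} y)"
              by (auto simp: h_def indicator_def)
          qed
        qed (unfold h_def, measurable)
        then show ?thesis unfolding L2_def h_def by auto
      qed
      then show ?thesis using m by auto
    qed
    show ?thesis
    proof (rule borel_measurable_LIMSEQ_real[where u="\<lambda>n \<omega>. real (Suc n) * inner_L2 \<mu> (u \<omega>) (h n)", OF _ hm])
      fix \<omega> assume \<omega>: "\<omega> \<in> space M"
      have "inner_L2 \<mu> (u \<omega>) (h n) = (LINT y:{x..x + 1 / real (Suc n)}|lborel. Y \<omega> y)" for n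
      proof -
        have [measurable]: "u \<omega> \<in> borel_measurable borel" "Y \<omega> \<in> borel_measurable borel" using mu mY \<omega> by auto
        show ?thesis unfolding inner_L2_def set_lebesgue_integral_def h_def
          by (rule integral_cong_AE) (use Y(2)[OF \<omega>] \<mu>0 in \<open>auto elim!: eventually_mono\<close>)
      qed
      then show "(\<lambda>n. real (Suc n) * inner_L2 \<mu> (u \<omega>) (h n)) \<longlonglongrightarrow> Y \<omega> x"
        using continuous_average_limit[OF indef_integral_continuous_on[OF Y(1)[OF \<omega>]], of x] by simp
    qed
  qed
  have "(\<lambda>(\<omega>, x). Y \<omega> x) \<in> borel_measurable (M \<Otimes>\<^sub>M lborel)"
    by (rule measurable_continuous_family[where X="\<lambda>x \<omega>. Y \<omega> x", OF Yx indef_integral_isCont[OF Y(1)]])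
  then have YY[measurable]: "(\<lambda>p. Y (fst p) (snd p)) \<in> borel_measurable (M \<Otimes>\<^sub>M lborel)" by (simp add: split_beta')
  define N where "N n = real (Suc n)" for n
  define Dn where "Dn n \<omega> x = N n * (Y \<omega> (x + 1 / N n) - Y \<omega> x)" for n \<omega> x
  have Dm: "(\<lambda>p. Dn n (fst p) (snd p)) \<in> borel_measurable (M \<Otimes>\<^sub>M lborel)" for n
  proof -
    have "(\<lambda>p. (fst p, snd p + 1 / N n)) \<in> M \<Otimes>\<^sub>M lborel \<rightarrow>\<^sub>M M \<Otimes>\<^sub>M lborel" by measurable
    from measurable_compose[OF this YY] have [measurable]:
      "(\<lambda>p. Y (fst p) (snd p + 1 / N n)) \<in> borel_measurable (M \<Otimes>\<^sub>M lborel)" by simp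
    show ?thesis unfolding Dn_def by measurable
  qed
  note [measurable] = Dm
  have A: "(\<lambda>\<omega>. \<integral>\<^sup>+x. ennreal ((Y \<omega> x)\<^sup>2 * v x) \<partial>lborel) \<in> borel_measurable M"
  proof (rule lborel.borel_measurable_nn_integral)
    have "(\<lambda>p. ennreal ((Y (fst p) (snd p))\<^sup>2 * v (snd p))) \<in> borel_measurable (M \<Otimes>\<^sub>M lborel)" by measurable
    then show "(\<lambda>(\<omega>, x). ennreal ((Y \<omega> x)\<^sup>2 * v x)) \<in> borel_measurable (M \<Otimes>\<^sub>M lborel)" by (simp add: split_beta')
  qed
  have B: "(\<lambda>\<omega>. \<integral>\<^sup>+x. liminf (\<lambda>n. ennreal ((Dn n \<omega> x)\<^sup>2 * v x)) \<partial>lborel) \<in> borel_measurable M"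
  proof (rule lborel.borel_measurable_nn_integral)
    have "(\<lambda>p. liminf (\<lambda>n. ennreal ((Dn n (fst p) (snd p))\<^sup>2 * v (snd p)))) \<in> borel_measurable (M \<Otimes>\<^sub>M lborel)" by measurable
    then show "(\<lambda>(\<omega>, x). liminf (\<lambda>n. ennreal ((Dn n \<omega> x)\<^sup>2 * v x))) \<in> borel_measurable (M \<Otimes>\<^sub>M lborel)" by (simp add: split_beta')
  qed
  have eq: "norm_H1 v (u \<omega>) = sqrt (enn2real (\<integral>\<^sup>+x. ennreal ((Y \<omega> x)\<^sup>2 * v x) \<partial>lborel) +
      enn2real (\<integral>\<^sup>+x. liminf (\<lambda>n. ennreal ((Dn n \<omega> x)\<^sup>2 * v x)) \<partial>lborel))" if \<omega>: "\<omega> \<in> space M" for \<omega>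
  proof -
    have "(\<integral>\<^sup>+x. ennreal ((u \<omega> x)\<^sup>2 * v x) \<partial>lborel) = (\<integral>\<^sup>+x. ennreal ((Y \<omega> x)\<^sup>2 * v x) \<partial>lborel)"
      by (rule nn_integral_cong_AE) (use Y(2)[OF \<omega>] in \<open>auto elim!: eventually_mono\<close>)
    moreover have "(\<integral>\<^sup>+x. ennreal ((wderiv (u \<omega>) x)\<^sup>2 * v x) \<partial>lborel) = (\<integral>\<^sup>+x. liminf (\<lambda>n. ennreal ((Dn n \<omega> x)\<^sup>2 * v x)) \<partial>lborel)"
    proof (rule nn_integral_cong_AE)
      show "AE x in lborel. ennreal ((wderiv (u \<omega>) x)\<^sup>2 * v x) = liminf (\<lambda>n. ennreal ((Dn n \<omega> x)\<^sup>2 * v x))"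
        using AE_lebesgue_differentiation[OF indef_integralD(1)[OF Y(1)[OF \<omega>]]]
      proof eventually_elim
        case (elim x)
        have "Dn n \<omega> x = real (Suc n) * (LINT y:{x..x + 1 / real (Suc n)}|lborel. wderiv (u \<omega>) y)" for n
          using indef_integralD(2)[OF Y(1)[OF \<omega>], of x "x + 1 / real (Suc n)"] by (simp add: Dn_def N_def)
        then have "(\<lambda>n. Dn n \<omega> x) \<longlonglongrightarrow> wderiv (u \<omega>) x" using elim by simp
        then have "(\<lambda>n. ennreal ((Dn n \<omega> x)\<^sup>2 * v x)) \<longlonglongrightarrow> ennreal ((wderiv (u \<omega>) x)\<^sup>2 * v x)"
          by (intro tendsto_ennrealI tendsto_intros)
        then show ?case by (simp add: lim_imp_Liminf)
      qed
    qed
    ultimately show ?thesis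
      unfolding norm_H1_def integral_sq_eq_enn2real[OF v mu(1)[OF \<omega>]] integral_sq_eq_enn2real[OF v mu(2)[OF \<omega>]] by simp
  qed
  have "(\<lambda>\<omega>. sqrt (enn2real (\<integral>\<^sup>+x. ennreal ((Y \<omega> x)\<^sup>2 * v x) \<partial>lborel) +
      enn2real (\<integral>\<^sup>+x. liminf (\<lambda>n. ennreal ((Dn n \<omega> x)\<^sup>2 * v x)) \<partial>lborel))) \<in> borel_measurable M"
    using A B by measurable
  then show ?thesis by (subst measurable_cong[OF eq])
qed

lemma sets_continuous_below:
  fixes N :: "real \<Rightarrow> 'w \<Rightarrow> real"
  assumes m: "\<And>t. t \<in> {0..T} \<Longrightarrow> N t \<in> borel_measurable M"
    and c: "\<And>\<omega>. \<omega> \<in> space M \<Longrightarrow> continuous_on {0..T} (\<lambda>t. N t \<omega>)" and T: "0 < T"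
  shows "{\<omega> \<in> space M. \<forall>t\<in>{0..<T}. N t \<omega> < a} \<in> sets M"
proof -
  define S where "S n = T * (1 - 1 / real (Suc n))" for n
  have S: "0 \<le> S n" "S n < T" for n using T by (auto simp: S_def field_simps)
  define E where "E n k = {\<omega> \<in> space M. \<forall>t\<in>\<rat> \<inter> {0..S n}. N t \<omega> \<le> a - 1 / real (Suc k)}" for n k :: nat
  have E: "E n k \<in> sets M" for n k
  proof -
    have "countable (\<rat> \<inter> {0..S n})" using countable_rat by blast
    moreover have "{\<omega> \<in> space M. N t \<omega> \<le> a - 1 / real (Suc k)} \<in> sets M" if "t \<in> \<rat> \<inter> {0..S n}" for t
    proof -
      have [measurable]: "N t \<in> borel_measurable M" using that S[of n] by (intro m) auto
      show ?thesis by measurable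
    qed
    ultimately have "space M - (\<Union>t\<in>\<rat> \<inter> {0..S n}. space M - {\<omega> \<in> space M. N t \<omega> \<le> a - 1 / real (Suc k)}) \<in> sets M"
      by (intro sets.Diff sets.top sets.countable_UN') auto
    moreover have "E n k = space M - (\<Union>t\<in>\<rat> \<inter> {0..S n}. space M - {\<omega> \<in> space M. N t \<omega> \<le> a - 1 / real (Suc k)})"
      unfolding E_def by blast
    ultimately show ?thesis by simp
  qed
  have "{\<omega> \<in> space M. \<forall>t\<in>{0..<T}. N t \<omega> < a} = (\<Inter>n. \<Union>k. E n k)"
  proof (intro set_eqI iffI)
    fix \<omega> assume "\<omega> \<in> {\<omega> \<in> space M. \<forall>t\<in>{0..<T}. N t \<omega> < a}"
    then have \<omega>: "\<omega> \<in> space M" "\<And>t. t \<in> {0..<T} \<Longrightarrow> N t \<omega> < a" by auto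
    have "\<exists>k. \<omega> \<in> E n k" for n
    proof -
      have "continuous_on {0..S n} (\<lambda>t. N t \<omega>)" by (rule continuous_on_subset[OF c[OF \<omega>(1)]]) (use S[of n] in auto)
      then obtain s where s: "s \<in> {0..S n}" "\<And>t. t \<in> {0..S n} \<Longrightarrow> N t \<omega> \<le> N s \<omega>"
        using continuous_attains_sup[of "{0..S n}" "\<lambda>t. N t \<omega>"] S[of n] by auto
      have "N s \<omega> < a" using s(1) S(2)[of n] by (intro \<omega>(2)) auto
      then obtain k where "1 / real (Suc k) < a - N s \<omega>" using nat_approx_posE[of "a - N s \<omega>"] by auto
      then have "\<omega> \<in> E n k" using s(2) \<omega>(1) by (force simp: E_def)
      then show ?thesis by blast
    qed
    then show "\<omega> \<in> (\<Inter>n. \<Union>k. E n k)" by blast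
  next
    fix \<omega> assume "\<omega> \<in> (\<Inter>n. \<Union>k. E n k)"
    then have ex: "\<And>n. \<exists>k. \<omega> \<in> E n k" by blast
    then have \<omega>: "\<omega> \<in> space M" by (auto simp: E_def)
    have "N t \<omega> < a" if t: "t \<in> {0..<T}" for t
    proof -
      obtain n where n: "1 / real (Suc n) < (T - t) / T" using nat_approx_posE[of "(T - t) / T"] t T by auto
      have "t < S n" using n T by (simp add: S_def field_simps)
      obtain k where k: "\<omega> \<in> E n k" using ex by blast
      have "N t \<omega> \<le> a - 1 / real (Suc k)"
      proof (rule ccontr)
        assume "\<not> ?thesis"
        then have "0 < N t \<omega> - (a - 1 / real (Suc k))" by simp
        then obtain d where d: "d > 0" "\<And>s. s \<in> {0..T} \<Longrightarrow> dist s t < d \<Longrightarrow> dist (N s \<omega>) (N t \<omega>) < N t \<omega> - (a - 1 / real (Suc k))"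
          using c[OF \<omega>] t unfolding continuous_on_iff by (metis atLeastAtMost_iff atLeastLessThan_iff less_imp_le)
        obtain s where s: "s \<in> \<rat>" "t < s" "s < min (t + d) (S n)"
          using Rats_dense_in_real[of t "min (t + d) (S n)"] d(1) \<open>t < S n\<close> by auto
        have "dist (N s \<omega>) (N t \<omega>) < N t \<omega> - (a - 1 / real (Suc k))"
          using s t S(2)[of n] by (intro d(2)) (auto simp: dist_real_def)
        moreover have "N s \<omega> \<le> a - 1 / real (Suc k)" using k s t by (auto simp: E_def)
        ultimately show False by (simp add: dist_real_def)
      qed
      moreover have "0 < 1 / real (Suc k)" by simp
      ultimately show ?thesis by linarith
    qed
    then show "\<omega> \<in> {\<omega> \<in> space M. \<forall>t\<in>{0..<T}. N t \<omega> < a}" using \<omega> by blast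
  qed
  also have "\<dots> \<in> sets M" using E by auto
  finally show ?thesis .
qed

lemma first_time_eq:
  assumes T: "0 < T"
  shows "first_time T P = T \<longleftrightarrow> (\<forall>t\<in>{0..<T}. \<not> P t)" and "first_time T P \<le> T"
proof -
  have bd: "bdd_below {t \<in> {0..T}. P t}" by (rule bdd_belowI[of _ 0]) auto
  show le: "first_time T P \<le> T"
  proof (cases "\<exists>t\<in>{0..T}. P t")
    case True
    then obtain t where "t \<in> {0..T}" "P t" by blast
    then have "Inf {t \<in> {0..T}. P t} \<le> t" by (intro cInf_lower[OF _ bd]) auto
    then show ?thesis using True \<open>t \<in> {0..T}\<close> by (simp add: first_time_def)
  qed (simp add: first_time_def)
  show "first_time T P = T \<longleftrightarrow> (\<forall>t\<in>{0..<T}. \<not> P t)"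
  proof
    assume eq: "first_time T P = T"
    show "\<forall>t\<in>{0..<T}. \<not> P t"
    proof (intro ballI notI)
      fix t assume t: "t \<in> {0..<T}" "P t"
      then have "t \<in> {t \<in> {0..T}. P t}" by auto
      then have "Inf {t \<in> {0..T}. P t} \<le> t" by (rule cInf_lower[OF _ bd])
      then show False using eq t unfolding first_time_def by (auto split: if_splits)
    qed
  next
    assume n: "\<forall>t\<in>{0..<T}. \<not> P t"
    show "first_time T P = T"
    proof (cases "\<exists>t\<in>{0..T}. P t")
      case True
      then have "{t \<in> {0..T}. P t} = {T}" using n T by (force simp: less_le)
      then show ?thesis by (simp add: first_time_def)
    qed (simp add: first_time_def)
  qed
qed

lemma min_first_time_eq:
  assumes "0 < T"
  shows "min (first_time T P) (first_time T Q) = T \<longleftrightarrow> (\<forall>t\<in>{0..<T}. \<not> P t) \<and> (\<forall>t\<in>{0..<T}. \<not> Q t)"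
  using first_time_eq[OF assms, of P] first_time_eq[OF assms, of Q] by (auto simp: min_def)

section \<open>The expansion\<close>

lemma (in travelling_front) front_path_AE:
  assumes u: "front_solution M F T \<nu> b f c vh Z W \<eta>0 \<epsilon> u"
    and c0: "is_c0 M F T \<nu> c vh Z W \<eta>0 m c0"
    and u0: "is_u0 M F T \<nu> b f c vh Z W \<eta>0 c0 u0" and \<epsilon>: "\<epsilon> > 0"
  shows "AE \<omega> in M. \<omega> \<in> space M \<and> front_path T \<nu> b c Z f vh \<phi>1 \<phi>2 K \<eta> \<epsilon> (\<lambda>t. u t \<omega>) (\<lambda>t. u0 t \<omega>) (\<lambda>t. W t \<omega>) (\<lambda>t. c0 t \<omega>) \<eta>0"
proof -
  have UC: "\<And>\<omega>. \<omega> \<in> space M \<Longrightarrow> C_H1 T \<mu> (\<lambda>t. u t \<omega>)" using u by (simp add: front_solution_def)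
  have VC: "\<And>\<omega>. \<omega> \<in> space M \<Longrightarrow> C_H1 T \<mu> (\<lambda>t. u0 t \<omega>)" using u0 by (simp add: is_u0_def)
  have CC: "\<And>\<omega>. \<omega> \<in> space M \<Longrightarrow> continuous_on {0..T} (\<lambda>t. c0 t \<omega>)" using c0 by (simp add: is_c0_def)
  have e1: "AE \<omega> in M. \<forall>h\<in>H1 \<mu>.
        set_integrable lborel {0..T} (\<lambda>s. front_drift \<nu> b f c vh Z s \<omega> (u s \<omega>) h) \<and>
        (\<forall>t\<in>{0..T}. inner_L2 \<mu> (u t \<omega>) h =
           inner_L2 \<mu> (\<lambda>x. \<epsilon> * \<eta>0 x) h + (LINT s:{0..t}|lborel. front_drift \<nu> b f c vh Z s \<omega> (u s \<omega>) h)
           + \<epsilon> * inner_L2 \<mu> (W t \<omega>) h)"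
    using u unfolding front_solution_def variational_solution_def by blast
  have e2: "AE \<omega> in M. \<forall>h\<in>H1 (\<lambda>_. 1).
        set_integrable lborel {0..T} (\<lambda>s. linear_drift \<nu> b f c vh c0 s \<omega> (u0 s \<omega>) h) \<and>
        (\<forall>t\<in>{0..T}. inner_L2 (\<lambda>_. 1) (u0 t \<omega>) h =
           inner_L2 (\<lambda>_. 1) \<eta>0 h + (LINT s:{0..t}|lborel. linear_drift \<nu> b f c vh c0 s \<omega> (u0 s \<omega>) h)
           + 1 * inner_L2 (\<lambda>_. 1) (W t \<omega>) h)"
    using u0 unfolding is_u0_def variational_solution_def by blast
  show ?thesis using e1 e2 AE_space
  proof eventually_elim
    case (elim \<omega>)
    note d = elim(1)[unfolded front_drift_def] elim(2)[unfolded linear_drift_def]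
    have "front_path_axioms T \<nu> b c Z f vh \<epsilon> (\<lambda>t. u t \<omega>) (\<lambda>t. u0 t \<omega>) (\<lambda>t. W t \<omega>) (\<lambda>t. c0 t \<omega>) \<eta>0"
      unfolding front_path_axioms_def
      by (intro conjI allI impI \<epsilon> UC VC CC elim(3) bspec[OF d(1)] bspec[OF d(2)])
    then show ?case using elim(3) by (simp add: front_path_def travelling_front_axioms)
  qed
qed

theorem theorem3p3:
  fixes T \<nu> b c Z q \<epsilon>\<^sub>0 :: real
    and f vh \<eta> :: "real \<Rightarrow> real"
    and M :: "'w measure" and F :: "real \<Rightarrow> 'w measure"
    and Q sqrtQ :: "(real \<Rightarrow> real) \<Rightarrow> real \<Rightarrow> real"
    and W :: "real \<Rightarrow> 'w \<Rightarrow> real \<Rightarrow> real"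
    and u :: "real \<Rightarrow> real \<Rightarrow> 'w \<Rightarrow> real \<Rightarrow> real"
    and c0 :: "real \<Rightarrow> real \<Rightarrow> 'w \<Rightarrow> real"
    and u0 :: "real \<Rightarrow> real \<Rightarrow> 'w \<Rightarrow> real \<Rightarrow> real"
  assumes "T > 0" and "\<nu> > 0" and "b > 0"
    and "bistable_reaction f"
    and "travelling_wave \<nu> b f c vh"
    and "Z > 0" and "(LINT x|lborel. Psi \<nu> c Z vh x * deriv vh x) = 1"
    and "stochastic_basis M F"
    and "Q_wiener_process M F T (wgt \<nu> c Z 0) Q W"
    and "is_sqrt_op (wgt \<nu> c Z 0) sqrtQ Q"
    and "hilbert_schmidt_L2_H1 (wgt \<nu> c Z 0) sqrtQ"
    and "\<eta> \<in> H1 (wgt \<nu> c Z 0)"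
    and "\<And>\<epsilon>. \<epsilon> > 0 \<Longrightarrow> front_solution M F T \<nu> b f c vh Z W \<eta> \<epsilon> (u \<epsilon>)"
    and "\<And>m. m > 0 \<Longrightarrow> is_c0 M F T \<nu> c vh Z W \<eta> m (c0 m)"
    and "\<And>m. m > 0 \<Longrightarrow> is_u0 M F T \<nu> b f c vh Z W \<eta> (c0 m) (u0 m)"
    and "0 \<le> q" and "q \<le> 1" and "q < 1 / 2"
    and "\<epsilon>\<^sub>0 > 0"
  shows "(\<exists>\<alpha>. \<forall>m>0. \<forall>\<epsilon>\<in>{0<..\<epsilon>\<^sub>0}. \<exists>r :: real \<Rightarrow> 'w \<Rightarrow> real \<Rightarrow> real.
            AE \<omega> in M.
              min (tau_u T \<nu> c Z q \<epsilon> (u \<epsilon>) \<omega>) (tau_C T q \<epsilon> (primitive (c0 m)) \<omega>) = T \<longrightarrow>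
                (\<forall>t\<in>{0..T}. AE x in lborel.
                   u \<epsilon> t \<omega> x + vh (x + c * t) =
                     vh (x + c * t + \<epsilon> * primitive (c0 m) t \<omega>)
                     + \<epsilon> * u0 m t \<omega> x + \<epsilon> * r t \<omega> x) \<and>
                C_H1 T (wgt \<nu> c Z 0) (\<lambda>t. r t \<omega>) \<and>
                norm_sup_T \<nu> c Z T (\<lambda>t. r t \<omega>) \<le> \<alpha> * \<epsilon> powr (1 - 2 * q))
       \<and> (q > 0 \<longrightarrow>
          (\<forall>m>0. ((\<lambda>\<epsilon>. measure M {\<omega> \<in> space M.
              min (tau_u T \<nu> c Z q \<epsilon> (u \<epsilon>) \<omega>) (tau_C T q \<epsilon> (primitive (c0 m)) \<omega>) = T})
            \<longlongrightarrow> 1) (at_right 0)))"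
proof -
  note T = assms(1) and \<nu> = assms(2) and b = assms(3) and bist = assms(4) and tw = assms(5) and Z = assms(6)
    and one = assms(7) and basis = assms(8) and \<eta>H = assms(12) and u = assms(13) and c0 = assms(14) and u0 = assms(15)
    and q0 = assms(16) and q1 = assms(17) and q2 = assms(18) and \<epsilon>0 = assms(19)
  obtain \<phi>1 \<phi>2 K where wave:
    "\<forall>x. (vh has_real_derivative deriv vh x) (at x)" "\<forall>x. (deriv vh has_real_derivative \<phi>1 x) (at x)"
    "\<forall>x. (\<phi>1 has_real_derivative \<phi>2 x) (at x)" "continuous_on UNIV \<phi>2"
    "\<forall>x. 0 \<le> vh x" "\<forall>x. vh x \<le> 1" "\<forall>x. 0 \<le> deriv vh x" "1 \<le> K"
    "\<forall>x. \<bar>\<phi>1 x\<bar> \<le> K * deriv vh x" "\<forall>x. \<bar>\<phi>2 x\<bar> \<le> K * deriv vh x"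
    "\<forall>x h. deriv vh (x + h) \<le> exp (K * \<bar>h\<bar>) * deriv vh x" "deriv vh \<in> L2 (wgt \<nu> c Z 0)"
    "\<forall>x. c * \<phi>1 x = \<nu> * \<phi>2 x + b * (deriv f (vh x) * deriv vh x)"
    using wave_properties[OF \<nu> b bist tw Z one] by metis
  obtain \<eta>f where \<eta>f: "\<eta>f > 0" "\<forall>u v. 0 \<le> v \<longrightarrow> v \<le> 1 \<longrightarrow> \<bar>f (u + v) - f v - deriv f v * u\<bar> \<le> \<eta>f * (1 + \<bar>u\<bar>) * \<bar>u\<bar>\<^sup>2"
    "\<forall>v. 0 \<le> v \<longrightarrow> v \<le> 1 \<longrightarrow> \<bar>deriv f v\<bar> \<le> \<eta>f"
    using bistable_reaction_bounds[OF bist] by blast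
  interpret tf: travelling_front T \<nu> b c Z f vh \<phi>1 \<phi>2 K \<eta>f
    by unfold_locales (use T \<nu> b Z bistable_reaction_deriv[OF bist] \<eta>f wave in \<open>simp_all\<close>)
  interpret prob_space M using basis by (simp add: stochastic_basis_def)
  define \<theta> where "\<theta> \<epsilon> = \<epsilon> powr (1 - q)" for \<epsilon>
  have \<theta>pos: "0 < \<theta> \<epsilon>" if "\<epsilon> > 0" for \<epsilon> using that by (simp add: \<theta>_def)
  have AEp: "AE \<omega> in M. \<omega> \<in> space M \<and> front_path T \<nu> b c Z f vh \<phi>1 \<phi>2 K \<eta>f \<epsilon> (\<lambda>t. u \<epsilon> t \<omega>) (\<lambda>t. u0 m t \<omega>)
      (\<lambda>t. W t \<omega>) (\<lambda>t. c0 m t \<omega>) \<eta>" if "\<epsilon> > 0" "m > 0" for \<epsilon> m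
    by (rule tf.front_path_AE[OF u[OF that(1)] c0[OF that(2)] u0[OF that(2)] that(1)])
  have event: "min (tau_u T \<nu> c Z q \<epsilon> (u \<epsilon>) \<omega>) (tau_C T q \<epsilon> (primitive (c0 m)) \<omega>) = T \<longleftrightarrow>
      (\<forall>t\<in>{0..<T}. norm_H1 (wgt \<nu> c Z t) (u \<epsilon> t \<omega>) < \<theta> \<epsilon>) \<and> (\<forall>t\<in>{0..<T}. \<bar>primitive (c0 m) t \<omega>\<bar> < \<epsilon> powr (- q))" for \<epsilon> m \<omega>
    unfolding tau_u_def tau_C_def min_first_time_eq[OF T] \<theta>_def by (auto simp: not_le)
  have up_to_T: "g t \<le> a" if "continuous_on {0..T} g" "\<forall>t\<in>{0..<T}. g t < a" "t \<in> {0..T}" for g :: "real \<Rightarrow> real" and a t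
  proof (rule continuous_le_on_closure[of "{0..<T}" g])
    show "continuous_on (closure {0..<T}) g" "t \<in> closure {0..<T}"
      using that T by (simp_all add: closure_atLeastLessThan)
  qed (use that in \<open>auto intro: less_imp_le\<close>)
  have part1: "\<exists>\<alpha>. \<forall>m>0. \<forall>\<epsilon>\<in>{0<..\<epsilon>\<^sub>0}. \<exists>r :: real \<Rightarrow> 'w \<Rightarrow> real \<Rightarrow> real.
            AE \<omega> in M.
              min (tau_u T \<nu> c Z q \<epsilon> (u \<epsilon>) \<omega>) (tau_C T q \<epsilon> (primitive (c0 m)) \<omega>) = T \<longrightarrow>
                (\<forall>t\<in>{0..T}. AE x in lborel.
                   u \<epsilon> t \<omega> x + vh (x + c * t) =
                     vh (x + c * t + \<epsilon> * primitive (c0 m) t \<omega>)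
                     + \<epsilon> * u0 m t \<omega> x + \<epsilon> * r t \<omega> x) \<and>
                C_H1 T (wgt \<nu> c Z 0) (\<lambda>t. r t \<omega>) \<and>
                norm_sup_T \<nu> c Z T (\<lambda>t. r t \<omega>) \<le> \<alpha> * \<epsilon> powr (1 - 2 * q)"
  proof (rule exI[of _ "tf.remainder_K (\<theta> \<epsilon>\<^sub>0)"], intro allI impI ballI)
    fix m \<epsilon> :: real assume m: "m > 0" and e: "\<epsilon> \<in> {0<..\<epsilon>\<^sub>0}"
    then have \<epsilon>: "\<epsilon> > 0" "\<epsilon> \<le> \<epsilon>\<^sub>0" by auto
    have \<theta>le: "\<theta> \<epsilon> \<le> \<theta> \<epsilon>\<^sub>0" unfolding \<theta>_def using \<epsilon> q1 by (intro powr_mono2) auto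
    have "(\<theta> \<epsilon>)\<^sup>2 / \<epsilon> = \<epsilon> powr ((1 - q) + (1 - q) - 1)"
      using \<epsilon> by (simp only: \<theta>_def power2_eq_square powr_add powr_diff) simp
    then have \<theta>sq: "(\<theta> \<epsilon>)\<^sup>2 / \<epsilon> = \<epsilon> powr (1 - 2 * q)" by (simp add: algebra_simps)
    have \<theta>q: "\<epsilon> * \<epsilon> powr (- q) = \<theta> \<epsilon>"
      using \<epsilon> powr_add[of \<epsilon> 1 "- q"] by (simp add: \<theta>_def)
    define r where "r t \<omega> x = (u \<epsilon> t \<omega> x + vh (x + c * t) - vh (x + c * t + \<epsilon> * primitive (c0 m) t \<omega>)) / \<epsilon> - u0 m t \<omega> x" for t \<omega> x
    show "\<exists>r :: real \<Rightarrow> 'w \<Rightarrow> real \<Rightarrow> real.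
            AE \<omega> in M.
              min (tau_u T \<nu> c Z q \<epsilon> (u \<epsilon>) \<omega>) (tau_C T q \<epsilon> (primitive (c0 m)) \<omega>) = T \<longrightarrow>
                (\<forall>t\<in>{0..T}. AE x in lborel.
                   u \<epsilon> t \<omega> x + vh (x + c * t) =
                     vh (x + c * t + \<epsilon> * primitive (c0 m) t \<omega>)
                     + \<epsilon> * u0 m t \<omega> x + \<epsilon> * r t \<omega> x) \<and>
                C_H1 T (wgt \<nu> c Z 0) (\<lambda>t. r t \<omega>) \<and>
                norm_sup_T \<nu> c Z T (\<lambda>t. r t \<omega>) \<le> tf.remainder_K (\<theta> \<epsilon>\<^sub>0) * \<epsilon> powr (1 - 2 * q)"
    proof (rule exI[of _ r])
      show "AE \<omega> in M.
              min (tau_u T \<nu> c Z q \<epsilon> (u \<epsilon>) \<omega>) (tau_C T q \<epsilon> (primitive (c0 m)) \<omega>) = T \<longrightarrow>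
                (\<forall>t\<in>{0..T}. AE x in lborel.
                   u \<epsilon> t \<omega> x + vh (x + c * t) =
                     vh (x + c * t + \<epsilon> * primitive (c0 m) t \<omega>)
                     + \<epsilon> * u0 m t \<omega> x + \<epsilon> * r t \<omega> x) \<and>
                C_H1 T (wgt \<nu> c Z 0) (\<lambda>t. r t \<omega>) \<and>
                norm_sup_T \<nu> c Z T (\<lambda>t. r t \<omega>) \<le> tf.remainder_K (\<theta> \<epsilon>\<^sub>0) * \<epsilon> powr (1 - 2 * q)"
        using AEp[OF \<epsilon>(1) m]
      proof (eventually_elim, intro impI)
        fix \<omega> assume p: "\<omega> \<in> space M \<and> front_path T \<nu> b c Z f vh \<phi>1 \<phi>2 K \<eta>f \<epsilon> (\<lambda>t. u \<epsilon> t \<omega>) (\<lambda>t. u0 m t \<omega>)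
          (\<lambda>t. W t \<omega>) (\<lambda>t. c0 m t \<omega>) \<eta>"
          and ev: "min (tau_u T \<nu> c Z q \<epsilon> (u \<epsilon>) \<omega>) (tau_C T q \<epsilon> (primitive (c0 m)) \<omega>) = T"
        interpret fp: front_path T \<nu> b c Z f vh \<phi>1 \<phi>2 K \<eta>f \<epsilon> "\<lambda>t. u \<epsilon> t \<omega>" "\<lambda>t. u0 m t \<omega>" "\<lambda>t. W t \<omega>" "\<lambda>t. c0 m t \<omega>" \<eta>
          using p by simp
        have Ceq: "fp.C = (\<lambda>t. primitive (c0 m) t \<omega>)" by (simp add: fp.C_def primitive_def fun_eq_iff)
        have req: "fp.r = (\<lambda>t. r t \<omega>)" by (simp add: fp.r_def r_def Ceq fun_eq_iff)
        have N: "norm_H1 (wgt \<nu> c Z t) (u \<epsilon> t \<omega>) \<le> \<theta> \<epsilon>" if "t \<in> {0..T}" for t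
          by (rule up_to_T[OF tf.continuous_norm_H1_wgt[OF fp.U] conjunct1[OF ev[unfolded event]] that])
        have cC: "continuous_on {0..T} (\<lambda>t. \<bar>fp.C t\<bar>)" by (intro continuous_intros fp.C_cont)
        have "\<bar>fp.C t\<bar> \<le> \<epsilon> powr (- q)" if "t \<in> {0..T}" for t
          by (rule up_to_T[OF cC _ that]) (use conjunct2[OF ev[unfolded event]] in \<open>simp add: Ceq\<close>)
        then have Cb: "\<bar>\<epsilon> * fp.C t\<bar> \<le> \<theta> \<epsilon>" if "t \<in> {0..T}" for t
          using mult_left_mono[of "\<bar>fp.C t\<bar>" "\<epsilon> powr (- q)" \<epsilon>] that \<epsilon> \<theta>q by (simp add: abs_mult)
        note rd = fp.remainder_decomposition[OF less_imp_le[OF \<theta>pos[OF \<epsilon>(1)]] \<theta>le N Cb, unfolded req \<theta>sq]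
        have "u \<epsilon> t \<omega> x + vh (x + c * t) = vh (x + c * t + \<epsilon> * primitive (c0 m) t \<omega>) + \<epsilon> * u0 m t \<omega> x + \<epsilon> * r t \<omega> x" for t x
          using \<epsilon>(1) by (simp add: r_def field_simps)
        then show "(\<forall>t\<in>{0..T}. AE x in lborel.
                   u \<epsilon> t \<omega> x + vh (x + c * t) =
                     vh (x + c * t + \<epsilon> * primitive (c0 m) t \<omega>)
                     + \<epsilon> * u0 m t \<omega> x + \<epsilon> * r t \<omega> x) \<and>
                C_H1 T (wgt \<nu> c Z 0) (\<lambda>t. r t \<omega>) \<and>
                norm_sup_T \<nu> c Z T (\<lambda>t. r t \<omega>) \<le> tf.remainder_K (\<theta> \<epsilon>\<^sub>0) * \<epsilon> powr (1 - 2 * q)"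
          using rd by simp
      qed
    qed
  qed
  have part2: "((\<lambda>\<epsilon>. measure M {\<omega> \<in> space M.
              min (tau_u T \<nu> c Z q \<epsilon> (u \<epsilon>) \<omega>) (tau_C T q \<epsilon> (primitive (c0 m)) \<omega>) = T}) \<longlongrightarrow> 1) (at_right 0)"
    if q: "q > 0" and m: "m > 0" for m
    unfolding tendsto_at_iff_sequentially
  proof (intro allI impI)
    fix X :: "nat \<Rightarrow> real" assume "\<forall>i. X i \<in> {0<..} - {0}" and X0: "X \<longlonglongrightarrow> 0"
    then have X: "X i > 0" for i by auto
    define E where "E n = {\<omega> \<in> space M.
       min (tau_u T \<nu> c Z q (X n) (u (X n)) \<omega>) (tau_C T q (X n) (primitive (c0 m)) \<omega>) = T}" for n
    have F: "subalgebra M (F t)" for t using basis by (simp add: stochastic_basis_def)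
    have ccont: "\<And>\<omega>. \<omega> \<in> space M \<Longrightarrow> continuous_on {0..T} (\<lambda>t. c0 m t \<omega>)"
      and cF: "\<And>t. t \<in> {0..T} \<Longrightarrow> c0 m t \<in> borel_measurable (F t)"
      using c0[OF m] by (auto simp: is_c0_def)
    have cmeas: "c0 m t \<in> borel_measurable M" if "t \<in> {0..T}" for t
      by (rule measurable_from_subalg[OF F cF[OF that]])
    have E: "E n \<in> sets M" for n
    proof -
      have ad: "adapted_L2 F T (wgt \<nu> c Z 0) (u (X n))" and UC: "\<And>\<omega>. \<omega> \<in> space M \<Longrightarrow> C_H1 T (wgt \<nu> c Z 0) (\<lambda>t. u (X n) t \<omega>)"
        using u[OF X[of n]] by (simp_all add: front_solution_def variational_solution_def)
      have 1: "{\<omega> \<in> space M. \<forall>t\<in>{0..<T}. norm_H1 (wgt \<nu> c Z t) (u (X n) t \<omega>) < \<theta> (X n)} \<in> sets M"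
      proof (rule sets_continuous_below[OF _ tf.continuous_norm_H1_wgt[OF UC] T])
        fix t assume t: "t \<in> {0..T}"
        show "(\<lambda>\<omega>. norm_H1 (wgt \<nu> c Z t) (u (X n) t \<omega>)) \<in> borel_measurable M"
        proof (rule measurable_norm_H1[OF tf.weight_\<mu> tf.mu_ge1 tf.weight_wgt_t])
          show "u (X n) t \<omega> \<in> H1 (wgt \<nu> c Z 0)" if "\<omega> \<in> space M" for \<omega>
            using UC[OF that] t by (simp add: C_H1_def)
          show "(\<lambda>\<omega>. inner_L2 (wgt \<nu> c Z 0) (u (X n) t \<omega>) h) \<in> borel_measurable M" if "h \<in> L2 (wgt \<nu> c Z 0)" for h
          proof (rule measurable_from_subalg[OF F])
            show "(\<lambda>\<omega>. inner_L2 (wgt \<nu> c Z 0) (u (X n) t \<omega>) h) \<in> borel_measurable (F t)"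
              using ad t that by (simp add: adapted_L2_def)
          qed
        qed
      qed
      have 2: "{\<omega> \<in> space M. \<forall>t\<in>{0..<T}. \<bar>primitive (c0 m) t \<omega>\<bar> < X n powr (- q)} \<in> sets M"
      proof (rule sets_continuous_below[OF _ _ T])
        fix t assume t: "t \<in> {0..T}"
        show "(\<lambda>\<omega>. \<bar>primitive (c0 m) t \<omega>\<bar>) \<in> borel_measurable M"
          unfolding primitive_def using measurable_primitive[OF cmeas ccont t] by auto
      next
        fix \<omega> assume "\<omega> \<in> space M"
        then show "continuous_on {0..T} (\<lambda>t. \<bar>primitive (c0 m) t \<omega>\<bar>)"
          unfolding primitive_def by (intro continuous_intros set_integral_continuous ccont)
      qed
      have "E n = {\<omega> \<in> space M. \<forall>t\<in>{0..<T}. norm_H1 (wgt \<nu> c Z t) (u (X n) t \<omega>) < \<theta> (X n)} \<inter>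
          {\<omega> \<in> space M. \<forall>t\<in>{0..<T}. \<bar>primitive (c0 m) t \<omega>\<bar> < X n powr (- q)}"
        unfolding E_def event by blast
      then show ?thesis using sets.Int[OF 1 2] by simp
    qed
    have Xq: "(\<lambda>n. X n powr q) \<longlonglongrightarrow> 0" and X\<theta>: "(\<lambda>n. \<theta> (X n)) \<longlonglongrightarrow> 0"
      using tendsto_powr'[OF X0 tendsto_const[of q]] tendsto_powr'[OF X0 tendsto_const[of "1 - q"]] q q2 X
      by (auto simp: \<theta>_def less_imp_le)
    have "AE \<omega> in M. \<forall>n. \<omega> \<in> space M \<and> front_path T \<nu> b c Z f vh \<phi>1 \<phi>2 K \<eta>f (X n) (\<lambda>t. u (X n) t \<omega>) (\<lambda>t. u0 m t \<omega>)
      (\<lambda>t. W t \<omega>) (\<lambda>t. c0 m t \<omega>) \<eta>"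
      by (subst AE_all_countable, intro allI AEp X m)
    then have lim: "AE \<omega> in M. (\<lambda>n. indicat_real (E n) \<omega>) \<longlonglongrightarrow> 1"
    proof eventually_elim
      fix \<omega> assume p: "\<forall>n. \<omega> \<in> space M \<and> front_path T \<nu> b c Z f vh \<phi>1 \<phi>2 K \<eta>f (X n) (\<lambda>t. u (X n) t \<omega>) (\<lambda>t. u0 m t \<omega>)
        (\<lambda>t. W t \<omega>) (\<lambda>t. c0 m t \<omega>) \<eta>"
      then have \<omega>: "\<omega> \<in> space M" by blast
      define C where "C t = primitive (c0 m) t \<omega>" for t
      have Cc: "continuous_on {0..T} C" unfolding C_def primitive_def by (intro set_integral_continuous ccont \<omega>)
      have VC: "C_H1 T (wgt \<nu> c Z 0) (\<lambda>t. u0 m t \<omega>)" using u0[OF m] \<omega> by (simp add: is_u0_def)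
      obtain A where A: "\<And>t. t \<in> {0..T} \<Longrightarrow>
        norm_L2 (wgt \<nu> c Z 0) (\<lambda>x. u0 m t \<omega> x + C t * deriv vh (x + c * t)) +
        norm_L2 (wgt \<nu> c Z 0) (\<lambda>x. wderiv (u0 m t \<omega>) x + C t * \<phi>1 (x + c * t)) \<le> A"
        using tf.front_profile_bounded[OF VC Cc] by blast
      have "bounded (C ` {0..T})" by (intro compact_imp_bounded compact_continuous_image Cc compact_Icc)
      then obtain B where B: "\<And>t. t \<in> {0..T} \<Longrightarrow> \<bar>C t\<bar> \<le> B" by (force simp: bounded_iff)
      define P where "P = 2 * (tf.parabolic_K T * (b * (2 * \<eta>f * tf.D)))"
      have "(\<lambda>n. X n powr q * A + P * ((1 + 2 * \<theta> (X n)) * \<theta> (X n))) \<longlonglongrightarrow> 0 * A + P * ((1 + 2 * 0) * 0)"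
        by (intro tendsto_intros Xq X\<theta>)
      then have "\<forall>\<^sub>F n in sequentially. X n powr q * A + P * ((1 + 2 * \<theta> (X n)) * \<theta> (X n)) < 1"
        by (intro order_tendstoD) auto
      moreover have "(\<lambda>n. X n powr q * B) \<longlonglongrightarrow> 0 * B" by (intro tendsto_intros Xq)
      then have "\<forall>\<^sub>F n in sequentially. X n powr q * B < 1"
        by (intro order_tendstoD) auto
      ultimately have "\<forall>\<^sub>F n in sequentially. indicat_real (E n) \<omega> = 1"
      proof eventually_elim
        case (elim n)
        interpret fp: front_path T \<nu> b c Z f vh \<phi>1 \<phi>2 K \<eta>f "X n" "\<lambda>t. u (X n) t \<omega>" "\<lambda>t. u0 m t \<omega>" "\<lambda>t. W t \<omega>" "\<lambda>t. c0 m t \<omega>" \<eta>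
          using p by simp
        have Ceq: "fp.C = C" by (simp add: fp.C_def C_def primitive_def fun_eq_iff)
        note Xn = X[of n] note tn = \<theta>pos[OF Xn]
        have X\<theta>q: "\<theta> (X n) * X n powr q = X n"
          using Xn by (simp add: \<theta>_def flip: powr_add)
        have "\<theta> (X n) * (X n powr q * A + P * ((1 + 2 * \<theta> (X n)) * \<theta> (X n))) < \<theta> (X n) * 1"
          using elim(1) tn by (rule mult_strict_left_mono)
        moreover have "\<theta> (X n) * (X n powr q * A + P * ((1 + 2 * \<theta> (X n)) * \<theta> (X n))) =
            (\<theta> (X n) * X n powr q) * A + 2 * (tf.parabolic_K T * tf.source_bound (\<theta> (X n)))"
          unfolding P_def tf.source_bound_def by (simp add: algebra_simps power2_eq_square)
        ultimately have small: "X n * A + 2 * (tf.parabolic_K T * tf.source_bound (\<theta> (X n))) < \<theta> (X n)"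
          by (simp add: X\<theta>q)
        have "norm_H1 (wgt \<nu> c Z t) (u (X n) t \<omega>) < \<theta> (X n)" if "t \<in> {0..T}" for t
          by (rule fp.norm_U_below[OF tn _ small that, unfolded Ceq, OF A])
        moreover have "\<bar>primitive (c0 m) t \<omega>\<bar> < X n powr (- q)" if "t \<in> {0..T}" for t
        proof -
          have "X n powr (- q) * (X n powr q * B) < X n powr (- q) * 1"
            using elim(2) Xn by (intro mult_strict_left_mono) auto
          moreover have "X n powr (- q) * (X n powr q * B) = B"
            using Xn by (simp add: powr_minus)
          ultimately show ?thesis using B[OF that] by (simp add: C_def)
        qed
        ultimately have "\<omega> \<in> E n" using \<omega> unfolding E_def event by auto
        then show ?case by simp
      qed
      then show "(\<lambda>n. indicat_real (E n) \<omega>) \<longlonglongrightarrow> 1" by (rule tendsto_eventually)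
    qed
    have "(\<lambda>n. LINT \<omega>|M. indicat_real (E n) \<omega>) \<longlonglongrightarrow> (LINT \<omega>|M. 1)"
      by (rule integral_dominated_convergence[where w="\<lambda>_. 1"]) (use lim E in \<open>auto simp: indicator_def\<close>)
    moreover have "(LINT \<omega>|M. indicat_real (E n) \<omega>) = measure M (E n)" for n
      using E[of n] sets.sets_into_space[OF E[of n]] by (simp add: Int_absorb1)
    ultimately have "(\<lambda>n. measure M (E n)) \<longlonglongrightarrow> 1" by (simp add: prob_space)
    then show "((\<lambda>\<epsilon>. measure M {\<omega> \<in> space M.
              min (tau_u T \<nu> c Z q \<epsilon> (u \<epsilon>) \<omega>) (tau_C T q \<epsilon> (primitive (c0 m)) \<omega>) = T}) \<circ> X) \<longlonglongrightarrow> 1"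
      by (simp add: E_def o_def)
  qed
  show ?thesis using part1 part2 by blast
qed

end
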